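(* Let $\Omega=\widetilde\Omega\times(0,1)$, where $\widetilde\Omega$ is a bounded domain of $\mathbb{R}^2$ with a Lipschitz boundary. Let $\alpha_1>0$, $\beta_1\in\mathbb{R}$, and let $\varepsilon_n\in(0,1)$, $r_n\in(0,\tfrac12)$, $\alpha_{2,n}>0$, $\beta_{2,n}\in\mathbb{R}$, $n\in\mathbb{N}$, be sequences such that $\varepsilon_n\to0$, $r_n\to0$ and $$\lim_{n\to\infty}\varepsilon_n^2|\ln r_n|=0,\qquad \lim_{n\to\infty}|\omega_n|\,\alpha_{2,n}=\alpha_2>0,\qquad \lim_{n\to\infty}|\omega_n|\,\beta_{2,n}=\beta_2\in\mathbb{R},$$ where $\omega_n$ and $\Omega_n$ are the fiber sets defined in the context. For $h\in\mathbb{R}^3$ consider the conductivity $$\sigma_n(h)=\begin{cases}\alpha_1I_3+\beta_1\mathscr{E}(h)&\text{in }\Omega\setminus\Omega_n\\ \alpha_{2,n}I_3+\beta_{2,n}\mathscr{E}(h)&\text{in }\Omega_n.\end{cases}$$ Then there exists a subsequence of $n$, still denoted by $n$, such that for any $f\in H^{-1}(\Omega)$ and any $h\in\mathbb{R}^3$, the solution $u_n$ of $$-\operatorname{div}(\sigma_n(h)\nabla u_n)=f\ \text{ in }\Omega,\qquad u_n=0\ \text{ on }\partial\Omega$$ converges weakly in $H^1_0(\Omega)$ to the solution $u$ of $$-\operatorname{div}(\sigma_*(h)\nabla u)=f\ \text{ in }\Omega,\qquad u=0\ \text{ on }\partial\Omega,$$ where $$\sigma_*(h)=\alpha_1I_3+\left(\frac{\alpha_2^3+\alpha_2\beta_2^2|h|^2}{\alpha_2^2+\beta_2^2h_3^2}\right)e_3\otimes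 e_3+\beta_1\mathscr{E}(h).$$
   Context: $I_3$ is the $3\times3$ unit matrix, $(e_1,e_2,e_3)$ the canonical basis of $\mathbb{R}^3$, and for $h=(h_1,h_2,h_3)\in\mathbb{R}^3$, $$\mathscr{E}(h)=\begin{pmatrix} 0 & -h_3 & h_2 \\ h_3 & 0 & -h_1 \\ -h_2 & h_1 & 0 \end{pmatrix},\quad\text{i.e. }\mathscr{E}(h)x=h\times x .$$ $Y=(-\tfrac12,\tfrac12)^3$ is the unit cube. The fiber in the period cell is $\omega_n=\{y\in Y: y_1^2+y_2^2\le r_n^2\}$, so $|\omega_n|=\pi r_n^2$. The set of fibers in $\Omega$ is $\Omega_n=\Omega\cap\bigcup_{\nu\in\mathbb{Z}^3}\varepsilon_n(\omega_n+\nu)$ (closed cylinders parallel to the $x_3$-axis of radius $\varepsilon_nr_n$, centered at the points $\varepsilon_nk$, $k\in\mathbb{Z}^2$, of the $x_1$-$x_2$ plane). *)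

theory Defs
  imports "HOL-Analysis.Analysis"
begin

section \<open>Test functions\<close>

definition partial_deriv :: "'n::finite \<Rightarrow> (real^'n \<Rightarrow> real) \<Rightarrow> real^'n \<Rightarrow> real" where
  "partial_deriv i f x = frechet_derivative f (at x) (axis i 1)"

primrec Ck :: "nat \<Rightarrow> (real^'n::finite \<Rightarrow> real) \<Rightarrow> bool" where
  "Ck 0 f \<longleftrightarrow> continuous_on UNIV f"
| "Ck (Suc k) f \<longleftrightarrow> (\<forall>x. f differentiable (at x)) \<and> (\<forall>i. Ck k (partial_deriv i f))"

definition test_functions :: "(real^'n::finite) set \<Rightarrow> (real^'n \<Rightarrow> real) set" where
  "test_functions \<Omega> = {\<phi>. (\<forall>k. Ck k \<phi>) \<and>
     compact (closure {x. \<phi> x \<noteq> 0}) \<and> closure {x. \<phi> x \<noteq> 0} \<subseteq> \<Omega>}"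


section \<open>Sobolev spaces\<close>

text \<open>Elements of the spaces below are representatives: functions on the whole of the
  Euclidean space whose values outside \<open>\<Omega>\<close> are irrelevant and which are identified
  when they agree almost everywhere in \<open>\<Omega>\<close>.\<close>

definition L2 :: "(real^'n::finite) set \<Rightarrow> (real^'n \<Rightarrow> 'b::euclidean_space) set" where
  "L2 \<Omega> = {u. u \<in> borel_measurable (lebesgue_on \<Omega>) \<and>
     integrable (lebesgue_on \<Omega>) (\<lambda>x. (norm (u x))\<^sup>2)}"

definition is_weak_grad ::
  "(real^'n::finite) set \<Rightarrow> (real^'n \<Rightarrow> real) \<Rightarrow> (real^'n \<Rightarrow> real^'n) \<Rightarrow> bool" where
  "is_weak_grad \<Omega> u g \<longleftrightarrow> (\<forall>\<phi>\<in>test_functions \<Omega>. \<forall>i.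
     (LINT x|lebesgue_on \<Omega>. u x * partial_deriv i \<phi> x) =
     - (LINT x|lebesgue_on \<Omega>. g x $ i * \<phi> x))"

definition H1 :: "(real^'n::finite) set \<Rightarrow> (real^'n \<Rightarrow> real) set" where
  "H1 \<Omega> = {u \<in> L2 \<Omega>. \<exists>g\<in>L2 \<Omega>. is_weak_grad \<Omega> u g}"

text \<open>The weak gradient of an element of \<open>H1 \<Omega>\<close>, which is unique up to null sets
  for open \<open>\<Omega>\<close>.\<close>

definition weak_grad :: "(real^'n::finite) set \<Rightarrow> (real^'n \<Rightarrow> real) \<Rightarrow> real^'n \<Rightarrow> real^'n" where
  "weak_grad \<Omega> u = (SOME g. g \<in> L2 \<Omega> \<and> is_weak_grad \<Omega> u g)"

definition H1_norm :: "(real^'n::finite) set \<Rightarrow> (real^'n \<Rightarrow> real) \<Rightarrow> real" where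
  "H1_norm \<Omega> u = sqrt ((LINT x|lebesgue_on \<Omega>. (u x)\<^sup>2) +
     (LINT x|lebesgue_on \<Omega>. (norm (weak_grad \<Omega> u x))\<^sup>2))"

text \<open>The closure of the test functions in \<open>H1 \<Omega>\<close>.\<close>

definition H10 :: "(real^'n::finite) set \<Rightarrow> (real^'n \<Rightarrow> real) set" where
  "H10 \<Omega> = {u \<in> H1 \<Omega>. \<exists>\<phi>::nat \<Rightarrow> real^'n \<Rightarrow> real. (\<forall>k. \<phi> k \<in> test_functions \<Omega>) \<and>
     (\<lambda>k. H1_norm \<Omega> (\<lambda>x. \<phi> k x - u x)) \<longlonglongrightarrow> 0}"

text \<open>The dual of \<open>H10 \<Omega>\<close>. The bound forces a functional to take equal values on
  representatives that agree almost everywhere in \<open>\<Omega>\<close>; its values outside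
  \<open>H10 \<Omega>\<close> are irrelevant.\<close>

definition H_minus1 :: "(real^'n::finite) set \<Rightarrow> ((real^'n \<Rightarrow> real) \<Rightarrow> real) set" where
  "H_minus1 \<Omega> = {F.
     (\<forall>u\<in>H10 \<Omega>. \<forall>v\<in>H10 \<Omega>. F (\<lambda>x. u x + v x) = F u + F v) \<and>
     (\<forall>c. \<forall>u\<in>H10 \<Omega>. F (\<lambda>x. c * u x) = c * F u) \<and>
     (\<exists>C. \<forall>u\<in>H10 \<Omega>. \<bar>F u\<bar> \<le> C * H1_norm \<Omega> u)}"

definition weakly_converges_H10 ::
  "(real^'n::finite) set \<Rightarrow> (nat \<Rightarrow> real^'n \<Rightarrow> real) \<Rightarrow> (real^'n \<Rightarrow> real) \<Rightarrow> bool" where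
  "weakly_converges_H10 \<Omega> U u \<longleftrightarrow> (\<forall>n. U n \<in> H10 \<Omega>) \<and> u \<in> H10 \<Omega> \<and>
     (\<forall>F\<in>H_minus1 \<Omega>. (\<lambda>n. F (U n)) \<longlonglongrightarrow> F u)"


section \<open>The Dirichlet problem\<close>

text \<open>Weak solutions of \<open>- div (\<sigma> \<nabla>u) = F\<close> in \<open>\<Omega>\<close>, \<open>u = 0\<close> on the boundary.\<close>

definition is_solution :: "(real^'n::finite) set \<Rightarrow> (real^'n \<Rightarrow> real^'n^'n) \<Rightarrow>
    ((real^'n \<Rightarrow> real) \<Rightarrow> real) \<Rightarrow> (real^'n \<Rightarrow> real) \<Rightarrow> bool" where
  "is_solution \<Omega> \<sigma> F u \<longleftrightarrow> u \<in> H10 \<Omega> \<and>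
     (\<forall>v\<in>H10 \<Omega>. (LINT x|lebesgue_on \<Omega>. (\<sigma> x *v weak_grad \<Omega> u x) \<bullet> weak_grad \<Omega> v x) = F v)"

definition is_the_solution :: "(real^'n::finite) set \<Rightarrow> (real^'n \<Rightarrow> real^'n^'n) \<Rightarrow>
    ((real^'n \<Rightarrow> real) \<Rightarrow> real) \<Rightarrow> (real^'n \<Rightarrow> real) \<Rightarrow> bool" where
  "is_the_solution \<Omega> \<sigma> F u \<longleftrightarrow> is_solution \<Omega> \<sigma> F u \<and>
     (\<forall>v. is_solution \<Omega> \<sigma> F v \<longrightarrow> (AE x in lebesgue_on \<Omega>. v x = u x))"


section \<open>Domains\<close>

definition domain :: "'a::topological_space set \<Rightarrow> bool" where
  "domain D \<longleftrightarrow> open D \<and> connected D \<and> D \<noteq> {}"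

text \<open>Near each of its boundary points, and in suitable orthonormal coordinates, the set
  is the region strictly above the graph of a Lipschitz function.\<close>

definition lipschitz_boundary :: "(real^2) set \<Rightarrow> bool" where
  "lipschitz_boundary D \<longleftrightarrow> (\<forall>p\<in>frontier D. \<exists>R \<rho> L \<gamma>.
     orthogonal_transformation (R :: real^2 \<Rightarrow> real^2) \<and> 0 < \<rho> \<and> L-lipschitz_on UNIV (\<gamma> :: real \<Rightarrow> real) \<and>
     (\<forall>x\<in>ball p \<rho>. x \<in> D \<longleftrightarrow> \<gamma> (R x $ 1) < R x $ 2))"

definition cylinder :: "(real^2) set \<Rightarrow> (real^3) set" where
  "cylinder D = {x. vector [x $ 1, x $ 2] \<in> D \<and> 0 < x $ 3 \<and> x $ 3 < 1}"


section \<open>Fibers and conductivities\<close>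

definition unit_cell :: "(real^3) set" where
  "unit_cell = {y. \<forall>i. - 1/2 < y $ i \<and> y $ i < 1/2}"

definition cell_fiber :: "real \<Rightarrow> (real^3) set" where
  "cell_fiber r = {y \<in> unit_cell. (y $ 1)\<^sup>2 + (y $ 2)\<^sup>2 \<le> r\<^sup>2}"

definition fibers :: "(real^3) set \<Rightarrow> real \<Rightarrow> real \<Rightarrow> (real^3) set" where
  "fibers \<Omega> \<epsilon> r =
     \<Omega> \<inter> (\<Union>\<nu>\<in>{\<nu>. \<forall>i. \<nu> $ i \<in> \<int>}. (\<lambda>y. \<epsilon> *\<^sub>R (y + \<nu>)) ` cell_fiber r)"

definition cross_matrix :: "real^3 \<Rightarrow> real^3^3" where
  "cross_matrix h = vector
     [vector [0, - h $ 3, h $ 2],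
      vector [h $ 3, 0, - h $ 1],
      vector [- h $ 2, h $ 1, 0]]"

lemma cross_matrix_mult: "cross_matrix h *v x = cross3 h x"
  by (simp add: cross_matrix_def cross3_def matrix_vector_mult_def vec_eq_iff forall_3 sum_3)

definition tensor :: "real^3 \<Rightarrow> real^3 \<Rightarrow> real^3^3" where
  "tensor a b = (\<chi> i j. a $ i * b $ j)"

definition two_phase_conductivity ::
  "real \<Rightarrow> real \<Rightarrow> real \<Rightarrow> real \<Rightarrow> (real^3) set \<Rightarrow> real^3 \<Rightarrow> real^3 \<Rightarrow> real^3^3" where
  "two_phase_conductivity \<alpha>\<^sub>1 \<beta>\<^sub>1 \<alpha>\<^sub>2 \<beta>\<^sub>2 A h x =
     (if x \<in> A then \<alpha>\<^sub>2 *\<^sub>R mat 1 + \<beta>\<^sub>2 *\<^sub>R cross_matrix h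
      else \<alpha>\<^sub>1 *\<^sub>R mat 1 + \<beta>\<^sub>1 *\<^sub>R cross_matrix h)"

definition homogenized_conductivity ::
  "real \<Rightarrow> real \<Rightarrow> real \<Rightarrow> real \<Rightarrow> real^3 \<Rightarrow> real^3^3" where
  "homogenized_conductivity \<alpha>\<^sub>1 \<beta>\<^sub>1 \<alpha>\<^sub>2 \<beta>\<^sub>2 h =
     \<alpha>\<^sub>1 *\<^sub>R mat 1 +
     ((\<alpha>\<^sub>2 ^ 3 + \<alpha>\<^sub>2 * \<beta>\<^sub>2\<^sup>2 * (norm h)\<^sup>2) / (\<alpha>\<^sub>2\<^sup>2 + \<beta>\<^sub>2\<^sup>2 * (h $ 3)\<^sup>2)) *\<^sub>R
       tensor (axis 3 1) (axis 3 1) +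
     \<beta>\<^sub>1 *\<^sub>R cross_matrix h"

end

theory Submission
  imports Defs
begin

text \<open>The equation with conductivity \<open>\<sigma>\<^sub>n\<close> is tested with \<open>v + z\<close>, where
  \<open>z = w\<^sub>1 (c\<^sub>1 \<partial>\<^sub>3v - \<partial>\<^sub>1v) + w\<^sub>2 (c\<^sub>2 \<partial>\<^sub>3v - \<partial>\<^sub>2v)\<close>. The correctors \<open>w\<^sub>1\<close>, \<open>w\<^sub>2\<close> are uniformly small and
  their gradients are supported in a small set, but in the fibers these gradients are the first and the
  second unit vector up to a small error. Hence in the fibers the gradient of \<open>v + z\<close> is almost
  \<open>\<partial>\<^sub>3v (c\<^sub>1, c\<^sub>2, 1)\<close>. The constants are chosen such that the adjoint of the conductivity of
  the fibers maps \<open>(c\<^sub>1, c\<^sub>2, 1)\<close> to a multiple \<open>\<kappa>\<close> of the third unit vector, so that only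
  \<open>\<kappa> \<partial>\<^sub>3u \<partial>\<^sub>3v\<close> remains of the flux through the fibers; here \<open>\<kappa> |\<omega>\<^sub>n|\<close> tends to the coefficient
  of \<open>e\<^sub>3 \<otimes> e\<^sub>3\<close> in \<open>\<sigma>\<^sub>*\<close>. Since the fibers are invariant in the third direction, the derivative of
  \<open>u\<close> can be moved to \<open>v\<close>, and for a function with gradient in \<open>L\<^sup>2\<close> the integral over the fibers is
  \<open>|\<omega>\<^sub>n|\<close> times the integral over \<open>\<Omega>\<close> up to an error of relative order \<open>(\<epsilon>\<^sup>2 (1 + |ln r|))\<^sup>1\<^sup>/\<^sup>2\<close>. The whole
  sequence converges: no subsequence has to be extracted.\<close>


section \<open>Smooth functions\<close>

text \<open>The obstacle is the flux in the fibers. Their conductivity is of order 1/|omega_n|, so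
  this flux keeps a finite total on a vanishing volume, and the cross product mixes into it the
  horizontal derivatives of \<open>u\<close>, whose behaviour in the fibers is unknown; the choice
  of the direction for the adjoint removes exactly these derivatives. The energy bound makes the
  flux through the fibers bounded in L1, so it suffices that the gradient of the test function
  misses this direction by O(r) there. The logarithm has a single source: replacing the indicator of
  the fibers by its mean costs the integral of 1/t over the scales between the fiber radius and the
  period. The limit is identified by duality. A functional \<open>F\<close> is represented through
  the adjoint limit problem by some \<open>z\<close>, so that \<open>F u_n\<close> is the flux of
  \<open>u_n\<close> for the limit conductivity tested with \<open>z\<close>; convergence of these
  fluxes for test functions, a uniform energy bound and density then give weak convergence. The
  limit \<open>u\<close> itself comes from Lax-Milgram, which is why the whole sequence is treated
  at once.\<close>

lemma partial_deriv_eq: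
  "(f has_derivative f') (at x) \<Longrightarrow> partial_deriv i f x = f' (axis i 1)"
  unfolding partial_deriv_def by (metis frechet_derivative_at)

lemma Ck_continuous: "Ck k f \<Longrightarrow> continuous_on UNIV f"
  by (cases k) (auto intro!: differentiable_imp_continuous_on simp: differentiable_on_def)

lemma Ck_SucD: "Ck (Suc k) f \<Longrightarrow> Ck k f"
proof (induction k arbitrary: f)
  case 0
  then show ?case using Ck_continuous[of "Suc 0" f] by simp
next
  case (Suc k)
  have "f differentiable (at x)" for x
    using Suc.prems by simp
  moreover have "Ck k (partial_deriv i f)" for i
    using Suc.prems Suc.IH[of "partial_deriv i f"] by simp
  ultimately show ?case by simp
qed

lemma partial_deriv_const [simp]: "partial_deriv i (\<lambda>x. c) = (\<lambda>x. 0)"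
  by (rule ext) (subst partial_deriv_eq[OF has_derivative_const], simp)

lemma partial_deriv_nth: "partial_deriv i (\<lambda>x. x $ j) = (\<lambda>x. if i = j then 1 else 0)"
  by (rule ext) (subst partial_deriv_eq[OF bounded_linear_imp_has_derivative[OF bounded_linear_vec_nth]], auto simp: axis_def)

lemma partial_deriv_add:
  assumes "f differentiable (at x)" "g differentiable (at x)"
  shows "partial_deriv i (\<lambda>x. f x + g x) x = partial_deriv i f x + partial_deriv i g x"
proof -
  have "((\<lambda>x. f x + g x) has_derivative (\<lambda>h. frechet_derivative f (at x) h + frechet_derivative g (at x) h)) (at x)"
    using assms by (intro has_derivative_add) (auto simp: frechet_derivative_works)
  from partial_deriv_eq[OF this] show ?thesis by (simp add: partial_deriv_def)
qed

lemma partial_deriv_mult: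
  assumes "f differentiable (at x)" "g differentiable (at x)"
  shows "partial_deriv i (\<lambda>x. f x * g x) x = f x * partial_deriv i g x + partial_deriv i f x * g x"
proof -
  have "((\<lambda>x. f x * g x) has_derivative
      (\<lambda>h. f x * frechet_derivative g (at x) h + frechet_derivative f (at x) h * g x)) (at x)"
    using assms by (intro has_derivative_mult) (auto simp: frechet_derivative_works)
  from partial_deriv_eq[OF this] show ?thesis by (simp add: partial_deriv_def)
qed

lemma has_derivative_chain_real:
  assumes "(F has_real_derivative d) (at (g x))" "g differentiable (at x)"
  shows "((\<lambda>x. F (g x)) has_derivative (\<lambda>h. d * frechet_derivative g (at x) h)) (at x)"
proof -
  have "(F has_derivative (\<lambda>h. d * h)) (at (g x))"
    using assms(1) by (simp add: has_field_derivative_def)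
  moreover have "(g has_derivative frechet_derivative g (at x)) (at x)"
    using assms(2) by (simp add: frechet_derivative_works)
  ultimately show ?thesis
    using has_derivative_compose[of g "frechet_derivative g (at x)" x UNIV F "\<lambda>h. d * h"] by simp
qed

lemma partial_deriv_chain:
  assumes "(F has_real_derivative d) (at (g x))" "g differentiable (at x)"
  shows "partial_deriv i (\<lambda>x. F (g x)) x = d * partial_deriv i g x"
  using partial_deriv_eq[OF has_derivative_chain_real[OF assms]] by (simp add: partial_deriv_def)

lemma Ck_const: "Ck k (\<lambda>x. c)"
  by (induction k arbitrary: c) auto

lemma Ck_nth: "Ck k (\<lambda>x. x $ j)"
proof (cases k)
  case (Suc m)
  have "(\<lambda>x::real^'a. x $ j) differentiable (at x)" for x
    by (auto intro!: linear_imp_differentiable bounded_linear_imp_differentiable bounded_linear_vec_nth)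
  then show ?thesis
    by (auto simp: Suc partial_deriv_nth intro!: Ck_const)
qed (auto intro!: continuous_intros)

lemma Ck_add: "Ck k f \<Longrightarrow> Ck k g \<Longrightarrow> Ck k (\<lambda>x. f x + g x)"
proof (induction k arbitrary: f g)
  case (Suc k)
  have "partial_deriv i (\<lambda>x. f x + g x) = (\<lambda>x. partial_deriv i f x + partial_deriv i g x)" for i
    using Suc.prems by (intro ext partial_deriv_add) auto
  then show ?case using Suc by auto
qed (auto intro!: continuous_intros)

lemma Ck_mult: "Ck k f \<Longrightarrow> Ck k g \<Longrightarrow> Ck k (\<lambda>x. f x * g x)"
proof (induction k arbitrary: f g)
  case (Suc k)
  have "partial_deriv i (\<lambda>x. f x * g x) =
      (\<lambda>x. f x * partial_deriv i g x + partial_deriv i f x * g x)" for i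
    using Suc.prems by (intro ext partial_deriv_mult) auto
  moreover have "Ck k f" "Ck k g"
    using Suc.prems Ck_SucD by blast+
  ultimately show ?case using Suc by (auto intro!: Ck_add)
qed (auto intro!: continuous_intros)

text \<open>The witness lists all derivatives at once: differentiating \<open>F m (g x)\<close>
  produces \<open>F (Suc m)\<close>, so the induction for compositions has to speak about every
  \<open>F m\<close>.\<close>

definition smooth_real :: "(real \<Rightarrow> real) \<Rightarrow> bool" where
  "smooth_real f \<longleftrightarrow> (\<exists>F. F 0 = f \<and> (\<forall>m x. (F m has_real_derivative F (Suc m) x) (at x)))"

lemma Ck_compose:
  assumes "smooth_real f" "Ck k g"
  shows "Ck k (\<lambda>x. f (g x))"
proof -
  obtain F where F: "F 0 = f" "\<And>m x. (F m has_real_derivative F (Suc m) x) (at x)"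
    using assms(1) unfolding smooth_real_def by metis
  have "Ck k (\<lambda>x. F m (g x))" for m
    using assms(2)
  proof (induction k arbitrary: m)
    case 0
    have "continuous_on UNIV (F m)"
      using F(2) by (blast intro: DERIV_isCont continuous_at_imp_continuous_on)+
    then show ?case using 0 by (auto intro: continuous_on_compose2)
  next
    case (Suc k)
    have "partial_deriv i (\<lambda>x. F m (g x)) = (\<lambda>x. F (Suc m) (g x) * partial_deriv i g x)" for i
      using Suc.prems F(2) by (intro ext partial_deriv_chain) auto
    moreover have "Ck k (\<lambda>x. F (Suc m) (g x) * partial_deriv i g x)" for i
      using Suc Ck_SucD by (intro Ck_mult) auto
    moreover have "(\<lambda>x. F m (g x)) differentiable (at x)" for x
      using has_derivative_chain_real[OF F(2), of g x m] Suc.prems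
      by (auto simp: differentiable_def)
    ultimately show ?case by auto
  qed
  from this[of 0] show ?thesis using F(1) by simp
qed

text \<open>The derivative of the inverse is a polynomial in the inverse itself, so the induction
  hypothesis feeds the next order. \<open>smooth_real\<close> cannot be applied to
  \<open>inverse\<close>, as it demands derivatives on the whole line.\<close>

lemma Ck_inverse:
  assumes "Ck k g" "\<And>x. g x \<noteq> 0"
  shows "Ck k (\<lambda>x. inverse (g x))"
  using assms(1)
proof (induction k)
  case (Suc k)
  have d: "(inverse has_real_derivative - (inverse (g x) * inverse (g x))) (at (g x))" for x
    using assms(2)[of x] by (auto intro!: derivative_eq_intros)
  have "partial_deriv i (\<lambda>x. inverse (g x)) =
      (\<lambda>x. (-1) * (inverse (g x) * inverse (g x)) * partial_deriv i g x)" for i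
    using Suc.prems by (intro ext, subst partial_deriv_chain[where F = inverse, OF d]) auto
  moreover have "Ck k (\<lambda>x. (-1) * (inverse (g x) * inverse (g x)) * partial_deriv i g x)" for i
    using Suc Ck_SucD by (intro Ck_mult Ck_const) auto
  moreover have "(\<lambda>x. inverse (g x)) differentiable (at x)" for x
    using has_derivative_chain_real[where F = inverse and g = g, OF d] Suc.prems by (auto simp: differentiable_def)
  ultimately show ?case by simp
qed (auto intro!: continuous_intros simp: assms(2))

section \<open>A smooth function that is flat at zero, and smooth steps\<close>

definition flat :: "real \<Rightarrow> real" where
  "flat x = (if x \<le> 0 then 0 else exp (- inverse x))"

text \<open>With 1/x in place of x this says that all derivatives of \<open>flat\<close> are o(x) at
  0 from the right, which is what smoothness at the origin comes down to.\<close>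

lemma tendsto_poly_div_exp_0: "((\<lambda>x::real. poly p x * exp (- x)) \<longlongrightarrow> 0) at_top"
proof -
  have "((\<lambda>x::real. \<Sum>i\<le>degree p. coeff p i * (x ^ i / exp x)) \<longlongrightarrow> (\<Sum>i\<le>degree p. coeff p i * 0)) at_top"
    by (intro tendsto_sum tendsto_mult tendsto_const tendsto_power_div_exp_0)
  moreover have "(\<Sum>i\<le>degree p. coeff p i * (x ^ i / exp x)) = poly p x * exp (- x)" for x :: real
    unfolding poly_altdef sum_distrib_right by (intro sum.cong refl) (simp add: exp_minus field_simps)
  ultimately show ?thesis by simp
qed

lemma smooth_real_flat: "smooth_real flat"
proof -
  \<comment> \<open>On the positive axis the k-th derivative is P_k(1/x) exp(-1/x); differentiating
    once more gives (1/x)^2 (P_k - P_k')(1/x) exp(-1/x), hence the recursion.\<close>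
  define P :: "nat \<Rightarrow> real poly" where "P = rec_nat 1 (\<lambda>_ p. [:0, 0, 1:] * (p - pderiv p))"
  have P: "P 0 = 1" "\<And>k. P (Suc k) = [:0, 0, 1:] * (P k - pderiv (P k))"
    by (simp_all add: P_def)
  define F where "F k x = (if x \<le> 0 then 0 else poly (P k) (inverse x) * exp (- inverse x))" for k and x :: real
  have pos: "(F k has_real_derivative F (Suc k) x) (at x)" if "x > 0" for k x
  proof -
    have "((\<lambda>x. poly (P k) (inverse x)) has_real_derivative
        poly (pderiv (P k)) (inverse x) * - (inverse x * inverse x)) (at x)"
      using that by (intro DERIV_chain2[OF poly_DERIV]) (auto intro!: derivative_eq_intros)
    moreover have "((\<lambda>x. exp (- inverse x)) has_real_derivative
        exp (- inverse x) * (inverse x * inverse x)) (at x)"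
      using that by (auto intro!: derivative_eq_intros)
    ultimately have "((\<lambda>x. poly (P k) (inverse x) * exp (- inverse x)) has_real_derivative
        poly (pderiv (P k)) (inverse x) * - (inverse x * inverse x) * exp (- inverse x)
        + exp (- inverse x) * (inverse x * inverse x) * poly (P k) (inverse x)) (at x)"
      by (rule DERIV_mult)
    also have "poly (pderiv (P k)) (inverse x) * - (inverse x * inverse x) * exp (- inverse x)
        + exp (- inverse x) * (inverse x * inverse x) * poly (P k) (inverse x) = F (Suc k) x"
      using that by (simp add: F_def P(2)) (simp only: algebra_simps)
    finally have "((\<lambda>x. poly (P k) (inverse x) * exp (- inverse x)) has_real_derivative F (Suc k) x) (at x)" .
    then show ?thesis
      by (rule has_field_derivative_transform_within_open[where S = "{0<..}"]) (use that in \<open>auto simp: F_def\<close>)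
  qed
  have neg: "(F k has_real_derivative F (Suc k) x) (at x)" if "x < 0" for k x
  proof -
    have "((\<lambda>x. 0) has_real_derivative F (Suc k) x) (at x)"
      using that by (auto simp: F_def)
    then show ?thesis
      by (rule has_field_derivative_transform_within_open[where S = "{..<0}"]) (use that in \<open>auto simp: F_def\<close>)
  qed
  \<comment> \<open>The left difference quotient is identically zero; the right one becomes a
    polynomial times exp(-x) at infinity after the substitution x -> 1/x.\<close>
  have zero: "(F k has_real_derivative F (Suc k) 0) (at 0)" for k
  proof -
    have "((\<lambda>h. F k h / h) \<longlongrightarrow> 0) (at_left 0)"
      by (rule tendsto_eventually) (auto simp: F_def eventually_at_filter)
    moreover have "((\<lambda>h. F k h / h) \<longlongrightarrow> 0) (at_right 0)"
    proof -
      have "((\<lambda>x. F k (inverse x) / inverse x) \<longlongrightarrow> 0) at_top"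
      proof (rule Lim_transform_eventually)
        show "((\<lambda>x. poly (P k * [:0, 1:]) x * exp (- x)) \<longlongrightarrow> 0) at_top"
          by (rule tendsto_poly_div_exp_0)
        show "\<forall>\<^sub>F x in at_top. poly (P k * [:0, 1:]) x * exp (- x) = F k (inverse x) / inverse x"
          using eventually_gt_at_top[of 0] by eventually_elim (simp add: F_def divide_inverse)
      qed
      then show ?thesis by (subst filterlim_at_right_to_top)
    qed
    ultimately have "((\<lambda>h. F k h / h) \<longlongrightarrow> 0) (at 0)"
      by (simp add: filterlim_at_split)
    moreover have "F k 0 = 0" "F (Suc k) 0 = 0"
      by (simp_all add: F_def)
    ultimately show ?thesis by (simp add: DERIV_def)
  qed
  have "(F k has_real_derivative F (Suc k) x) (at x)" for k x
    using pos[of x k] neg[of x k] zero[of k] linorder_cases[of x 0] by metis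
  moreover have "F 0 = flat"
    by (auto simp: F_def flat_def P)
  ultimately show ?thesis unfolding smooth_real_def by (intro exI[of _ F]) simp
qed

lemma flat_nonneg: "0 \<le> flat x"
  by (simp add: flat_def)

lemma flat_pos: "0 < x \<Longrightarrow> 0 < flat x"
  by (simp add: flat_def)

lemma flat_eq_0: "x \<le> 0 \<Longrightarrow> flat x = 0"
  by (simp add: flat_def)

lemma flat_sum_pos: "0 < flat x + flat (1 - x)"
  using flat_pos[of x] flat_pos[of "1 - x"] flat_nonneg[of x] flat_nonneg[of "1 - x"]
  by (cases "x > 0") (auto simp: flat_eq_0)

text \<open>Of x and 1 - x at least one is positive, so the denominator never vanishes. Writing the
  quotient with \<open>inverse\<close> makes \<open>Ck_inverse\<close> applicable.\<close>

definition smooth_step :: "real \<Rightarrow> real" where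
  "smooth_step x = flat x * inverse (flat x + flat (1 - x))"

lemma smooth_step_eq_0: "x \<le> 0 \<Longrightarrow> smooth_step x = 0"
  by (simp add: smooth_step_def flat_eq_0)

lemma smooth_step_eq_1: "1 \<le> x \<Longrightarrow> smooth_step x = 1"
  using flat_pos[of x] by (simp add: smooth_step_def flat_eq_0)

lemma smooth_step_nonneg: "0 \<le> smooth_step x"
  using flat_sum_pos[of x] flat_nonneg[of x] by (simp add: smooth_step_def)

lemma smooth_step_le_1: "smooth_step x \<le> 1"
  using flat_sum_pos[of x] flat_nonneg[of "1 - x"] by (simp add: smooth_step_def field_simps)

lemma Ck_diff: "Ck k f \<Longrightarrow> Ck k g \<Longrightarrow> Ck k (\<lambda>x. f x - g x)"
  using Ck_add[of k f "\<lambda>x. (-1) * g x"] Ck_mult[OF Ck_const, of k g "-1"] by simp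

lemma Ck_smooth_step: "Ck k g \<Longrightarrow> Ck k (\<lambda>x. smooth_step (g x))"
  unfolding smooth_step_def using flat_sum_pos
  by (intro Ck_mult Ck_inverse Ck_add Ck_compose[OF smooth_real_flat] Ck_diff Ck_const)
     (auto simp: less_imp_neq[symmetric] dual_order.strict_implies_not_eq)

text \<open>Serves to bound the derivative of the cutoff \<open>bump\<close> on a compact interval,
  which is where the constant of the correctors comes from.\<close>

lemma smooth_step_C1:
  obtains d where "\<And>x. (smooth_step has_real_derivative d x) (at x)" "continuous_on UNIV d"
proof -
  obtain F where F: "F 0 = flat" "\<And>m x. (F m has_real_derivative F (Suc m) x) (at x)"
    using smooth_real_flat unfolding smooth_real_def by metis
  have f: "(flat has_real_derivative F 1 x) (at x)" for x
    using F(2)[of 0 x] F(1) by simp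
  have cf: "continuous_on UNIV flat" "continuous_on UNIV (F 1)"
    using F(2)[of 1] f by (blast intro: DERIV_isCont continuous_at_imp_continuous_on)+
  define d where "d x = F 1 x * inverse (flat x + flat (1 - x))
     - inverse (flat x + flat (1 - x)) * (F 1 x - F 1 (1 - x)) * inverse (flat x + flat (1 - x)) * flat x" for x
  show ?thesis
  proof
    have ne: "flat x + flat (1 - x) \<noteq> 0" for x
      using flat_sum_pos[of x] by simp
    show "(smooth_step has_real_derivative d x) (at x)" for x
    proof -
      have "((\<lambda>x. flat (1 - x)) has_real_derivative F 1 (1 - x) * (0 - 1)) (at x)"
        using DERIV_diff[OF DERIV_const[of 1] DERIV_ident]
        by (rule DERIV_chain2[where f = flat and g = "\<lambda>x. 1 - x", OF f[of "1 - x"]])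
      from DERIV_mult[OF f DERIV_inverse_fun[OF DERIV_add[OF f this] ne]]
      show ?thesis
        unfolding smooth_step_def[abs_def] d_def
        by (rule DERIV_cong) simp
    qed
    have "continuous_on UNIV (\<lambda>x. flat (1 - x))" "continuous_on UNIV (\<lambda>x. F 1 (1 - x))"
      by (rule continuous_on_compose2[OF cf(1)] continuous_on_compose2[OF cf(2)],
          simp add: continuous_on_diff continuous_on_id, simp)+
    then show "continuous_on UNIV d"
      unfolding d_def by (intro continuous_intros cf ballI ne)
  qed
qed



section \<open>Test functions\<close>

definition grad :: "(real^'n::finite \<Rightarrow> real) \<Rightarrow> real^'n \<Rightarrow> real^'n" where
  "grad \<phi> x = (\<chi> i. partial_deriv i \<phi> x)"

lemma grad_nth [simp]: "grad \<phi> x $ i = partial_deriv i \<phi> x"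
  by (simp add: grad_def)

lemma has_derivative_grad:
  assumes "\<phi> differentiable (at x)"
  shows "(\<phi> has_derivative (\<lambda>h. grad \<phi> x \<bullet> h)) (at x)"
proof -
  let ?D = "frechet_derivative \<phi> (at x)"
  have D: "(\<phi> has_derivative ?D) (at x)"
    using assms by (simp add: frechet_derivative_works)
  then have lin: "linear ?D"
    by (simp add: has_derivative_linear)
  have "?D h = grad \<phi> x \<bullet> h" for h
  proof -
    have "?D h = ?D (\<Sum>i\<in>UNIV. h $ i *\<^sub>R axis i 1)"
      using basis_expansion[of h] by (simp add: scalar_mult_eq_scaleR)
    also have "\<dots> = (\<Sum>i\<in>UNIV. h $ i * ?D (axis i 1))"
      using lin by (simp add: linear_sum linear_cmul)
    also have "\<dots> = grad \<phi> x \<bullet> h"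
      by (simp add: inner_vec_def partial_deriv_def mult.commute)
    finally show ?thesis .
  qed
  then have "?D = (\<lambda>h. grad \<phi> x \<bullet> h)" by blast
  with D show ?thesis by simp
qed

definition smooth :: "(real^'n::finite \<Rightarrow> real) \<Rightarrow> bool" where
  "smooth f \<longleftrightarrow> (\<forall>k. Ck k f)"

lemma smooth_differentiable: "smooth f \<Longrightarrow> f differentiable (at x)"
  unfolding smooth_def using Ck.simps(2) by blast

lemma smooth_partial_deriv: "smooth f \<Longrightarrow> smooth (partial_deriv i f)"
  unfolding smooth_def using Ck.simps(2) by blast

lemma smooth_continuous: "smooth f \<Longrightarrow> continuous_on S f"
  unfolding smooth_def using Ck.simps(1) continuous_on_subset by blast

lemma smooth_has_derivative: "smooth f \<Longrightarrow> (f has_derivative (\<lambda>h. grad f x \<bullet> h)) (at x)"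
  by (simp add: smooth_differentiable has_derivative_grad)

lemma smooth_const: "smooth (\<lambda>x. c)"
  and smooth_nth: "smooth (\<lambda>x. x $ j)"
  and smooth_add: "smooth f \<Longrightarrow> smooth g \<Longrightarrow> smooth (\<lambda>x. f x + g x)"
  and smooth_diff: "smooth f \<Longrightarrow> smooth g \<Longrightarrow> smooth (\<lambda>x. f x - g x)"
  and smooth_mult: "smooth f \<Longrightarrow> smooth g \<Longrightarrow> smooth (\<lambda>x. f x * g x)"
  and smooth_compose: "smooth_real F \<Longrightarrow> smooth f \<Longrightarrow> smooth (\<lambda>x. F (f x))"
  and smooth_smooth_step: "smooth f \<Longrightarrow> smooth (\<lambda>x. smooth_step (f x))"
  unfolding smooth_def
  by (simp_all add: Ck_const Ck_nth Ck_add Ck_diff Ck_mult Ck_compose Ck_smooth_step)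

lemma smooth_sum: "(\<And>i. i \<in> I \<Longrightarrow> smooth (f i)) \<Longrightarrow> smooth (\<lambda>x. \<Sum>i\<in>I. f i x)"
  by (induction I rule: infinite_finite_induct) (auto intro: smooth_const smooth_add)

lemma partial_deriv_mult_smooth:
  "smooth f \<Longrightarrow> smooth g \<Longrightarrow>
    partial_deriv i (\<lambda>x. f x * g x) x = f x * partial_deriv i g x + partial_deriv i f x * g x"
  by (simp add: partial_deriv_mult smooth_differentiable)

lemma grad_add:
  "smooth f \<Longrightarrow> smooth g \<Longrightarrow> grad (\<lambda>x. f x + g x) x = grad f x + grad g x"
  by (simp add: vec_eq_iff partial_deriv_add smooth_differentiable)

lemma grad_mult:
  "smooth f \<Longrightarrow> smooth g \<Longrightarrow> grad (\<lambda>x. f x * g x) x = f x *\<^sub>R grad g x + g x *\<^sub>R grad f x"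
  by (simp add: vec_eq_iff partial_deriv_mult_smooth)

lemma grad_cmult: "smooth f \<Longrightarrow> grad (\<lambda>x. c * f x) x = c *\<^sub>R grad f x"
  by (simp add: grad_mult smooth_const) (simp add: vec_eq_iff)

lemma grad_diff:
  "smooth f \<Longrightarrow> smooth g \<Longrightarrow> grad (\<lambda>x. f x - g x) x = grad f x - grad g x"
  using grad_add[of f "\<lambda>x. (-1) * g x" x] grad_cmult[of g "-1" x] smooth_mult[OF smooth_const[of "-1"], of g]
  by simp

lemma continuous_on_grad: "smooth f \<Longrightarrow> continuous_on S (grad f)"
  unfolding grad_def by (intro continuous_on_vec_lambda smooth_continuous smooth_partial_deriv)

text \<open>Replaces the closure of the support by any compact set outside which the function
  vanishes; the closure is contained in it because compact sets are closed.\<close>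

lemma test_functionsI:
  assumes "smooth f" "compact K" "K \<subseteq> \<Omega>" "\<And>x. x \<notin> K \<Longrightarrow> f x = 0"
  shows "f \<in> test_functions \<Omega>"
proof -
  have "{x. f x \<noteq> 0} \<subseteq> K" using assms(4) by blast
  then have "closure {x. f x \<noteq> 0} \<subseteq> K"
    by (simp add: assms(2) closure_minimal compact_imp_closed)
  moreover from this have "compact (closure {x. f x \<noteq> 0})"
    using assms(2) by (meson bounded_subset closed_closure compact_eq_bounded_closed)
  ultimately show ?thesis
    using assms by (auto simp: test_functions_def smooth_def)
qed

lemma test_smooth: "f \<in> test_functions \<Omega> \<Longrightarrow> smooth f"
  by (simp add: test_functions_def smooth_def)

text \<open>The complement of the support is open, so near each of its points the function is
  identically zero and its derivatives vanish there as well.\<close>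

lemma test_support:
  assumes "f \<in> test_functions \<Omega>"
  obtains K where "compact K" "K \<subseteq> \<Omega>" "\<And>x. x \<notin> K \<Longrightarrow> f x = 0"
    "\<And>x i. x \<notin> K \<Longrightarrow> partial_deriv i f x = 0" "\<And>x. x \<notin> K \<Longrightarrow> grad f x = 0"
proof -
  define K where "K = closure {x. f x \<noteq> 0}"
  have K: "compact K" "K \<subseteq> \<Omega>" "closed K"
    using assms by (simp_all add: test_functions_def K_def)
  have z: "f x = 0" if "x \<notin> K" for x
    using that closure_subset[of "{x. f x \<noteq> 0}"] unfolding K_def by blast
  have pz: "partial_deriv i f x = 0" if "x \<notin> K" for x i
  proof -
    have "((\<lambda>x. 0) has_derivative (\<lambda>h. 0)) (at x)" by simp
    then have "(f has_derivative (\<lambda>h. 0)) (at x)"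
      by (rule has_derivative_transform_within_open[where s = "- K"])
        (use that K(3) z in auto)
    from partial_deriv_eq[OF this] show ?thesis by simp
  qed
  have "grad f x = 0" if "x \<notin> K" for x
    using pz[OF that] by (simp add: vec_eq_iff)
  with K(1,2) z pz show ?thesis
    by (rule that)
qed

lemma test_zero_outside: "f \<in> test_functions \<Omega> \<Longrightarrow> x \<notin> \<Omega> \<Longrightarrow> f x = 0"
  by (erule test_support) blast

lemma test_grad_zero_outside: "f \<in> test_functions \<Omega> \<Longrightarrow> x \<notin> \<Omega> \<Longrightarrow> grad f x = 0"
  by (erule test_support) blast

lemma test_partial_deriv:
  assumes "f \<in> test_functions \<Omega>"
  shows "partial_deriv i f \<in> test_functions \<Omega>"
proof -
  obtain K where "compact K" "K \<subseteq> \<Omega>" "\<And>x i. x \<notin> K \<Longrightarrow> partial_deriv i f x = 0"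
    using test_support[OF assms] by metis
  then show ?thesis
    by (intro test_functionsI[of _ K] smooth_partial_deriv test_smooth[OF assms])
qed

lemma test_mult_smooth:
  assumes "smooth g" "f \<in> test_functions \<Omega>"
  shows "(\<lambda>x. g x * f x) \<in> test_functions \<Omega>"
proof -
  obtain K where "compact K" "K \<subseteq> \<Omega>" "\<And>x. x \<notin> K \<Longrightarrow> f x = 0"
    using test_support[OF assms(2)] by metis
  then show ?thesis
    using assms by (intro test_functionsI[of _ K]) (auto intro: smooth_mult test_smooth)
qed

lemma test_cmult: "f \<in> test_functions \<Omega> \<Longrightarrow> (\<lambda>x. c * f x) \<in> test_functions \<Omega>"
  by (rule test_mult_smooth[OF smooth_const])

lemma test_add:
  assumes "f \<in> test_functions \<Omega>" "g \<in> test_functions \<Omega>"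
  shows "(\<lambda>x. f x + g x) \<in> test_functions \<Omega>"
proof -
  obtain K where K: "compact K" "K \<subseteq> \<Omega>" "\<And>x. x \<notin> K \<Longrightarrow> f x = 0"
    using test_support[OF assms(1)] by metis
  obtain L where L: "compact L" "L \<subseteq> \<Omega>" "\<And>x. x \<notin> L \<Longrightarrow> g x = 0"
    using test_support[OF assms(2)] by metis
  show ?thesis
    using assms K L
    by (intro test_functionsI[of _ "K \<union> L"]) (auto intro: smooth_add test_smooth)
qed

lemma test_diff:
  "f \<in> test_functions \<Omega> \<Longrightarrow> g \<in> test_functions \<Omega> \<Longrightarrow> (\<lambda>x. f x - g x) \<in> test_functions \<Omega>"
  using test_add[of f \<Omega> "\<lambda>x. (-1) * g x"] test_cmult[of g \<Omega> "-1"] by simp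

lemma test_bounded:
  assumes "f \<in> test_functions \<Omega>"
  obtains C where "C > 0" "\<And>x. \<bar>f x\<bar> \<le> C" "\<And>x. norm (grad f x) \<le> C"
proof -
  obtain K where K: "compact K" "K \<subseteq> \<Omega>" "\<And>x. x \<notin> K \<Longrightarrow> f x = 0" "\<And>x. x \<notin> K \<Longrightarrow> grad f x = 0"
    using test_support[OF assms] by metis
  have "bounded (f ` K)" "bounded (grad f ` K)"
    using K(1) test_smooth[OF assms]
    by (auto intro!: compact_imp_bounded compact_continuous_image smooth_continuous continuous_on_grad)
  then obtain A B where AB: "\<And>x. x \<in> K \<Longrightarrow> norm (f x) \<le> A" "\<And>x. x \<in> K \<Longrightarrow> norm (grad f x) \<le> B"
    by (auto simp: bounded_iff)
  show ?thesis
  proof (rule that[of "max 1 (max A B)"])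
    show "\<bar>f x\<bar> \<le> max 1 (max A B)" for x
      using AB(1)[of x] K(3)[of x] by (cases "x \<in> K") auto
    show "norm (grad f x) \<le> max 1 (max A B)" for x
      using AB(2)[of x] K(4)[of x] by (cases "x \<in> K") auto
  qed simp
qed

lemma test_borel [measurable_dest]: "f \<in> test_functions \<Omega> \<Longrightarrow> f \<in> borel_measurable borel"
  by (intro borel_measurable_continuous_onI smooth_continuous test_smooth)

lemma grad_borel: "smooth f \<Longrightarrow> grad f \<in> borel_measurable borel"
  by (intro borel_measurable_continuous_onI continuous_on_grad)

lemma measurable_lebesgue_on: "f \<in> borel_measurable borel \<Longrightarrow> f \<in> borel_measurable (lebesgue_on S)"
  by (rule measurable_restrict_space1) (simp add: measurable_completion)

subsection \<open>The fundamental lemma of the calculus of variations\<close>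

text \<open>The squared distance is a polynomial in the coordinates. For positive \<open>r\<close>
  the function is positive exactly in the open ball, which makes it a building block for indicators
  of open sets.\<close>

lemma smooth_flat_ball:
  "smooth (\<lambda>x::real^'n::finite. flat (r\<^sup>2 - (dist c x)\<^sup>2))"
proof -
  have eq: "(dist c x)\<^sup>2 = (\<Sum>i\<in>UNIV. (x $ i - c $ i) * (x $ i - c $ i))" for x
    by (simp add: dist_norm power2_norm_eq_inner inner_vec_def) (simp add: algebra_simps)
  show ?thesis
    unfolding eq
    by (intro smooth_compose[OF smooth_real_flat] smooth_diff smooth_const smooth_sum smooth_mult smooth_nth)
qed

text \<open>The open set is a countable union of balls. A finite sum of the corresponding ball
  functions is positive on a growing part of the set; multiplying it by k and applying
  \<open>smooth_step\<close> saturates the value at 1 pointwise.\<close>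

lemma indicator_open_test_approx:
  fixes U :: "(real^'n::finite) set"
  assumes "open U"
  obtains \<psi> where "\<And>k::nat. \<psi> k \<in> test_functions U" "\<And>k x. 0 \<le> \<psi> k x \<and> \<psi> k x \<le> 1"
    "\<And>x. (\<lambda>k. \<psi> k x) \<longlonglongrightarrow> indicator U x"
proof (cases "U = {}")
  case True
  show ?thesis
    by (rule that[of "\<lambda>k x. 0"]) (auto simp: True intro!: test_functionsI[of _ "{}"] smooth_const)
next
  case False
  \<comment> \<open>The closed balls are required to lie in \<open>U\<close>, so that the supports
    are compact subsets of \<open>U\<close>.\<close>
  define B where "B = {b :: (real^'n) \<times> real. snd b > 0 \<and> cball (fst b) (snd b) \<subseteq> U}"
  define G where "G = (\<lambda>b :: (real^'n) \<times> real. ball (fst b) (snd b))"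
  have "open S" if "S \<in> G ` B" for S
    using that by (auto simp: G_def)
  then obtain F where F: "F \<subseteq> G ` B" "countable F" "\<Union> F = \<Union> (G ` B)"
    by (rule Lindelof)
  have U: "\<Union> F = U"
    unfolding F(3)
  proof (intro equalityI subsetI)
    fix x assume "x \<in> U"
    then obtain e where "e > 0" "cball x e \<subseteq> U"
      using assms open_contains_cball by blast
    then have "x \<in> G (x, e)" "(x, e) \<in> B"
      by (simp_all add: G_def B_def)
    then show "x \<in> \<Union> (G ` B)" by blast
  next
    fix x assume "x \<in> \<Union> (G ` B)"
    then show "x \<in> U" using ball_subset_cball by (auto simp: B_def G_def)
  qed
  have "F \<noteq> {}" using U False by auto
  then have ran: "range (from_nat_into F) = F"
    using F(2) by (simp add: range_from_nat_into)
  have "\<exists>b\<in>B. from_nat_into F j = G b" for j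
    using subsetD[OF F(1) from_nat_into[OF \<open>F \<noteq> {}\<close>]] by (rule imageE) auto
  then obtain b where b: "\<And>j. b j \<in> B" "\<And>j. from_nat_into F j = G (b j)"
    by metis
  define c \<rho> where "c j = fst (b j)" and "\<rho> j = snd (b j)" for j :: nat
  have c\<rho>: "\<rho> j > 0" "cball (c j) (\<rho> j) \<subseteq> U" "from_nat_into F j = ball (c j) (\<rho> j)" for j
    using b[of j] by (auto simp: c_def \<rho>_def B_def G_def)
  define s where "s k x = (\<Sum>j\<le>k. flat ((\<rho> j)\<^sup>2 - (dist (c j) x)\<^sup>2))" for k :: nat and x
  \<comment> \<open>The partial sums do not decrease in k, so at a point of \<open>U\<close> the
    factor k eventually pushes the argument beyond 1; outside \<open>U\<close> the argument is
    always 0.\<close>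
  define \<psi> where "\<psi> k x = smooth_step (real k * s k x)" for k x
  have "\<psi> k \<in> test_functions U" for k
  proof (rule test_functionsI[of _ "\<Union>j\<le>k. cball (c j) (\<rho> j)"])
    show "smooth (\<psi> k)"
      unfolding \<psi>_def s_def by (intro smooth_smooth_step smooth_mult smooth_const smooth_sum smooth_flat_ball)
    fix x assume x: "x \<notin> (\<Union>j\<le>k. cball (c j) (\<rho> j))"
    have "flat ((\<rho> j)\<^sup>2 - (dist (c j) x)\<^sup>2) = 0" if "j \<le> k" for j
    proof -
      have "x \<notin> cball (c j) (\<rho> j)" using x that by blast
      then have "\<rho> j < dist (c j) x" by (simp add: not_le)
      then show ?thesis using c\<rho>(1)[of j] by (intro flat_eq_0) (simp add: power_mono)
    qed
    then show "\<psi> k x = 0" by (simp add: \<psi>_def s_def smooth_step_eq_0)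
  qed (use c\<rho>(2) in auto)
  moreover have "(\<lambda>k. \<psi> k x) \<longlonglongrightarrow> indicator U x" for x
  proof (cases "x \<in> U")
    case True
    then obtain j where j: "x \<in> ball (c j) (\<rho> j)"
      using U ran c\<rho>(3) by (metis UnionE imageE)
    then have "(dist (c j) x)\<^sup>2 < (\<rho> j)\<^sup>2"
      by (intro power_strict_mono) auto
    then have fp: "flat ((\<rho> j)\<^sup>2 - (dist (c j) x)\<^sup>2) > 0" (is "?d > 0")
      by (intro flat_pos) simp
    have "\<forall>\<^sub>F k in sequentially. \<psi> k x = indicator U x"
    proof -
      obtain N :: nat where N: "1 / ?d < real N" using reals_Archimedean2 by blast
      have "\<psi> k x = indicator U x" if "k \<ge> max N j" for k
      proof -
        have "?d \<le> s k x"
          unfolding s_def using that by (intro member_le_sum) (auto simp: flat_nonneg)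
        moreover have "1 \<le> real k * ?d"
        proof -
          have "1 / ?d \<le> real k" using N that by linarith
          then show ?thesis using fp by (simp add: field_simps)
        qed
        ultimately have "1 \<le> real k * s k x"
          by (meson mult_left_mono of_nat_0_le_iff order_trans)
        then show ?thesis using True by (simp add: \<psi>_def smooth_step_eq_1)
      qed
      then show ?thesis unfolding eventually_sequentially by blast
    qed
    then show ?thesis by (rule tendsto_eventually)
  next
    case False
    have "\<psi> k x = 0" for k
      using calculation False test_zero_outside by blast
    then show ?thesis using False by simp
  qed
  ultimately show ?thesis
    by (intro that[of \<psi>]) (auto simp: \<psi>_def smooth_step_nonneg smooth_step_le_1)
qed

text \<open>Dominated convergence turns the vanishing against test functions into vanishing
  integrals over open sets; these generate the Borel sets, and Lebesgue sets differ from Borel sets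
  by null sets. A function all of whose integrals vanish is zero almost everywhere.\<close>

lemma fundamental_lemma_calculus_of_variations:
  fixes f :: "real^'n::finite \<Rightarrow> real"
  assumes \<Omega>: "open \<Omega>" "bounded \<Omega>" and f: "integrable (lebesgue_on \<Omega>) f"
    and zero: "\<And>\<phi>. \<phi> \<in> test_functions \<Omega> \<Longrightarrow> (LINT x|lebesgue_on \<Omega>. f x * \<phi> x) = 0"
  shows "AE x in lebesgue_on \<Omega>. f x = 0"
proof -
  let ?M = "lebesgue_on \<Omega>"
  interpret finite_measure ?M
    using \<Omega> by (intro finite_measure_lebesgue_on lmeasurable_open)
  have fm [measurable]: "f \<in> borel_measurable ?M" using f by auto
  have bM: "A \<inter> \<Omega> \<in> sets ?M" if "A \<in> sets borel" for A
    using that \<Omega> by (auto simp: sets_restrict_space)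
  have op: "(LINT x:V \<inter> \<Omega>|?M. f x) = 0" if "open V" for V
  proof -
    obtain \<psi> where \<psi>: "\<And>k::nat. \<psi> k \<in> test_functions (V \<inter> \<Omega>)" "\<And>k x. 0 \<le> \<psi> k x \<and> \<psi> k x \<le> 1"
      "\<And>x. (\<lambda>k. \<psi> k x) \<longlonglongrightarrow> indicator (V \<inter> \<Omega>) x"
      using indicator_open_test_approx[OF open_Int[OF \<open>open V\<close> \<Omega>(1)]] by metis
    have "\<psi> k \<in> test_functions \<Omega>" for k
      using \<psi>(1)[of k] by (auto simp: test_functions_def)
    then have "(LINT x|?M. f x * \<psi> k x) = 0" for k by (rule zero)
    moreover have "(\<lambda>k. LINT x|?M. f x * \<psi> k x) \<longlonglongrightarrow> (LINT x|?M. f x * indicator (V \<inter> \<Omega>) x)"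
    proof (rule integral_dominated_convergence[where w = "\<lambda>x. \<bar>f x\<bar>"])
      show "(\<lambda>x. f x * indicator (V \<inter> \<Omega>) x) \<in> borel_measurable ?M"
        using bM[of V] that by measurable
      show "(\<lambda>x. f x * \<psi> k x) \<in> borel_measurable ?M" for k
        using measurable_lebesgue_on[OF test_borel[OF \<psi>(1)[of k]], of \<Omega>] by measurable
      show "AE x in ?M. (\<lambda>k. f x * \<psi> k x) \<longlonglongrightarrow> f x * indicator (V \<inter> \<Omega>) x"
        using \<psi>(3) by (auto intro!: tendsto_mult)
      have "\<bar>f x\<bar> * \<bar>\<psi> k x\<bar> \<le> \<bar>f x\<bar> * 1" for k x
        using \<psi>(2)[of k x] by (intro mult_left_mono) auto
      then show "AE x in ?M. norm (f x * \<psi> k x) \<le> \<bar>f x\<bar>" for k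
        by (auto simp: abs_mult)
    qed (use f in auto)
    ultimately have "(LINT x|?M. f x * indicator (V \<inter> \<Omega>) x) = 0"
      by (simp add: LIMSEQ_const_iff)
    then show ?thesis by (simp add: set_lebesgue_integral_def mult.commute)
  qed
  \<comment> \<open>Open sets are stable under intersection and the sets with vanishing integral
    form a Dynkin system, so the property spreads to all Borel sets.\<close>
  have bor: "(LINT x:B \<inter> \<Omega>|?M. f x) = 0" if "B \<in> sets borel" for B
  proof -
    have int: "set_integrable ?M (B \<inter> \<Omega>) f" if "B \<in> sets borel" for B
      unfolding set_integrable_def using bM[OF that] f by (rule integrable_mult_indicator)
    have "Int_stable {S :: (real^'n) set. open S}" "{S :: (real^'n) set. open S} \<subseteq> Pow UNIV"
      "B \<in> sigma_sets UNIV {S. open S}"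
      using that by (auto simp: borel_def Int_stable_def)
    then show ?thesis
    proof (induction rule: sigma_sets_induct_disjoint)
      case (basic A)
      then show ?case using op by simp
    next
      case (compl A)
      then have A: "A \<in> sets borel" by (simp add: borel_def)
      have "(LINT x:UNIV \<inter> \<Omega>|?M. f x) = (LINT x:(A \<inter> \<Omega>) \<union> ((UNIV - A) \<inter> \<Omega>)|?M. f x)"
        by (intro arg_cong2[where f = "\<lambda>S. set_lebesgue_integral ?M S"]) auto
      also have "\<dots> = (LINT x:A \<inter> \<Omega>|?M. f x) + (LINT x:(UNIV - A) \<inter> \<Omega>|?M. f x)"
        using A by (intro set_integral_Un int) auto
      finally show ?case using compl op[of UNIV] by simp
    next
      case (union A)
      then have A: "A i \<in> sets borel" for i by (auto simp: borel_def)
      have "(LINT x:(\<Union>i. A i) \<inter> \<Omega>|?M. f x) = (LINT x:(\<Union>i. A i \<inter> \<Omega>)|?M. f x)"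
        by (simp add: Int_UN_distrib2)
      also have "\<dots> = (\<Sum>i. (LINT x:(A i \<inter> \<Omega>)|?M. f x))"
      proof (rule lebesgue_integral_countable_add)
        show "A i \<inter> \<Omega> \<inter> (A j \<inter> \<Omega>) = {}" if "i \<noteq> j" for i j
          using union(1) that by (auto simp: disjoint_family_on_def)
        show "set_integrable ?M (\<Union>i. A i \<inter> \<Omega>) f"
          using int[of "\<Union>i. A i"] A by (simp add: Int_UN_distrib2)
      qed (use A bM in auto)
      finally show ?case using union by simp
    qed (simp add: set_lebesgue_integral_def)
  qed
  have "(LINT x:A|?M. f x) = (LINT x:A|?M. 0)" if A: "A \<in> sets ?M" for A
  proof -
  have "A \<in> sets lebesgue" "A \<subseteq> \<Omega>"
    using A \<Omega> by (auto simp: sets_restrict_space)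
  \<comment> \<open>A Lebesgue set is an F-sigma set up to the null set \<open>T\<close>, and the
    F-sigma part is already settled by \<open>bor\<close>.\<close>
  then obtain C T where C: "fsigma C" "T \<in> null_sets lebesgue" "C \<union> T = A"
    using lebesgue_set_almost_fsigma by metis
  then have CB: "C \<in> sets borel" by (auto elim: fsigma.cases)
  have AC: "A = (C \<union> T) \<inter> \<Omega>" using C \<open>A \<subseteq> \<Omega>\<close> by auto
  have "AE x in lebesgue. x \<notin> T" using C(2) by (rule AE_not_in)
  then have "AE x in ?M. x \<notin> T"
    using \<Omega> by (auto simp: AE_restrict_space_iff)
  then have "(LINT x:A|?M. f x) = (LINT x:C \<inter> \<Omega>|?M. f x)"
    unfolding set_lebesgue_integral_def
  proof (intro integral_cong_AE)
    show "(\<lambda>x. indicat_real A x *\<^sub>R f x) \<in> borel_measurable ?M"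
      "(\<lambda>x. indicat_real (C \<inter> \<Omega>) x *\<^sub>R f x) \<in> borel_measurable ?M"
      using A bM[OF CB] by measurable
    show "AE x in ?M. indicat_real A x *\<^sub>R f x = indicat_real (C \<inter> \<Omega>) x *\<^sub>R f x"
      using \<open>AE x in ?M. x \<notin> T\<close> by eventually_elim (auto simp: AC split: split_indicator)
  qed
  then show "(LINT x:A|?M. f x) = (LINT x:A|?M. 0)"
    using bor[OF CB] by simp
  qed
  then show ?thesis
    by (rule density_unique_banach[OF f integrable_zero])
qed



section \<open>Square-integrable functions\<close>

text \<open>Stated for an arbitrary measure; for \<open>lebesgue_on \<Omega>\<close> it is
  membership in \<open>L2 \<Omega>\<close>, with \<open>l2\<close> the corresponding
  seminorm.\<close>

definition sqi :: "'a measure \<Rightarrow> ('a \<Rightarrow> 'b::euclidean_space) \<Rightarrow> bool" where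
  "sqi M f \<longleftrightarrow> f \<in> borel_measurable M \<and> integrable M (\<lambda>x. (norm (f x))\<^sup>2)"

definition l2 :: "'a measure \<Rightarrow> ('a \<Rightarrow> 'b::euclidean_space) \<Rightarrow> real" where
  "l2 M f = sqrt (LINT x|M. (norm (f x))\<^sup>2)"

lemma sqi_measurable [measurable_dest]: "sqi M f \<Longrightarrow> f \<in> borel_measurable M"
  by (simp add: sqi_def)

lemma sqi_integrable: "sqi M f \<Longrightarrow> integrable M (\<lambda>x. (norm (f x))\<^sup>2)"
  by (simp add: sqi_def)

lemma l2_nonneg [simp]: "0 \<le> l2 M f"
  by (simp add: l2_def)

lemma l2_power2: "(l2 M f)\<^sup>2 = (LINT x|M. (norm (f x))\<^sup>2)"
  by (simp add: l2_def)

lemma sqi_bound: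
  assumes "sqi M g" "f \<in> borel_measurable M" "AE x in M. norm (f x) \<le> C * norm (g x)"
  shows "sqi M f"
proof -
  have "integrable M (\<lambda>x. (norm (f x))\<^sup>2)"
  proof (rule Bochner_Integration.integrable_bound)
    show "integrable M (\<lambda>x. C\<^sup>2 * (norm (g x))\<^sup>2)"
      using sqi_integrable[OF assms(1)] by simp
    show "(\<lambda>x. (norm (f x))\<^sup>2) \<in> borel_measurable M"
      using assms(2) by measurable
    show "AE x in M. norm ((norm (f x))\<^sup>2) \<le> norm (C\<^sup>2 * (norm (g x))\<^sup>2)"
      using assms(3)
    proof eventually_elim
      case (elim x)
      then have "(norm (f x))\<^sup>2 \<le> (C * norm (g x))\<^sup>2"
        by (rule power_mono) simp
      then show ?case by (simp add: power_mult_distrib)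
    qed
  qed
  then show ?thesis using assms(2) by (simp add: sqi_def)
qed

lemma sqi_scaleR: "sqi M f \<Longrightarrow> sqi M (\<lambda>x. c *\<^sub>R f x)"
  by (rule sqi_bound[where C = "\<bar>c\<bar>"]) auto

lemma sqi_cmult: "sqi M f \<Longrightarrow> sqi M (\<lambda>x. c * (f x :: real))"
  using sqi_scaleR[of M f c] by simp

lemma norm_add_power2_le: "(norm (a + b))\<^sup>2 \<le> 2 * (norm a)\<^sup>2 + 2 * (norm (b :: 'b::real_normed_vector))\<^sup>2"
proof -
  have "(norm (a + b))\<^sup>2 \<le> (norm a + norm b)\<^sup>2"
    by (intro power_mono norm_triangle_ineq norm_ge_zero)
  also have "\<dots> \<le> 2 * (norm a)\<^sup>2 + 2 * (norm b)\<^sup>2"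
    using sum_squares_ge_zero[of "norm a - norm b" 0] by (simp add: power2_eq_square algebra_simps)
  finally show ?thesis .
qed

lemma sqi_add:
  assumes "sqi M f" "sqi M g"
  shows "sqi M (\<lambda>x. f x + g x)"
proof -
  have "integrable M (\<lambda>x. (norm (f x + g x))\<^sup>2)"
  proof (rule Bochner_Integration.integrable_bound)
    show "integrable M (\<lambda>x. 2 * (norm (f x))\<^sup>2 + 2 * (norm (g x))\<^sup>2)"
      using assms by (auto simp: sqi_def)
    show "(\<lambda>x. (norm (f x + g x))\<^sup>2) \<in> borel_measurable M"
      using assms by measurable
    show "AE x in M. norm ((norm (f x + g x))\<^sup>2) \<le> norm (2 * (norm (f x))\<^sup>2 + 2 * (norm (g x))\<^sup>2)"
      using norm_add_power2_le by (intro AE_I2) (simp add: abs_of_nonneg)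
  qed
  then show ?thesis using assms by (auto simp: sqi_def)
qed

lemma sqi_diff:
  assumes "sqi M f" "sqi M g"
  shows "sqi M (\<lambda>x. f x - g x)"
  using sqi_add[OF assms(1) sqi_scaleR[OF assms(2), of "-1"]] by simp

lemma sqi_norm_mult:
  assumes "sqi M f" "sqi M g"
  shows "integrable M (\<lambda>x. norm (f x) * norm (g x))"
proof (rule Bochner_Integration.integrable_bound)
  show "integrable M (\<lambda>x. (norm (f x))\<^sup>2 + (norm (g x))\<^sup>2)"
    using assms by (auto simp: sqi_def)
  show "(\<lambda>x. norm (f x) * norm (g x)) \<in> borel_measurable M"
    using assms by measurable
  have "norm (f x) * norm (g x) \<le> (norm (f x))\<^sup>2 + (norm (g x))\<^sup>2" for x
  proof -
    have "2 * norm (f x) * norm (g x) \<le> (norm (f x))\<^sup>2 + (norm (g x))\<^sup>2"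
      by (rule sum_squares_bound)
    moreover have "0 \<le> norm (f x) * norm (g x)" by simp
    ultimately show ?thesis by linarith
  qed
  then show "AE x in M. norm (norm (f x) * norm (g x)) \<le> norm ((norm (f x))\<^sup>2 + (norm (g x))\<^sup>2)"
    by (intro AE_I2) (simp add: abs_mult abs_of_nonneg)
qed

text \<open>All integrands of the flux estimates are controlled in this form, by a product of two
  square integrable norms; \<open>abs_integral_sqi_le\<close> is the quantitative counterpart with
  the same premises.\<close>

lemma integrable_sqi_bound:
  fixes k :: "'a \<Rightarrow> real"
  assumes "sqi M f" "sqi M g" "k \<in> borel_measurable M"
    and "AE x in M. \<bar>k x\<bar> \<le> C * (norm (f x) * norm (g x))"
  shows "integrable M k"
proof (rule Bochner_Integration.integrable_bound[OF _ assms(3)])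
  show "integrable M (\<lambda>x. C * (norm (f x) * norm (g x)))"
    using sqi_norm_mult[OF assms(1,2)] by simp
  show "AE x in M. norm (k x) \<le> norm (C * (norm (f x) * norm (g x)))"
    using assms(4) by eventually_elim auto
qed

lemma l2_eq_0_AE:
  assumes "sqi M f" "l2 M f = 0"
  shows "AE x in M. f x = 0"
proof -
  have "(LINT x|M. (norm (f x))\<^sup>2) = 0" using assms(2) by (simp add: l2_def)
  then have "AE x in M. (norm (f x))\<^sup>2 = 0"
    using integral_nonneg_eq_0_iff_AE[OF sqi_integrable[OF assms(1)]] by simp
  then show ?thesis by simp
qed

text \<open>Young's inequality with a weight \<open>s\<close>, integrated; the ratio of the two
  norms is the weight that makes the right-hand side equal to twice the product of the
  norms.\<close>

lemma integral_norm_mult_le: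
  assumes "sqi M f" "sqi M g"
  shows "(LINT x|M. norm (f x) * norm (g x)) \<le> l2 M f * l2 M g"
proof (cases "l2 M f = 0 \<or> l2 M g = 0")
  case True
  then have "AE x in M. norm (f x) * norm (g x) = 0"
    using l2_eq_0_AE[OF assms(1)] l2_eq_0_AE[OF assms(2)] by (auto elim: eventually_mono)
  then have "(LINT x|M. norm (f x) * norm (g x)) = 0"
    by (rule integral_eq_zero_AE)
  then show ?thesis by simp
next
  case False
  define s where "s = l2 M g / l2 M f"
  have pos: "l2 M f > 0" "l2 M g > 0"
    using False l2_nonneg[of M f] l2_nonneg[of M g] by linarith+
  then have s: "s > 0" by (simp add: s_def)
  have "2 * (norm (f x) * norm (g x)) \<le> s * (norm (f x))\<^sup>2 + (norm (g x))\<^sup>2 / s" for x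
  proof -
    have "2 * (sqrt s * norm (f x)) * (norm (g x) / sqrt s) \<le> (sqrt s * norm (f x))\<^sup>2 + (norm (g x) / sqrt s)\<^sup>2"
      by (rule sum_squares_bound)
    then show ?thesis using s by (simp add: power_mult_distrib power_divide)
  qed
  then have "(LINT x|M. 2 * (norm (f x) * norm (g x))) \<le> (LINT x|M. s * (norm (f x))\<^sup>2 + (norm (g x))\<^sup>2 / s)"
    using assms by (intro integral_mono) (auto intro!: sqi_norm_mult sqi_integrable)
  also have "\<dots> = s * (l2 M f)\<^sup>2 + (l2 M g)\<^sup>2 / s"
    using assms by (simp add: l2_power2 sqi_integrable)
  also have "\<dots> = 2 * (l2 M f * l2 M g)"
    using pos by (simp add: s_def power2_eq_square)
  finally show ?thesis by simp
qed

lemma abs_integral_sqi_le: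
  fixes k :: "'a \<Rightarrow> real"
  assumes "sqi M f" "sqi M g" "k \<in> borel_measurable M"
    and "AE x in M. \<bar>k x\<bar> \<le> C * (norm (f x) * norm (g x))" "0 \<le> C"
  shows "\<bar>LINT x|M. k x\<bar> \<le> C * (l2 M f * l2 M g)"
proof -
  have "\<bar>LINT x|M. k x\<bar> \<le> (LINT x|M. \<bar>k x\<bar>)"
    by (rule integral_abs_bound)
  also have "\<dots> \<le> (LINT x|M. C * (norm (f x) * norm (g x)))"
    using assms by (intro integral_mono_AE) (auto intro!: integrable_sqi_bound[OF assms(1-4)] sqi_norm_mult)
  also have "\<dots> \<le> C * (l2 M f * l2 M g)"
    using integral_norm_mult_le[OF assms(1,2)] assms(5) by (simp add: mult_left_mono)
  finally show ?thesis .
qed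

lemma sqi_inner:
  assumes "sqi M f" "sqi M g"
  shows "integrable M (\<lambda>x. f x \<bullet> g x)"
  by (rule integrable_sqi_bound[OF assms, where C = 1])
     (use assms in \<open>auto simp: Cauchy_Schwarz_ineq2\<close>)

lemma Cauchy_Schwarz_l2:
  assumes "sqi M f" "sqi M g"
  shows "\<bar>LINT x|M. f x \<bullet> g x\<bar> \<le> l2 M f * l2 M g"
  using abs_integral_sqi_le[OF assms, where C = 1 and k = "\<lambda>x. f x \<bullet> g x"] assms
  by (auto simp: Cauchy_Schwarz_ineq2)

lemma l2_add_power2:
  assumes "sqi M f" "sqi M g"
  shows "(l2 M (\<lambda>x. f x + g x))\<^sup>2 = (l2 M f)\<^sup>2 + 2 * (LINT x|M. f x \<bullet> g x) + (l2 M g)\<^sup>2"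
proof -
  have "(norm (f x + g x))\<^sup>2 = (norm (f x))\<^sup>2 + 2 * (f x \<bullet> g x) + (norm (g x))\<^sup>2" for x
    by (simp add: power2_norm_eq_inner inner_add inner_commute)
  then show ?thesis
    using assms by (simp add: l2_power2 sqi_integrable sqi_inner)
qed

lemma l2_triangle:
  assumes "sqi M f" "sqi M g"
  shows "l2 M (\<lambda>x. f x + g x) \<le> l2 M f + l2 M g"
proof (rule power2_le_imp_le)
  have "(LINT x|M. f x \<bullet> g x) \<le> l2 M f * l2 M g"
    using Cauchy_Schwarz_l2[OF assms] by linarith
  then show "(l2 M (\<lambda>x. f x + g x))\<^sup>2 \<le> (l2 M f + l2 M g)\<^sup>2"
    by (simp add: l2_add_power2[OF assms] power2_sum)
qed simp

lemma l2_scaleR: "l2 M (\<lambda>x. c *\<^sub>R f x) = \<bar>c\<bar> * l2 M f"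
  by (simp add: l2_def power_mult_distrib real_sqrt_mult)

lemma l2_cmult: "l2 M (\<lambda>x. c * (f x :: real)) = \<bar>c\<bar> * l2 M f"
  using l2_scaleR[of M c f] by simp

lemma l2_minus_commute: "l2 M (\<lambda>x. f x - g x) = l2 M (\<lambda>x. g x - f x)"
  by (simp add: l2_def norm_minus_commute)

lemma l2_triangle_sub:
  assumes "sqi M f" "sqi M g" "sqi M h"
  shows "l2 M (\<lambda>x. f x - h x) \<le> l2 M (\<lambda>x. f x - g x) + l2 M (\<lambda>x. g x - h x)"
  using l2_triangle[OF sqi_diff[OF assms(1,2)] sqi_diff[OF assms(2,3)]] by simp

lemma l2_cong_AE:
  assumes "AE x in M. norm (f x) = norm (g x)" "f \<in> borel_measurable M" "g \<in> borel_measurable M"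
  shows "l2 M f = l2 M g"
  unfolding l2_def
  by (intro arg_cong[where f = sqrt] integral_cong_AE) (use assms in \<open>auto elim: eventually_mono\<close>)

lemma l2_mono_AE:
  assumes "sqi M g" "f \<in> borel_measurable M" "AE x in M. norm (f x) \<le> C * norm (g x)" "0 \<le> C"
  shows "l2 M f \<le> C * l2 M g"
proof -
  have "l2 M f \<le> l2 M (\<lambda>x. C *\<^sub>R g x)"
    unfolding l2_def
  proof (intro real_sqrt_le_mono integral_mono_AE)
    show "integrable M (\<lambda>x. (norm (f x))\<^sup>2)" "integrable M (\<lambda>x. (norm (C *\<^sub>R g x))\<^sup>2)"
      by (rule sqi_integrable[OF sqi_bound[OF assms(1-3)]], rule sqi_integrable[OF sqi_scaleR[OF assms(1)]])
    show "AE x in M. (norm (f x))\<^sup>2 \<le> (norm (C *\<^sub>R g x))\<^sup>2"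
      using assms(3) by eventually_elim (use assms(4) in \<open>auto intro!: power_mono\<close>)
  qed
  then show ?thesis using assms(4) by (simp add: l2_scaleR)
qed

lemma (in finite_measure) sqi_bounded:
  assumes "f \<in> borel_measurable M" "AE x in M. norm (f x) \<le> C"
  shows "sqi M f"
proof -
  have "sqi M (\<lambda>x. 1 :: real)" by (simp add: sqi_def)
  from sqi_bound[OF this assms(1), of C] assms(2) show ?thesis by simp
qed

lemma (in finite_measure) sqi_imp_integrable:
  assumes "sqi M f"
  shows "integrable M f"
proof -
  have "sqi M (\<lambda>x. 1 :: real)" by (simp add: sqi_def)
  from sqi_norm_mult[OF assms this] have "integrable M (\<lambda>x. norm (f x))" by simp
  then show ?thesis using sqi_measurable[OF assms] by (rule integrable_norm_cancel)
qed

text \<open>On a finite measure an L2 Cauchy sequence is Cauchy in L1 and therefore has a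
  subsequence that converges almost everywhere. Its limit is the L2 limit of the whole sequence by
  Fatou's lemma.\<close>

lemma (in finite_measure) l2_complete:
  fixes F :: "nat \<Rightarrow> 'a \<Rightarrow> 'b::euclidean_space"
  assumes F: "\<And>n. sqi M (F n)"
    and Cauchy: "\<And>e. e > 0 \<Longrightarrow> \<exists>N. \<forall>m\<ge>N. \<forall>n\<ge>N. l2 M (\<lambda>x. F m x - F n x) < e"
  shows "\<exists>G. sqi M G \<and> (\<lambda>n. l2 M (\<lambda>x. F n x - G x)) \<longlonglongrightarrow> 0"
proof -
  have one: "sqi M (\<lambda>x. 1 :: real)" by (simp add: sqi_def)
  have l1: "(LINT x|M. norm (F i x - F j x)) \<le> l2 M (\<lambda>x. F i x - F j x) * l2 M (\<lambda>x. 1 :: real)" for i j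
    using integral_norm_mult_le[OF sqi_diff[OF F F] one] by simp
  have "\<exists>N. \<forall>i\<ge>N. \<forall>j\<ge>N. (LINT x|M. norm (F i x - F j x)) < e" if e: "e > 0" for e
  proof -
    define A where "A = l2 M (\<lambda>x. 1 :: real) + 1"
    have A: "A > 0" using l2_nonneg[of M "\<lambda>x. 1 :: real"] by (simp add: A_def add_nonneg_pos)
    obtain N where N: "\<And>m n. m \<ge> N \<Longrightarrow> n \<ge> N \<Longrightarrow> l2 M (\<lambda>x. F m x - F n x) < e / A"
      using Cauchy[of "e / A"] e A by auto
    have "(LINT x|M. norm (F i x - F j x)) < e" if "i \<ge> N" "j \<ge> N" for i j
    proof -
      have "(LINT x|M. norm (F i x - F j x)) \<le> l2 M (\<lambda>x. F i x - F j x) * A"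
        using l1[of i j] by (rule order_trans) (auto simp: A_def intro!: mult_left_mono)
      also have "\<dots> < e" using N[OF that] A by (simp add: field_simps)
      finally show ?thesis .
    qed
    then show ?thesis by blast
  qed
  then obtain r where r: "strict_mono r" "AE x in M. Cauchy (\<lambda>i. F (r i) x)"
    using cauchy_L1_AE_cauchy_subseq[of M F] sqi_imp_integrable[OF F] by metis
  define G where "G x = lim (\<lambda>i. F (r i) x)" for x
  have Gm [measurable]: "G \<in> borel_measurable M"
    unfolding G_def using sqi_measurable[OF F] by measurable
  have lim: "AE x in M. (\<lambda>i. F (r i) x) \<longlonglongrightarrow> G x"
    using r(2) by eventually_elim (simp only: G_def Cauchy_convergent_iff convergent_LIMSEQ_iff)
  \<comment> \<open>Fatou's lemma along the subsequence: a bound for the distance of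
    \<open>F n\<close> to all late members is inherited by the distance to \<open>G\<close>. Used
    once for square integrability of \<open>G\<close> and once for the convergence.\<close>
  have key: "sqi M (\<lambda>x. F n x - G x) \<and> l2 M (\<lambda>x. F n x - G x) \<le> e"
    if "e > 0" "\<And>m. m \<ge> N \<Longrightarrow> l2 M (\<lambda>x. F n x - F m x) < e" for e n N
  proof -
    have nn: "(\<integral>\<^sup>+x. ennreal ((norm (F n x - G x))\<^sup>2) \<partial>M) \<le> ennreal (e\<^sup>2)"
    proof -
      have "(\<integral>\<^sup>+x. ennreal ((norm (F n x - G x))\<^sup>2) \<partial>M)
          = (\<integral>\<^sup>+x. liminf (\<lambda>i. ennreal ((norm (F n x - F (r i) x))\<^sup>2)) \<partial>M)"
      proof (rule nn_integral_cong_AE)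
        show "AE x in M. ennreal ((norm (F n x - G x))\<^sup>2) = liminf (\<lambda>i. ennreal ((norm (F n x - F (r i) x))\<^sup>2))"
          using lim
        proof eventually_elim
          case (elim x)
          have "(\<lambda>i. ennreal ((norm (F n x - F (r i) x))\<^sup>2)) \<longlonglongrightarrow> ennreal ((norm (F n x - G x))\<^sup>2)"
            by (intro tendsto_ennrealI tendsto_intros elim)
          from lim_imp_Liminf[OF _ this] show ?case by simp
        qed
      qed
      also have "\<dots> \<le> liminf (\<lambda>i. \<integral>\<^sup>+x. ennreal ((norm (F n x - F (r i) x))\<^sup>2) \<partial>M)"
        using sqi_measurable[OF F] by (intro nn_integral_liminf) measurable
      also have "\<dots> \<le> ennreal (e\<^sup>2)"
      proof (rule Liminf_le)
        show "\<forall>\<^sub>F i in sequentially. (\<integral>\<^sup>+x. ennreal ((norm (F n x - F (r i) x))\<^sup>2) \<partial>M) \<le> ennreal (e\<^sup>2)"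
          using eventually_ge_at_top[of N]
        proof eventually_elim
          case (elim i)
          then have "r i \<ge> N" using seq_suble[OF r(1), of i] by linarith
          then have "(l2 M (\<lambda>x. F n x - F (r i) x))\<^sup>2 \<le> e\<^sup>2"
            using that(2) by (intro power_mono) (auto intro: less_imp_le)
          then show ?case
            using sqi_integrable[OF sqi_diff[OF F F]]
            by (subst nn_integral_eq_integral) (auto simp: l2_power2)
        qed
      qed simp
      finally show ?thesis .
    qed
    have i: "integrable M (\<lambda>x. (norm (F n x - G x))\<^sup>2)"
      using nn sqi_measurable[OF F]
      by (intro integrableI_bounded) (auto intro: order.strict_trans1 simp: ennreal_less_top)
    have "(LINT x|M. (norm (F n x - G x))\<^sup>2) \<le> e\<^sup>2"
      using nn by (subst (asm) nn_integral_eq_integral[OF i]) auto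
    then have "l2 M (\<lambda>x. F n x - G x) \<le> sqrt (e\<^sup>2)"
      unfolding l2_def by (rule real_sqrt_le_mono)
    then show ?thesis using that(1) i sqi_measurable[OF F[of n]] Gm by (auto simp: sqi_def)
  qed
  obtain N0 where N0: "\<And>m n. m \<ge> N0 \<Longrightarrow> n \<ge> N0 \<Longrightarrow> l2 M (\<lambda>x. F m x - F n x) < 1"
    using Cauchy[of 1] by auto
  have "sqi M (\<lambda>x. F N0 x - G x)"
    using key[of 1 N0 N0] N0 by auto
  from sqi_diff[OF F[of N0] this] have "sqi M G" by simp
  moreover have "(\<lambda>n. l2 M (\<lambda>x. F n x - G x)) \<longlonglongrightarrow> 0"
  proof (rule LIMSEQ_I)
    fix e :: real assume "e > 0"
    then obtain N where N: "\<And>m n. m \<ge> N \<Longrightarrow> n \<ge> N \<Longrightarrow> l2 M (\<lambda>x. F m x - F n x) < e / 2"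
      using Cauchy[of "e / 2"] by auto
    have "l2 M (\<lambda>x. F n x - G x) \<le> e / 2" if "n \<ge> N" for n
      using key[of "e / 2" N n] N[OF that] \<open>e > 0\<close> by auto
    then have "norm (l2 M (\<lambda>x. F n x - G x) - 0) < e" if "n \<ge> N" for n
      using that \<open>e > 0\<close> l2_nonneg[of M "\<lambda>x. F n x - G x"] by fastforce
    then show "\<exists>N. \<forall>n\<ge>N. norm (l2 M (\<lambda>x. F n x - G x) - 0) < e" by blast
  qed
  ultimately show ?thesis by blast
qed



section \<open>The Lax-Milgram theorem\<close>

text \<open>Evaluating at the minimum t = -b/c gives the claim. For c = 0 a nonzero \<open>b\<close>
  would allow a \<open>t\<close> at which the value is -1.\<close>

lemma quadratic_nonneg_discriminant:
  fixes a b c :: real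
  assumes "\<And>t. 0 \<le> a + 2 * t * b + t\<^sup>2 * c" "0 \<le> c"
  shows "b\<^sup>2 \<le> a * c"
proof (cases "c = 0")
  case True
  have "b = 0"
  proof (rule ccontr)
    assume "b \<noteq> 0"
    then have "2 * (- (a + 1) / (2 * b)) * b = - (a + 1)" by simp
    then show False using assms(1)[of "- (a + 1) / (2 * b)"] True by simp
  qed
  then show ?thesis using True by simp
next
  case False
  then have c: "c > 0" using assms(2) by simp
  have "0 \<le> a + 2 * (- b / c) * b + (- b / c)\<^sup>2 * c" by (rule assms(1))
  also have "\<dots> = a - b\<^sup>2 / c"
    using c by (simp add: power2_eq_square field_simps)
  finally show ?thesis using c by (simp add: field_simps)
qed

text \<open>A Hilbert space of real functions without the separation axiom: functions at distance zero,
  such as representatives of the same class, need not be equal.\<close>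

locale seminner_space =
  fixes H :: "('a \<Rightarrow> real) set" and I :: "('a \<Rightarrow> real) \<Rightarrow> ('a \<Rightarrow> real) \<Rightarrow> real"
  assumes H_zero: "(\<lambda>x. 0) \<in> H"
    and H_add: "u \<in> H \<Longrightarrow> v \<in> H \<Longrightarrow> (\<lambda>x. u x + v x) \<in> H"
    and H_cmult: "u \<in> H \<Longrightarrow> (\<lambda>x. c * u x) \<in> H"
    and I_commute: "u \<in> H \<Longrightarrow> v \<in> H \<Longrightarrow> I u v = I v u"
    and I_add_left: "u \<in> H \<Longrightarrow> v \<in> H \<Longrightarrow> w \<in> H \<Longrightarrow> I (\<lambda>x. u x + v x) w = I u w + I v w"
    and I_cmult_left: "u \<in> H \<Longrightarrow> v \<in> H \<Longrightarrow> I (\<lambda>x. c * u x) v = c * I u v"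
    and I_nonneg: "u \<in> H \<Longrightarrow> 0 \<le> I u u"
    and complete: "(\<And>n::nat. U n \<in> H) \<Longrightarrow>
      (\<And>e. e > 0 \<Longrightarrow> \<exists>N. \<forall>m\<ge>N. \<forall>n\<ge>N. I (\<lambda>x. U m x - U n x) (\<lambda>x. U m x - U n x) < e) \<Longrightarrow>
      \<exists>u\<in>H. (\<lambda>n. I (\<lambda>x. U n x - u x) (\<lambda>x. U n x - u x)) \<longlonglongrightarrow> 0"
begin

lemma H_diff: "u \<in> H \<Longrightarrow> v \<in> H \<Longrightarrow> (\<lambda>x. u x - v x) \<in> H"
  using H_add[of u "\<lambda>x. (-1) * v x"] H_cmult[of v "-1"] by simp

lemma I_add_right:
  assumes "u \<in> H" "v \<in> H" "w \<in> H"
  shows "I w (\<lambda>x. u x + v x) = I w u + I w v"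
  using I_add_left[OF assms] I_commute[OF assms(3) H_add[OF assms(1,2)]]
    I_commute[OF assms(3,1)] I_commute[OF assms(3,2)] by simp

lemma I_cmult_right:
  assumes "u \<in> H" "v \<in> H"
  shows "I v (\<lambda>x. c * u x) = c * I v u"
  using I_cmult_left[OF assms] I_commute[OF assms(2) H_cmult[OF assms(1)]] I_commute[OF assms(2,1)]
  by simp

lemma I_diff_left:
  assumes "u \<in> H" "v \<in> H" "w \<in> H"
  shows "I (\<lambda>x. u x - v x) w = I u w - I v w"
  using I_add_left[of u "\<lambda>x. (-1) * v x" w] H_cmult[of v "-1"] I_cmult_left[of v w "-1"] assms by simp

lemma I_add_cmult:
  assumes "u \<in> H" "v \<in> H"
  shows "I (\<lambda>x. u x + t * v x) (\<lambda>x. u x + t * v x) = I u u + 2 * t * I u v + t\<^sup>2 * I v v"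
proof -
  have tv: "(\<lambda>x. t * v x) \<in> H" and s: "(\<lambda>x. u x + t * v x) \<in> H"
    using assms by (auto intro!: H_cmult H_add)
  show ?thesis
    using assms tv s
    by (simp add: I_add_left I_add_right I_cmult_left I_cmult_right I_commute[of v u] power2_eq_square algebra_simps)
qed

lemma I_Cauchy_Schwarz:
  assumes "u \<in> H" "v \<in> H"
  shows "\<bar>I u v\<bar> \<le> sqrt (I u u) * sqrt (I v v)"
proof -
  have "0 \<le> I u u + 2 * t * I u v + t\<^sup>2 * I v v" for t
    using I_nonneg[of "\<lambda>x. u x + t * v x"] I_add_cmult[OF assms, of t] assms H_add H_cmult by simp
  then have "(I u v)\<^sup>2 \<le> I u u * I v v"
    using I_nonneg assms by (intro quadratic_nonneg_discriminant)
  then have "sqrt ((I u v)\<^sup>2) \<le> sqrt (I u u * I v v)"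
    by (rule real_sqrt_le_mono)
  then show ?thesis by (simp add: real_sqrt_mult)
qed

text \<open>The representing element minimises \<open>I u u - 2 * F u\<close>. The parallelogram
  identity makes every minimising sequence Cauchy, and the representation is the Euler equation of
  the minimum.\<close>

lemma Riesz_representation:
  assumes F_add: "\<And>u v. u \<in> H \<Longrightarrow> v \<in> H \<Longrightarrow> F (\<lambda>x. u x + v x) = F u + F v"
    and F_cmult: "\<And>c u. u \<in> H \<Longrightarrow> F (\<lambda>x. c * u x) = c * F u"
    and F_bound: "\<And>u. u \<in> H \<Longrightarrow> \<bar>F u\<bar> \<le> C * sqrt (I u u)"
  shows "\<exists>w\<in>H. \<forall>v\<in>H. I w v = F v"
proof -
  define J where "J u = I u u - 2 * F u" for u
  define m where "m = Inf (J ` H)"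
  have lower: "- C\<^sup>2 \<le> J u" if "u \<in> H" for u
  proof -
    have "0 \<le> (sqrt (I u u) - C)\<^sup>2" by simp
    also have "\<dots> = I u u - 2 * (C * sqrt (I u u)) + C\<^sup>2"
      using I_nonneg[OF that] by (simp add: power2_diff)
    also have "\<dots> \<le> J u + C\<^sup>2"
      using F_bound[OF that] by (simp add: J_def)
    finally show ?thesis by simp
  qed
  then have bdd: "bdd_below (J ` H)" by (auto intro!: bdd_belowI)
  have m_le: "m \<le> J u" if "u \<in> H" for u
    unfolding m_def using bdd that by (intro cInf_lower) auto
  have "\<exists>u\<in>H. J u < m + 1 / real (Suc n)" for n
    using cInf_lessD[of "J ` H" "m + 1 / real (Suc n)"] H_zero unfolding m_def by force
  then obtain U where U: "\<And>n. U n \<in> H" "\<And>n. J (U n) < m + 1 / real (Suc n)"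
    by metis
  \<comment> \<open>With \<open>?h\<close> the midpoint of \<open>u\<close> and \<open>v\<close>,
    the squared distance equals 2 J(u) + 2 J(v) - 4 J(?h), and J(?h) is at least
    \<open>m\<close>.\<close>
  have parallelogram: "I (\<lambda>x. u x - v x) (\<lambda>x. u x - v x) \<le> 2 * (J u - m) + 2 * (J v - m)"
    if "u \<in> H" "v \<in> H" for u v
  proof -
    let ?h = "\<lambda>x. (1/2) * (u x + 1 * v x)"
    have s: "(\<lambda>x. u x + 1 * v x) \<in> H" using H_add[OF that] by simp
    have "I ?h ?h = (1/4) * (I u u + 2 * I u v + I v v)"
      using H_cmult[OF s, of "1/2"] s I_add_cmult[OF that, of 1]
      by (simp only: I_cmult_left I_cmult_right) simp
    moreover have "F ?h = (1/2) * (F u + F v)"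
      using F_cmult[OF s, of "1/2"] F_add[OF that] by simp
    moreover have "m \<le> J ?h" using H_cmult[OF s] by (intro m_le)
    moreover have "I (\<lambda>x. u x - v x) (\<lambda>x. u x - v x) = I u u - 2 * I u v + I v v"
      using I_add_cmult[OF that, of "-1"] by simp
    ultimately show ?thesis by (simp add: J_def)
  qed
  have tend: "(\<lambda>n. 1 / real (Suc n)) \<longlonglongrightarrow> 0"
    using LIMSEQ_inverse_real_of_nat by (simp add: inverse_eq_divide)
  have "\<exists>w\<in>H. (\<lambda>n. I (\<lambda>x. U n x - w x) (\<lambda>x. U n x - w x)) \<longlonglongrightarrow> 0"
  proof (rule complete)
    fix e :: real assume "e > 0"
    then obtain N where N: "\<And>n. n \<ge> N \<Longrightarrow> 1 / real (Suc n) < e / 4"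
      using LIMSEQ_D[OF tend, of "e / 4"] by auto
    have JN: "J (U n) < m + e / 4" if "n \<ge> N" for n
      using U(2) add_strict_left_mono[OF N[OF that]] by (rule less_trans)
    have "I (\<lambda>x. U i x - U j x) (\<lambda>x. U i x - U j x) < e" if "i \<ge> N" "j \<ge> N" for i j
      using parallelogram[OF U(1) U(1), of i j] JN[OF that(1)] JN[OF that(2)] by argo
    then show "\<exists>N. \<forall>i\<ge>N. \<forall>j\<ge>N. I (\<lambda>x. U i x - U j x) (\<lambda>x. U i x - U j x) < e" by blast
  qed (rule U)
  then obtain w where w: "w \<in> H" "(\<lambda>n. I (\<lambda>x. U n x - w x) (\<lambda>x. U n x - w x)) \<longlonglongrightarrow> 0"
    by blast
  have "I w v = F v" if v: "v \<in> H" for v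
  proof -
    have "(\<lambda>n. sqrt (I (\<lambda>x. U n x - w x) (\<lambda>x. U n x - w x)) * sqrt (I v v)) \<longlonglongrightarrow> sqrt 0 * sqrt (I v v)"
      by (intro tendsto_intros w)
    then have "(\<lambda>n. sqrt (I (\<lambda>x. U n x - w x) (\<lambda>x. U n x - w x)) * sqrt (I v v)) \<longlonglongrightarrow> 0"
      by simp
    moreover have "\<forall>\<^sub>F n in sequentially. norm (I (\<lambda>x. U n x - w x) v)
        \<le> sqrt (I (\<lambda>x. U n x - w x) (\<lambda>x. U n x - w x)) * sqrt (I v v)"
      using I_Cauchy_Schwarz[OF H_diff[OF U(1) w(1)] v] by simp
    ultimately have "(\<lambda>n. I (\<lambda>x. U n x - w x) v) \<longlonglongrightarrow> 0"
      by (rule Lim_null_comparison[rotated])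
    then have lim: "(\<lambda>n. I (U n) v) \<longlonglongrightarrow> I w v"
      using I_diff_left[OF U(1) w(1) v] by (simp add: LIM_zero_iff)
    \<comment> \<open>This is the limit of J(U n + t v) - m, with the excess of J(U n) over
      \<open>m\<close> bounded by 1/(n+1). A nonnegative parabola through 0 has no linear term,
      which is the discriminant bound with constant term 0.\<close>
    have "0 \<le> 0 + 2 * t * (I w v - F v) + t\<^sup>2 * I v v" for t
    proof (rule LIMSEQ_le_const)
      show "(\<lambda>n. 1 / real (Suc n) + 2 * t * (I (U n) v - F v) + t\<^sup>2 * I v v)
          \<longlonglongrightarrow> 0 + 2 * t * (I w v - F v) + t\<^sup>2 * I v v"
        by (intro tendsto_intros lim tend)
      have "0 \<le> 1 / real (Suc n) + 2 * t * (I (U n) v - F v) + t\<^sup>2 * I v v" for n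
      proof -
        have tv: "(\<lambda>x. t * v x) \<in> H" using H_cmult[OF v] .
        have "m \<le> J (\<lambda>x. U n x + t * v x)"
          using H_add[OF U(1) tv] by (rule m_le)
        also have "\<dots> = J (U n) + 2 * t * (I (U n) v - F v) + t\<^sup>2 * I v v"
          by (simp add: J_def I_add_cmult[OF U(1) v] F_add[OF U(1) tv] F_cmult[OF v] algebra_simps)
        finally show ?thesis using U(2)[of n] by argo
      qed
      then show "\<exists>N. \<forall>n\<ge>N. 0 \<le> 1 / real (Suc n) + 2 * t * (I (U n) v - F v) + t\<^sup>2 * I v v" by blast
    qed
    then have "(I w v - F v)\<^sup>2 \<le> 0 * I v v"
      using I_nonneg[OF v] by (rule quadratic_nonneg_discriminant)
    then show ?thesis by simp
  qed
  then show ?thesis using w(1) by blast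
qed

text \<open>The adjoint \<open>S\<close> of the operator of \<open>B\<close> is bounded below, so that \<open>I (S w) (S v)\<close> is again a complete
  inner product; if it represents \<open>F\<close> by \<open>w\<close>, then \<open>S w\<close> solves the problem.\<close>

theorem Lax_Milgram:
  assumes B_add_left: "\<And>u v w. u \<in> H \<Longrightarrow> v \<in> H \<Longrightarrow> w \<in> H \<Longrightarrow> B (\<lambda>x. u x + v x) w = B u w + B v w"
    and B_cmult_left: "\<And>c u v. u \<in> H \<Longrightarrow> v \<in> H \<Longrightarrow> B (\<lambda>x. c * u x) v = c * B u v"
    and B_add_right: "\<And>u v w. u \<in> H \<Longrightarrow> v \<in> H \<Longrightarrow> w \<in> H \<Longrightarrow> B w (\<lambda>x. u x + v x) = B w u + B w v"
    and B_cmult_right: "\<And>c u v. u \<in> H \<Longrightarrow> v \<in> H \<Longrightarrow> B v (\<lambda>x. c * u x) = c * B v u"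
    and B_bound: "\<And>u v. u \<in> H \<Longrightarrow> v \<in> H \<Longrightarrow> \<bar>B u v\<bar> \<le> K * (sqrt (I u u) * sqrt (I v v))"
    and B_coercive: "\<And>u. u \<in> H \<Longrightarrow> c * I u u \<le> B u u" and "c > 0"
    and F_add: "\<And>u v. u \<in> H \<Longrightarrow> v \<in> H \<Longrightarrow> F (\<lambda>x. u x + v x) = F u + F v"
    and F_cmult: "\<And>c u. u \<in> H \<Longrightarrow> F (\<lambda>x. c * u x) = c * F u"
    and F_bound: "\<And>u. u \<in> H \<Longrightarrow> \<bar>F u\<bar> \<le> C * sqrt (I u u)"
  shows "\<exists>u\<in>H. \<forall>v\<in>H. B u v = F v"
proof -
  \<comment> \<open>\<open>S v\<close> represents \<open>B\<close> in its first argument for fixed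
    second argument \<open>v\<close>, so \<open>S\<close> is the adjoint operator;
    \<open>low\<close> and \<open>up\<close> below say that it distorts the norm by bounded factors
    only.\<close>
  have "\<exists>w\<in>H. \<forall>u\<in>H. I w u = B u v" if v: "v \<in> H" for v
  proof (rule Riesz_representation)
    show "\<bar>B u v\<bar> \<le> (K * sqrt (I v v)) * sqrt (I u u)" if "u \<in> H" for u
      using B_bound[OF that v] by (simp add: mult_ac)
  qed (use v B_add_left B_cmult_left in auto)
  then obtain S where S: "\<And>v. v \<in> H \<Longrightarrow> S v \<in> H" "\<And>u v. v \<in> H \<Longrightarrow> u \<in> H \<Longrightarrow> I (S v) u = B u v"
    by metis
  have low: "c * sqrt (I v v) \<le> sqrt (I (S v) (S v))" if v: "v \<in> H" for v
  proof (cases "I v v = 0")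
    case False
    then have pos: "sqrt (I v v) > 0" using I_nonneg[OF v] by simp
    have "c * sqrt (I v v) * sqrt (I v v) = c * I v v"
      using I_nonneg[OF v] by simp
    also have "\<dots> \<le> I (S v) v" using B_coercive[OF v] S(2)[OF v v] by simp
    also have "\<dots> \<le> sqrt (I (S v) (S v)) * sqrt (I v v)"
      using I_Cauchy_Schwarz[OF S(1)[OF v] v] by linarith
    finally show ?thesis using pos by simp
  qed (use I_nonneg[OF S(1)[OF v]] in auto)
  have up: "I (S v) (S v) \<le> K\<^sup>2 * I v v" if v: "v \<in> H" for v
  proof (cases "I (S v) (S v) = 0")
    case True
    then show ?thesis using I_nonneg[OF v] by simp
  next
    case False
    then have pos: "sqrt (I (S v) (S v)) > 0" using I_nonneg[OF S(1)[OF v]] by simp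
    have "sqrt (I (S v) (S v)) * sqrt (I (S v) (S v)) = B (S v) v"
      using I_nonneg[OF S(1)[OF v]] S(2)[OF v S(1)[OF v]] by simp
    also have "\<dots> \<le> (K * sqrt (I v v)) * sqrt (I (S v) (S v))"
      using B_bound[OF S(1)[OF v] v] by (simp add: mult_ac)
    finally have "sqrt (I (S v) (S v)) \<le> K * sqrt (I v v)"
      by (rule mult_right_le_imp_le) (rule pos)
    then have "(sqrt (I (S v) (S v)))\<^sup>2 \<le> (K * sqrt (I v v))\<^sup>2"
      using pos by (intro power_mono) auto
    then show ?thesis using I_nonneg[OF S(1)[OF v]] I_nonneg[OF v] by (simp add: power_mult_distrib)
  qed
  \<comment> \<open>Completeness is transferred in two directions: \<open>low\<close> turns Cauchy
    sequences of the new product into Cauchy sequences of the old one, and \<open>up\<close> turns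
    convergence in the old product into convergence in the new one.\<close>
  interpret S: seminner_space H "\<lambda>u v. I (S u) (S v)"
  proof
    show "I (S u) (S v) = I (S v) (S u)" if "u \<in> H" "v \<in> H" for u v
      using that S(1) I_commute by simp
    show "I (S (\<lambda>x. u x + v x)) (S w) = I (S u) (S w) + I (S v) (S w)"
      if "u \<in> H" "v \<in> H" "w \<in> H" for u v w
      using that by (simp add: S B_add_right H_add)
    show "I (S (\<lambda>x. c * u x)) (S v) = c * I (S u) (S v)" if "u \<in> H" "v \<in> H" for c u v
      using that by (simp add: S B_cmult_right H_cmult)
    fix U :: "nat \<Rightarrow> 'a \<Rightarrow> real"
    assume U: "\<And>n. U n \<in> H"
      and Cauchy: "\<And>e. e > 0 \<Longrightarrow> \<exists>N. \<forall>m\<ge>N. \<forall>n\<ge>N.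
        I (S (\<lambda>x. U m x - U n x)) (S (\<lambda>x. U m x - U n x)) < e"
    have "\<exists>u\<in>H. (\<lambda>n. I (\<lambda>x. U n x - u x) (\<lambda>x. U n x - u x)) \<longlonglongrightarrow> 0"
    proof (rule complete[OF U])
      fix e :: real assume e: "e > 0"
      then obtain N where N: "\<And>m n. m \<ge> N \<Longrightarrow> n \<ge> N \<Longrightarrow>
          I (S (\<lambda>x. U m x - U n x)) (S (\<lambda>x. U m x - U n x)) < c\<^sup>2 * e"
        using Cauchy[of "c\<^sup>2 * e"] \<open>c > 0\<close> by auto
      have "I (\<lambda>x. U m x - U n x) (\<lambda>x. U m x - U n x) < e" if "m \<ge> N" "n \<ge> N" for m n
      proof -
        let ?v = "\<lambda>x. U m x - U n x"
        have v: "?v \<in> H" using U H_diff by blast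
        have "(c * sqrt (I ?v ?v))\<^sup>2 \<le> (sqrt (I (S ?v) (S ?v)))\<^sup>2"
          using low[OF v] \<open>c > 0\<close> I_nonneg[OF v] by (intro power_mono) auto
        then have "c\<^sup>2 * I ?v ?v \<le> I (S ?v) (S ?v)"
          using I_nonneg[OF v] I_nonneg[OF S(1)[OF v]] by (simp add: power_mult_distrib)
        also have "\<dots> < c\<^sup>2 * e" by (rule N[OF that])
        finally show ?thesis using \<open>c > 0\<close> by simp
      qed
      then show "\<exists>N. \<forall>m\<ge>N. \<forall>n\<ge>N. I (\<lambda>x. U m x - U n x) (\<lambda>x. U m x - U n x) < e" by blast
    qed
    then obtain u where u: "u \<in> H" "(\<lambda>n. I (\<lambda>x. U n x - u x) (\<lambda>x. U n x - u x)) \<longlonglongrightarrow> 0" by blast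
    have "(\<lambda>n. K\<^sup>2 * I (\<lambda>x. U n x - u x) (\<lambda>x. U n x - u x)) \<longlonglongrightarrow> K\<^sup>2 * 0"
      by (intro tendsto_intros u)
    then have "(\<lambda>n. K\<^sup>2 * I (\<lambda>x. U n x - u x) (\<lambda>x. U n x - u x)) \<longlonglongrightarrow> 0"
      by simp
    moreover have "\<forall>\<^sub>F n in sequentially. norm (I (S (\<lambda>x. U n x - u x)) (S (\<lambda>x. U n x - u x)))
        \<le> K\<^sup>2 * I (\<lambda>x. U n x - u x) (\<lambda>x. U n x - u x)"
      using up[OF H_diff[OF U u(1)]] I_nonneg[OF S(1)[OF H_diff[OF U u(1)]]] by simp
    ultimately have "(\<lambda>n. I (S (\<lambda>x. U n x - u x)) (S (\<lambda>x. U n x - u x))) \<longlonglongrightarrow> 0"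
      by (rule Lim_null_comparison[rotated])
    then show "\<exists>u\<in>H. (\<lambda>n. I (S (\<lambda>x. U n x - u x)) (S (\<lambda>x. U n x - u x))) \<longlonglongrightarrow> 0"
      using u(1) by blast
  qed (auto intro: H_zero H_add H_cmult I_nonneg S)
  have "\<bar>F u\<bar> \<le> (\<bar>C\<bar> / c) * sqrt (I (S u) (S u))" if u: "u \<in> H" for u
  proof -
    have "\<bar>F u\<bar> \<le> \<bar>C\<bar> * sqrt (I u u)"
      using F_bound[OF u] I_nonneg[OF u]
      by (meson abs_ge_self mult_right_mono order_trans real_sqrt_ge_zero)
    also have "\<dots> \<le> \<bar>C\<bar> * (sqrt (I (S u) (S u)) / c)"
      using low[OF u] \<open>c > 0\<close> by (intro mult_left_mono) (auto simp: field_simps)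
    finally show ?thesis by simp
  qed
  from S.Riesz_representation[OF F_add F_cmult this]
  obtain w where w: "w \<in> H" "\<And>v. v \<in> H \<Longrightarrow> I (S w) (S v) = F v" by blast
  have "B (S w) v = F v" if "v \<in> H" for v
    using w S that I_commute by metis
  then show ?thesis using S(1)[OF w(1)] by blast
qed

end



section \<open>The space \<open>H10\<close> on a bounded open set\<close>

lemma test_Lipschitz:
  assumes "f \<in> test_functions \<Omega>" "\<And>x. norm (grad f x) \<le> C"
  shows "\<bar>f y - f x\<bar> \<le> C * norm (y - x)"
proof -
  have "norm (f y - f x) \<le> C * norm (y - x)"
  proof (rule differentiable_bound[OF convex_UNIV])
    show "(f has_derivative (\<lambda>h. grad f z \<bullet> h)) (at z within UNIV)" for z
      using smooth_has_derivative[OF test_smooth[OF assms(1)]] by simp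
    show "onorm (\<lambda>h. grad f z \<bullet> h) \<le> C" for z
    proof (rule onorm_le)
      fix h
      have "norm (grad f z \<bullet> h) \<le> norm (grad f z) * norm h"
        by (simp add: Cauchy_Schwarz_ineq2)
      also have "\<dots> \<le> C * norm h" by (intro mult_right_mono assms(2)) simp
      finally show "norm (grad f z \<bullet> h) \<le> C * norm h" .
    qed
  qed auto
  then show ?thesis by simp
qed

lemma smooth_DERIV_line:
  assumes "smooth f"
  shows "((\<lambda>t. f (x + t *\<^sub>R v)) has_real_derivative grad f (x + t *\<^sub>R v) \<bullet> v) (at t)"
proof -
  have "((\<lambda>t. x + t *\<^sub>R v) has_derivative (\<lambda>s. s *\<^sub>R v)) (at t)"
    by (auto intro!: derivative_eq_intros)
  from has_derivative_compose[OF this smooth_has_derivative[OF assms]]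
  show ?thesis
    unfolding has_field_derivative_def by (rule has_derivative_eq_rhs) (auto simp: fun_eq_iff)
qed

lemma lborel_integral_translate:
  fixes f :: "'a::euclidean_space \<Rightarrow> real"
  assumes "f \<in> borel_measurable borel"
  shows "(LINT x|lborel. f (c + x)) = (LINT x|lborel. f x)"
proof -
  have "(LINT x|lborel. f x) = (LINT x|distr lborel borel ((+) c). f x)"
    by (simp add: lborel_distr_plus)
  also have "\<dots> = (LINT x|lborel. f (c + x))"
    using assms by (intro integral_distr) auto
  finally show ?thesis by simp
qed

lemma integrable_bounded_support:
  fixes f :: "'a::euclidean_space \<Rightarrow> real"
  assumes "f \<in> borel_measurable borel" "\<And>x. \<bar>f x\<bar> \<le> C" "bounded S" "\<And>x. x \<notin> S \<Longrightarrow> f x = 0"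
  shows "integrable lborel f"
proof -
  obtain R where R: "\<And>x. x \<in> S \<Longrightarrow> norm x \<le> R"
    using assms(3) by (auto simp: bounded_iff)
  show ?thesis
  proof (rule integrableI_bounded_set[where A = "cball 0 R" and B = C])
    show "emeasure lborel (cball (0::'a) R) < \<infinity>"
      by (rule emeasure_bounded_finite) simp
    show "AE x in lborel. x \<in> cball 0 R \<longrightarrow> norm (f x) \<le> C"
      using assms(2) by simp
    have "f x = 0" if "x \<notin> cball 0 R" for x
      using that R[of x] assms(4)[of x] by (cases "x \<in> S") auto
    then show "AE x in lborel. x \<notin> cball 0 R \<longrightarrow> f x = 0"
      by simp
  qed (use assms(1) in auto)
qed

text \<open>Since both Lebesgue measure and \<open>w\<close> are invariant under translations along
  the i-th axis, the integral of \<open>w\<close> times any difference quotient of \<open>f\<close>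
  vanishes. With w = 1 this is integration by parts; with an indicator of vertical fibers it moves
  vertical derivatives across the discontinuous coefficient.\<close>

lemma integral_invariant_partial_deriv:
  fixes f w :: "real^'n::finite \<Rightarrow> real"
  assumes f: "f \<in> test_functions \<Omega>"
    and w: "w \<in> borel_measurable borel" "\<And>x. \<bar>w x\<bar> \<le> B" "\<And>x t. w (t *\<^sub>R axis i 1 + x) = w x"
  shows "(LINT x|lborel. w x * partial_deriv i f x) = 0"
proof -
  let ?e = "axis i (1::real) :: real^'n"
  obtain K where K: "compact K" "K \<subseteq> \<Omega>" "\<And>x. x \<notin> K \<Longrightarrow> f x = 0"
    using test_support[OF f] by metis
  obtain R where R: "\<And>x. x \<in> K \<Longrightarrow> norm x \<le> R"
    using compact_imp_bounded[OF K(1)] by (auto simp: bounded_iff)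
  have f0: "f x = 0" if "norm x > R" for x
    using K(3)[of x] R[of x] that by (cases "x \<in> K") auto
  obtain C where C: "C > 0" "\<And>x. \<bar>f x\<bar> \<le> C" "\<And>x. norm (grad f x) \<le> C"
    using test_bounded[OF f] by metis
  have B: "B \<ge> 0" using w(2)[of 0] by linarith
  have fb [measurable]: "f \<in> borel_measurable borel" using f by measurable
  note w(1) [measurable]
  define h where "h n = 1 / real (Suc n)" for n
  have h: "h n > 0" "h n \<le> 1" for n by (auto simp: h_def)
  have h0: "h \<longlonglongrightarrow> 0"
    unfolding h_def using LIMSEQ_inverse_real_of_nat by (simp add: inverse_eq_divide)
  define q where "q n x = (f (h n *\<^sub>R ?e + x) - f x) / h n" for n x
  have q_meas [measurable]: "q n \<in> borel_measurable borel" for n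
    unfolding q_def by measurable
  have "(LINT x|lborel. w x * q n x) = 0" for n
  proof -
    have i1: "integrable lborel (\<lambda>x. w x * f x)"
    proof (rule integrable_bounded_support[of _ "B * C" "cball 0 R"])
      show "\<bar>w x * f x\<bar> \<le> B * C" for x
        using w(2) C(2) B unfolding abs_mult by (intro mult_mono) auto
    qed (use f0 in auto)
    have i2: "integrable lborel (\<lambda>x. w x * f (h n *\<^sub>R ?e + x))"
    proof (rule integrable_bounded_support[of _ "B * C" "cball 0 (R + 1)"])
      show "\<bar>w x * f (h n *\<^sub>R ?e + x)\<bar> \<le> B * C" for x
        using w(2) C(2) B unfolding abs_mult by (intro mult_mono) auto
      fix x :: "real^'n" assume "x \<notin> cball 0 (R + 1)"
      then have "norm x > R + 1" by simp
      moreover have "norm x \<le> norm (h n *\<^sub>R ?e + x) + norm (h n *\<^sub>R ?e)"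
        using norm_triangle_ineq4[of "h n *\<^sub>R ?e + x" "h n *\<^sub>R ?e"] by simp
      ultimately show "w x * f (h n *\<^sub>R ?e + x) = 0"
        using h[of n] f0[of "h n *\<^sub>R ?e + x"] by (simp add: norm_axis_1)
    qed auto
    have "(LINT x|lborel. w x * f (h n *\<^sub>R ?e + x)) = (LINT x|lborel. w (h n *\<^sub>R ?e + x) * f (h n *\<^sub>R ?e + x))"
      by (simp add: w(3))
    also have "\<dots> = (LINT x|lborel. w x * f x)"
      by (rule lborel_integral_translate) measurable
    finally have eq: "(LINT x|lborel. w x * f (h n *\<^sub>R ?e + x)) = (LINT x|lborel. w x * f x)" .
    have "(LINT x|lborel. w x * q n x) = (LINT x|lborel. (w x * f (h n *\<^sub>R ?e + x) - w x * f x) / h n)"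
      by (simp add: q_def algebra_simps diff_divide_distrib)
    also have "\<dots> = 0"
      using i1 i2 eq by simp
    finally show ?thesis .
  qed
  moreover have "(\<lambda>n. LINT x|lborel. w x * q n x) \<longlonglongrightarrow> (LINT x|lborel. w x * partial_deriv i f x)"
  \<comment> \<open>The steps \<open>h n\<close> are at most 1, so every difference quotient
    vanishes outside the ball of radius R + 1, and the Lipschitz bound of \<open>f\<close> controls
    it inside.\<close>
  proof (rule integral_dominated_convergence[where w = "\<lambda>x. B * C * indicator (cball 0 (R + 1)) x"])
    show "(\<lambda>x. w x * partial_deriv i f x) \<in> borel_measurable lborel"
      using test_borel[OF test_partial_deriv[OF f, of i]] by measurable
    show "integrable lborel (\<lambda>x. B * C * indicator (cball (0::real^'n) (R + 1)) x :: real)"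
      using emeasure_bounded_finite[of "cball (0::real^'n) (R + 1)"]
      by (intro integrable_mult_right integrable_real_indicator) auto
    have "(\<lambda>n. q n x) \<longlonglongrightarrow> partial_deriv i f x" for x
    proof -
      have "((\<lambda>t. f (t *\<^sub>R ?e + x)) has_real_derivative partial_deriv i f x) (at 0)"
        using smooth_DERIV_line[OF test_smooth[OF f], of x ?e 0] by (simp add: inner_axis add.commute)
      then have "((\<lambda>t. (f (t *\<^sub>R ?e + x) - f x) / t) \<longlongrightarrow> partial_deriv i f x) (at 0)"
        by (simp add: DERIV_def)
      moreover have "filterlim h (at 0) sequentially"
        using h0 h(1) by (auto simp: filterlim_at less_imp_neq[symmetric] dual_order.strict_implies_not_eq)
      ultimately show ?thesis
        unfolding q_def by (rule filterlim_compose)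
    qed
    then show "AE x in lborel. (\<lambda>n. w x * q n x) \<longlonglongrightarrow> w x * partial_deriv i f x"
      by (intro AE_I2 tendsto_mult tendsto_const)
    have "norm (w x * q n x) \<le> B * C * indicator (cball 0 (R + 1)) x" for n x
    proof (cases "norm x > R + 1")
      case True
      have "norm x \<le> norm (h n *\<^sub>R ?e + x) + norm (h n *\<^sub>R ?e)"
        using norm_triangle_ineq4[of "h n *\<^sub>R ?e + x" "h n *\<^sub>R ?e"] by simp
      then have "q n x = 0"
        using True h[of n] f0[of x] f0[of "h n *\<^sub>R ?e + x"] by (simp add: q_def norm_axis_1)
      then show ?thesis using B C(1) by simp
    next
      case False
      have "\<bar>f (h n *\<^sub>R ?e + x) - f x\<bar> \<le> C * h n"
        using test_Lipschitz[OF f C(3), of "h n *\<^sub>R ?e + x" x] h[of n] by (simp add: norm_axis_1)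
      then have "\<bar>q n x\<bar> \<le> C" using h[of n] by (simp add: q_def field_simps)
      then have "norm (w x * q n x) \<le> B * C"
        using w(2) B by (simp add: abs_mult mult_mono)
      then show ?thesis using False by simp
    qed
    then show "AE x in lborel. norm (w x * q n x) \<le> B * C * indicator (cball 0 (R + 1)) x" for n
      by simp
  qed measurable
  ultimately show ?thesis by (simp add: LIMSEQ_const_iff)
qed

lemma integral_lebesgue_on_lborel:
  fixes f :: "'a::euclidean_space \<Rightarrow> real"
  assumes "S \<in> sets lebesgue" "f \<in> borel_measurable borel" "\<And>x. x \<notin> S \<Longrightarrow> f x = 0"
  shows "(LINT x|lebesgue_on S. f x) = (LINT x|lborel. f x)"
proof -
  have "(LINT x|lebesgue_on S. f x) = (LINT x|lebesgue. indicator S x *\<^sub>R f x)"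
    using assms(1) by (intro integral_restrict_space) simp
  also have "\<dots> = (LINT x|lebesgue. f x)"
    using assms(3) by (intro Bochner_Integration.integral_cong) (auto split: split_indicator)
  also have "\<dots> = (LINT x|lborel. f x)"
    using assms(2) by (intro integral_completion) simp
  finally show ?thesis .
qed

lemma sqi_vec_nth: "sqi M g \<Longrightarrow> sqi M (\<lambda>x. (g x :: real^'n::finite) $ i)"
  by (rule sqi_bound[where C = 1])
    (auto simp: component_le_norm_cart, simp add: cart_eq_inner_axis sqi_measurable)

lemma tendsto_integral_inner:
  fixes F :: "nat \<Rightarrow> 'a \<Rightarrow> 'b::euclidean_space"
  assumes "\<And>k. sqi M (F k)" "sqi M f" "sqi M g" "(\<lambda>k. l2 M (\<lambda>x. F k x - f x)) \<longlonglongrightarrow> 0"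
  shows "(\<lambda>k. LINT x|M. F k x \<bullet> g x) \<longlonglongrightarrow> (LINT x|M. f x \<bullet> g x)"
proof -
  have "(\<lambda>k. l2 M (\<lambda>x. F k x - f x) * l2 M g) \<longlonglongrightarrow> 0"
    using tendsto_mult_right[OF assms(4), of "l2 M g"] by simp
  moreover have "\<forall>\<^sub>F k in sequentially. norm ((LINT x|M. F k x \<bullet> g x) - (LINT x|M. f x \<bullet> g x))
      \<le> l2 M (\<lambda>x. F k x - f x) * l2 M g"
  proof (intro always_eventually allI)
    fix k
    have "(LINT x|M. F k x \<bullet> g x) - (LINT x|M. f x \<bullet> g x) = (LINT x|M. (F k x - f x) \<bullet> g x)"
      using assms by (simp add: inner_diff_left sqi_inner)
    then show "norm ((LINT x|M. F k x \<bullet> g x) - (LINT x|M. f x \<bullet> g x)) \<le> l2 M (\<lambda>x. F k x - f x) * l2 M g"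
      using Cauchy_Schwarz_l2[OF sqi_diff[OF assms(1,2)] assms(3), of k] by simp
  qed
  ultimately have "(\<lambda>k. (LINT x|M. F k x \<bullet> g x) - (LINT x|M. f x \<bullet> g x)) \<longlonglongrightarrow> 0"
    by (rule Lim_null_comparison[rotated])
  then show ?thesis by (simp add: LIM_zero_iff)
qed



locale bounded_open_set =
  fixes \<Omega> :: "(real^'n::finite) set"
  assumes open_\<Omega>: "open \<Omega>" and bounded_\<Omega>: "bounded \<Omega>"

sublocale bounded_open_set \<subseteq> finite_measure "lebesgue_on \<Omega>"
  using open_\<Omega> bounded_\<Omega> by (intro finite_measure_lebesgue_on lmeasurable_open)

section \<open>Weak gradients, and \<open>H10\<close> as limits of test functions\<close>

context bounded_open_set
begin

abbreviation "M \<equiv> lebesgue_on \<Omega>"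

lemma \<Omega>_lebesgue: "\<Omega> \<in> sets lebesgue"
  using open_\<Omega> by simp

lemma L2_iff_sqi: "u \<in> L2 \<Omega> \<longleftrightarrow> sqi M u"
  by (simp add: L2_def sqi_def)

lemma test_measurable [measurable_dest]: "\<phi> \<in> test_functions S \<Longrightarrow> \<phi> \<in> borel_measurable M"
  by (intro measurable_lebesgue_on test_borel)

lemma grad_measurable: "smooth \<phi> \<Longrightarrow> grad \<phi> \<in> borel_measurable M"
  by (intro measurable_lebesgue_on grad_borel)

lemma sqi_test:
  assumes "\<phi> \<in> test_functions S"
  shows "sqi M \<phi>" "sqi M (grad \<phi>)"
proof -
  obtain C where "\<And>x. \<bar>\<phi> x\<bar> \<le> C" "\<And>x. norm (grad \<phi> x) \<le> C"
    using test_bounded[OF assms] by metis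
  then show "sqi M \<phi>" "sqi M (grad \<phi>)"
    using assms by (auto intro!: sqi_bounded[where C = C] test_measurable grad_measurable test_smooth)
qed

lemma sqi_test_axis: "\<phi> \<in> test_functions S \<Longrightarrow> sqi M (\<lambda>x. \<phi> x *\<^sub>R axis i (1::real))"
  by (rule sqi_bound[OF sqi_test(1), where C = 1]) auto

lemma integral_partial_deriv_test:
  assumes "\<phi> \<in> test_functions \<Omega>"
  shows "(LINT x|M. partial_deriv i \<phi> x) = 0"
proof -
  have "(LINT x|M. partial_deriv i \<phi> x) = (LINT x|lborel. partial_deriv i \<phi> x)"
    using test_partial_deriv[OF assms, of i]
    by (intro integral_lebesgue_on_lborel \<Omega>_lebesgue test_borel) (auto intro: test_zero_outside)
  also have "\<dots> = 0"
    using integral_invariant_partial_deriv[OF assms, of "\<lambda>x. 1" 1 i] by simp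
  finally show ?thesis .
qed

text \<open>The partial derivative of the product of two test functions has integral zero; the
  product rule splits it into the two sides.\<close>

lemma is_weak_grad_test:
  assumes \<phi>: "\<phi> \<in> test_functions \<Omega>"
  shows "is_weak_grad \<Omega> \<phi> (grad \<phi>)"
  unfolding is_weak_grad_def
proof (intro ballI allI)
  fix \<psi> i assume \<psi>: "\<psi> \<in> test_functions \<Omega>"
  note s = test_smooth[OF \<phi>] test_smooth[OF \<psi>]
  have i1: "integrable M (\<lambda>x. \<phi> x * partial_deriv i \<psi> x)"
    using sqi_inner[OF sqi_test(1)[OF \<phi>] sqi_test(1)[OF test_partial_deriv[OF \<psi>, of i]]] by simp
  have i2: "integrable M (\<lambda>x. partial_deriv i \<phi> x * \<psi> x)"
    using sqi_inner[OF sqi_test(1)[OF test_partial_deriv[OF \<phi>, of i]] sqi_test(1)[OF \<psi>]] by simp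
  have "(LINT x|M. \<phi> x * partial_deriv i \<psi> x + partial_deriv i \<phi> x * \<psi> x) = 0"
    using integral_partial_deriv_test[OF test_mult_smooth[OF s(1) \<psi>], of i]
    by (simp add: partial_deriv_mult_smooth[OF s])
  then show "(LINT x|M. \<phi> x * partial_deriv i \<psi> x) = - (LINT x|M. grad \<phi> x $ i * \<psi> x)"
    using i1 i2 by simp
qed

lemma integrable_weak_grad:
  assumes "\<psi> \<in> test_functions \<Omega>"
  shows "sqi M u \<Longrightarrow> integrable M (\<lambda>x. u x * partial_deriv i \<psi> x)"
    and "sqi M g \<Longrightarrow> integrable M (\<lambda>x. (g x :: real^'n) $ i * \<psi> x)"
  using sqi_inner[OF _ sqi_test(1)[OF test_partial_deriv[OF assms, of i]], of u]
    sqi_inner[OF sqi_vec_nth[of M g i] sqi_test(1)[OF assms]] by simp_all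

lemma is_weak_grad_add:
  assumes "sqi M u" "sqi M g" "is_weak_grad \<Omega> u g" "sqi M v" "sqi M k" "is_weak_grad \<Omega> v k"
  shows "is_weak_grad \<Omega> (\<lambda>x. u x + v x) (\<lambda>x. g x + k x)"
  using assms
  by (auto simp: is_weak_grad_def distrib_right integrable_weak_grad)

lemma is_weak_grad_cmult:
  assumes "is_weak_grad \<Omega> u g"
  shows "is_weak_grad \<Omega> (\<lambda>x. c * u x) (\<lambda>x. c *\<^sub>R g x)"
  using assms by (auto simp: is_weak_grad_def mult.assoc)

text \<open>The fundamental lemma is applied to each component of the difference. This is what makes
  the choice in \<open>weak_grad\<close> harmless up to null sets.\<close>

lemma is_weak_grad_unique:
  assumes "sqi M g" "is_weak_grad \<Omega> u g" "sqi M k" "is_weak_grad \<Omega> u k"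
  shows "AE x in M. g x = k x"
proof -
  have "AE x in M. g x $ i - k x $ i = 0" for i
  proof (rule fundamental_lemma_calculus_of_variations[OF open_\<Omega> bounded_\<Omega>])
    show "integrable M (\<lambda>x. g x $ i - k x $ i)"
      using assms by (intro sqi_imp_integrable sqi_diff sqi_vec_nth)
    fix \<phi> assume \<phi>: "\<phi> \<in> test_functions \<Omega>"
    have "(LINT x|M. (g x $ i - k x $ i) * \<phi> x) = (LINT x|M. g x $ i * \<phi> x) - (LINT x|M. k x $ i * \<phi> x)"
      using assms \<phi> by (simp add: left_diff_distrib integrable_weak_grad)
    also have "\<dots> = 0"
    proof -
      have "(LINT x|M. u x * partial_deriv i \<phi> x) = - (LINT x|M. g x $ i * \<phi> x)"
        "(LINT x|M. u x * partial_deriv i \<phi> x) = - (LINT x|M. k x $ i * \<phi> x)"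
        using assms(2,4) \<phi> unfolding is_weak_grad_def by blast+
      then show ?thesis by simp
    qed
    finally show "(LINT x|M. (g x $ i - k x $ i) * \<phi> x) = 0" .
  qed
  then have "AE x in M. \<forall>i. g x $ i - k x $ i = 0"
    by (rule eventually_all_finite)
  then show ?thesis by eventually_elim (simp add: vec_eq_iff)
qed

lemma weak_grad_H1:
  assumes "u \<in> H1 \<Omega>"
  shows "sqi M (weak_grad \<Omega> u)" "is_weak_grad \<Omega> u (weak_grad \<Omega> u)"
proof -
  have "\<exists>g. g \<in> L2 \<Omega> \<and> is_weak_grad \<Omega> u g" using assms by (auto simp: H1_def)
  from someI_ex[OF this] show "sqi M (weak_grad \<Omega> u)" "is_weak_grad \<Omega> u (weak_grad \<Omega> u)"
    by (simp_all add: weak_grad_def L2_iff_sqi)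
qed

lemma H1I: "sqi M u \<Longrightarrow> sqi M g \<Longrightarrow> is_weak_grad \<Omega> u g \<Longrightarrow> u \<in> H1 \<Omega>"
  by (auto simp: H1_def L2_iff_sqi)

lemma weak_grad_AE:
  assumes "sqi M u" "sqi M g" "is_weak_grad \<Omega> u g"
  shows "AE x in M. weak_grad \<Omega> u x = g x"
  using is_weak_grad_unique[OF weak_grad_H1[OF H1I[OF assms]] assms(2,3)] .

lemma H1_norm_l2: "H1_norm \<Omega> u = sqrt ((l2 M u)\<^sup>2 + (l2 M (weak_grad \<Omega> u))\<^sup>2)"
  by (simp add: H1_norm_def l2_power2)

text \<open>The gradient limit \<open>g\<close> is an explicit argument instead of
  \<open>weak_grad \<Omega> u\<close>: limits of gradients can then be handled before it is known
  that \<open>u\<close> has a weak gradient, and before the arbitrary choice inside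
  \<open>weak_grad\<close> has to be compared with them.\<close>

definition approximates :: "(nat \<Rightarrow> real^'n \<Rightarrow> real) \<Rightarrow> (real^'n \<Rightarrow> real) \<Rightarrow> (real^'n \<Rightarrow> real^'n) \<Rightarrow> bool" where
  "approximates \<phi> u g \<longleftrightarrow> (\<forall>k. \<phi> k \<in> test_functions \<Omega>) \<and> (\<lambda>k. l2 M (\<lambda>x. \<phi> k x - u x)) \<longlonglongrightarrow> 0 \<and>
    (\<lambda>k. l2 M (\<lambda>x. grad (\<phi> k) x - g x)) \<longlonglongrightarrow> 0"

lemma approximates_weak_grad:
  assumes "sqi M u" "sqi M g" "approximates \<phi> u g"
  shows "is_weak_grad \<Omega> u g"
  unfolding is_weak_grad_def
proof (intro ballI allI)
  fix \<psi> i assume \<psi>: "\<psi> \<in> test_functions \<Omega>"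
  have \<phi>: "\<phi> k \<in> test_functions \<Omega>" for k using assms(3) by (simp add: approximates_def)
  have "(\<lambda>k. LINT x|M. \<phi> k x * partial_deriv i \<psi> x) \<longlonglongrightarrow> (LINT x|M. u x * partial_deriv i \<psi> x)"
    using tendsto_integral_inner[OF sqi_test(1)[OF \<phi>] assms(1) sqi_test(1)[OF test_partial_deriv[OF \<psi>, of i]]]
      assms(3) by (simp add: approximates_def)
  moreover have lim: "(\<lambda>k. LINT x|M. grad (\<phi> k) x $ i * \<psi> x) \<longlonglongrightarrow> (LINT x|M. g x $ i * \<psi> x)"
    using tendsto_integral_inner[OF sqi_test(2)[OF \<phi>] assms(2) sqi_test_axis[OF \<psi>, of i]]
      assms(3) by (simp add: approximates_def inner_axis mult.commute)
  moreover have eq: "(LINT x|M. \<phi> k x * partial_deriv i \<psi> x) = - (LINT x|M. grad (\<phi> k) x $ i * \<psi> x)" for k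
    using is_weak_grad_test[OF \<phi>] \<psi> unfolding is_weak_grad_def by blast
  ultimately show "(LINT x|M. u x * partial_deriv i \<psi> x) = - (LINT x|M. g x $ i * \<psi> x)"
    using LIMSEQ_unique[OF _ tendsto_minus[OF lim]] unfolding eq by blast
qed

text \<open>The defining identity of the weak gradient is stable under L2 limits, so
  \<open>g\<close> is a weak gradient of \<open>u\<close> and uniqueness identifies it with the
  chosen one. The \<open>H1_norm\<close> of the differences is then an explicit expression in the
  two L2 distances.\<close>

lemma approximates_H10:
  assumes "sqi M u" "sqi M g" "approximates \<phi> u g"
  shows "u \<in> H10 \<Omega>" "AE x in M. weak_grad \<Omega> u x = g x"
proof -
  note ug = approximates_weak_grad[OF assms]
  show "AE x in M. weak_grad \<Omega> u x = g x"
    by (rule weak_grad_AE[OF assms(1,2) ug])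
  have \<phi>: "\<phi> k \<in> test_functions \<Omega>" for k using assms(3) by (simp add: approximates_def)
  have "l2 M (weak_grad \<Omega> (\<lambda>x. \<phi> k x - u x)) = l2 M (\<lambda>x. grad (\<phi> k) x - g x)" for k
  proof (rule l2_cong_AE)
    have w: "is_weak_grad \<Omega> (\<lambda>x. \<phi> k x - u x) (\<lambda>x. grad (\<phi> k) x - g x)"
      using is_weak_grad_add[OF sqi_test[OF \<phi>] is_weak_grad_test[OF \<phi>] sqi_cmult[OF assms(1)]
        sqi_scaleR[OF assms(2)] is_weak_grad_cmult[OF ug], of k "-1"] by simp
    note s = sqi_diff[OF sqi_test(1)[OF \<phi>] assms(1)] sqi_diff[OF sqi_test(2)[OF \<phi>] assms(2)]
    show "AE x in M. norm (weak_grad \<Omega> (\<lambda>x. \<phi> k x - u x) x) = norm (grad (\<phi> k) x - g x)"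
      using weak_grad_AE[OF s w] by eventually_elim simp
    show "weak_grad \<Omega> (\<lambda>x. \<phi> k x - u x) \<in> borel_measurable M"
      by (rule sqi_measurable[OF weak_grad_H1(1)[OF H1I[OF s w]]])
    show "(\<lambda>x. grad (\<phi> k) x - g x) \<in> borel_measurable M"
      by (rule sqi_measurable[OF s(2)])
  qed
  then have eq: "H1_norm \<Omega> (\<lambda>x. \<phi> k x - u x) =
      sqrt ((l2 M (\<lambda>x. \<phi> k x - u x))\<^sup>2 + (l2 M (\<lambda>x. grad (\<phi> k) x - g x))\<^sup>2)" for k
    by (simp add: H1_norm_l2)
  have "(\<lambda>k. l2 M (\<lambda>x. \<phi> k x - u x)) \<longlonglongrightarrow> 0" "(\<lambda>k. l2 M (\<lambda>x. grad (\<phi> k) x - g x)) \<longlonglongrightarrow> 0"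
    using assms(3) by (auto simp: approximates_def)
  then have "(\<lambda>k. H1_norm \<Omega> (\<lambda>x. \<phi> k x - u x)) \<longlonglongrightarrow> sqrt (0\<^sup>2 + 0\<^sup>2)"
    unfolding eq by (intro tendsto_intros)
  then show "u \<in> H10 \<Omega>"
    using H1I[OF assms(1,2) ug] \<phi> by (auto simp: H10_def)
qed

lemma H10_sqi:
  assumes "u \<in> H10 \<Omega>"
  shows "sqi M u" "sqi M (weak_grad \<Omega> u)" "is_weak_grad \<Omega> u (weak_grad \<Omega> u)"
  using assms weak_grad_H1[of u] by (auto simp: H10_def H1_def L2_iff_sqi)

text \<open>The converse of \<open>approximates_H10\<close>: the \<open>H1_norm\<close> dominates
  both L2 distances. Together the two lemmas allow properties of \<open>H10\<close> to be proved by
  calculating with sequences of test functions.\<close>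

lemma H10_approximates:
  assumes u: "u \<in> H10 \<Omega>"
  obtains \<phi> where "approximates \<phi> u (weak_grad \<Omega> u)"
proof -
  obtain \<phi> where \<phi>: "\<And>k. \<phi> k \<in> test_functions \<Omega>"
    and lim: "(\<lambda>k. H1_norm \<Omega> (\<lambda>x. \<phi> k x - u x)) \<longlonglongrightarrow> 0"
    using u by (auto simp: H10_def)
  note s = H10_sqi[OF u]
  have le: "l2 M v \<le> H1_norm \<Omega> v" "l2 M (weak_grad \<Omega> v) \<le> H1_norm \<Omega> v" for v
    unfolding H1_norm_l2 by (auto intro!: real_le_rsqrt)
  have "l2 M (weak_grad \<Omega> (\<lambda>x. \<phi> k x - u x)) = l2 M (\<lambda>x. grad (\<phi> k) x - weak_grad \<Omega> u x)" for k
  proof (rule l2_cong_AE)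
    have w: "is_weak_grad \<Omega> (\<lambda>x. \<phi> k x - u x) (\<lambda>x. grad (\<phi> k) x - weak_grad \<Omega> u x)"
      using is_weak_grad_add[OF sqi_test[OF \<phi>] is_weak_grad_test[OF \<phi>] sqi_cmult[OF s(1)]
        sqi_scaleR[OF s(2)] is_weak_grad_cmult[OF s(3)], of k "-1"] by simp
    note s' = sqi_diff[OF sqi_test(1)[OF \<phi>] s(1)] sqi_diff[OF sqi_test(2)[OF \<phi>] s(2)]
    show "AE x in M. norm (weak_grad \<Omega> (\<lambda>x. \<phi> k x - u x) x) = norm (grad (\<phi> k) x - weak_grad \<Omega> u x)"
      using weak_grad_AE[OF s' w] by eventually_elim simp
    show "weak_grad \<Omega> (\<lambda>x. \<phi> k x - u x) \<in> borel_measurable M"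
      by (rule sqi_measurable[OF weak_grad_H1(1)[OF H1I[OF s' w]]])
    show "(\<lambda>x. grad (\<phi> k) x - weak_grad \<Omega> u x) \<in> borel_measurable M"
      by (rule sqi_measurable[OF s'(2)])
  qed
  then have "l2 M (\<lambda>x. grad (\<phi> k) x - weak_grad \<Omega> u x) \<le> H1_norm \<Omega> (\<lambda>x. \<phi> k x - u x)" for k
    using le(2)[of "\<lambda>x. \<phi> k x - u x"] by simp
  then have "(\<lambda>k. l2 M (\<lambda>x. grad (\<phi> k) x - weak_grad \<Omega> u x)) \<longlonglongrightarrow> 0"
    by (intro Lim_null_comparison[OF _ lim]) auto
  moreover have "(\<lambda>k. l2 M (\<lambda>x. \<phi> k x - u x)) \<longlonglongrightarrow> 0"
    using le(1) by (intro Lim_null_comparison[OF _ lim]) auto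
  ultimately show ?thesis
    using \<phi> by (intro that[of \<phi>]) (auto simp: approximates_def)
qed

lemma test_H10:
  assumes "\<phi> \<in> test_functions \<Omega>"
  shows "\<phi> \<in> H10 \<Omega>" "AE x in M. weak_grad \<Omega> \<phi> x = grad \<phi> x"
proof -
  have "approximates (\<lambda>_. \<phi>) \<phi> (grad \<phi>)"
    using assms by (simp add: approximates_def l2_def)
  from approximates_H10[OF sqi_test[OF assms] this]
  show "\<phi> \<in> H10 \<Omega>" "AE x in M. weak_grad \<Omega> \<phi> x = grad \<phi> x" .
qed

lemma tendsto_0_le:
  fixes f g h :: "nat \<Rightarrow> real"
  assumes "f \<longlonglongrightarrow> 0" "g \<longlonglongrightarrow> 0" "\<And>k. 0 \<le> h k" "\<And>k. h k \<le> f k + g k"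
  shows "h \<longlonglongrightarrow> 0"
proof (rule Lim_null_comparison)
  show "\<forall>\<^sub>F k in sequentially. norm (h k) \<le> f k + g k" using assms(3,4) by simp
  show "(\<lambda>k. f k + g k) \<longlonglongrightarrow> 0" using tendsto_add[OF assms(1,2)] by simp
qed

text \<open>The sums of the approximating test functions approximate the sum. The formula for the
  gradient holds only almost everywhere, because \<open>weak_grad\<close> makes a separate choice
  for every function.\<close>

lemma H10_add:
  assumes "u \<in> H10 \<Omega>" "v \<in> H10 \<Omega>"
  shows "(\<lambda>x. u x + v x) \<in> H10 \<Omega>"
    "AE x in M. weak_grad \<Omega> (\<lambda>x. u x + v x) x = weak_grad \<Omega> u x + weak_grad \<Omega> v x"
proof -
  obtain \<phi> where \<phi>: "approximates \<phi> u (weak_grad \<Omega> u)" by (rule H10_approximates[OF assms(1)])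
  obtain \<psi> where \<psi>: "approximates \<psi> v (weak_grad \<Omega> v)" by (rule H10_approximates[OF assms(2)])
  have t: "\<phi> k \<in> test_functions \<Omega>" "\<psi> k \<in> test_functions \<Omega>" for k
    using \<phi> \<psi> by (auto simp: approximates_def)
  note s = H10_sqi[OF assms(1)] H10_sqi[OF assms(2)]
  have "approximates (\<lambda>k x. \<phi> k x + \<psi> k x) (\<lambda>x. u x + v x) (\<lambda>x. weak_grad \<Omega> u x + weak_grad \<Omega> v x)"
    unfolding approximates_def
  proof (intro conjI allI)
    show "(\<lambda>x. \<phi> k x + \<psi> k x) \<in> test_functions \<Omega>" for k using t by (rule test_add)
    show "(\<lambda>k. l2 M (\<lambda>x. \<phi> k x + \<psi> k x - (u x + v x))) \<longlonglongrightarrow> 0"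
    proof (rule tendsto_0_le[OF _ _ l2_nonneg])
      show "(\<lambda>k. l2 M (\<lambda>x. \<phi> k x - u x)) \<longlonglongrightarrow> 0" "(\<lambda>k. l2 M (\<lambda>x. \<psi> k x - v x)) \<longlonglongrightarrow> 0"
        using \<phi> \<psi> by (auto simp: approximates_def)
      show "l2 M (\<lambda>x. \<phi> k x + \<psi> k x - (u x + v x)) \<le> l2 M (\<lambda>x. \<phi> k x - u x) + l2 M (\<lambda>x. \<psi> k x - v x)" for k
        using l2_triangle[OF sqi_diff[OF sqi_test(1)[OF t(1)] s(1)] sqi_diff[OF sqi_test(1)[OF t(2)] s(4)], of k k]
        by (simp add: algebra_simps)
    qed
    show "(\<lambda>k. l2 M (\<lambda>x. grad (\<lambda>x. \<phi> k x + \<psi> k x) x - (weak_grad \<Omega> u x + weak_grad \<Omega> v x))) \<longlonglongrightarrow> 0"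
    proof (rule tendsto_0_le[OF _ _ l2_nonneg])
      show "(\<lambda>k. l2 M (\<lambda>x. grad (\<phi> k) x - weak_grad \<Omega> u x)) \<longlonglongrightarrow> 0"
        "(\<lambda>k. l2 M (\<lambda>x. grad (\<psi> k) x - weak_grad \<Omega> v x)) \<longlonglongrightarrow> 0"
        using \<phi> \<psi> by (auto simp: approximates_def)
      show "l2 M (\<lambda>x. grad (\<lambda>x. \<phi> k x + \<psi> k x) x - (weak_grad \<Omega> u x + weak_grad \<Omega> v x))
          \<le> l2 M (\<lambda>x. grad (\<phi> k) x - weak_grad \<Omega> u x) + l2 M (\<lambda>x. grad (\<psi> k) x - weak_grad \<Omega> v x)" for k
        using l2_triangle[OF sqi_diff[OF sqi_test(2)[OF t(1)] s(2)] sqi_diff[OF sqi_test(2)[OF t(2)] s(5)], of k k]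
        by (simp add: grad_add test_smooth[OF t(1)] test_smooth[OF t(2)] algebra_simps)
    qed
  qed
  from approximates_H10[OF sqi_add[OF s(1,4)] sqi_add[OF s(2,5)] this]
  show "(\<lambda>x. u x + v x) \<in> H10 \<Omega>"
    "AE x in M. weak_grad \<Omega> (\<lambda>x. u x + v x) x = weak_grad \<Omega> u x + weak_grad \<Omega> v x" .
qed

lemma H10_cmult:
  assumes "u \<in> H10 \<Omega>"
  shows "(\<lambda>x. c * u x) \<in> H10 \<Omega>" "AE x in M. weak_grad \<Omega> (\<lambda>x. c * u x) x = c *\<^sub>R weak_grad \<Omega> u x"
proof -
  obtain \<phi> where \<phi>: "approximates \<phi> u (weak_grad \<Omega> u)" by (rule H10_approximates[OF assms(1)])
  have t: "\<phi> k \<in> test_functions \<Omega>" for k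
    using \<phi> by (auto simp: approximates_def)
  note s = H10_sqi[OF assms(1)]
  have "approximates (\<lambda>k x. c * \<phi> k x) (\<lambda>x. c * u x) (\<lambda>x. c *\<^sub>R weak_grad \<Omega> u x)"
    unfolding approximates_def
  proof (intro conjI allI)
    show "(\<lambda>x. c * \<phi> k x) \<in> test_functions \<Omega>" for k using t by (rule test_cmult)
    have "(\<lambda>k. l2 M (\<lambda>x. \<phi> k x - u x)) \<longlonglongrightarrow> 0"
      "(\<lambda>k. l2 M (\<lambda>x. grad (\<phi> k) x - weak_grad \<Omega> u x)) \<longlonglongrightarrow> 0"
      using \<phi> by (auto simp: approximates_def)
    then have "(\<lambda>k. \<bar>c\<bar> * l2 M (\<lambda>x. \<phi> k x - u x)) \<longlonglongrightarrow> \<bar>c\<bar> * 0"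
      "(\<lambda>k. \<bar>c\<bar> * l2 M (\<lambda>x. grad (\<phi> k) x - weak_grad \<Omega> u x)) \<longlonglongrightarrow> \<bar>c\<bar> * 0"
      by - (rule tendsto_mult_left, assumption)+
    then show "(\<lambda>k. l2 M (\<lambda>x. c * \<phi> k x - c * u x)) \<longlonglongrightarrow> 0"
      "(\<lambda>k. l2 M (\<lambda>x. grad (\<lambda>x. c * \<phi> k x) x - c *\<^sub>R weak_grad \<Omega> u x)) \<longlonglongrightarrow> 0"
      by (simp_all add: grad_cmult test_smooth[OF t] l2_cmult l2_scaleR
          flip: right_diff_distrib scaleR_right_diff_distrib)
  qed
  from approximates_H10[OF sqi_cmult[OF s(1)] sqi_scaleR[OF s(2)] this]
  show "(\<lambda>x. c * u x) \<in> H10 \<Omega>" "AE x in M. weak_grad \<Omega> (\<lambda>x. c * u x) x = c *\<^sub>R weak_grad \<Omega> u x" .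
qed

lemma H10_diff:
  assumes "u \<in> H10 \<Omega>" "v \<in> H10 \<Omega>"
  shows "(\<lambda>x. u x - v x) \<in> H10 \<Omega>"
    "AE x in M. weak_grad \<Omega> (\<lambda>x. u x - v x) x = weak_grad \<Omega> u x - weak_grad \<Omega> v x"
proof -
  have eq: "(\<lambda>x. u x - v x) = (\<lambda>x. u x + (-1) * v x)" by simp
  note c = H10_cmult[OF assms(2), of "-1"]
  show "(\<lambda>x. u x - v x) \<in> H10 \<Omega>" unfolding eq by (rule H10_add(1)[OF assms(1) c(1)])
  show "AE x in M. weak_grad \<Omega> (\<lambda>x. u x - v x) x = weak_grad \<Omega> u x - weak_grad \<Omega> v x"
    unfolding eq using H10_add(2)[OF assms(1) c(1)] c(2) by eventually_elim simp
qed

end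



section \<open>Poincare inequality and completeness of \<open>H10\<close> in the gradient
  norm\<close>

context bounded_open_set
begin

text \<open>The derivative of x_i \<phi>^2 in direction i is \<phi>^2 + 2 x_i \<phi> \<partial>_i
  \<phi> and has integral zero; Cauchy-Schwarz and division by the norm of \<phi> give the
  bound.\<close>

lemma Poincare_test:
  assumes \<phi>: "\<phi> \<in> test_functions \<Omega>" and R: "\<And>x. x \<in> \<Omega> \<Longrightarrow> \<bar>x $ i\<bar> \<le> R" "0 \<le> R"
  shows "l2 M \<phi> \<le> 2 * R * l2 M (grad \<phi>)"
proof -
  note s = test_smooth[OF \<phi>]
  have test: "(\<lambda>x. x $ i * (\<phi> x * \<phi> x)) \<in> test_functions \<Omega>"
    by (intro test_mult_smooth smooth_nth s \<phi>)
  have pd: "partial_deriv i (\<lambda>x. x $ i * (\<phi> x * \<phi> x)) x = 2 * (x $ i * \<phi> x * partial_deriv i \<phi> x) + \<phi> x * \<phi> x" for x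
    by (subst partial_deriv_mult_smooth[OF smooth_nth smooth_mult[OF s s]],
        subst partial_deriv_mult_smooth[OF s s]) (simp add: partial_deriv_nth algebra_simps)
  have bound: "AE x in M. \<bar>x $ i * \<phi> x * partial_deriv i \<phi> x\<bar> \<le> R * (norm (\<phi> x) * norm (grad \<phi> x))"
  proof (rule AE_I2)
    fix x assume "x \<in> space M"
    then have "x \<in> \<Omega>" by simp
    have "\<bar>partial_deriv i \<phi> x\<bar> \<le> norm (grad \<phi> x)"
      using component_le_norm_cart[of "grad \<phi> x" i] by simp
    then have "\<bar>x $ i\<bar> * \<bar>\<phi> x\<bar> * \<bar>partial_deriv i \<phi> x\<bar> \<le> R * \<bar>\<phi> x\<bar> * norm (grad \<phi> x)"
      using R \<open>x \<in> \<Omega>\<close> by (intro mult_mono) auto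
    then show "\<bar>x $ i * \<phi> x * partial_deriv i \<phi> x\<bar> \<le> R * (norm (\<phi> x) * norm (grad \<phi> x))"
      by (simp add: abs_mult mult.assoc)
  qed
  have m: "(\<lambda>x. x $ i * \<phi> x * partial_deriv i \<phi> x) \<in> borel_measurable M"
    using test_mult_smooth[OF smooth_mult[OF smooth_nth s] test_partial_deriv[OF \<phi>], of i i] by measurable
  note i1 = integrable_sqi_bound[OF sqi_test[OF \<phi>] m bound]
  have i2: "integrable M (\<lambda>x. \<phi> x * \<phi> x)"
    using sqi_inner[OF sqi_test(1)[OF \<phi>] sqi_test(1)[OF \<phi>]] by simp
  have "0 = (LINT x|M. 2 * (x $ i * \<phi> x * partial_deriv i \<phi> x) + \<phi> x * \<phi> x)"
    using integral_partial_deriv_test[OF test, of i] by (simp add: pd)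
  also have "\<dots> = 2 * (LINT x|M. x $ i * \<phi> x * partial_deriv i \<phi> x) + (l2 M \<phi>)\<^sup>2"
    using i1 i2 unfolding l2_power2 by (simp flip: power2_eq_square)
  finally have "(l2 M \<phi>)\<^sup>2 \<le> 2 * (R * (l2 M \<phi> * l2 M (grad \<phi>)))"
    using abs_integral_sqi_le[OF sqi_test[OF \<phi>] m bound R(2)] by linarith
  then have "l2 M \<phi> * l2 M \<phi> \<le> (2 * R * l2 M (grad \<phi>)) * l2 M \<phi>"
    by (simp add: power2_eq_square mult_ac)
  then show ?thesis
    using l2_nonneg[of M \<phi>] R(2) by (cases "l2 M \<phi> = 0") (auto simp: mult_le_cancel_right)
qed

lemma Poincare:
  obtains P where "P > 0" "\<And>u. u \<in> H10 \<Omega> \<Longrightarrow> l2 M u \<le> P * l2 M (weak_grad \<Omega> u)"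
proof -
  obtain R where R: "\<And>x. x \<in> \<Omega> \<Longrightarrow> norm x \<le> R" using bounded_\<Omega> by (auto simp: bounded_iff)
  define P where "P = 2 * max 1 R"
  have "P > 0" by (simp add: P_def)
  have test: "l2 M \<phi> \<le> P * l2 M (grad \<phi>)" if "\<phi> \<in> test_functions \<Omega>" for \<phi>
    unfolding P_def
  proof (rule Poincare_test[OF that])
    fix x assume "x \<in> \<Omega>"
    \<comment> \<open>Any coordinate serves; \<open>undefined\<close> names one of them for a
      general finite index type.\<close>
    then show "\<bar>x $ undefined\<bar> \<le> max 1 R"
      using R component_le_norm_cart[of x undefined] by (meson max.coboundedI2 order_trans)
  qed simp
  have "l2 M u \<le> P * l2 M (weak_grad \<Omega> u)" if u: "u \<in> H10 \<Omega>" for u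
  proof -
    obtain \<phi> where \<phi>: "approximates \<phi> u (weak_grad \<Omega> u)" by (rule H10_approximates[OF u])
    have t: "\<phi> k \<in> test_functions \<Omega>" for k using \<phi> by (auto simp: approximates_def)
    note s = H10_sqi[OF u]
    have "(\<lambda>k. l2 M (\<lambda>x. \<phi> k x - u x)) \<longlonglongrightarrow> 0" "(\<lambda>k. l2 M (\<lambda>x. grad (\<phi> k) x - weak_grad \<Omega> u x)) \<longlonglongrightarrow> 0"
      using \<phi> by (auto simp: approximates_def)
    then have "(\<lambda>k. l2 M (\<lambda>x. \<phi> k x - u x) + P * (l2 M (\<lambda>x. grad (\<phi> k) x - weak_grad \<Omega> u x) + l2 M (weak_grad \<Omega> u)))
        \<longlonglongrightarrow> 0 + P * (0 + l2 M (weak_grad \<Omega> u))"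
      by (intro tendsto_intros)
    moreover have "l2 M u \<le> l2 M (\<lambda>x. \<phi> k x - u x) +
        P * (l2 M (\<lambda>x. grad (\<phi> k) x - weak_grad \<Omega> u x) + l2 M (weak_grad \<Omega> u))" for k
    proof -
      have "l2 M u \<le> l2 M (\<lambda>x. u x - \<phi> k x) + l2 M (\<phi> k)"
        using l2_triangle[OF sqi_diff[OF s(1) sqi_test(1)[OF t]] sqi_test(1)[OF t], of k k] by simp
      moreover have "l2 M (grad (\<phi> k)) \<le> l2 M (\<lambda>x. grad (\<phi> k) x - weak_grad \<Omega> u x) + l2 M (weak_grad \<Omega> u)"
        using l2_triangle[OF sqi_diff[OF sqi_test(2)[OF t] s(2)] s(2), of k] by simp
      then have "P * l2 M (grad (\<phi> k)) \<le> P * (l2 M (\<lambda>x. grad (\<phi> k) x - weak_grad \<Omega> u x) + l2 M (weak_grad \<Omega> u))"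
        using \<open>P > 0\<close> by simp
      ultimately show ?thesis
        using test[OF t, of k] l2_minus_commute[of M u "\<phi> k"] by linarith
    qed
    ultimately have "l2 M u \<le> 0 + P * (0 + l2 M (weak_grad \<Omega> u))"
      by (intro LIMSEQ_le_const) auto
    then show ?thesis by simp
  qed
  with \<open>P > 0\<close> show ?thesis by (rule that)
qed

text \<open>By the Poincare inequality this product alone, without the L2 term, makes
  \<open>H10\<close> complete, so that energy estimates for the gradient are bounds in the Hilbert
  norm.\<close>

definition grad_inner :: "(real^'n \<Rightarrow> real) \<Rightarrow> (real^'n \<Rightarrow> real) \<Rightarrow> real" where
  "grad_inner u v = (LINT x|M. weak_grad \<Omega> u x \<bullet> weak_grad \<Omega> v x)"

lemma grad_inner_self: "grad_inner u u = (l2 M (weak_grad \<Omega> u))\<^sup>2"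
  by (simp add: grad_inner_def l2_power2 power2_norm_eq_inner)

lemma sqrt_grad_inner: "sqrt (grad_inner u u) = l2 M (weak_grad \<Omega> u)"
  by (simp add: grad_inner_self)

lemma l2_weak_grad_diff:
  assumes "u \<in> H10 \<Omega>" "v \<in> H10 \<Omega>"
  shows "l2 M (weak_grad \<Omega> (\<lambda>x. u x - v x)) = l2 M (\<lambda>x. weak_grad \<Omega> u x - weak_grad \<Omega> v x)"
proof (rule l2_cong_AE)
  show "AE x in M. norm (weak_grad \<Omega> (\<lambda>x. u x - v x) x) = norm (weak_grad \<Omega> u x - weak_grad \<Omega> v x)"
    using H10_diff(2)[OF assms] by eventually_elim simp
  show "weak_grad \<Omega> (\<lambda>x. u x - v x) \<in> borel_measurable M"
    by (rule sqi_measurable[OF H10_sqi(2)[OF H10_diff(1)[OF assms]]])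
  show "(\<lambda>x. weak_grad \<Omega> u x - weak_grad \<Omega> v x) \<in> borel_measurable M"
    by (rule sqi_measurable[OF sqi_diff[OF H10_sqi(2)[OF assms(1)] H10_sqi(2)[OF assms(2)]]])
qed

text \<open>The functions and their gradients converge separately in L2, the functions by the
  Poincare inequality. That the two limits belong together is shown by a sequence of test functions
  converging to both.\<close>

lemma H10_complete:
  assumes U: "\<And>n::nat. U n \<in> H10 \<Omega>"
    and Cauchy: "\<And>e. e > 0 \<Longrightarrow> \<exists>N. \<forall>m\<ge>N. \<forall>n\<ge>N. l2 M (weak_grad \<Omega> (\<lambda>x. U m x - U n x)) < e"
  shows "\<exists>u\<in>H10 \<Omega>. (\<lambda>n. l2 M (weak_grad \<Omega> (\<lambda>x. U n x - u x))) \<longlonglongrightarrow> 0"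
proof -
  obtain P where P: "P > 0" "\<And>u. u \<in> H10 \<Omega> \<Longrightarrow> l2 M u \<le> P * l2 M (weak_grad \<Omega> u)"
    using Poincare by blast
  note s = H10_sqi[OF U]
  have "\<exists>u. sqi M u \<and> (\<lambda>n. l2 M (\<lambda>x. U n x - u x)) \<longlonglongrightarrow> 0"
  proof (rule l2_complete[OF s(1)])
    fix e :: real assume e: "e > 0"
    then obtain N where N: "\<And>m n. m \<ge> N \<Longrightarrow> n \<ge> N \<Longrightarrow> l2 M (weak_grad \<Omega> (\<lambda>x. U m x - U n x)) < e / P"
      using Cauchy[of "e / P"] P(1) by auto
    have "l2 M (\<lambda>x. U m x - U n x) < e" if "m \<ge> N" "n \<ge> N" for m n
    proof -
      have "l2 M (\<lambda>x. U m x - U n x) \<le> P * l2 M (weak_grad \<Omega> (\<lambda>x. U m x - U n x))"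
        by (rule P(2)[OF H10_diff(1)[OF U U]])
      also have "\<dots> < e" using N[OF that] P(1) by (simp add: field_simps)
      finally show ?thesis .
    qed
    then show "\<exists>N. \<forall>m\<ge>N. \<forall>n\<ge>N. l2 M (\<lambda>x. U m x - U n x) < e" by blast
  qed
  then obtain u where u: "sqi M u" "(\<lambda>n. l2 M (\<lambda>x. U n x - u x)) \<longlonglongrightarrow> 0" by blast
  have "\<exists>g. sqi M g \<and> (\<lambda>n. l2 M (\<lambda>x. weak_grad \<Omega> (U n) x - g x)) \<longlonglongrightarrow> 0"
    using Cauchy by (intro l2_complete[OF s(2)]) (simp add: l2_weak_grad_diff[OF U U])
  then obtain g where g: "sqi M g" "(\<lambda>n. l2 M (\<lambda>x. weak_grad \<Omega> (U n) x - g x)) \<longlonglongrightarrow> 0" by blast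
  \<comment> \<open>A diagonal choice: for each n one test function that is 1/(n+1)-close to
    \<open>U n\<close> both in value and in gradient.\<close>
  have "\<exists>\<phi>. \<phi> \<in> test_functions \<Omega> \<and> l2 M (\<lambda>x. \<phi> x - U n x) < 1 / real (Suc n) \<and>
      l2 M (\<lambda>x. grad \<phi> x - weak_grad \<Omega> (U n) x) < 1 / real (Suc n)" for n
  proof -
    obtain \<phi> where \<phi>: "approximates \<phi> (U n) (weak_grad \<Omega> (U n))" by (rule H10_approximates[OF U])
    then have "(\<lambda>k. l2 M (\<lambda>x. \<phi> k x - U n x)) \<longlonglongrightarrow> 0"
      "(\<lambda>k. l2 M (\<lambda>x. grad (\<phi> k) x - weak_grad \<Omega> (U n) x)) \<longlonglongrightarrow> 0"
      by (auto simp: approximates_def)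
    then have "\<forall>\<^sub>F k in sequentially. l2 M (\<lambda>x. \<phi> k x - U n x) < 1 / real (Suc n)"
      "\<forall>\<^sub>F k in sequentially. l2 M (\<lambda>x. grad (\<phi> k) x - weak_grad \<Omega> (U n) x) < 1 / real (Suc n)"
      by - (rule order_tendstoD(2), assumption, simp)+
    then have "\<forall>\<^sub>F k in sequentially. l2 M (\<lambda>x. \<phi> k x - U n x) < 1 / real (Suc n) \<and>
        l2 M (\<lambda>x. grad (\<phi> k) x - weak_grad \<Omega> (U n) x) < 1 / real (Suc n)"
      by (rule eventually_conj)
    from eventually_happens'[OF sequentially_bot this] obtain k where
      k: "l2 M (\<lambda>x. \<phi> k x - U n x) < 1 / real (Suc n)"
        "l2 M (\<lambda>x. grad (\<phi> k) x - weak_grad \<Omega> (U n) x) < 1 / real (Suc n)"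
      by blast
    have "\<phi> k \<in> test_functions \<Omega>" using \<phi> by (simp add: approximates_def)
    with k show ?thesis by (intro exI[of _ "\<phi> k"] conjI)
  qed
  then have "\<exists>\<phi>. \<forall>n. \<phi> n \<in> test_functions \<Omega> \<and> l2 M (\<lambda>x. \<phi> n x - U n x) < 1 / real (Suc n) \<and>
      l2 M (\<lambda>x. grad (\<phi> n) x - weak_grad \<Omega> (U n) x) < 1 / real (Suc n)"
    by (intro choice allI)
  then obtain \<phi> where \<phi>: "\<And>n. \<phi> n \<in> test_functions \<Omega>"
    "\<And>n. l2 M (\<lambda>x. \<phi> n x - U n x) < 1 / real (Suc n)"
    "\<And>n. l2 M (\<lambda>x. grad (\<phi> n) x - weak_grad \<Omega> (U n) x) < 1 / real (Suc n)"
    by blast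
  have lim: "(\<lambda>n. 1 / real (Suc n)) \<longlonglongrightarrow> 0"
    using LIMSEQ_inverse_real_of_nat by (simp add: inverse_eq_divide)
  have "approximates \<phi> u g"
    unfolding approximates_def
  proof (intro conjI allI)
    show "(\<lambda>k. l2 M (\<lambda>x. \<phi> k x - u x)) \<longlonglongrightarrow> 0"
    proof (rule tendsto_0_le[OF lim u(2) l2_nonneg])
      show "l2 M (\<lambda>x. \<phi> k x - u x) \<le> 1 / real (Suc k) + l2 M (\<lambda>x. U k x - u x)" for k
        using l2_triangle_sub[OF sqi_test(1)[OF \<phi>(1)] s(1) u(1), of k k] \<phi>(2)[of k] by argo
    qed
    show "(\<lambda>k. l2 M (\<lambda>x. grad (\<phi> k) x - g x)) \<longlonglongrightarrow> 0"
    proof (rule tendsto_0_le[OF lim g(2) l2_nonneg])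
      show "l2 M (\<lambda>x. grad (\<phi> k) x - g x) \<le> 1 / real (Suc k) + l2 M (\<lambda>x. weak_grad \<Omega> (U k) x - g x)" for k
        using l2_triangle_sub[OF sqi_test(2)[OF \<phi>(1)] s(2) g(1), of k k] \<phi>(3)[of k] by argo
    qed
  qed (rule \<phi>(1))
  note ug = approximates_H10[OF u(1) g(1) this]
  have "l2 M (weak_grad \<Omega> (\<lambda>x. U n x - u x)) = l2 M (\<lambda>x. weak_grad \<Omega> (U n) x - g x)" for n
    unfolding l2_weak_grad_diff[OF U ug(1)]
  proof (rule l2_cong_AE)
    show "AE x in M. norm (weak_grad \<Omega> (U n) x - weak_grad \<Omega> u x) = norm (weak_grad \<Omega> (U n) x - g x)"
      using ug(2) by eventually_elim simp
    show "(\<lambda>x. weak_grad \<Omega> (U n) x - weak_grad \<Omega> u x) \<in> borel_measurable M"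
      by (rule sqi_measurable[OF sqi_diff[OF s(2) H10_sqi(2)[OF ug(1)]]])
    show "(\<lambda>x. weak_grad \<Omega> (U n) x - g x) \<in> borel_measurable M"
      by (rule sqi_measurable[OF sqi_diff[OF s(2) g(1)]])
  qed
  then show ?thesis using ug(1) g(2) by (intro bexI[of _ u]) simp_all
qed

text \<open>Linearity of the weak gradient holds only almost everywhere, so it becomes usable under
  the integral sign, where null sets do not matter. Stated for a general pointwise bilinear form to
  cover both \<open>grad_inner\<close> and \<open>flux_form\<close>.\<close>

lemma bilinear_integral:
  fixes L :: "real^'n \<Rightarrow> real^'n \<Rightarrow> real^'n \<Rightarrow> real"
  assumes lin: "\<And>x. bilinear (L x)"
    and int: "\<And>g k. sqi M g \<Longrightarrow> sqi M k \<Longrightarrow> integrable M (\<lambda>x. L x (g x) (k x))"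
  defines "B u v \<equiv> (LINT x|M. L x (weak_grad \<Omega> u x) (weak_grad \<Omega> v x))"
  assumes "u \<in> H10 \<Omega>" "v \<in> H10 \<Omega>" "w \<in> H10 \<Omega>"
  shows "B (\<lambda>x. u x + v x) w = B u w + B v w" "B (\<lambda>x. c * u x) w = c * B u w"
    "B w (\<lambda>x. u x + v x) = B w u + B w v" "B w (\<lambda>x. c * u x) = c * B w u"
proof -
  note su = H10_sqi(2)[OF assms(4)] and sv = H10_sqi(2)[OF assms(5)] and sw = H10_sqi(2)[OF assms(6)]
  note a = H10_add[OF assms(4,5)] and c = H10_cmult[OF assms(4), of c]
  note sa = H10_sqi(2)[OF a(1)] and sc = H10_sqi(2)[OF c(1)]
  note bm = borel_measurable_integrable[OF int]
  have "B (\<lambda>x. u x + v x) w = (LINT x|M. L x (weak_grad \<Omega> u x) (weak_grad \<Omega> w x) + L x (weak_grad \<Omega> v x) (weak_grad \<Omega> w x))"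
    unfolding B_def
  proof (rule integral_cong_AE)
    show "AE x in M. L x (weak_grad \<Omega> (\<lambda>x. u x + v x) x) (weak_grad \<Omega> w x) =
        L x (weak_grad \<Omega> u x) (weak_grad \<Omega> w x) + L x (weak_grad \<Omega> v x) (weak_grad \<Omega> w x)"
      using a(2) by eventually_elim (simp add: bilinear_ladd[OF lin])
  qed (intro bm borel_measurable_add sa su sv sw)+
  then show "B (\<lambda>x. u x + v x) w = B u w + B v w"
    unfolding B_def using int su sv sw by simp
  have "B w (\<lambda>x. u x + v x) = (LINT x|M. L x (weak_grad \<Omega> w x) (weak_grad \<Omega> u x) + L x (weak_grad \<Omega> w x) (weak_grad \<Omega> v x))"
    unfolding B_def
  proof (rule integral_cong_AE)
    show "AE x in M. L x (weak_grad \<Omega> w x) (weak_grad \<Omega> (\<lambda>x. u x + v x) x) =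
        L x (weak_grad \<Omega> w x) (weak_grad \<Omega> u x) + L x (weak_grad \<Omega> w x) (weak_grad \<Omega> v x)"
      using a(2) by eventually_elim (simp add: bilinear_radd[OF lin])
  qed (intro bm borel_measurable_add sa su sv sw)+
  then show "B w (\<lambda>x. u x + v x) = B w u + B w v"
    unfolding B_def using int su sv sw by simp
  have "B (\<lambda>x. c * u x) w = (LINT x|M. c * L x (weak_grad \<Omega> u x) (weak_grad \<Omega> w x))"
    unfolding B_def
  proof (rule integral_cong_AE)
    show "AE x in M. L x (weak_grad \<Omega> (\<lambda>x. c * u x) x) (weak_grad \<Omega> w x) = c * L x (weak_grad \<Omega> u x) (weak_grad \<Omega> w x)"
      using c(2) by eventually_elim (simp add: bilinear_lmul[OF lin])
  qed (intro bm borel_measurable_times borel_measurable_const sc su sw)+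
  then show "B (\<lambda>x. c * u x) w = c * B u w"
    unfolding B_def by simp
  have "B w (\<lambda>x. c * u x) = (LINT x|M. c * L x (weak_grad \<Omega> w x) (weak_grad \<Omega> u x))"
    unfolding B_def
  proof (rule integral_cong_AE)
    show "AE x in M. L x (weak_grad \<Omega> w x) (weak_grad \<Omega> (\<lambda>x. c * u x) x) = c * L x (weak_grad \<Omega> w x) (weak_grad \<Omega> u x)"
      using c(2) by eventually_elim (simp add: bilinear_rmul[OF lin])
  qed (intro bm borel_measurable_times borel_measurable_const sc su sw)+
  then show "B w (\<lambda>x. c * u x) = c * B w u"
    unfolding B_def by simp
qed

lemma grad_inner_linear:
  assumes "u \<in> H10 \<Omega>" "v \<in> H10 \<Omega>" "w \<in> H10 \<Omega>"
  shows "grad_inner (\<lambda>x. u x + v x) w = grad_inner u w + grad_inner v w"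
    "grad_inner (\<lambda>x. c * u x) w = c * grad_inner u w"
  unfolding grad_inner_def
  by (rule bilinear_integral[OF _ _ assms], simp add: bilinear_conv_bounded_bilinear bounded_bilinear_inner,
      rule sqi_inner, assumption+)+

sublocale H10: seminner_space "H10 \<Omega>" grad_inner
proof
  show "(\<lambda>x. 0) \<in> H10 \<Omega>"
    by (intro test_H10 test_functionsI[of _ "{}"]) (auto intro: smooth_const)
  show "grad_inner u v = grad_inner v u" for u v
    by (simp add: grad_inner_def inner_commute)
  fix U :: "nat \<Rightarrow> real^'n \<Rightarrow> real"
  assume U: "\<And>n. U n \<in> H10 \<Omega>"
    and Cauchy: "\<And>e. e > 0 \<Longrightarrow> \<exists>N. \<forall>m\<ge>N. \<forall>n\<ge>N. grad_inner (\<lambda>x. U m x - U n x) (\<lambda>x. U m x - U n x) < e"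
  have "\<exists>N. \<forall>m\<ge>N. \<forall>n\<ge>N. l2 M (weak_grad \<Omega> (\<lambda>x. U m x - U n x)) < e" if e: "e > 0" for e
  proof -
    obtain N where "\<And>m n. m \<ge> N \<Longrightarrow> n \<ge> N \<Longrightarrow> grad_inner (\<lambda>x. U m x - U n x) (\<lambda>x. U m x - U n x) < e\<^sup>2"
      using Cauchy[of "e\<^sup>2"] zero_less_power[OF e, of 2] by blast
    then have "l2 M (weak_grad \<Omega> (\<lambda>x. U m x - U n x)) < e" if "m \<ge> N" "n \<ge> N" for m n
      using that less_imp_le[OF e] unfolding grad_inner_self by (blast intro: power_less_imp_less_base)
    then show ?thesis by blast
  qed
  from H10_complete[OF U this] obtain u where u: "u \<in> H10 \<Omega>"
    "(\<lambda>n. l2 M (weak_grad \<Omega> (\<lambda>x. U n x - u x))) \<longlonglongrightarrow> 0" by blast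
  have "(\<lambda>n. (l2 M (weak_grad \<Omega> (\<lambda>x. U n x - u x)))\<^sup>2) \<longlonglongrightarrow> 0\<^sup>2"
    by (intro tendsto_intros u)
  then show "\<exists>u\<in>H10 \<Omega>. (\<lambda>n. grad_inner (\<lambda>x. U n x - u x) (\<lambda>x. U n x - u x)) \<longlonglongrightarrow> 0"
    using u(1) unfolding grad_inner_self by (intro bexI[of _ u]) simp_all
qed (auto simp: H10_add H10_cmult grad_inner_linear grad_inner_self)

text \<open>The Poincare inequality absorbs the L2 part of the \<open>H1_norm\<close>, so
  functionals are bounded by the gradient norm in which all energy estimates are made.\<close>

lemma H_minus1_bound:
  assumes "F \<in> H_minus1 \<Omega>"
  obtains C where "C \<ge> 0" "\<And>u. u \<in> H10 \<Omega> \<Longrightarrow> \<bar>F u\<bar> \<le> C * l2 M (weak_grad \<Omega> u)"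
proof -
  obtain P where P: "P > 0" "\<And>u. u \<in> H10 \<Omega> \<Longrightarrow> l2 M u \<le> P * l2 M (weak_grad \<Omega> u)"
    using Poincare by blast
  obtain C where C: "\<And>u. u \<in> H10 \<Omega> \<Longrightarrow> \<bar>F u\<bar> \<le> C * H1_norm \<Omega> u"
    using assms unfolding H_minus1_def by blast
  have "\<bar>F u\<bar> \<le> \<bar>C\<bar> * (P + 1) * l2 M (weak_grad \<Omega> u)" if u: "u \<in> H10 \<Omega>" for u
  proof -
    have "H1_norm \<Omega> u \<le> l2 M u + l2 M (weak_grad \<Omega> u)"
      unfolding H1_norm_l2 by (rule sqrt_sum_squares_le_sum) auto
    also have "\<dots> \<le> (P + 1) * l2 M (weak_grad \<Omega> u)"
      using P(2)[OF u] by (simp add: algebra_simps)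
    finally have le: "H1_norm \<Omega> u \<le> (P + 1) * l2 M (weak_grad \<Omega> u)" .
    have "0 \<le> H1_norm \<Omega> u" by (simp add: H1_norm_l2)
    then have "C * H1_norm \<Omega> u \<le> \<bar>C\<bar> * H1_norm \<Omega> u"
      by (intro mult_right_mono) auto
    also have "\<dots> \<le> \<bar>C\<bar> * ((P + 1) * l2 M (weak_grad \<Omega> u))"
      using le by (intro mult_left_mono) auto
    finally show ?thesis using C[OF u] by (simp add: mult.assoc)
  qed
  then show ?thesis using P(1) by (intro that[of "\<bar>C\<bar> * (P + 1)"]) auto
qed

section \<open>Coercive flux forms and well-posedness of the Dirichlet problem\<close>

definition flux_form :: "(real^'n \<Rightarrow> real^'n^'n) \<Rightarrow> (real^'n \<Rightarrow> real) \<Rightarrow> (real^'n \<Rightarrow> real) \<Rightarrow> real" where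
  "flux_form \<sigma> u v = (LINT x|M. (\<sigma> x *v weak_grad \<Omega> u x) \<bullet> weak_grad \<Omega> v x)"

text \<open>\<open>c\<close> is the ellipticity constant and \<open>K\<close> the operator bound.
  Symmetry is not imposed, as the Hall term is antisymmetric. Measurability is expressed by the
  action on measurable vector fields, the only way in which the matrix field is used.\<close>

definition conductivity :: "real \<Rightarrow> real \<Rightarrow> (real^'n \<Rightarrow> real^'n^'n) \<Rightarrow> bool" where
  "conductivity c K \<sigma> \<longleftrightarrow> 0 < c \<and> 0 \<le> K \<and>
     (\<forall>g \<in> borel_measurable M. (\<lambda>x. \<sigma> x *v g x) \<in> borel_measurable M) \<and>
     (\<forall>x \<xi>. norm (\<sigma> x *v \<xi>) \<le> K * norm \<xi>) \<and>
     (\<forall>x \<xi>. c * (norm \<xi>)\<^sup>2 \<le> (\<sigma> x *v \<xi>) \<bullet> \<xi>)"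

context
  fixes c K \<sigma>
  assumes \<sigma>: "conductivity c K \<sigma>"
begin

lemma conductivity_bound: "\<bar>(\<sigma> x *v \<xi>) \<bullet> \<eta>\<bar> \<le> K * (norm \<xi> * norm \<eta>)"
proof -
  have "\<bar>(\<sigma> x *v \<xi>) \<bullet> \<eta>\<bar> \<le> norm (\<sigma> x *v \<xi>) * norm \<eta>"
    by (rule Cauchy_Schwarz_ineq2)
  also have "\<dots> \<le> K * norm \<xi> * norm \<eta>"
    using \<sigma> by (intro mult_right_mono) (auto simp: conductivity_def)
  finally show ?thesis by (simp add: mult.assoc)
qed

lemma flux_measurable:
  assumes "sqi M g" "sqi M k"
  shows "(\<lambda>x. (\<sigma> x *v g x) \<bullet> k x) \<in> borel_measurable M"
  using \<sigma> sqi_measurable[OF assms(1)] sqi_measurable[OF assms(2)]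
  by (intro borel_measurable_inner) (auto simp: conductivity_def)

lemma flux_integrable:
  assumes "sqi M g" "sqi M k"
  shows "integrable M (\<lambda>x. (\<sigma> x *v g x) \<bullet> k x)"
  using conductivity_bound by (intro integrable_sqi_bound[OF assms flux_measurable[OF assms], of K]) auto

lemma flux_form_bound:
  assumes "u \<in> H10 \<Omega>" "v \<in> H10 \<Omega>"
  shows "\<bar>flux_form \<sigma> u v\<bar> \<le> K * (l2 M (weak_grad \<Omega> u) * l2 M (weak_grad \<Omega> v))"
  unfolding flux_form_def
  using H10_sqi(2)[OF assms(1)] H10_sqi(2)[OF assms(2)] conductivity_bound \<sigma>
  by (intro abs_integral_sqi_le flux_measurable) (auto simp: conductivity_def)

lemma flux_form_coercive:
  assumes "u \<in> H10 \<Omega>"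
  shows "c * (l2 M (weak_grad \<Omega> u))\<^sup>2 \<le> flux_form \<sigma> u u"
proof -
  note s = H10_sqi(2)[OF assms]
  have "c * (l2 M (weak_grad \<Omega> u))\<^sup>2 = (LINT x|M. c * (norm (weak_grad \<Omega> u x))\<^sup>2)"
    by (simp add: l2_power2)
  also have "\<dots> \<le> flux_form \<sigma> u u"
    unfolding flux_form_def using \<sigma>
    by (intro integral_mono) (auto intro!: flux_integrable s sqi_integrable simp: conductivity_def)
  finally show ?thesis .
qed

lemma flux_form_linear:
  assumes "u \<in> H10 \<Omega>" "v \<in> H10 \<Omega>" "w \<in> H10 \<Omega>"
  shows "flux_form \<sigma> (\<lambda>x. u x + v x) w = flux_form \<sigma> u w + flux_form \<sigma> v w"
    "flux_form \<sigma> (\<lambda>x. b * u x) w = b * flux_form \<sigma> u w"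
    "flux_form \<sigma> w (\<lambda>x. u x + v x) = flux_form \<sigma> w u + flux_form \<sigma> w v"
    "flux_form \<sigma> w (\<lambda>x. b * u x) = b * flux_form \<sigma> w u"
proof -
  have "bilinear (\<lambda>\<xi> \<eta>. (\<sigma> x *v \<xi>) \<bullet> \<eta>)" for x
    by (auto simp: bilinear_def matrix_vector_right_distrib inner_add_left inner_add_right
        matrix_vector_mult_scaleR intro!: linearI)
  then have lin: "bilinear ((\<lambda>x \<xi> \<eta>. (\<sigma> x *v \<xi>) \<bullet> \<eta>) x)" for x by simp
  show "flux_form \<sigma> (\<lambda>x. u x + v x) w = flux_form \<sigma> u w + flux_form \<sigma> v w"
    unfolding flux_form_def by (rule bilinear_integral(1)[OF lin flux_integrable assms])
  show "flux_form \<sigma> (\<lambda>x. b * u x) w = b * flux_form \<sigma> u w"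
    unfolding flux_form_def by (rule bilinear_integral(2)[OF lin flux_integrable assms])
  show "flux_form \<sigma> w (\<lambda>x. u x + v x) = flux_form \<sigma> w u + flux_form \<sigma> w v"
    unfolding flux_form_def by (rule bilinear_integral(3)[OF lin flux_integrable assms])
  show "flux_form \<sigma> w (\<lambda>x. b * u x) = b * flux_form \<sigma> w u"
    unfolding flux_form_def by (rule bilinear_integral(4)[OF lin flux_integrable assms])
qed

lemma flux_form_diff_left:
  assumes "u \<in> H10 \<Omega>" "v \<in> H10 \<Omega>" "w \<in> H10 \<Omega>"
  shows "flux_form \<sigma> (\<lambda>x. u x - v x) w = flux_form \<sigma> u w - flux_form \<sigma> v w"
  using flux_form_linear(1)[OF assms(1) H10_cmult(1)[OF assms(2), of "-1"] assms(3)]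
    flux_form_linear(2)[OF assms(2) assms(2) assms(3), of "-1"] by simp

lemma flux_form_diff_right:
  assumes "u \<in> H10 \<Omega>" "v \<in> H10 \<Omega>" "w \<in> H10 \<Omega>"
  shows "flux_form \<sigma> w (\<lambda>x. u x - v x) = flux_form \<sigma> w u - flux_form \<sigma> w v"
  using flux_form_linear(3)[OF assms(1) H10_cmult(1)[OF assms(2), of "-1"] assms(3)]
    flux_form_linear(4)[OF assms(2) assms(2) assms(3), of "-1"] by simp

text \<open>The hypotheses of Lax-Milgram are symmetric in the two arguments of the form. The first
  statement solves the Dirichlet problem; the second solves the adjoint problem and is used to
  represent functionals in the proof of weak convergence.\<close>

lemma flux_form_solvable:
  assumes F: "F \<in> H_minus1 \<Omega>"
  shows "\<exists>u\<in>H10 \<Omega>. \<forall>v\<in>H10 \<Omega>. flux_form \<sigma> u v = F v"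
    and "\<exists>u\<in>H10 \<Omega>. \<forall>v\<in>H10 \<Omega>. flux_form \<sigma> v u = F v"
proof -
  obtain C where C: "\<And>u. u \<in> H10 \<Omega> \<Longrightarrow> \<bar>F u\<bar> \<le> C * l2 M (weak_grad \<Omega> u)"
    using H_minus1_bound[OF F] by metis
  have Fl: "\<And>u v. u \<in> H10 \<Omega> \<Longrightarrow> v \<in> H10 \<Omega> \<Longrightarrow> F (\<lambda>x. u x + v x) = F u + F v"
    "\<And>b u. u \<in> H10 \<Omega> \<Longrightarrow> F (\<lambda>x. b * u x) = b * F u"
    using F by (auto simp: H_minus1_def)
  have c: "c > 0" using \<sigma> by (simp add: conductivity_def)
  show "\<exists>u\<in>H10 \<Omega>. \<forall>v\<in>H10 \<Omega>. flux_form \<sigma> u v = F v"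
    by (rule H10.Lax_Milgram[where K = K and c = c and C = C])
      (simp_all add: flux_form_linear flux_form_bound flux_form_coercive sqrt_grad_inner grad_inner_self c Fl C)
  show "\<exists>u\<in>H10 \<Omega>. \<forall>v\<in>H10 \<Omega>. flux_form \<sigma> v u = F v"
  proof (rule H10.Lax_Milgram[where K = K and c = c and C = C])
    show "\<bar>flux_form \<sigma> v u\<bar> \<le> K * (sqrt (grad_inner u u) * sqrt (grad_inner v v))"
      if "u \<in> H10 \<Omega>" "v \<in> H10 \<Omega>" for u v
      using flux_form_bound[OF that(2,1)] by (simp add: sqrt_grad_inner mult_ac)
  qed (simp_all add: flux_form_linear flux_form_coercive sqrt_grad_inner grad_inner_self c Fl C)
qed

text \<open>Coercivity applied to the difference of two solutions makes its gradient vanish, and the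
  Poincare inequality then makes the difference itself vanish almost everywhere.\<close>

lemma is_the_solutionI:
  assumes "u \<in> H10 \<Omega>" "\<And>v. v \<in> H10 \<Omega> \<Longrightarrow> flux_form \<sigma> u v = F v"
  shows "is_the_solution \<Omega> \<sigma> F u"
  unfolding is_the_solution_def
proof (intro conjI allI impI)
  show "is_solution \<Omega> \<sigma> F u"
    using assms by (simp add: is_solution_def flux_form_def)
  fix v assume "is_solution \<Omega> \<sigma> F v"
  then have v: "v \<in> H10 \<Omega>" "\<And>w. w \<in> H10 \<Omega> \<Longrightarrow> flux_form \<sigma> v w = F w"
    by (auto simp: is_solution_def flux_form_def)
  note d = H10_diff(1)[OF v(1) assms(1)]
  obtain P where P: "P > 0" "\<And>u. u \<in> H10 \<Omega> \<Longrightarrow> l2 M u \<le> P * l2 M (weak_grad \<Omega> u)"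
    using Poincare by blast
  have "c * (l2 M (weak_grad \<Omega> (\<lambda>x. v x - u x)))\<^sup>2 \<le> 0"
    using flux_form_coercive[OF d] flux_form_diff_left[OF v(1) assms(1) d] v(2)[OF d] assms(2)[OF d] by simp
  then have "l2 M (weak_grad \<Omega> (\<lambda>x. v x - u x)) = 0"
    using \<sigma> by (simp add: conductivity_def mult_le_0_iff)
  then have "l2 M (\<lambda>x. v x - u x) = 0"
    using P(2)[OF d] l2_nonneg[of M "\<lambda>x. v x - u x"] by simp
  from l2_eq_0_AE[OF H10_sqi(1)[OF d] this] show "AE x in M. v x = u x"
    by eventually_elim simp
qed

end

end



section \<open>Averages over periodic fibers\<close>

lemma lborel_nn_integral_translate:
  fixes f :: "'a::euclidean_space \<Rightarrow> ennreal"
  assumes [measurable]: "f \<in> borel_measurable borel"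
  shows "(\<integral>\<^sup>+x. f (c + x) \<partial>lborel) = (\<integral>\<^sup>+x. f x \<partial>lborel)"
proof -
  have "(\<integral>\<^sup>+x. f x \<partial>lborel) = (\<integral>\<^sup>+x. f x \<partial>distr lborel borel ((+) c))"
    by (simp add: lborel_distr_plus)
  also have "\<dots> = (\<integral>\<^sup>+x. f (c + x) \<partial>lborel)"
    by (intro nn_integral_distr) auto
  finally show ?thesis by simp
qed

lemma measurable_nth [measurable]: "(\<lambda>x::real^'n::finite. x $ i) \<in> borel_measurable borel"
  by (intro borel_measurable_continuous_onI continuous_intros)

lemma unit_cell_box: "unit_cell = box (vec (- 1/2)) (vec (1/2))"
  by (auto simp: unit_cell_def mem_box_cart)

lemma unit_cell_borel [measurable]: "unit_cell \<in> sets borel"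
  by (simp add: unit_cell_box)

lemma emeasure_box_cart:
  fixes a b :: "real^'n::finite"
  assumes "\<And>i. a $ i \<le> b $ i"
  shows "emeasure lborel (box a b) = ennreal (\<Prod>i\<in>UNIV. b $ i - a $ i)"
proof -
  have ne: "cbox a b \<noteq> {}" using assms by (simp add: interval_ne_empty_cart)
  have le: "a \<bullet> k \<le> b \<bullet> k" if "k \<in> Basis" for k
    using that assms by (auto simp: Basis_vec_def inner_axis)
  have "emeasure lborel (box a b) = emeasure lborel (cbox a b)"
    using le by (simp add: emeasure_lborel_box emeasure_lborel_cbox)
  also have "\<dots> = ennreal (measure lborel (cbox a b))"
    by (intro emeasure_eq_ennreal_measure) (simp add: emeasure_lborel_cbox_eq)
  also have "measure lborel (cbox a b) = (\<Prod>i\<in>UNIV. b $ i - a $ i)"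
    using content_cbox_cart[OF ne] by simp
  finally show ?thesis .
qed

lemma emeasure_unit_cell [simp]: "emeasure lborel unit_cell = 1"
  unfolding unit_cell_box by (subst emeasure_box_cart) auto

lemma AE_nth_neq: "AE z in lborel. (z :: real^'n::finite) $ i \<noteq> c"
proof -
  have "{z :: real^'n. z $ i = c} \<in> null_sets lborel"
    using negligible_standard_hyperplane[of "axis i 1 :: real^'n" c]
    by (subst null_sets_completion_iff[symmetric]) (auto simp: negligible_iff_null_sets inner_axis Basis_vec_def)
  from AE_not_in[OF this] show ?thesis by eventually_elim simp
qed

text \<open>The open unit cells miss their faces, so the lattice translates cover only almost every
  point; the translation \<open>a\<close> is needed for shifted cells.\<close>

lemma AE_nth_notin_translated_Ints: "AE z in lborel. \<forall>i. (z :: real^'n::finite) $ i - a i \<notin> \<int>"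
proof -
  have "AE z in lborel. (z :: real^'n) $ i - a i \<noteq> of_int k" for i and k :: int
    using AE_nth_neq[of i "a i + of_int k"] by eventually_elim (auto simp: algebra_simps)
  then have "AE z in lborel. \<forall>k::int. (z :: real^'n) $ i - a i \<noteq> of_int k" for i
    by (simp add: AE_all_countable)
  then have "AE z in lborel. \<forall>i. \<forall>k::int. (z :: real^'n) $ i - a i \<noteq> of_int k"
    by (rule eventually_all_finite)
  then show ?thesis by eventually_elim (auto elim!: Ints_cases)
qed

definition lattice :: "(real^'n::finite) set" where
  "lattice = {\<nu>. \<forall>i. \<nu> $ i \<in> \<int>}"

lemma countable_lattice: "countable (lattice :: (real^'n::finite) set)"
proof -
  have "lattice \<subseteq> range (\<lambda>k :: 'n \<Rightarrow> int. (\<chi> i. real_of_int (k i)))"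
  proof
    fix \<nu> :: "real^'n" assume "\<nu> \<in> lattice"
    then have "\<forall>i. \<exists>k::int. \<nu> $ i = of_int k" by (auto simp: lattice_def elim!: Ints_cases)
    then obtain k :: "'n \<Rightarrow> int" where "\<And>i. \<nu> $ i = of_int (k i)" by metis
    then have "\<nu> = (\<chi> i. real_of_int (k i))" by (simp add: vec_eq_iff)
    then show "\<nu> \<in> range (\<lambda>k :: 'n \<Rightarrow> int. (\<chi> i. real_of_int (k i)))" by blast
  qed
  moreover have "countable (range (\<lambda>k :: 'n \<Rightarrow> int. (\<chi> i. real_of_int (k i)) :: real^'n))"
    by (intro countable_image) simp
  ultimately show ?thesis by (rule countable_subset)
qed

lemma lattice_uminus: "\<nu> \<in> lattice \<Longrightarrow> - \<nu> \<in> lattice"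
  by (simp add: lattice_def)

text \<open>Off the faces the componentwise rounding of \<open>z\<close> is the only lattice vector
  whose cell contains \<open>z\<close>. The sum over the lattice is written as an integral for the
  counting measure, so that it can be exchanged with Lebesgue integrals.\<close>

lemma unit_cell_tiling:
  assumes "\<And>i. z $ i - 1/2 \<notin> \<int>"
  shows "(\<integral>\<^sup>+\<nu>. indicator unit_cell (z + \<nu>) \<partial>count_space lattice) = 1"
    and "(\<integral>\<^sup>+\<nu>. indicator unit_cell (z - \<nu>) \<partial>count_space lattice) = 1"
proof -
  define \<mu> :: "real^3" where "\<mu> = (\<chi> i. of_int (round (z $ i)))"
  have \<mu>: "\<mu> \<in> lattice" by (simp add: lattice_def \<mu>_def)
  have in_cell: "z - \<nu> \<in> unit_cell \<longleftrightarrow> \<nu> = \<mu>" if "\<nu> \<in> lattice" for \<nu>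
  proof -
    have "- 1/2 < z $ i - \<nu> $ i \<and> z $ i - \<nu> $ i < 1/2 \<longleftrightarrow> \<nu> $ i = of_int (round (z $ i))" for i
    proof -
      obtain k :: int where k: "\<nu> $ i = of_int k" using \<open>\<nu> \<in> lattice\<close> by (auto simp: lattice_def elim!: Ints_cases)
      have ne: "z $ i - of_int m \<noteq> 1/2" "z $ i - of_int m \<noteq> - 1/2" for m :: int
      proof -
        show "z $ i - of_int m \<noteq> 1/2"
          using assms[of i] Ints_of_int[of m] by (metis add_diff_cancel_left' diff_add_cancel diff_diff_eq2 add.commute)
        show "z $ i - of_int m \<noteq> - 1/2"
        proof
          assume "z $ i - of_int m = - 1/2"
          then have "z $ i - 1/2 = of_int (m - 1)" by simp
          then show False using assms[of i] Ints_of_int by metis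
        qed
      qed
      have r: "- 1/2 \<le> z $ i - of_int (round (z $ i))" "z $ i - of_int (round (z $ i)) \<le> 1/2"
        using of_int_round_abs_le[of "z $ i"] by linarith+
      show ?thesis
      proof
        assume "- 1/2 < z $ i - \<nu> $ i \<and> z $ i - \<nu> $ i < 1/2"
        then have "round (z $ i) = k" by (intro round_unique) (auto simp: k)
        then show "\<nu> $ i = of_int (round (z $ i))" by (simp add: k)
      next
        assume "\<nu> $ i = of_int (round (z $ i))"
        then show "- 1/2 < z $ i - \<nu> $ i \<and> z $ i - \<nu> $ i < 1/2"
          using r ne[of "round (z $ i)"] by (simp add: less_le)
      qed
    qed
    then show ?thesis by (auto simp: unit_cell_def vec_eq_iff \<mu>_def)
  qed
  have "(\<integral>\<^sup>+\<nu>. indicator unit_cell (z - \<nu>) \<partial>count_space lattice)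
      = (\<integral>\<^sup>+\<nu>. indicator {\<mu>} \<nu> \<partial>count_space lattice)"
    by (intro nn_integral_cong) (auto simp: in_cell split: split_indicator)
  also have "\<dots> = 1" using \<mu> by (subst nn_integral_indicator) auto
  finally show "(\<integral>\<^sup>+\<nu>. indicator unit_cell (z - \<nu>) \<partial>count_space lattice) = 1" .
  have "(\<integral>\<^sup>+\<nu>. indicator unit_cell (z + \<nu>) \<partial>count_space lattice)
      = (\<integral>\<^sup>+\<nu>. indicator {- \<mu>} \<nu> \<partial>count_space lattice)"
  proof (intro nn_integral_cong)
    fix \<nu> :: "real^3" assume "\<nu> \<in> space (count_space lattice)"
    then have "z + \<nu> \<in> unit_cell \<longleftrightarrow> \<nu> = - \<mu>"
      using in_cell[of "- \<nu>"] lattice_uminus[of \<nu>] by (auto simp: equation_minus_iff)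
    then show "indicator unit_cell (z + \<nu>) = (indicator {- \<mu>} \<nu> :: ennreal)"
      by (auto split: split_indicator)
  qed
  also have "\<dots> = 1" using lattice_uminus[OF \<mu>] by (subst nn_integral_indicator) auto
  finally show "(\<integral>\<^sup>+\<nu>. indicator unit_cell (z + \<nu>) \<partial>count_space lattice) = 1" .
qed

text \<open>Both integrals are the integral over \<open>\<nu>\<close> in the lattice of the integral of \<open>f\<close> over the
  intersection of the shifted cell with the cell at \<open>\<nu>\<close>.\<close>

lemma nn_integral_cell_shift:
  fixes f :: "real^3 \<Rightarrow> ennreal"
  assumes [measurable]: "f \<in> borel_measurable borel"
    and per: "\<And>\<nu> y. \<nu> \<in> lattice \<Longrightarrow> f (\<nu> + y) = f y"
  shows "(\<integral>\<^sup>+z. indicator unit_cell z * f (x + z) \<partial>lborel) = (\<integral>\<^sup>+z. indicator unit_cell z * f z \<partial>lborel)"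
proof -
  let ?I = "indicator unit_cell :: real^3 \<Rightarrow> ennreal"
  have "(\<integral>\<^sup>+z. ?I z * f (x + z) \<partial>lborel) = (\<integral>\<^sup>+z. ?I (- x + (x + z)) * f (x + z) \<partial>lborel)"
    by simp
  also have "\<dots> = (\<integral>\<^sup>+z. ?I (- x + z) * f z \<partial>lborel)"
    by (rule lborel_nn_integral_translate[of "\<lambda>z. ?I (- x + z) * f z"]) measurable
  also have "\<dots> = (\<integral>\<^sup>+z. (\<integral>\<^sup>+\<nu>. ?I (z - \<nu>) * (?I (- x + z) * f z) \<partial>count_space lattice) \<partial>lborel)"
  proof (rule nn_integral_cong_AE)
    show "AE z in lborel. ?I (- x + z) * f z = (\<integral>\<^sup>+\<nu>. ?I (z - \<nu>) * (?I (- x + z) * f z) \<partial>count_space lattice)"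
      using AE_nth_notin_translated_Ints[of "\<lambda>_. 1/2"]
      by eventually_elim (simp add: nn_integral_multc unit_cell_tiling)
  qed
  also have "\<dots> = (\<integral>\<^sup>+\<nu>. (\<integral>\<^sup>+z. ?I (z - \<nu>) * (?I (- x + z) * f z) \<partial>lborel) \<partial>count_space lattice)"
    by (intro nn_integral_count_space_nn_integral countable_lattice) measurable
  also have "\<dots> = (\<integral>\<^sup>+\<nu>. (\<integral>\<^sup>+z. ?I (z - x + \<nu>) * (?I z * f z) \<partial>lborel) \<partial>count_space lattice)"
  proof (rule nn_integral_cong)
    fix \<nu> :: "real^3" assume "\<nu> \<in> space (count_space lattice)"
    then have "f (\<nu> + z) = f z" for z
      using per by simp
    then have "(\<integral>\<^sup>+z. ?I (z - x + \<nu>) * (?I z * f z) \<partial>lborel)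
        = (\<integral>\<^sup>+z. ?I (\<nu> + z - \<nu>) * (?I (- x + (\<nu> + z)) * f (\<nu> + z)) \<partial>lborel)"
      by (intro nn_integral_cong) (simp add: algebra_simps)
    also have "\<dots> = (\<integral>\<^sup>+z. ?I (z - \<nu>) * (?I (- x + z) * f z) \<partial>lborel)"
      by (rule lborel_nn_integral_translate[of "\<lambda>z. ?I (z - \<nu>) * (?I (- x + z) * f z)"]) measurable
    finally show "(\<integral>\<^sup>+z. ?I (z - \<nu>) * (?I (- x + z) * f z) \<partial>lborel)
        = (\<integral>\<^sup>+z. ?I (z - x + \<nu>) * (?I z * f z) \<partial>lborel)" by simp
  qed
  also have "\<dots> = (\<integral>\<^sup>+z. (\<integral>\<^sup>+\<nu>. ?I (z - x + \<nu>) * (?I z * f z) \<partial>count_space lattice) \<partial>lborel)"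
    by (intro nn_integral_count_space_nn_integral[symmetric] countable_lattice) measurable
  also have "\<dots> = (\<integral>\<^sup>+z. ?I z * f z \<partial>lborel)"
  proof (rule nn_integral_cong_AE)
    show "AE z in lborel. (\<integral>\<^sup>+\<nu>. ?I (z - x + \<nu>) * (?I z * f z) \<partial>count_space lattice) = ?I z * f z"
      using AE_nth_notin_translated_Ints[of "\<lambda>i. x $ i + 1/2"]
      by eventually_elim (simp add: nn_integral_multc unit_cell_tiling diff_diff_eq)
  qed
  finally show ?thesis .
qed

text \<open>The horizontal part is kept as a vector of three components: functions can then be
  shifted horizontally and averaged over the three-dimensional cell without a change of
  space.\<close>

definition horiz :: "real^3 \<Rightarrow> real^3" where
  "horiz z = (\<chi> i. if i = 3 then 0 else z $ i)"

lemma horiz_nth [simp]: "horiz z $ 1 = z $ 1" "horiz z $ 2 = z $ 2" "horiz z $ 3 = 0"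
  by (simp_all add: horiz_def)

lemma continuous_on_horiz [continuous_intros]: "continuous_on S g \<Longrightarrow> continuous_on S (\<lambda>x. horiz (g x))"
  unfolding horiz_def
proof (intro continuous_on_vec_lambda)
  show "continuous_on S (\<lambda>x. if i = 3 then 0 else g x $ i)" if "continuous_on S g" for i
    using that by (cases "i = 3") (auto intro!: continuous_intros)
qed

lemma horiz_measurable [measurable]: "horiz \<in> borel_measurable borel"
  by (intro borel_measurable_continuous_onI continuous_on_horiz continuous_on_id)

lemma norm_horiz_power2: "(norm (horiz z))\<^sup>2 = (z $ 1)\<^sup>2 + (z $ 2)\<^sup>2"
  by (simp add: power2_norm_eq_inner inner_vec_def sum_3) (simp add: power2_eq_square)

lemma norm_horiz_unit_cell:
  assumes "z \<in> unit_cell"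
  shows "(norm (horiz z))\<^sup>2 \<le> 1/2" "norm (horiz z) \<le> 1"
proof -
  have "\<bar>z $ i\<bar> \<le> 1/2" for i using assms by (auto simp: unit_cell_def abs_le_iff less_imp_le dest!: spec[of _ i])
  then have "(z $ i)\<^sup>2 \<le> (1/2)\<^sup>2" for i by (metis abs_ge_zero power2_abs power_mono)
  from this[of 1] this[of 2] show le: "(norm (horiz z))\<^sup>2 \<le> 1/2"
    unfolding norm_horiz_power2 by (simp add: power_divide)
  then have "(norm (horiz z))\<^sup>2 \<le> 1\<^sup>2" by simp
  then show "norm (horiz z) \<le> 1" by (rule power2_le_imp_le) simp
qed

text \<open>Covers two families with the same averaging estimates: the fibers themselves
  (\<open>rods\<close>) and the larger set containing the gradients of the correctors
  (\<open>slab\<close>).\<close>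

locale periodic_rods =
  fixes A :: "(real^3) set"
  assumes A_borel [measurable]: "A \<in> sets borel"
    and A_periodic: "\<And>\<nu> y. \<nu> \<in> lattice \<Longrightarrow> \<nu> + y \<in> A \<longleftrightarrow> y \<in> A"
    and A_vertical: "\<And>y t. y + t *\<^sub>R axis 3 1 \<in> A \<longleftrightarrow> y \<in> A"
begin

definition area :: ennreal where "area = emeasure lborel (A \<inter> unit_cell)"

lemma area_le_1: "area \<le> 1"
proof -
  have "area \<le> emeasure lborel unit_cell"
    unfolding area_def by (intro emeasure_mono) auto
  then show ?thesis by simp
qed

lemma A_horiz: "y + horiz z \<in> A \<longleftrightarrow> y + z \<in> A"
proof -
  have "y + z = y + horiz z + z $ 3 *\<^sub>R axis 3 1"
    by (simp add: vec_eq_iff forall_3 axis_def)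
  then show ?thesis using A_vertical by metis
qed

lemma cell_average: "(\<integral>\<^sup>+z. indicator unit_cell z * indicator A (y + horiz z) \<partial>lborel) = area"
proof -
  have "(\<integral>\<^sup>+z. indicator unit_cell z * indicator A (y + horiz z) \<partial>lborel)
      = (\<integral>\<^sup>+z. indicator unit_cell z * indicator A (y + z) \<partial>(lborel :: (real^3) measure))"
    by (simp add: indicator_def A_horiz)
  also have "\<dots> = (\<integral>\<^sup>+z. indicator unit_cell z * indicator A z \<partial>(lborel :: (real^3) measure))"
    by (rule nn_integral_cell_shift) (auto simp: indicator_def A_periodic)
  also have "\<dots> = (\<integral>\<^sup>+z. indicator (A \<inter> unit_cell) z \<partial>lborel)"
    by (intro nn_integral_cong) (auto split: split_indicator)
  also have "\<dots> = area" unfolding area_def by (intro nn_integral_indicator) auto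
  finally show ?thesis .
qed

text \<open>Translating \<open>x\<close> by the shift moves it from \<open>G\<close> into the
  indicator; by periodicity the average over the cell of the shifted indicator is
  \<open>area\<close> for every \<open>x\<close>. This is the exact identity behind replacing the
  indicator of the fibers by its mean.\<close>

lemma rods_average:
  fixes G :: "real^3 \<Rightarrow> ennreal" and \<epsilon> :: real
  assumes [measurable]: "G \<in> borel_measurable borel" and "\<epsilon> > 0"
  shows "(\<integral>\<^sup>+x. indicator A (x /\<^sub>R \<epsilon>) * (\<integral>\<^sup>+z. indicator unit_cell z * G (x - \<epsilon> *\<^sub>R horiz z) \<partial>lborel) \<partial>lborel)
    = area * (\<integral>\<^sup>+x. G x \<partial>lborel)"
proof -
  let ?I = "indicator unit_cell :: real^3 \<Rightarrow> ennreal" and ?A = "indicator A :: real^3 \<Rightarrow> ennreal"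
  have "(\<integral>\<^sup>+x. ?A (x /\<^sub>R \<epsilon>) * (\<integral>\<^sup>+z. ?I z * G (x - \<epsilon> *\<^sub>R horiz z) \<partial>lborel) \<partial>lborel)
      = (\<integral>\<^sup>+x. (\<integral>\<^sup>+z. ?A (x /\<^sub>R \<epsilon>) * (?I z * G (x - \<epsilon> *\<^sub>R horiz z)) \<partial>lborel) \<partial>lborel)"
    by (intro nn_integral_cong nn_integral_cmult[symmetric]) measurable
  also have "\<dots> = (\<integral>\<^sup>+z. (\<integral>\<^sup>+x. ?A (x /\<^sub>R \<epsilon>) * (?I z * G (x - \<epsilon> *\<^sub>R horiz z)) \<partial>lborel) \<partial>lborel)"
    by (rule lborel_pair.Fubini'[symmetric]) measurable
  also have "\<dots> = (\<integral>\<^sup>+z. (\<integral>\<^sup>+x. ?A (x /\<^sub>R \<epsilon> + horiz z) * (?I z * G x) \<partial>lborel) \<partial>lborel)"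
  proof (rule nn_integral_cong)
    fix z
    have "(\<integral>\<^sup>+x. ?A (x /\<^sub>R \<epsilon>) * (?I z * G (x - \<epsilon> *\<^sub>R horiz z)) \<partial>lborel)
       = (\<integral>\<^sup>+x. ?A ((\<epsilon> *\<^sub>R horiz z + x) /\<^sub>R \<epsilon>) * (?I z * G (\<epsilon> *\<^sub>R horiz z + x - \<epsilon> *\<^sub>R horiz z)) \<partial>lborel)"
      by (rule lborel_nn_integral_translate[symmetric]) measurable
    also have "\<dots> = (\<integral>\<^sup>+x. ?A (x /\<^sub>R \<epsilon> + horiz z) * (?I z * G x) \<partial>lborel)"
      using \<open>\<epsilon> > 0\<close> by (simp add: scaleR_add_right add.commute)
    finally show "(\<integral>\<^sup>+x. ?A (x /\<^sub>R \<epsilon>) * (?I z * G (x - \<epsilon> *\<^sub>R horiz z)) \<partial>lborel)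
       = (\<integral>\<^sup>+x. ?A (x /\<^sub>R \<epsilon> + horiz z) * (?I z * G x) \<partial>lborel)" .
  qed
  also have "\<dots> = (\<integral>\<^sup>+x. (\<integral>\<^sup>+z. G x * (?I z * ?A (x /\<^sub>R \<epsilon> + horiz z)) \<partial>lborel) \<partial>lborel)"
    by (subst lborel_pair.Fubini') (auto simp: mult_ac)
  also have "\<dots> = (\<integral>\<^sup>+x. G x * area \<partial>lborel)"
    by (intro nn_integral_cong) (simp add: nn_integral_cmult cell_average)
  also have "\<dots> = area * (\<integral>\<^sup>+x. G x \<partial>lborel)"
    by (simp add: nn_integral_multc mult.commute)
  finally show ?thesis .
qed

text \<open>For \<open>x\<close> in \<open>B\<close> all shifted points lie in \<open>B'\<close>, so
  the cell average of the indicator of \<open>B'\<close> is 1 there, and \<open>rods_average\<close>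
  applies to that indicator.\<close>

lemma rods_measure_le:
  assumes [measurable]: "B \<in> sets borel" "B' \<in> sets borel" and "\<epsilon> > 0"
    and sub: "\<And>x z. x \<in> B \<Longrightarrow> z \<in> unit_cell \<Longrightarrow> x - \<epsilon> *\<^sub>R horiz z \<in> B'"
  shows "(\<integral>\<^sup>+x. indicator A (x /\<^sub>R \<epsilon>) * indicator B x \<partial>lborel) \<le> area * emeasure lborel B'"
proof -
  have "(\<integral>\<^sup>+x. indicator A (x /\<^sub>R \<epsilon>) * indicator B x \<partial>lborel)
      \<le> (\<integral>\<^sup>+x. indicator A (x /\<^sub>R \<epsilon>) * (\<integral>\<^sup>+z. indicator unit_cell z * indicator B' (x - \<epsilon> *\<^sub>R horiz z) \<partial>lborel) \<partial>lborel)"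
  proof (intro nn_integral_mono mult_left_mono)
    fix x :: "real^3"
    have "indicator B x = (\<integral>\<^sup>+z. indicator B x * indicator unit_cell z \<partial>(lborel :: (real^3) measure))"
      by (subst nn_integral_cmult) auto
    also have "\<dots> \<le> (\<integral>\<^sup>+z. indicator unit_cell z * indicator B' (x - \<epsilon> *\<^sub>R horiz z) \<partial>lborel)"
      using sub by (intro nn_integral_mono) (auto split: split_indicator)
    finally show "indicator B x \<le> (\<integral>\<^sup>+z. indicator unit_cell z * indicator B' (x - \<epsilon> *\<^sub>R horiz z) \<partial>lborel)" .
  qed simp
  also have "\<dots> = area * emeasure lborel B'"
    by (subst rods_average[OF _ \<open>\<epsilon> > 0\<close>]) auto
  finally show ?thesis .
qed

end



section \<open>Energy along horizontal segments that end in the rods\<close>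

definition stretch :: "real \<Rightarrow> real^3 \<Rightarrow> real^3" where
  "stretch t z = (\<chi> i. if i = 3 then z $ i else t * z $ i)"

lemma stretch_measurable [measurable (raw)]:
  assumes [measurable]: "f \<in> borel_measurable M" "g \<in> borel_measurable M"
  shows "(\<lambda>x. stretch (f x) (g x)) \<in> borel_measurable M"
proof -
  have "stretch t z = t *\<^sub>R horiz z + z $ 3 *\<^sub>R axis 3 1" for t z
    by (simp add: vec_eq_iff stretch_def horiz_def axis_def)
  then show ?thesis by simp
qed

lemma Basis_real3: "(Basis :: (real^3) set) = {axis 1 1, axis 2 1, axis 3 1}"
  by (auto simp: Basis_vec_def) (metis exhaust_3)

text \<open>Only the two horizontal coordinates are scaled, hence the Jacobian is the second power
  of \<open>t\<close> although the space has dimension three.\<close>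

lemma nn_integral_stretch:
  fixes H :: "real^3 \<Rightarrow> ennreal"
  assumes [measurable]: "H \<in> borel_measurable borel" and t: "t > 0"
  shows "(\<integral>\<^sup>+w. H w \<partial>lborel) = ennreal (t\<^sup>2) * (\<integral>\<^sup>+z. H (stretch t z) \<partial>lborel)"
proof -
  define c where "c j = (if j = axis 3 1 then 1 else t)" for j :: "real^3"
  define T where "T x = (0::real^3) + (\<Sum>j\<in>Basis. (c j * (x \<bullet> j)) *\<^sub>R j)" for x :: "real^3"
  have "c j \<noteq> 0" for j using t by (simp add: c_def)
  then have eq: "lborel = density (distr lborel borel T) (\<lambda>_. (\<Prod>j\<in>Basis. \<bar>c j\<bar>))"
    unfolding T_def by (rule lborel_affine_euclidean)
  have "T x = stretch t x" for x
  proof -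
    have "T x $ i = c (axis i 1) * x $ i" for i
    proof -
      have "axis i 1 \<in> (Basis :: (real^3) set)" by (auto simp: Basis_vec_def)
      then have "T x \<bullet> axis i 1 = c (axis i 1) * (x \<bullet> axis i 1)"
        unfolding T_def by simp
      moreover have "T x $ i = T x \<bullet> axis i 1" by (simp add: inner_axis)
      ultimately have "T x $ i = c (axis i 1) * (x \<bullet> axis i 1)" by simp
      then show ?thesis by (simp add: inner_axis)
    qed
    then have "T x $ i = stretch t x $ i" for i by (simp add: stretch_def c_def axis_eq_axis)
    then show ?thesis by (subst vec_eq_iff) simp
  qed
  then have T: "T = stretch t" by blast
  have Tm [measurable]: "stretch t \<in> borel_measurable borel"
    unfolding T[symmetric] T_def by measurable
  have "(\<Prod>j\<in>Basis. \<bar>c j\<bar>) = t\<^sup>2"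
    using t by (simp add: Basis_real3 c_def axis_eq_axis power2_eq_square)
  then have "(\<integral>\<^sup>+w. H w \<partial>lborel) = (\<integral>\<^sup>+w. H w \<partial>density (distr lborel borel (stretch t)) (\<lambda>_. ennreal (t\<^sup>2)))"
    using eq by (simp add: T)
  also have "\<dots> = (\<integral>\<^sup>+z. ennreal (t\<^sup>2) * H (stretch t z) \<partial>lborel)"
    by (simp add: nn_integral_density nn_integral_distr)
  also have "\<dots> = ennreal (t\<^sup>2) * (\<integral>\<^sup>+z. H (stretch t z) \<partial>lborel)"
    by (simp add: nn_integral_cmult)
  finally show ?thesis .
qed

lemma smooth_line_increment:
  assumes "smooth f"
  shows "ennreal \<bar>f (x + d) - f x\<bar> \<le>
    (\<integral>\<^sup>+t. indicator {0..1} t * ennreal (norm (grad f (x + t *\<^sub>R d)) * norm d) \<partial>lborel)"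
proof -
  define g where "g t = grad f (x + t *\<^sub>R d) \<bullet> d" for t
  have cont: "continuous_on UNIV g"
    unfolding g_def by (intro continuous_intros continuous_on_compose2[OF continuous_on_grad[OF assms, of UNIV]]) auto
  have d: "((\<lambda>t. f (x + t *\<^sub>R d)) has_real_derivative g t) (at t)" for t
    unfolding g_def by (rule smooth_DERIV_line[OF assms])
  have hb: "has_bochner_integral lborel (\<lambda>t. g t * indicator {0..1} t) (f (x + 1 *\<^sub>R d) - f (x + 0 *\<^sub>R d))"
    using cont by (intro has_bochner_integral_FTC_Icc_real d) (auto simp: continuous_on_eq_continuous_at)
  then have "f (x + d) - f x = (LINT t|lborel. g t * indicator {0..1} t)"
    by (simp add: has_bochner_integral_integral_eq)
  then have "ennreal \<bar>f (x + d) - f x\<bar> \<le> (\<integral>\<^sup>+t. ennreal (norm (g t * indicator {0..1} t)) \<partial>lborel)"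
    using integral_norm_bound_ennreal[OF integrable.intros[OF hb]] by simp
  also have "\<dots> \<le> (\<integral>\<^sup>+t. indicator {0..1} t * ennreal (norm (grad f (x + t *\<^sub>R d)) * norm d) \<partial>lborel)"
    unfolding g_def
    by (intro nn_integral_mono) (auto split: split_indicator intro!: ennreal_leI Cauchy_Schwarz_ineq2)
  finally show ?thesis .
qed

text \<open>Expanding (k a b - 1)^2. It trades an integral linear in the gradient for one quadratic
  in it plus a constant; the weight will be a multiple of \<open>max t r\<close>, which depends on
  the position along the segment.\<close>

lemma young_weighted:
  fixes a b k :: real
  assumes "k > 0"
  shows "a * b \<le> k / 2 * (a\<^sup>2 * b\<^sup>2) + 1 / (2 * k)"
proof -
  have "0 \<le> (k * (a * b) - 1)\<^sup>2 / (2 * k)" using assms by simp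
  also have "\<dots> = k / 2 * (a\<^sup>2 * b\<^sup>2) + 1 / (2 * k) - a * b"
    using assms by (simp add: power2_eq_square field_simps)
  finally show ?thesis by simp
qed

text \<open>The origin of the logarithm: on [0, r] the integrand is 1/r and contributes 1, on [r, 1]
  it is 1/t and contributes -ln r.\<close>

lemma nn_integral_inverse_max:
  assumes r: "0 < r" "r < 1"
  shows "(\<integral>\<^sup>+t. indicator {0..1} t * ennreal (1 / max t r) \<partial>lborel) \<le> ennreal (1 + \<bar>ln r\<bar>)"
proof -
  have "(\<integral>\<^sup>+t. indicator {0..1} t * ennreal (1 / max t r) \<partial>lborel)
      \<le> (\<integral>\<^sup>+t. ennreal (1 / r) * indicator {0..r} t + ennreal (1 / t) * indicator {r..1} t \<partial>lborel)"
    using r by (intro nn_integral_mono) (auto split: split_indicator simp: max_def)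
  also have "\<dots> = ennreal (1 / r) * emeasure lborel {0..r} + (\<integral>\<^sup>+t. ennreal (1 / t) * indicator {r..1} t \<partial>lborel)"
    by (simp add: nn_integral_add nn_integral_cmult)
  also have "(\<integral>\<^sup>+t. ennreal (1 / t) * indicator {r..1} t \<partial>lborel) = ennreal (ln 1 - ln r)"
    using r by (intro nn_integral_FTC_Icc) (auto intro!: derivative_eq_intros)
  also have "ennreal (1 / r) * emeasure lborel {0..r} = 1"
    using r by (simp flip: ennreal_mult)
  also have "1 + ennreal (ln 1 - ln r) = ennreal (1 + \<bar>ln r\<bar>)"
  proof -
    have "ln r \<le> 0" using r by simp
    then have "ennreal (1 + - ln r) = ennreal 1 + ennreal (- ln r)" by (intro ennreal_plus) auto
    then show ?thesis using \<open>ln r \<le> 0\<close> by simp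
  qed
  finally show ?thesis .
qed

lemma nn_integral_cube_tail:
  assumes "0 < p"
  shows "(\<integral>\<^sup>+t. ennreal (1 / t ^ 3) * indicator {p..} t \<partial>lborel) = ennreal (1 / (2 * p\<^sup>2))"
proof -
  have "(\<integral>\<^sup>+t. ennreal (1 / t ^ 3) * indicator {p..} t \<partial>lborel) = ennreal (0 - (- 1 / (2 * p\<^sup>2)))"
  proof (rule nn_integral_FTC_atLeast)
    show "((\<lambda>t. - 1 / (2 * t\<^sup>2)) has_real_derivative 1 / t ^ 3) (at t)" if "p \<le> t" for t
      using that assms by (auto intro!: derivative_eq_intros simp: field_simps power2_eq_square power3_eq_cube)
    show "0 \<le> 1 / t ^ 3" if "p \<le> t" for t using that assms by simp
    show "((\<lambda>t::real. - 1 / (2 * t\<^sup>2)) \<longlongrightarrow> 0) at_top"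
    proof -
      have "((\<lambda>t::real. (- 1 / 2) * (inverse t)\<^sup>2) \<longlongrightarrow> (- 1 / 2) * 0\<^sup>2) at_top"
        by (intro tendsto_intros tendsto_inverse_0_at_top filterlim_ident)
      then show ?thesis by (simp add: field_simps)
    qed
  qed auto
  then show ?thesis by simp
qed

context periodic_rods
begin

text \<open>For \<open>t\<close> below \<open>r\<close> the points \<open>x - t \<epsilon> horiz z\<close> are spread by the translations in \<open>x\<close>, for larger \<open>t\<close>
  by the dilation in \<open>z\<close>; the weight \<open>max t r\<close> balances the two regimes.\<close>

lemma rods_weighted_energy:
  fixes G :: "real^3 \<Rightarrow> ennreal"
  assumes [measurable]: "G \<in> borel_measurable borel" and \<epsilon>: "0 < \<epsilon>" and r: "0 < r" "r < 1"
  shows "(\<integral>\<^sup>+x. indicator A (x /\<^sub>R \<epsilon>) * (\<integral>\<^sup>+z. indicator unit_cell z * (\<integral>\<^sup>+t. indicator {0..1} t *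
      (ennreal (max t r) * (ennreal ((norm (horiz z))\<^sup>2) * G (x - (t * \<epsilon>) *\<^sub>R horiz z))) \<partial>lborel) \<partial>lborel) \<partial>lborel)
    \<le> (ennreal (r\<^sup>2) + area) * (\<integral>\<^sup>+x. G x \<partial>lborel)"
proof -
  let ?I = "indicator unit_cell :: real^3 \<Rightarrow> ennreal" and ?A = "\<lambda>x. indicator A (x /\<^sub>R \<epsilon>) :: ennreal"
  let ?N = "\<integral>\<^sup>+x. G x \<partial>lborel"
  define h where "h t x z = ennreal ((norm (horiz z))\<^sup>2) * G (x - (t * \<epsilon>) *\<^sub>R horiz z)" for t x z
  have h_meas [measurable]: "(\<lambda>(t, x, z). h t x z) \<in> borel_measurable (borel \<Otimes>\<^sub>M (borel \<Otimes>\<^sub>M borel))"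
    unfolding h_def by measurable
  have h_meas1 [measurable]: "(\<lambda>t. h t x z) \<in> borel_measurable borel"
    "(\<lambda>x. h t x z) \<in> borel_measurable borel" "(\<lambda>z. h t x z) \<in> borel_measurable borel"
    "(\<lambda>p. h (fst p) x (snd p)) \<in> borel_measurable (borel \<Otimes>\<^sub>M borel)"
    "(\<lambda>p. h (snd p) x (fst p)) \<in> borel_measurable (borel \<Otimes>\<^sub>M borel)"
    "(\<lambda>p. h (snd p) (fst (fst p)) (snd (fst p))) \<in> borel_measurable ((borel \<Otimes>\<^sub>M borel) \<Otimes>\<^sub>M borel)"
    "(\<lambda>p. h t (fst p) (snd p)) \<in> borel_measurable (borel \<Otimes>\<^sub>M borel)" for t x z
    unfolding h_def by measurable
  \<comment> \<open>The indicator of the rods is dropped. Translation invariance makes each integral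
    over \<open>x\<close> equal to \<open>?N\<close>, while the weight and the length of the
    interval contribute one factor \<open>r\<close> each.\<close>
  have small: "(\<integral>\<^sup>+x. ?A x * (\<integral>\<^sup>+z. ?I z * (\<integral>\<^sup>+t. indicator {0..r} t * (ennreal r * h t x z) \<partial>lborel) \<partial>lborel) \<partial>lborel)
      \<le> ennreal (r\<^sup>2) * ?N"
  proof -
    have "(\<integral>\<^sup>+x. ?A x * (\<integral>\<^sup>+z. ?I z * (\<integral>\<^sup>+t. indicator {0..r} t * (ennreal r * h t x z) \<partial>lborel) \<partial>lborel) \<partial>lborel)
        \<le> (\<integral>\<^sup>+x. (\<integral>\<^sup>+z. (\<integral>\<^sup>+t. ?I z * (indicator {0..r} t * (ennreal r * G (x - (t * \<epsilon>) *\<^sub>R horiz z))) \<partial>lborel) \<partial>lborel) \<partial>lborel)"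
    proof (rule nn_integral_mono)
      fix x :: "real^3"
      have "?A x * (\<integral>\<^sup>+z. ?I z * (\<integral>\<^sup>+t. indicator {0..r} t * (ennreal r * h t x z) \<partial>lborel) \<partial>lborel)
         \<le> 1 * (\<integral>\<^sup>+z. ?I z * (\<integral>\<^sup>+t. indicator {0..r} t * (ennreal r * h t x z) \<partial>lborel) \<partial>lborel)"
        by (intro mult_right_mono) (auto split: split_indicator)
      also have "\<dots> \<le> (\<integral>\<^sup>+z. (\<integral>\<^sup>+t. ?I z * (indicator {0..r} t * (ennreal r * G (x - (t * \<epsilon>) *\<^sub>R horiz z))) \<partial>lborel) \<partial>lborel)"
        unfolding mult_1_left
      proof (rule nn_integral_mono)
        fix z :: "real^3"
        have "h t x z \<le> G (x - (t * \<epsilon>) *\<^sub>R horiz z)" if "z \<in> unit_cell" for t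
        proof -
          have "ennreal ((norm (horiz z))\<^sup>2) \<le> ennreal 1"
            using norm_horiz_unit_cell(1)[OF that] by (intro ennreal_leI) simp
          then have "h t x z \<le> ennreal 1 * G (x - (t * \<epsilon>) *\<^sub>R horiz z)"
            unfolding h_def by (rule mult_right_mono) simp
          then show ?thesis by simp
        qed
        then show "?I z * (\<integral>\<^sup>+t. indicator {0..r} t * (ennreal r * h t x z) \<partial>lborel)
            \<le> (\<integral>\<^sup>+t. ?I z * (indicator {0..r} t * (ennreal r * G (x - (t * \<epsilon>) *\<^sub>R horiz z))) \<partial>lborel)"
          by (cases "z \<in> unit_cell") (auto intro!: nn_integral_mono mult_left_mono)
      qed
      finally show "?A x * (\<integral>\<^sup>+z. ?I z * (\<integral>\<^sup>+t. indicator {0..r} t * (ennreal r * h t x z) \<partial>lborel) \<partial>lborel)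
         \<le> (\<integral>\<^sup>+z. (\<integral>\<^sup>+t. ?I z * (indicator {0..r} t * (ennreal r * G (x - (t * \<epsilon>) *\<^sub>R horiz z))) \<partial>lborel) \<partial>lborel)" .
    qed
    also have "\<dots> = (\<integral>\<^sup>+z. (\<integral>\<^sup>+x. (\<integral>\<^sup>+t. ?I z * (indicator {0..r} t * (ennreal r * G (x - (t * \<epsilon>) *\<^sub>R horiz z))) \<partial>lborel) \<partial>lborel) \<partial>lborel)"
      by (rule lborel_pair.Fubini') measurable
    also have "\<dots> = (\<integral>\<^sup>+z. (\<integral>\<^sup>+t. (\<integral>\<^sup>+x. ?I z * (indicator {0..r} t * (ennreal r * G (x - (t * \<epsilon>) *\<^sub>R horiz z))) \<partial>lborel) \<partial>lborel) \<partial>lborel)"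
      by (intro nn_integral_cong lborel_pair.Fubini') measurable
    also have "\<dots> = (\<integral>\<^sup>+z. (\<integral>\<^sup>+t. ?I z * (indicator {0..r} t * (ennreal r * ?N)) \<partial>lborel) \<partial>lborel)"
    proof (intro nn_integral_cong)
      fix z :: "real^3" and t :: real
      have "(\<integral>\<^sup>+x. G (x - (t * \<epsilon>) *\<^sub>R horiz z) \<partial>lborel) = ?N"
        using lborel_nn_integral_translate[of G "- ((t * \<epsilon>) *\<^sub>R horiz z)"] by simp
      then show "(\<integral>\<^sup>+x. ?I z * (indicator {0..r} t * (ennreal r * G (x - (t * \<epsilon>) *\<^sub>R horiz z))) \<partial>lborel)
          = ?I z * (indicator {0..r} t * (ennreal r * ?N))"
        by (simp add: nn_integral_cmult)
    qed
    also have "\<dots> = ennreal r * (ennreal r * ?N)"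
      using r by (simp add: nn_integral_cmult nn_integral_multc)
    also have "\<dots> = ennreal (r\<^sup>2) * ?N"
      using r by (simp add: power2_eq_square ennreal_mult mult.assoc)
    finally show ?thesis .
  qed
  \<comment> \<open>Holds for every single \<open>x\<close>, by substituting the point w =
    \<open>stretch t z\<close>; the resulting integral over the cell is of the form to which
    \<open>rods_average\<close> applies, and this yields the factor \<open>area\<close>.\<close>
  have large: "(\<integral>\<^sup>+z. ?I z * (\<integral>\<^sup>+t. indicator {r..1} t * (ennreal t * h t x z) \<partial>lborel) \<partial>lborel)
      \<le> (\<integral>\<^sup>+w. ?I w * G (x - \<epsilon> *\<^sub>R horiz w) \<partial>lborel)" for x
  proof -
    define H where "H t w = ?I (stretch (1 / t) w) * (ennreal ((norm (horiz w))\<^sup>2) * G (x - \<epsilon> *\<^sub>R horiz w))" for t w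
    have H_meas [measurable]: "(\<lambda>(t, w). H t w) \<in> borel_measurable (borel \<Otimes>\<^sub>M borel)"
      unfolding H_def by measurable
    have H_meas1 [measurable]: "(\<lambda>t. H t w) \<in> borel_measurable borel"
      "(\<lambda>w. H t w) \<in> borel_measurable borel"
      "(\<lambda>p. H (fst p) (snd p)) \<in> borel_measurable (borel \<Otimes>\<^sub>M borel)"
      "(\<lambda>p. H (snd p) (fst p)) \<in> borel_measurable (borel \<Otimes>\<^sub>M borel)" for t w
      unfolding H_def by measurable
    \<comment> \<open>The power t^(-3) collects the weight t, the Jacobian t^(-2), and another
      t^(-2) from expressing the squared length of \<open>horiz z\<close> through
      \<open>w\<close>.\<close>
    have inner: "ennreal t * (\<integral>\<^sup>+z. ?I z * h t x z \<partial>lborel) = ennreal (1 / t ^ 3) * (\<integral>\<^sup>+w. H t w \<partial>lborel)"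
      if t: "t > 0" for t
    proof -
      have "H t (stretch t z) = ennreal (t\<^sup>2) * (?I z * h t x z)" for z
      proof -
        have "stretch (1 / t) (stretch t z) = z" using t by (simp add: stretch_def vec_eq_iff)
        moreover have hz: "horiz (stretch t z) = t *\<^sub>R horiz z"
          by (simp add: vec_eq_iff forall_3 stretch_def horiz_def)
        moreover have "ennreal ((norm (t *\<^sub>R horiz z))\<^sup>2) = ennreal (t\<^sup>2) * ennreal ((norm (horiz z))\<^sup>2)"
          by (simp add: power_mult_distrib ennreal_mult)
        ultimately show ?thesis by (simp add: H_def h_def mult_ac)
      qed
      then have "(\<integral>\<^sup>+w. H t w \<partial>lborel) = ennreal (t\<^sup>2) * (ennreal (t\<^sup>2) * (\<integral>\<^sup>+z. ?I z * h t x z \<partial>lborel))"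
        by (subst nn_integral_stretch[OF _ t]) (simp_all add: nn_integral_cmult)
      then have "ennreal (1 / t ^ 3) * (\<integral>\<^sup>+w. H t w \<partial>lborel)
          = (ennreal (1 / t ^ 3) * ennreal (t\<^sup>2) * ennreal (t\<^sup>2)) * (\<integral>\<^sup>+z. ?I z * h t x z \<partial>lborel)"
        by (simp add: mult_ac)
      also have "ennreal (1 / t ^ 3) * ennreal (t\<^sup>2) * ennreal (t\<^sup>2) = ennreal (1 / t ^ 3 * t\<^sup>2 * t\<^sup>2)"
      proof -
        have "ennreal (1 / t ^ 3) * ennreal (t\<^sup>2) = ennreal (1 / t ^ 3 * t\<^sup>2)"
          "ennreal (1 / t ^ 3 * t\<^sup>2) * ennreal (t\<^sup>2) = ennreal (1 / t ^ 3 * t\<^sup>2 * t\<^sup>2)"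
          using t by (intro ennreal_mult[symmetric]; simp)+
        then show ?thesis by (simp only:)
      qed
      also have "1 / t ^ 3 * t\<^sup>2 * t\<^sup>2 = t"
        using t by (simp add: power2_eq_square power3_eq_cube)
      finally show ?thesis by simp
    qed
    have "(\<integral>\<^sup>+z. ?I z * (\<integral>\<^sup>+t. indicator {r..1} t * (ennreal t * h t x z) \<partial>lborel) \<partial>lborel)
        = (\<integral>\<^sup>+z. (\<integral>\<^sup>+t. indicator {r..1} t * (ennreal t * (?I z * h t x z)) \<partial>lborel) \<partial>lborel)"
      by (intro nn_integral_cong, subst nn_integral_cmult[symmetric]) (simp_all add: mult_ac)
    also have "\<dots> = (\<integral>\<^sup>+t. (\<integral>\<^sup>+z. indicator {r..1} t * (ennreal t * (?I z * h t x z)) \<partial>lborel) \<partial>lborel)"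
      by (rule lborel_pair.Fubini') measurable
    also have "\<dots> = (\<integral>\<^sup>+t. (\<integral>\<^sup>+w. indicator {r..1} t * (ennreal (1 / t ^ 3) * H t w) \<partial>lborel) \<partial>lborel)"
    proof (rule nn_integral_cong)
      fix t :: real
      show "(\<integral>\<^sup>+z. indicator {r..1} t * (ennreal t * (?I z * h t x z)) \<partial>lborel)
          = (\<integral>\<^sup>+w. indicator {r..1} t * (ennreal (1 / t ^ 3) * H t w) \<partial>lborel)"
        using inner[of t] r by (cases "t \<in> {r..1}") (simp_all add: nn_integral_cmult)
    qed
    also have "\<dots> = (\<integral>\<^sup>+w. (\<integral>\<^sup>+t. indicator {r..1} t * (ennreal (1 / t ^ 3) * H t w) \<partial>lborel) \<partial>lborel)"
      by (rule lborel_pair.Fubini'[symmetric]) measurable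
    also have "\<dots> \<le> (\<integral>\<^sup>+w. ?I w * G (x - \<epsilon> *\<^sub>R horiz w) \<partial>lborel)"
    proof (rule nn_integral_mono)
      fix w :: "real^3"
      define p where "p = norm (horiz w)"
      show "(\<integral>\<^sup>+t. indicator {r..1} t * (ennreal (1 / t ^ 3) * H t w) \<partial>lborel) \<le> ?I w * G (x - \<epsilon> *\<^sub>R horiz w)"
      proof (cases "p = 0")
        case True
        then show ?thesis by (simp add: H_def p_def)
      next
        case False
        then have p: "p > 0" by (simp add: p_def)
        \<comment> \<open>If \<open>w\<close> stretched by 1/t lies in the cell, then
          \<open>w\<close> lies in it too and its horizontal length \<open>p\<close> is at most
          \<open>t\<close>. So only t >= p contributes, and p^2 times the tail integral of t^(-3) is
          1/2.\<close>
        have *: "indicator {r..1} t * (ennreal (1 / t ^ 3) * H t w)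
            \<le> (ennreal (p\<^sup>2) * (?I w * G (x - \<epsilon> *\<^sub>R horiz w))) * (ennreal (1 / t ^ 3) * indicator {p..} t)" for t
        proof (cases "t \<in> {r..1} \<and> stretch (1 / t) w \<in> unit_cell")
          case False
          then show ?thesis by (auto simp: H_def)
        next
          case True
          then have t: "0 < t" "t \<le> 1" and cell: "stretch (1 / t) w \<in> unit_cell" using r by auto
          have "horiz (stretch (1 / t) w) = (1 / t) *\<^sub>R horiz w"
            by (simp add: vec_eq_iff forall_3 stretch_def horiz_def)
          then have "p \<le> t" using norm_horiz_unit_cell(2)[OF cell] t by (simp add: p_def field_simps)
          moreover have "w \<in> unit_cell"
            unfolding unit_cell_def mem_Collect_eq
          proof
            fix i :: 3
            have b: "- 1/2 < stretch (1 / t) w $ i" "stretch (1 / t) w $ i < 1/2"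
              using cell by (auto simp: unit_cell_def)
            show "- 1/2 < w $ i \<and> w $ i < 1/2"
            proof (cases "i = 3")
              case False
              then have "- t < 2 * w $ i" "2 * w $ i < t" using b t by (simp_all add: stretch_def field_simps)
              then show ?thesis using t by simp
            qed (use b in \<open>simp add: stretch_def\<close>)
          qed
          ultimately show ?thesis using True by (simp add: H_def p_def mult_ac)
        qed
        have "(\<integral>\<^sup>+t. indicator {r..1} t * (ennreal (1 / t ^ 3) * H t w) \<partial>lborel)
            \<le> (\<integral>\<^sup>+t. (ennreal (p\<^sup>2) * (?I w * G (x - \<epsilon> *\<^sub>R horiz w))) * (ennreal (1 / t ^ 3) * indicator {p..} t) \<partial>lborel)"
          by (intro nn_integral_mono *)
        also have "\<dots> = (ennreal (p\<^sup>2) * (?I w * G (x - \<epsilon> *\<^sub>R horiz w))) * ennreal (1 / (2 * p\<^sup>2))"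
          by (subst nn_integral_cmult) (auto simp: nn_integral_cube_tail[OF p])
        also have "\<dots> = (ennreal (p\<^sup>2) * ennreal (1 / (2 * p\<^sup>2))) * (?I w * G (x - \<epsilon> *\<^sub>R horiz w))"
          by (simp add: mult_ac)
        also have "\<dots> \<le> 1 * (?I w * G (x - \<epsilon> *\<^sub>R horiz w))"
        proof (rule mult_right_mono)
          have "ennreal (p\<^sup>2) * ennreal (1 / (2 * p\<^sup>2)) = ennreal (1 / 2)"
            using p by (simp flip: ennreal_mult)
          also have "\<dots> \<le> ennreal 1" by (rule ennreal_leI) simp
          finally show "ennreal (p\<^sup>2) * ennreal (1 / (2 * p\<^sup>2)) \<le> 1" by simp
        qed simp
        finally show ?thesis by simp
      qed
    qed
    finally show ?thesis .
  qed
  have split: "indicator {0..1} t * (ennreal (max t r) * h t x z)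
      \<le> indicator {0..r} t * (ennreal r * h t x z) + indicator {r..1} t * (ennreal t * h t x z)" for t x z
    using r by (auto split: split_indicator simp: max_def)
  have "(\<integral>\<^sup>+x. ?A x * (\<integral>\<^sup>+z. ?I z * (\<integral>\<^sup>+t. indicator {0..1} t * (ennreal (max t r) * h t x z) \<partial>lborel) \<partial>lborel) \<partial>lborel)
      \<le> (\<integral>\<^sup>+x. ?A x * (\<integral>\<^sup>+z. ?I z * (\<integral>\<^sup>+t. indicator {0..r} t * (ennreal r * h t x z) + indicator {r..1} t * (ennreal t * h t x z) \<partial>lborel) \<partial>lborel) \<partial>lborel)"
    by (intro nn_integral_mono mult_left_mono split) auto
  also have "\<dots> = (\<integral>\<^sup>+x. ?A x * (\<integral>\<^sup>+z. ?I z * (\<integral>\<^sup>+t. indicator {0..r} t * (ennreal r * h t x z) \<partial>lborel) \<partial>lborel) \<partial>lborel)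
      + (\<integral>\<^sup>+x. ?A x * (\<integral>\<^sup>+z. ?I z * (\<integral>\<^sup>+t. indicator {r..1} t * (ennreal t * h t x z) \<partial>lborel) \<partial>lborel) \<partial>lborel)"
    by (simp add: nn_integral_add distrib_left)
  also have "\<dots> \<le> ennreal (r\<^sup>2) * ?N + (\<integral>\<^sup>+x. ?A x * (\<integral>\<^sup>+w. ?I w * G (x - \<epsilon> *\<^sub>R horiz w) \<partial>lborel) \<partial>lborel)"
    by (intro add_mono small nn_integral_mono mult_left_mono large) auto
  also have "\<dots> = (ennreal (r\<^sup>2) + area) * ?N"
    using \<epsilon> by (simp add: rods_average distrib_right)
  finally show ?thesis unfolding h_def .
qed

end



context periodic_rods
begin

text \<open>The increment of \<open>v\<close> is integrated along the segment and split by Young's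
  inequality with weight \<open>k * max t r\<close>: the quadratic part is the weighted energy, the
  constant part is the logarithmic integral. The set \<open>B\<close> confines the latter to points
  near the support of \<open>v\<close>; \<open>k\<close> stays free to balance the two
  parts.\<close>

lemma rods_deviation:
  fixes v :: "real^3 \<Rightarrow> real"
  assumes v: "smooth v" and \<epsilon>: "0 < \<epsilon>" and r: "0 < r" "r < 1" and k: "0 < k"
    and [measurable]: "B \<in> sets borel"
    and B: "\<And>x z. x \<notin> B \<Longrightarrow> z \<in> unit_cell \<Longrightarrow> v (x - \<epsilon> *\<^sub>R horiz z) = v x"
  shows "(\<integral>\<^sup>+x. indicator A (x /\<^sub>R \<epsilon>) * (\<integral>\<^sup>+z. indicator unit_cell z *
      ennreal \<bar>v (x - \<epsilon> *\<^sub>R horiz z) - v x\<bar> \<partial>lborel) \<partial>lborel)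
    \<le> ennreal (k * \<epsilon>\<^sup>2 / 2) * ((ennreal (r\<^sup>2) + area) * (\<integral>\<^sup>+x. ennreal ((norm (grad v x))\<^sup>2) \<partial>lborel))
      + ennreal (1 / (2 * k)) * ennreal (1 + \<bar>ln r\<bar>) * (\<integral>\<^sup>+x. indicator A (x /\<^sub>R \<epsilon>) * indicator B x \<partial>lborel)"
proof -
  let ?I = "indicator unit_cell :: real^3 \<Rightarrow> ennreal" and ?A = "\<lambda>x. indicator A (x /\<^sub>R \<epsilon>) :: ennreal"
  note [measurable] = grad_borel[OF v] borel_measurable_continuous_onI[OF smooth_continuous[OF v]]
  define X where "X x z = (\<integral>\<^sup>+t. indicator {0..1} t * (ennreal (max t r) * (ennreal ((norm (horiz z))\<^sup>2) *
      ennreal ((norm (grad v (x - (t * \<epsilon>) *\<^sub>R horiz z)))\<^sup>2))) \<partial>lborel)" for x z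
  define L where "L = (\<integral>\<^sup>+t. indicator {0..1} t * ennreal (1 / max t r) \<partial>lborel)"
  have X_meas [measurable]: "(\<lambda>p. X (fst p) (snd p)) \<in> borel_measurable (borel \<Otimes>\<^sub>M borel)"
    "(\<lambda>z. X x z) \<in> borel_measurable borel" for x
    unfolding X_def by measurable
  define c d where "c = ennreal (k * \<epsilon>\<^sup>2 / 2)" and "d = ennreal (1 / (2 * k))"
  have pointwise: "ennreal \<bar>v (x - \<epsilon> *\<^sub>R horiz z) - v x\<bar> \<le> c * X x z + d * L * indicator B x"
    if z: "z \<in> unit_cell" for x z
  proof (cases "x \<in> B")
    case False
    then show ?thesis using B[OF False z] by simp
  next
    case True
    have "ennreal \<bar>v (x + - (\<epsilon> *\<^sub>R horiz z)) - v x\<bar> \<le> (\<integral>\<^sup>+t. indicator {0..1} t *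
        ennreal (norm (grad v (x + t *\<^sub>R - (\<epsilon> *\<^sub>R horiz z))) * norm (- (\<epsilon> *\<^sub>R horiz z))) \<partial>lborel)"
      by (rule smooth_line_increment[OF v])
    also have "\<dots> \<le> (\<integral>\<^sup>+t. c * (indicator {0..1} t * (ennreal (max t r) * (ennreal ((norm (horiz z))\<^sup>2) *
        ennreal ((norm (grad v (x - (t * \<epsilon>) *\<^sub>R horiz z)))\<^sup>2)))) + d * (indicator {0..1} t * ennreal (1 / max t r)) \<partial>lborel)"
    proof (rule nn_integral_mono)
      fix t :: real
      let ?a = "norm (grad v (x - (t * \<epsilon>) *\<^sub>R horiz z))" and ?b = "norm (horiz z)" and ?m = "max t r"
      have m: "?m > 0" using r by (simp add: less_max_iff_disj)
      \<comment> \<open>The Young parameter is \<open>k * ?m\<close>: its first term carries the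
        weight \<open>max t r\<close> of \<open>rods_weighted_energy\<close>, its second the
        reciprocal weight of \<open>nn_integral_inverse_max\<close>.\<close>
      have "?a * (\<epsilon> * ?b) \<le> k * ?m / 2 * (?a\<^sup>2 * (\<epsilon> * ?b)\<^sup>2) + 1 / (2 * (k * ?m))"
        using k m by (intro young_weighted) simp
      also have "\<dots> = (k * \<epsilon>\<^sup>2 / 2) * (?m * (?b\<^sup>2 * ?a\<^sup>2)) + 1 / (2 * k) * (1 / ?m)"
        by (simp add: power_mult_distrib mult_ac)
      finally have "ennreal (?a * (\<epsilon> * ?b)) \<le> ennreal ((k * \<epsilon>\<^sup>2 / 2) * (?m * (?b\<^sup>2 * ?a\<^sup>2)) + 1 / (2 * k) * (1 / ?m))"
        by (rule ennreal_leI)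
      also have "\<dots> = c * (ennreal ?m * (ennreal (?b\<^sup>2) * ennreal (?a\<^sup>2))) + d * ennreal (1 / ?m)"
      proof -
        have "ennreal ((k * \<epsilon>\<^sup>2 / 2) * (?m * (?b\<^sup>2 * ?a\<^sup>2)) + 1 / (2 * k) * (1 / ?m))
            = ennreal ((k * \<epsilon>\<^sup>2 / 2) * (?m * (?b\<^sup>2 * ?a\<^sup>2))) + ennreal (1 / (2 * k) * (1 / ?m))"
          using k m by (intro ennreal_plus) auto
        also have "ennreal (1 / (2 * k) * (1 / ?m)) = d * ennreal (1 / ?m)"
          unfolding d_def using k m by (intro ennreal_mult) auto
        also have "ennreal ((k * \<epsilon>\<^sup>2 / 2) * (?m * (?b\<^sup>2 * ?a\<^sup>2))) = c * ennreal (?m * (?b\<^sup>2 * ?a\<^sup>2))"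
          unfolding c_def using k m by (intro ennreal_mult) auto
        also have "ennreal (?m * (?b\<^sup>2 * ?a\<^sup>2)) = ennreal ?m * ennreal (?b\<^sup>2 * ?a\<^sup>2)"
          using m by (intro ennreal_mult) auto
        also have "ennreal (?b\<^sup>2 * ?a\<^sup>2) = ennreal (?b\<^sup>2) * ennreal (?a\<^sup>2)"
          by (intro ennreal_mult) auto
        finally show ?thesis .
      qed
      finally have le: "ennreal (?a * (\<epsilon> * ?b)) \<le> c * (ennreal ?m * (ennreal (?b\<^sup>2) * ennreal (?a\<^sup>2))) + d * ennreal (1 / ?m)" .
      show "indicator {0..1} t * ennreal (norm (grad v (x + t *\<^sub>R - (\<epsilon> *\<^sub>R horiz z))) * norm (- (\<epsilon> *\<^sub>R horiz z)))
        \<le> c * (indicator {0..1} t * (ennreal ?m * (ennreal (?b\<^sup>2) * ennreal (?a\<^sup>2)))) + d * (indicator {0..1} t * ennreal (1 / ?m))"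
        using le \<epsilon> by (cases "t \<in> {0..1}") simp_all
    qed
    also have "\<dots> = c * X x z + d * L"
      unfolding X_def L_def by (subst nn_integral_add) (auto simp: nn_integral_cmult)
    finally show ?thesis using True by simp
  qed
  have L_le: "L \<le> ennreal (1 + \<bar>ln r\<bar>)"
    unfolding L_def by (rule nn_integral_inverse_max[OF r])
  have "(\<integral>\<^sup>+x. ?A x * (\<integral>\<^sup>+z. ?I z * ennreal \<bar>v (x - \<epsilon> *\<^sub>R horiz z) - v x\<bar> \<partial>lborel) \<partial>lborel)
      \<le> (\<integral>\<^sup>+x. ?A x * (\<integral>\<^sup>+z. c * (?I z * X x z) + (d * L * indicator B x) * ?I z \<partial>lborel) \<partial>lborel)"
  proof (intro nn_integral_mono mult_left_mono)
    fix x z :: "real^3"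
    show "?I z * ennreal \<bar>v (x - \<epsilon> *\<^sub>R horiz z) - v x\<bar> \<le> c * (?I z * X x z) + (d * L * indicator B x) * ?I z"
      using pointwise[of z x] by (cases "z \<in> unit_cell") simp_all
  qed simp
  also have "\<dots> = (\<integral>\<^sup>+x. c * (?A x * (\<integral>\<^sup>+z. ?I z * X x z \<partial>lborel)) + (d * L) * (?A x * indicator B x) \<partial>lborel)"
  proof (rule nn_integral_cong)
    fix x :: "real^3"
    have "(\<integral>\<^sup>+z. c * (?I z * X x z) + (d * L * indicator B x) * ?I z \<partial>lborel)
        = c * (\<integral>\<^sup>+z. ?I z * X x z \<partial>lborel) + (d * L * indicator B x)"
      by (subst nn_integral_add) (auto simp: nn_integral_cmult)
    then show "?A x * (\<integral>\<^sup>+z. c * (?I z * X x z) + (d * L * indicator B x) * ?I z \<partial>lborel)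
        = c * (?A x * (\<integral>\<^sup>+z. ?I z * X x z \<partial>lborel)) + (d * L) * (?A x * indicator B x)"
      by (simp add: distrib_left mult_ac)
  qed
  also have "\<dots> = c * (\<integral>\<^sup>+x. ?A x * (\<integral>\<^sup>+z. ?I z * X x z \<partial>lborel) \<partial>lborel) + (d * L) * (\<integral>\<^sup>+x. ?A x * indicator B x \<partial>lborel)"
  proof -
    have m: "(\<lambda>x. \<integral>\<^sup>+z. ?I z * X x z \<partial>lborel) \<in> borel_measurable borel"
      unfolding X_def by measurable
    note [measurable] = m
    show ?thesis by (subst nn_integral_add) (auto simp: nn_integral_cmult)
  qed
  also have "\<dots> \<le> c * ((ennreal (r\<^sup>2) + area) * (\<integral>\<^sup>+x. ennreal ((norm (grad v x))\<^sup>2) \<partial>lborel))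
      + (d * ennreal (1 + \<bar>ln r\<bar>)) * (\<integral>\<^sup>+x. ?A x * indicator B x \<partial>lborel)"
    unfolding X_def
    by (intro add_mono mult_left_mono mult_right_mono rods_weighted_energy \<epsilon> r L_le) auto
  finally show ?thesis unfolding c_def d_def .
qed

lemma area_measure: "area = ennreal (measure lborel (A \<inter> unit_cell))"
  unfolding area_def using area_le_1 unfolding area_def
  by (intro emeasure_eq_ennreal_measure) (auto simp: top_unique)

text \<open>Against the indicator of the rods, the cell average of the shifted \<open>v\<close>
  gives exactly \<open>w\<close> times the integral of \<open>v\<close>. The error is therefore the
  difference between \<open>v\<close> and its shifts on the rods, estimated by
  \<open>rods_deviation\<close>. The bound keeps the factor \<open>w\<close>, which later
  compensates the conductivity of order 1/w.\<close>

lemma rods_average_estimate: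
  fixes v :: "real^3 \<Rightarrow> real"
  defines "w \<equiv> measure lborel (A \<inter> unit_cell)"
  assumes v: "v \<in> test_functions S" and S: "S \<subseteq> cball 0 R"
    and \<epsilon>: "0 < \<epsilon>" "\<epsilon> < 1" and r: "0 < r" "r < 1" and w: "r\<^sup>2 \<le> w"
  shows "\<bar>LINT x|lborel. (indicator A (x /\<^sub>R \<epsilon>) - w) * v x\<bar> \<le>
    w * sqrt (\<epsilon>\<^sup>2 * (1 + \<bar>ln r\<bar>)) * ((LINT x|lborel. (norm (grad v x))\<^sup>2) + measure lborel (cball (0::real^3) (R + 2)))"
proof -
  let ?I = "indicator unit_cell :: real^3 \<Rightarrow> real" and ?A = "\<lambda>x. indicator A (x /\<^sub>R \<epsilon>) :: real"
  have vs: "smooth v" by (rule test_smooth[OF v])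
  have vb [measurable]: "v \<in> borel_measurable borel" by (rule test_borel[OF v])
  note [measurable] = grad_borel[OF vs]
  obtain C where C: "C > 0" "\<And>x. \<bar>v x\<bar> \<le> C" "\<And>x. norm (grad v x) \<le> C"
    using test_bounded[OF v] by metis
  have v0: "v x = 0" "grad v x = 0" if "norm x > R" for x
  proof -
    have "x \<notin> S" using S that by auto
    then show "v x = 0" "grad v x = 0"
      using test_zero_outside[OF v] test_grad_zero_outside[OF v] by auto
  qed
  have near: "norm x \<le> norm (x - \<epsilon> *\<^sub>R horiz z) + 1" "norm (x - \<epsilon> *\<^sub>R horiz z) \<le> norm x + 1"
    if "z \<in> unit_cell" for x z
  proof -
    have "norm (\<epsilon> *\<^sub>R horiz z) \<le> 1 * 1"
      using \<epsilon> norm_horiz_unit_cell(2)[OF that] unfolding norm_scaleR by (intro mult_mono) auto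
    then show "norm x \<le> norm (x - \<epsilon> *\<^sub>R horiz z) + 1" "norm (x - \<epsilon> *\<^sub>R horiz z) \<le> norm x + 1"
      using norm_triangle_sub[of x "\<epsilon> *\<^sub>R horiz z"] norm_triangle_ineq4[of x "\<epsilon> *\<^sub>R horiz z"] by linarith+
  qed
  \<comment> \<open>The quantity in question is minus the double integral of \<open>D\<close>:
    \<open>D2\<close> integrates to the term with the indicator, and \<open>D1\<close>, which has
    the same integral as \<open>D3\<close>, to the term with the mean.\<close>
  define D where "D = (\<lambda>(x, z). ?A x * ?I z * (v (x - \<epsilon> *\<^sub>R horiz z) - v x))"
  define D1 where "D1 = (\<lambda>(x, z). ?A x * ?I z * v (x - \<epsilon> *\<^sub>R horiz z))"
  define D2 where "D2 = (\<lambda>(x, z). ?A x * ?I z * v x)"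
  define D3 where "D3 = (\<lambda>(x, z). ?I z * indicator A (x /\<^sub>R \<epsilon> + horiz z) * v x)"
  let ?P = "lborel \<Otimes>\<^sub>M lborel :: ((real^3) \<times> (real^3)) measure"
  have meas [measurable]: "D \<in> borel_measurable ?P" "D1 \<in> borel_measurable ?P" "D2 \<in> borel_measurable ?P" "D3 \<in> borel_measurable ?P"
    unfolding D_def D1_def D2_def D3_def by measurable
  define K where "K = cball (0::real^3) (R + 1) \<times> cball (0::real^3) 2"
  have cell: "norm z \<le> 2" if "z \<in> unit_cell" for z
  proof -
    have "\<bar>z $ i\<bar> \<le> 1/2" for i using that by (auto simp: unit_cell_def abs_le_iff less_imp_le dest!: spec[of _ i])
    then have "(\<Sum>i\<in>UNIV. \<bar>z $ i\<bar>) \<le> (\<Sum>i\<in>(UNIV::3 set). 1/2)" by (intro sum_mono)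
    then show ?thesis using norm_le_l1_cart[of z] by simp
  qed
  have int: "integrable ?P f" if "f \<in> borel_measurable ?P" "\<And>p. \<bar>f p\<bar> \<le> C" "\<And>p. p \<notin> K \<Longrightarrow> f p = 0"
    for f :: "(real^3) \<times> (real^3) \<Rightarrow> real"
    unfolding lborel_prod
    using that by (intro integrable_bounded_support[of _ C K]) (auto simp: lborel_prod K_def bounded_Times)
  have bound: "\<bar>D1 (x, z)\<bar> \<le> C" "\<bar>D2 (x, z)\<bar> \<le> C" "\<bar>D3 (x, z)\<bar> \<le> C" for x z
    using C(1,2) by (auto simp: D1_def D2_def D3_def indicator_def intro: less_imp_le)
  have zero: "D1 (x, z) = 0 \<and> D2 (x, z) = 0 \<and> D3 (x, z) = 0" if "(x, z) \<notin> K" for x z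
  proof (cases "z \<in> unit_cell")
    case True
    then have "norm x > R + 1" using cell[OF True] that by (auto simp: K_def)
    then have "v x = 0" "v (x - \<epsilon> *\<^sub>R horiz z) = 0"
      using near(1)[OF True, of x] by (auto intro!: v0(1))
    then show ?thesis by (simp add: D1_def D2_def D3_def)
  qed (simp add: D1_def D2_def D3_def)
  have i1: "integrable ?P D1" and i2: "integrable ?P D2" and i3: "integrable ?P D3"
    using bound zero by (intro int meas; force)+
  have D_eq: "D = (\<lambda>p. D1 p - D2 p)"
    by (auto simp: D_def D1_def D2_def algebra_simps)
  have I1: "(LINT z|lborel. ?I z) = 1" by (simp add: measure_def)
  have cav: "(LINT z|lborel. ?I z * indicator A (y + horiz z)) = w" for y
  proof -
    have "(\<integral>\<^sup>+z. ennreal (?I z * indicator A (y + horiz z)) \<partial>lborel) = area"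
      using cell_average[of y] by (simp add: ennreal_mult ennreal_indicator)
    then show ?thesis
      by (subst integral_eq_nn_integral) (auto simp: area_measure w_def)
  qed
  have "(LINT p|?P. D2 p) = (LINT x|lborel. (LINT z|lborel. D2 (x, z)))"
    by (rule lborel_pair.integral_fst'[OF i2, symmetric])
  also have "\<dots> = (LINT x|lborel. ?A x * v x)"
    by (simp add: D2_def I1 mult.assoc mult.commute[of "?I _"] measure_def)
  finally have e2: "(LINT p|?P. D2 p) = (LINT x|lborel. ?A x * v x)" .
  have "(LINT p|?P. D1 p) = (LINT z|lborel. (LINT x|lborel. D1 (x, z)))"
    using lborel_pair.integral_snd[of "curry D1"] i1 by simp
  also have "\<dots> = (LINT z|lborel. (LINT x|lborel. D3 (x, z)))"
  proof (rule Bochner_Integration.integral_cong[OF refl])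
    fix z
    \<comment> \<open>After this translation the shift acts on the indicator, whose average over the
      cell does not depend on \<open>x\<close>.\<close>
    have "(LINT x|lborel. D1 (x, z)) = (LINT x|lborel. D1 (\<epsilon> *\<^sub>R horiz z + x, z))"
      by (rule lborel_integral_translate[symmetric]) (unfold D1_def prod.case, measurable)
    also have "\<dots> = (LINT x|lborel. D3 (x, z))"
      using \<epsilon> by (simp add: D1_def D3_def scaleR_add_right add.commute mult_ac)
    finally show "(LINT x|lborel. D1 (x, z)) = (LINT x|lborel. D3 (x, z))" .
  qed
  also have "\<dots> = (LINT p|?P. D3 p)"
    using lborel_pair.integral_snd[of "curry D3"] i3 by simp
  also have "\<dots> = (LINT x|lborel. (LINT z|lborel. D3 (x, z)))"
    by (rule lborel_pair.integral_fst'[OF i3, symmetric])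
  also have "\<dots> = (LINT x|lborel. w * v x)"
    by (simp add: D3_def cav)
  finally have e1: "(LINT p|?P. D1 p) = (LINT x|lborel. w * v x)" .
  have iv: "integrable lborel v"
    by (rule integrable_bounded_support[of _ C "cball 0 R"]) (use C v0 in auto)
  have iAv: "integrable lborel (\<lambda>x. ?A x * v x)"
    by (rule integrable_bounded_support[of _ C "cball 0 R"])
       (use C v0 in \<open>auto split: split_indicator intro: less_imp_le\<close>)
  have "(LINT x|lborel. (?A x - w) * v x) = - (LINT p|?P. D p)"
    using i1 i2 iv iAv by (simp add: D_eq e1 e2 left_diff_distrib)
  then have "ennreal \<bar>LINT x|lborel. (?A x - w) * v x\<bar> = ennreal (norm (LINT p|?P. D p))"
    by simp
  also have "\<dots> \<le> (\<integral>\<^sup>+p. ennreal (norm (D p)) \<partial>?P)"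
    using i1 i2 by (intro integral_norm_bound_ennreal) (simp add: D_eq)
  also have "\<dots> = (\<integral>\<^sup>+x. (\<integral>\<^sup>+z. ennreal (norm (D (x, z))) \<partial>lborel) \<partial>lborel)"
    by (rule lborel.nn_integral_fst[symmetric]) measurable
  also have "\<dots> = (\<integral>\<^sup>+x. indicator A (x /\<^sub>R \<epsilon>) * (\<integral>\<^sup>+z. indicator unit_cell z *
      ennreal \<bar>v (x - \<epsilon> *\<^sub>R horiz z) - v x\<bar> \<partial>lborel) \<partial>lborel)"
  proof (rule nn_integral_cong)
    fix x
    have "(\<integral>\<^sup>+z. ennreal (norm (D (x, z))) \<partial>lborel) = (\<integral>\<^sup>+z. indicator A (x /\<^sub>R \<epsilon>) * (indicator unit_cell z *
      ennreal \<bar>v (x - \<epsilon> *\<^sub>R horiz z) - v x\<bar>) \<partial>lborel)"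
      by (intro nn_integral_cong) (auto simp: D_def split: split_indicator)
    then show "(\<integral>\<^sup>+z. ennreal (norm (D (x, z))) \<partial>lborel) = indicator A (x /\<^sub>R \<epsilon>) * (\<integral>\<^sup>+z. indicator unit_cell z *
      ennreal \<bar>v (x - \<epsilon> *\<^sub>R horiz z) - v x\<bar> \<partial>lborel)"
      by (simp add: nn_integral_cmult)
  qed
  finally have main: "ennreal \<bar>LINT x|lborel. (?A x - w) * v x\<bar> \<le> \<dots>" .
  define L where "L = sqrt (1 + \<bar>ln r\<bar>)"
  have L: "L > 0" "L\<^sup>2 = 1 + \<bar>ln r\<bar>" by (simp_all add: L_def)
  define N where "N = (LINT x|lborel. (norm (grad v x))\<^sup>2)"
  define b where "b = measure lborel (cball (0::real^3) (R + 2))"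
  have N: "(\<integral>\<^sup>+x. ennreal ((norm (grad v x))\<^sup>2) \<partial>lborel) = ennreal N" "N \<ge> 0"
  proof -
    have "\<bar>(norm (grad v x))\<^sup>2\<bar> \<le> C\<^sup>2" for x using C(3)[of x] by (simp add: power_mono)
    then have "integrable lborel (\<lambda>x. (norm (grad v x))\<^sup>2)"
      using v0(2) by (intro integrable_bounded_support[of _ "C\<^sup>2" "cball 0 R"]) auto
    then show "(\<integral>\<^sup>+x. ennreal ((norm (grad v x))\<^sup>2) \<partial>lborel) = ennreal N"
      unfolding N_def by (intro nn_integral_eq_integral) auto
  qed (simp add: N_def)
  have b: "emeasure lborel (cball (0::real^3) (R + 2)) = ennreal b"
    unfolding b_def using emeasure_bounded_finite[of "cball (0::real^3) (R + 2)"]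
    by (intro emeasure_eq_ennreal_measure) auto
  have w0: "0 \<le> w" by (simp add: w_def)
  \<comment> \<open>The choice k = L/\<epsilon> with L^2 = 1 + |ln r| makes both terms of order
    \<epsilon> L w; the premise that r^2 is at most \<open>w\<close> absorbs r^2 into the area. A
    shift has length at most 1, hence radius R + 1 for the points that can reach the support and R +
    2 for their shifts.\<close>
  have "ennreal \<bar>LINT x|lborel. (?A x - w) * v x\<bar>
      \<le> ennreal ((L / \<epsilon>) * \<epsilon>\<^sup>2 / 2) * ((ennreal (r\<^sup>2) + area) * (\<integral>\<^sup>+x. ennreal ((norm (grad v x))\<^sup>2) \<partial>lborel))
      + ennreal (1 / (2 * (L / \<epsilon>))) * ennreal (1 + \<bar>ln r\<bar>) *
        (\<integral>\<^sup>+x. indicator A (x /\<^sub>R \<epsilon>) * indicator (cball 0 (R + 1)) x \<partial>lborel)"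
    using main
  proof (rule order_trans)
    show "(\<integral>\<^sup>+x. indicator A (x /\<^sub>R \<epsilon>) * (\<integral>\<^sup>+z. indicator unit_cell z *
      ennreal \<bar>v (x - \<epsilon> *\<^sub>R horiz z) - v x\<bar> \<partial>lborel) \<partial>lborel) \<le>
      ennreal ((L / \<epsilon>) * \<epsilon>\<^sup>2 / 2) * ((ennreal (r\<^sup>2) + area) * (\<integral>\<^sup>+x. ennreal ((norm (grad v x))\<^sup>2) \<partial>lborel))
      + ennreal (1 / (2 * (L / \<epsilon>))) * ennreal (1 + \<bar>ln r\<bar>) *
        (\<integral>\<^sup>+x. indicator A (x /\<^sub>R \<epsilon>) * indicator (cball 0 (R + 1)) x \<partial>lborel)"
    proof (rule rods_deviation[OF vs \<epsilon>(1) r])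
      fix x z :: "real^3" assume "x \<notin> cball 0 (R + 1)" "z \<in> unit_cell"
      then show "v (x - \<epsilon> *\<^sub>R horiz z) = v x" using near(1)[of z x] by (simp add: v0(1))
    qed (use L \<epsilon> in auto)
  qed
  also have "\<dots> \<le> ennreal ((L / \<epsilon>) * \<epsilon>\<^sup>2 / 2) * ((ennreal (r\<^sup>2) + ennreal w) * ennreal N)
      + ennreal (1 / (2 * (L / \<epsilon>))) * ennreal (1 + \<bar>ln r\<bar>) * (ennreal w * ennreal b)"
  proof (intro add_mono mult_left_mono)
    have "(\<integral>\<^sup>+x. indicator A (x /\<^sub>R \<epsilon>) * indicator (cball 0 (R + 1)) x \<partial>lborel) \<le> area * emeasure lborel (cball (0::real^3) (R + 2))"
    proof (rule rods_measure_le[OF _ _ \<epsilon>(1)])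
      show "x - \<epsilon> *\<^sub>R horiz z \<in> cball 0 (R + 2)" if "x \<in> cball 0 (R + 1)" "z \<in> unit_cell" for x z
        using near(2)[OF that(2), of x] that(1) by simp
    qed auto
    then show "(\<integral>\<^sup>+x. indicator A (x /\<^sub>R \<epsilon>) * indicator (cball 0 (R + 1)) x \<partial>lborel) \<le> ennreal w * ennreal b"
      by (simp add: b area_measure w_def)
  qed (auto simp: N area_measure w_def)
  also have "\<dots> = ennreal ((L / \<epsilon>) * \<epsilon>\<^sup>2 / 2 * ((r\<^sup>2 + w) * N) + 1 / (2 * (L / \<epsilon>)) * (1 + \<bar>ln r\<bar>) * (w * b))"
    using L \<epsilon> w0 N(2) by (simp add: b_def flip: ennreal_plus ennreal_mult)
  also have "\<dots> \<le> ennreal (w * sqrt (\<epsilon>\<^sup>2 * (1 + \<bar>ln r\<bar>)) * (N + b))"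
  proof (rule ennreal_leI)
    have "(L / \<epsilon>) * \<epsilon>\<^sup>2 / 2 * ((r\<^sup>2 + w) * N) = (\<epsilon> * L) / 2 * ((r\<^sup>2 + w) * N)"
      using \<epsilon> by (simp add: power2_eq_square)
    also have "\<dots> \<le> (\<epsilon> * L) / 2 * ((w + w) * N)"
      using w L \<epsilon> N(2) by (intro mult_left_mono mult_right_mono add_mono) auto
    finally have 1: "(L / \<epsilon>) * \<epsilon>\<^sup>2 / 2 * ((r\<^sup>2 + w) * N) \<le> \<epsilon> * L * w * N" by simp
    have "1 / (2 * (L / \<epsilon>)) * (1 + \<bar>ln r\<bar>) * (w * b) = (\<epsilon> * L) / 2 * (w * b)"
      unfolding L(2)[symmetric] using L(1) \<epsilon> by (simp add: power2_eq_square)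
    also have "\<dots> \<le> \<epsilon> * L * (w * b)"
      using L(1) \<epsilon> w0 by (intro mult_right_mono) (auto simp: b_def)
    finally have 2: "1 / (2 * (L / \<epsilon>)) * (1 + \<bar>ln r\<bar>) * (w * b) \<le> \<epsilon> * L * (w * b)" .
    have "sqrt (\<epsilon>\<^sup>2 * (1 + \<bar>ln r\<bar>)) = \<epsilon> * L"
      using \<epsilon> by (simp add: L_def real_sqrt_mult)
    then show "(L / \<epsilon>) * \<epsilon>\<^sup>2 / 2 * ((r\<^sup>2 + w) * N) + 1 / (2 * (L / \<epsilon>)) * (1 + \<bar>ln r\<bar>) * (w * b)
        \<le> w * sqrt (\<epsilon>\<^sup>2 * (1 + \<bar>ln r\<bar>)) * (N + b)"
      using add_mono[OF 1 2] by (simp add: algebra_simps)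
  qed
  finally show ?thesis
    using w0 N(2) by (simp add: N_def b_def)
qed

end



section \<open>Circular fibers as vertically infinite periodic rods\<close>

definition rods :: "real \<Rightarrow> (real^3) set" where
  "rods r = {y. \<exists>k l :: int. (y $ 1 - of_int k)\<^sup>2 + (y $ 2 - of_int l)\<^sup>2 \<le> r\<^sup>2}"

lemma lattice_nth_int: "\<nu> \<in> lattice \<Longrightarrow> \<exists>k::int. \<nu> $ i = of_int k"
  by (auto simp: lattice_def elim!: Ints_cases)

lemma periodic_rods_rods: "periodic_rods (rods r)"
proof
  have "rods r = (\<Union>k::int. \<Union>l::int. {y. (y $ 1 - of_int k)\<^sup>2 + (y $ 2 - of_int l)\<^sup>2 \<le> r\<^sup>2})"
    by (auto simp: rods_def)
  also have "\<dots> \<in> sets borel"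
    by (intro sets.countable_UN'' borel_closed closed_Collect_le continuous_intros) auto
  finally show "rods r \<in> sets borel" .
  have shift: "\<nu> + y \<in> rods r" if "\<nu> \<in> lattice" "y \<in> rods r" for \<nu> y
  proof -
    obtain k l :: int where kl: "(y $ 1 - of_int k)\<^sup>2 + (y $ 2 - of_int l)\<^sup>2 \<le> r\<^sup>2"
      using \<open>y \<in> rods r\<close> by (auto simp: rods_def)
    obtain a b :: int where ab: "\<nu> $ 1 = of_int a" "\<nu> $ 2 = of_int b"
      using lattice_nth_int[OF \<open>\<nu> \<in> lattice\<close>] by metis
    have "((\<nu> + y) $ 1 - of_int (a + k))\<^sup>2 + ((\<nu> + y) $ 2 - of_int (b + l))\<^sup>2 \<le> r\<^sup>2"
      using kl by (simp add: ab)
    then show ?thesis unfolding rods_def by blast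
  qed
  show "\<nu> + y \<in> rods r \<longleftrightarrow> y \<in> rods r" if "\<nu> \<in> lattice" for \<nu> y
    using shift[OF that, of y] shift[OF lattice_uminus[OF that], of "\<nu> + y"] by auto
  show "y + t *\<^sub>R axis 3 1 \<in> rods r \<longleftrightarrow> y \<in> rods r" for y t
    by (simp add: rods_def axis_def)
qed

text \<open>With r < 1/2 a rod with nonzero centre stays outside the open cell, since there a
  coordinate differs from a nonzero integer by more than 1/2.\<close>

lemma rods_unit_cell:
  assumes "0 \<le> r" "r < 1/2"
  shows "rods r \<inter> unit_cell = cell_fiber r"
proof (intro equalityI subsetI)
  fix y assume "y \<in> rods r \<inter> unit_cell"
  then obtain k l :: int where kl: "(y $ 1 - of_int k)\<^sup>2 + (y $ 2 - of_int l)\<^sup>2 \<le> r\<^sup>2" and y: "y \<in> unit_cell"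
    by (auto simp: rods_def)
  have "(y $ 1 - of_int k)\<^sup>2 \<le> r\<^sup>2" "(y $ 2 - of_int l)\<^sup>2 \<le> r\<^sup>2"
    using kl zero_le_power2[of "y $ 1 - of_int k"] zero_le_power2[of "y $ 2 - of_int l"] by linarith+
  then have "\<bar>y $ 1 - of_int k\<bar> \<le> r" "\<bar>y $ 2 - of_int l\<bar> \<le> r"
    using assms(1) by (simp_all add: abs_le_square_iff[symmetric])
  moreover have "\<bar>y $ 1\<bar> < 1/2" "\<bar>y $ 2\<bar> < 1/2"
    using y by (auto simp: unit_cell_def abs_less_iff dest: spec[of _ 1] spec[of _ 2])
  ultimately have "k = 0" "l = 0" using assms(2) by auto
  then show "y \<in> cell_fiber r" using kl y by (simp add: cell_fiber_def)
next
  fix y assume "y \<in> cell_fiber r"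
  then show "y \<in> rods r \<inter> unit_cell"
    by (auto simp: cell_fiber_def rods_def intro!: exI[of _ 0])
qed

lemma cell_fiber_borel: "cell_fiber r \<in> sets borel"
proof -
  have "cell_fiber r = unit_cell \<inter> {y. (y $ 1)\<^sup>2 + (y $ 2)\<^sup>2 \<le> r\<^sup>2}" by (auto simp: cell_fiber_def)
  moreover have "{y :: real^3. (y $ 1)\<^sup>2 + (y $ 2)\<^sup>2 \<le> r\<^sup>2} \<in> sets borel"
    by (intro borel_closed closed_Collect_le continuous_intros)
  ultimately show ?thesis by simp
qed

lemma measure_cell_fiber: "measure lebesgue (cell_fiber r) = measure lborel (cell_fiber r)"
  using cell_fiber_borel by (simp add: measure_completion)

lemma prod_3: "(\<Prod>i\<in>(UNIV :: 3 set). f i) = f 1 * f 2 * (f 3 :: real)"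
  unfolding UNIV_3 by (simp add: ac_simps)

lemma measure_box_vector:
  assumes "0 \<le> s"
  shows "measure lborel (box (vector [- s, - s, - 1/2]) (vector [s, s, 1/2] :: real^3)) = 4 * s\<^sup>2"
    "emeasure lborel (box (vector [- s, - s, - 1/2]) (vector [s, s, 1/2] :: real^3)) = ennreal (4 * s\<^sup>2)"
proof -
  let ?a = "vector [- s, - s, - 1/2] :: real^3" and ?b = "vector [s, s, 1/2] :: real^3"
  have "\<forall>i. ?a $ i \<le> ?b $ i" using assms by (simp add: forall_3)
  then have "?a $ i \<le> ?b $ i" for i by blast
  then have "emeasure lborel (box ?a ?b) = ennreal (\<Prod>i\<in>UNIV. ?b $ i - ?a $ i)"
    by (rule emeasure_box_cart)
  also have "(\<Prod>i\<in>UNIV. ?b $ i - ?a $ i) = 4 * s\<^sup>2"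
    unfolding prod_3 by (simp add: power2_eq_square)
  finally show e: "emeasure lborel (box ?a ?b) = ennreal (4 * s\<^sup>2)" .
  then show "measure lborel (box ?a ?b) = 4 * s\<^sup>2" by (simp add: measure_def)
qed

text \<open>Comparison with boxes of half width r/2 and 2r and height 1. The estimates use the cross
  section only through its order r^2 and the exact measure as a normalising factor.\<close>

lemma cell_fiber_measure_bounds:
  assumes "0 < r" "r < 1/2"
  shows "r\<^sup>2 \<le> measure lborel (cell_fiber r)" "measure lborel (cell_fiber r) \<le> 16 * r\<^sup>2"
proof -
  have fin: "cell_fiber r \<in> fmeasurable lborel"
  proof (rule fmeasurableI2[of unit_cell])
    show "unit_cell \<in> fmeasurable lborel" by (intro fmeasurableI) auto
  qed (auto simp: cell_fiber_def intro: cell_fiber_borel)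
  let ?B = "\<lambda>s. box (vector [- s, - s, - 1/2]) (vector [s, s, 1/2] :: real^3)"
  have "?B (r / 2) \<subseteq> cell_fiber r"
  proof
    fix y assume "y \<in> ?B (r / 2)"
    then have y: "\<bar>y $ 1\<bar> < r / 2" "\<bar>y $ 2\<bar> < r / 2" "\<bar>y $ 3\<bar> < 1/2"
      by (auto simp: mem_box_cart forall_3 abs_less_iff)
    have "\<bar>y $ 1\<bar>\<^sup>2 \<le> (r / 2)\<^sup>2" "\<bar>y $ 2\<bar>\<^sup>2 \<le> (r / 2)\<^sup>2"
      using y by (intro power_mono; simp)+
    then have "(y $ 1)\<^sup>2 \<le> r\<^sup>2 / 4" "(y $ 2)\<^sup>2 \<le> r\<^sup>2 / 4"
      by (simp_all add: power_divide)
    then have "(y $ 1)\<^sup>2 + (y $ 2)\<^sup>2 \<le> r\<^sup>2"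
      using zero_le_power2[of r] by linarith
    moreover have "y \<in> unit_cell"
      using y assms by (auto simp: unit_cell_def forall_3 abs_less_iff)
    ultimately show "y \<in> cell_fiber r" by (simp add: cell_fiber_def)
  qed
  then have "measure lborel (?B (r / 2)) \<le> measure lborel (cell_fiber r)"
    using fin by (intro measure_mono_fmeasurable) auto
  then show "r\<^sup>2 \<le> measure lborel (cell_fiber r)"
    using assms measure_box_vector(1)[of "r / 2"] by (simp add: power_divide)
  have "cell_fiber r \<subseteq> ?B (2 * r)"
  proof
    fix y assume y: "y \<in> cell_fiber r"
    then have "(y $ 1)\<^sup>2 \<le> r\<^sup>2" "(y $ 2)\<^sup>2 \<le> r\<^sup>2"
      using zero_le_power2[of "y $ 1"] zero_le_power2[of "y $ 2"] by (auto simp: cell_fiber_def intro: order_trans[rotated])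
    then have "\<bar>y $ 1\<bar> \<le> r" "\<bar>y $ 2\<bar> \<le> r"
      using assms(1) by (simp_all add: abs_le_square_iff[symmetric])
    then show "y \<in> ?B (2 * r)"
      using y assms by (auto simp: mem_box_cart forall_3 cell_fiber_def unit_cell_def)
  qed
  moreover have "?B (2 * r) \<in> fmeasurable lborel"
    using assms measure_box_vector(2)[of "2 * r"] by (intro fmeasurableI) auto
  ultimately have "measure lborel (cell_fiber r) \<le> measure lborel (?B (2 * r))"
    using cell_fiber_borel by (intro measure_mono_fmeasurable) auto
  then show "measure lborel (cell_fiber r) \<le> 16 * r\<^sup>2"
    using assms measure_box_vector(1)[of "2 * r"] by (simp add: power_mult_distrib)
qed

lemma fibers_borel:
  assumes "\<Omega> \<in> sets borel" "\<epsilon> \<noteq> 0"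
  shows "fibers \<Omega> \<epsilon> r \<in> sets borel"
proof -
  have "(\<lambda>y. \<epsilon> *\<^sub>R (y + \<nu>)) ` cell_fiber r = (\<lambda>x. x /\<^sub>R \<epsilon> - \<nu>) -` cell_fiber r" for \<nu>
  proof (intro equalityI subsetI)
    fix x assume "x \<in> (\<lambda>x. x /\<^sub>R \<epsilon> - \<nu>) -` cell_fiber r"
    then have "x /\<^sub>R \<epsilon> - \<nu> \<in> cell_fiber r" "x = \<epsilon> *\<^sub>R ((x /\<^sub>R \<epsilon> - \<nu>) + \<nu>)"
      using assms(2) by auto
    then show "x \<in> (\<lambda>y. \<epsilon> *\<^sub>R (y + \<nu>)) ` cell_fiber r" by blast
  qed (use assms(2) in auto)
  moreover have "(\<lambda>x. x /\<^sub>R \<epsilon> - \<nu>) -` cell_fiber r \<in> sets borel" for \<nu> :: "real^3"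
  proof -
    have "(\<lambda>x::real^3. x /\<^sub>R \<epsilon> - \<nu>) \<in> borel_measurable borel" by measurable
    from measurable_sets[OF this cell_fiber_borel[of r]] show ?thesis by simp
  qed
  moreover have "{\<nu> :: real^3. \<forall>i. \<nu> $ i \<in> \<int>} = lattice" by (simp add: lattice_def)
  ultimately show ?thesis
    unfolding fibers_def using assms(1) countable_lattice by (auto intro!: sets.countable_UN')
qed

text \<open>The cell fibers are open at their ends, so stacking them leaves gaps at the heights
  \<epsilon> (k + 1/2). These planes are null sets; off them the fibers are the rods, which have the
  exact vertical invariance.\<close>

lemma fibers_AE:
  assumes "\<Omega> \<in> sets lebesgue" "0 < \<epsilon>" "0 \<le> r" "r < 1/2"
  shows "AE x in lebesgue_on \<Omega>. x \<in> fibers \<Omega> \<epsilon> r \<longleftrightarrow> x /\<^sub>R \<epsilon> \<in> rods r"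
proof -
  have "AE x in lborel. \<forall>k::int. (x :: real^3) $ 3 \<noteq> \<epsilon> * (of_int k + 1/2)"
    unfolding AE_all_countable using AE_nth_neq by blast
  then have "AE x in lebesgue. \<forall>k::int. (x :: real^3) $ 3 \<noteq> \<epsilon> * (of_int k + 1/2)"
    by (rule AE_completion)
  then have "AE x in lebesgue. x \<in> \<Omega> \<longrightarrow> (x \<in> fibers \<Omega> \<epsilon> r \<longleftrightarrow> x /\<^sub>R \<epsilon> \<in> rods r)"
  proof eventually_elim
    case (elim x)
    have 1: "x /\<^sub>R \<epsilon> \<in> rods r" if fib: "x \<in> fibers \<Omega> \<epsilon> r"
    proof -
      obtain \<nu> y where \<nu>: "\<nu> \<in> lattice" "y \<in> cell_fiber r" "x = \<epsilon> *\<^sub>R (y + \<nu>)"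
        using fib by (auto simp: fibers_def lattice_def)
      obtain k l :: int where "\<nu> $ 1 = of_int k" "\<nu> $ 2 = of_int l"
        using lattice_nth_int[OF \<nu>(1)] by metis
      then have "((x /\<^sub>R \<epsilon>) $ 1 - of_int k)\<^sup>2 + ((x /\<^sub>R \<epsilon>) $ 2 - of_int l)\<^sup>2 \<le> r\<^sup>2"
        using \<nu> \<open>0 < \<epsilon>\<close> by (simp add: cell_fiber_def)
      then show ?thesis unfolding rods_def by blast
    qed
    have 2: "x \<in> fibers \<Omega> \<epsilon> r" if x: "x \<in> \<Omega>" and rod: "x /\<^sub>R \<epsilon> \<in> rods r"
    proof -
      obtain k l :: int where kl: "((x /\<^sub>R \<epsilon>) $ 1 - of_int k)\<^sup>2 + ((x /\<^sub>R \<epsilon>) $ 2 - of_int l)\<^sup>2 \<le> r\<^sup>2"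
        using rod by (auto simp: rods_def)
      define m where "m = round (x $ 3 / \<epsilon>)"
      define \<nu> :: "real^3" where "\<nu> = vector [of_int k, of_int l, of_int m]"
      define y where "y = x /\<^sub>R \<epsilon> - \<nu>"
      have ny: "\<nu> \<in> lattice" by (simp add: lattice_def \<nu>_def forall_3)
      have y1: "(y $ 1)\<^sup>2 + (y $ 2)\<^sup>2 \<le> r\<^sup>2" using kl by (simp add: y_def \<nu>_def)
      then have "(y $ 1)\<^sup>2 \<le> r\<^sup>2" "(y $ 2)\<^sup>2 \<le> r\<^sup>2"
        using zero_le_power2[of "y $ 1"] zero_le_power2[of "y $ 2"] by linarith+
      then have "\<bar>y $ 1\<bar> \<le> r" "\<bar>y $ 2\<bar> \<le> r"
        using assms(3) by (simp_all add: abs_le_square_iff[symmetric])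
      moreover have "\<bar>y $ 3\<bar> < 1/2"
      proof -
        have "y $ 3 = x $ 3 / \<epsilon> - of_int m" by (simp add: y_def \<nu>_def divide_inverse mult.commute)
        moreover have "\<bar>of_int m - x $ 3 / \<epsilon>\<bar> \<le> 1/2" unfolding m_def by (rule of_int_round_abs_le)
        moreover have "x $ 3 / \<epsilon> \<noteq> of_int m + 1/2" "x $ 3 / \<epsilon> \<noteq> of_int (m - 1) + 1/2"
          using elim[rule_format, of m] elim[rule_format, of "m - 1"] \<open>0 < \<epsilon>\<close> by (auto simp: field_simps)
        ultimately have "y $ 3 \<noteq> 1/2" "y $ 3 \<noteq> - 1/2" "\<bar>y $ 3\<bar> \<le> 1/2"
          by linarith+
        then show ?thesis by linarith
      qed
      ultimately have "y \<in> cell_fiber r"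
        using y1 assms(4) by (auto simp: cell_fiber_def unit_cell_def forall_3 abs_le_iff abs_less_iff)
      moreover have "x = \<epsilon> *\<^sub>R (y + \<nu>)" using \<open>0 < \<epsilon>\<close> by (simp add: y_def)
      ultimately show ?thesis using x ny by (auto simp: fibers_def lattice_def)
    qed
    show ?case using 1 2 by blast
  qed
  then show ?thesis using assms(1) by (simp add: AE_restrict_space_iff)
qed

text \<open>An indicator equals its square, so this bounds the L2 norms of the indicators of fibers
  and slabs by the square root of their cell measure, uniformly in \<epsilon>.\<close>

lemma (in periodic_rods) integral_rods_le:
  fixes \<Omega> :: "(real^3) set"
  assumes "open \<Omega>" "\<Omega> \<subseteq> cball 0 R" "0 < \<epsilon>" "\<epsilon> < 1"
  shows "(LINT x|lebesgue_on \<Omega>. indicator A (x /\<^sub>R \<epsilon>)) \<le>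
    measure lborel (A \<inter> unit_cell) * measure lborel (cball (0::real^3) (R + 1))"
proof -
  have [measurable]: "\<Omega> \<in> sets borel" using assms(1) by simp
  have "(LINT x|lebesgue_on \<Omega>. indicator A (x /\<^sub>R \<epsilon>) :: real) = (LINT x|lebesgue. indicator \<Omega> x *\<^sub>R indicator A (x /\<^sub>R \<epsilon>))"
    using assms(1) by (intro integral_restrict_space) simp
  also have "\<dots> = (LINT x|lborel. indicator \<Omega> x *\<^sub>R indicator A (x /\<^sub>R \<epsilon>))"
    by (intro integral_completion) simp
  also have "\<dots> = enn2real (\<integral>\<^sup>+x. ennreal (indicator \<Omega> x *\<^sub>R indicator A (x /\<^sub>R \<epsilon>)) \<partial>lborel)"
    by (intro integral_eq_nn_integral) auto
  also have "(\<integral>\<^sup>+x. ennreal (indicator \<Omega> x *\<^sub>R indicator A (x /\<^sub>R \<epsilon>)) \<partial>lborel)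
      = (\<integral>\<^sup>+x. indicator A (x /\<^sub>R \<epsilon>) * indicator \<Omega> x \<partial>lborel)"
    by (intro nn_integral_cong) (auto split: split_indicator)
  also have "enn2real \<dots> \<le> enn2real (area * emeasure lborel (cball (0::real^3) (R + 1)))"
  proof (rule enn2real_mono)
    show "(\<integral>\<^sup>+x. indicator A (x /\<^sub>R \<epsilon>) * indicator \<Omega> x \<partial>lborel) \<le> area * emeasure lborel (cball (0::real^3) (R + 1))"
    proof (rule rods_measure_le[OF _ _ assms(3)])
      fix x z :: "real^3" assume "x \<in> \<Omega>" "z \<in> unit_cell"
      have "norm (\<epsilon> *\<^sub>R horiz z) \<le> 1 * 1"
        using assms norm_horiz_unit_cell(2)[OF \<open>z \<in> unit_cell\<close>] unfolding norm_scaleR by (intro mult_mono) auto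
      moreover have "norm x \<le> R" using \<open>x \<in> \<Omega>\<close> assms(2) by auto
      ultimately show "x - \<epsilon> *\<^sub>R horiz z \<in> cball 0 (R + 1)"
        using norm_triangle_ineq4[of x "\<epsilon> *\<^sub>R horiz z"] by simp
    qed auto
    show "area * emeasure lborel (cball (0::real^3) (R + 1)) < top"
      using emeasure_bounded_finite[of "cball (0::real^3) (R + 1)"] by (simp add: area_measure ennreal_mult_less_top)
  qed
  also have "\<dots> = measure lborel (A \<inter> unit_cell) * measure lborel (cball (0::real^3) (R + 1))"
    by (simp add: enn2real_mult area_measure measure_def[symmetric])
  finally show ?thesis .
qed

text \<open>The fibers are invariant in the direction \<open>axis 3 1\<close>, so that the derivative of \<open>u\<close> in that direction
  can be moved to the test function before \<open>rods_average_estimate\<close> is applied.\<close>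

lemma vertical_derivative_estimate:
  fixes \<Omega> :: "(real^3) set"
  assumes "bounded_open_set \<Omega>" and v: "v \<in> test_functions \<Omega>"
  obtains C where "C \<ge> 0" "\<And>\<epsilon> r A u. 0 < \<epsilon> \<Longrightarrow> \<epsilon> < 1 \<Longrightarrow> 0 < r \<Longrightarrow> r < 1 \<Longrightarrow> periodic_rods A \<Longrightarrow>
    r\<^sup>2 \<le> measure lborel (A \<inter> unit_cell) \<Longrightarrow> u \<in> H10 \<Omega> \<Longrightarrow>
    \<bar>LINT x|lebesgue_on \<Omega>. (indicator A (x /\<^sub>R \<epsilon>) - measure lborel (A \<inter> unit_cell)) *
      (weak_grad \<Omega> u x $ 3 * partial_deriv 3 v x)\<bar>
    \<le> measure lborel (A \<inter> unit_cell) * sqrt (\<epsilon>\<^sup>2 * (1 + \<bar>ln r\<bar>)) *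
      (C * (1 + (l2 (lebesgue_on \<Omega>) (weak_grad \<Omega> u))\<^sup>2))"
proof -
  interpret bounded_open_set \<Omega> by fact
  \<comment> \<open>What remains after the derivative of \<open>u\<close> has been moved to the test
    function: the estimate is applied to \<phi> \<eta>, whose gradient is controlled by \<phi> and
    its gradient.\<close>
  define \<eta> where "\<eta> = partial_deriv 3 (partial_deriv 3 v)"
  have \<eta>: "\<eta> \<in> test_functions \<Omega>" unfolding \<eta>_def by (intro test_partial_deriv v)
  have p3: "partial_deriv 3 v \<in> test_functions \<Omega>" by (intro test_partial_deriv v)
  obtain E where E: "E > 0" "\<And>x. \<bar>\<eta> x\<bar> \<le> E" "\<And>x. norm (grad \<eta> x) \<le> E"
    using test_bounded[OF \<eta>] by metis
  obtain P where P: "P > 0" "\<And>u. u \<in> H10 \<Omega> \<Longrightarrow> l2 M u \<le> P * l2 M (weak_grad \<Omega> u)"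
    using Poincare by blast
  obtain R where "\<And>x. x \<in> \<Omega> \<Longrightarrow> norm x \<le> R" using bounded_\<Omega> by (auto simp: bounded_iff)
  then have R: "\<Omega> \<subseteq> cball 0 R" by auto
  define b where "b = measure lborel (cball (0::real^3) (R + 2))"
  \<comment> \<open>The first entry bounds the constant part, the second the coefficient of the
    squared gradient norm after the Poincare inequality has replaced the norm of \<phi>.\<close>
  define C where "C = max b (2 * E\<^sup>2 * (P\<^sup>2 + 1))"
  have C: "0 \<le> C" "b \<le> C" "2 * E\<^sup>2 * (P\<^sup>2 + 1) \<le> C"
    by (auto simp: C_def b_def le_max_iff_disj)
  have main: "\<bar>LINT x|M. (indicator A (x /\<^sub>R \<epsilon>) - w) * (weak_grad \<Omega> u x $ 3 * partial_deriv 3 v x)\<bar>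
      \<le> w * sqrt (\<epsilon>\<^sup>2 * (1 + \<bar>ln r\<bar>)) * (C * (1 + (l2 M (weak_grad \<Omega> u))\<^sup>2))"
    if \<epsilon>: "0 < \<epsilon>" "\<epsilon> < 1" and r: "0 < r" "r < 1" and "periodic_rods A"
      and w_def: "w = measure lborel (A \<inter> unit_cell)" and w: "r\<^sup>2 \<le> w" and u: "u \<in> H10 \<Omega>" for \<epsilon> r A u w
  proof -
    interpret A: periodic_rods A by fact
    let ?a = "\<lambda>x. indicator A (x /\<^sub>R \<epsilon>) - w :: real"
    have w01: "0 \<le> w" "w \<le> 1"
      using A.area_le_1 by (auto simp: w_def A.area_measure ennreal_le_1)
    have a_bound: "\<bar>?a x\<bar> \<le> 1" for x
      using w01 by (auto split: split_indicator)
    have a_meas [measurable]: "?a \<in> borel_measurable borel" by measurable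
    have a_measM [measurable]: "?a \<in> borel_measurable M" by (rule measurable_lebesgue_on[OF a_meas])
    let ?K = "w * sqrt (\<epsilon>\<^sup>2 * (1 + \<bar>ln r\<bar>))"
    have K0: "0 \<le> ?K" using w01 by simp
    have test: "\<bar>LINT x|M. ?a x * (partial_deriv 3 \<phi> x * partial_deriv 3 v x)\<bar> \<le> ?K * (b + 2 * E\<^sup>2 * ((l2 M \<phi>)\<^sup>2 + (l2 M (grad \<phi>))\<^sup>2))"
      if \<phi>: "\<phi> \<in> test_functions \<Omega>" for \<phi>
    proof -
      have s: "smooth \<phi>" "smooth (partial_deriv 3 v)" "smooth \<eta>"
        by (intro test_smooth[OF \<phi>] test_smooth[OF p3] test_smooth[OF \<eta>])+
      have f: "(\<lambda>x. \<phi> x * partial_deriv 3 v x) \<in> test_functions \<Omega>" by (rule test_mult_smooth[OF s(1) p3])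
      have g: "(\<lambda>x. \<phi> x * \<eta> x) \<in> test_functions \<Omega>" by (rule test_mult_smooth[OF s(1) \<eta>])
      have g': "(\<lambda>x. partial_deriv 3 \<phi> x * partial_deriv 3 v x) \<in> test_functions \<Omega>"
        by (rule test_mult_smooth[OF smooth_partial_deriv[OF s(1)] p3])
      have int: "integrable lborel (\<lambda>x. ?a x * k x)" if k: "k \<in> test_functions \<Omega>" for k
      proof -
        obtain B where B: "\<And>x. \<bar>k x\<bar> \<le> B" using test_bounded[OF k] by metis
        show ?thesis
        proof (rule integrable_bounded_support[of _ B \<Omega>])
          show "(\<lambda>x. ?a x * k x) \<in> borel_measurable borel" using test_borel[OF k] by measurable
          have "\<bar>?a x\<bar> * \<bar>k x\<bar> \<le> 1 * B" for x using a_bound B by (intro mult_mono) auto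
          then show "\<bar>?a x * k x\<bar> \<le> B" for x by (simp add: abs_mult)
        qed (use bounded_\<Omega> test_zero_outside[OF k] in auto)
      qed
      \<comment> \<open>The coefficient does not depend on the third coordinate; the product rule
        then exchanges \<open>partial_deriv 3 \<phi>\<close> for the second derivative of
        \<open>v\<close>.\<close>
      have "(LINT x|lborel. ?a x * partial_deriv 3 (\<lambda>x. \<phi> x * partial_deriv 3 v x) x) = 0"
      proof (rule integral_invariant_partial_deriv[OF f a_meas a_bound])
        fix x :: "real^3" and t :: real
        have "(t *\<^sub>R axis 3 1 + x) /\<^sub>R \<epsilon> = x /\<^sub>R \<epsilon> + (t / \<epsilon>) *\<^sub>R axis 3 1"
          by (simp add: scaleR_add_right divide_inverse mult.commute)
        then show "?a (t *\<^sub>R axis 3 1 + x) = ?a x" by (simp add: indicator_def A.A_vertical)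
      qed
      then have "(LINT x|lborel. ?a x * (\<phi> x * \<eta> x) + ?a x * (partial_deriv 3 \<phi> x * partial_deriv 3 v x)) = 0"
        by (simp add: partial_deriv_mult_smooth[OF s(1,2)] \<eta>_def distrib_left)
      then have eq: "(LINT x|lborel. ?a x * (partial_deriv 3 \<phi> x * partial_deriv 3 v x)) = - (LINT x|lborel. ?a x * (\<phi> x * \<eta> x))"
        using int[OF g] int[OF g'] by simp
      have toM: "(LINT x|M. ?a x * (partial_deriv 3 \<phi> x * partial_deriv 3 v x)) = (LINT x|lborel. ?a x * (partial_deriv 3 \<phi> x * partial_deriv 3 v x))"
        using test_borel[OF g'] test_zero_outside[OF g'] by (intro integral_lebesgue_on_lborel \<Omega>_lebesgue) auto
      have "\<bar>LINT x|lborel. ?a x * (\<phi> x * \<eta> x)\<bar> \<le> ?K * ((LINT x|lborel. (norm (grad (\<lambda>x. \<phi> x * \<eta> x) x))\<^sup>2) + b)"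
        unfolding b_def w_def by (rule A.rods_average_estimate[OF g R \<epsilon> r]) (use w w_def in simp)
      also have "(LINT x|lborel. (norm (grad (\<lambda>x. \<phi> x * \<eta> x) x))\<^sup>2) = (l2 M (grad (\<lambda>x. \<phi> x * \<eta> x)))\<^sup>2"
        unfolding l2_power2 using grad_borel[OF test_smooth[OF g]] test_grad_zero_outside[OF g]
        by (intro integral_lebesgue_on_lborel[symmetric] \<Omega>_lebesgue) auto
      also have "(l2 M (grad (\<lambda>x. \<phi> x * \<eta> x)))\<^sup>2 \<le> 2 * E\<^sup>2 * ((l2 M \<phi>)\<^sup>2 + (l2 M (grad \<phi>))\<^sup>2)"
      proof -
        have "(norm (grad (\<lambda>x. \<phi> x * \<eta> x) x))\<^sup>2 \<le> 2 * E\<^sup>2 * ((norm (\<phi> x))\<^sup>2 + (norm (grad \<phi> x))\<^sup>2)" for x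
        proof -
          have "(norm (grad (\<lambda>x. \<phi> x * \<eta> x) x))\<^sup>2 \<le> 2 * (norm (\<phi> x *\<^sub>R grad \<eta> x))\<^sup>2 + 2 * (norm (\<eta> x *\<^sub>R grad \<phi> x))\<^sup>2"
            unfolding grad_mult[OF s(1,3)] by (rule norm_add_power2_le)
          also have "\<dots> = 2 * ((\<phi> x)\<^sup>2 * (norm (grad \<eta> x))\<^sup>2) + 2 * (\<bar>\<eta> x\<bar>\<^sup>2 * (norm (grad \<phi> x))\<^sup>2)"
            by (simp add: power_mult_distrib)
          also have "\<dots> \<le> 2 * ((\<phi> x)\<^sup>2 * E\<^sup>2) + 2 * (E\<^sup>2 * (norm (grad \<phi> x))\<^sup>2)"
            using E by (intro add_mono mult_left_mono mult_right_mono power_mono) auto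
          finally show ?thesis by (simp add: algebra_simps)
        qed
        then have "(LINT x|M. (norm (grad (\<lambda>x. \<phi> x * \<eta> x) x))\<^sup>2) \<le> (LINT x|M. 2 * E\<^sup>2 * ((norm (\<phi> x))\<^sup>2 + (norm (grad \<phi> x))\<^sup>2))"
          using sqi_integrable[OF sqi_test(2)[OF g]] sqi_integrable[OF sqi_test(1)[OF \<phi>]] sqi_integrable[OF sqi_test(2)[OF \<phi>]]
          by (intro integral_mono) auto
        then show ?thesis
          unfolding l2_power2 using sqi_integrable[OF sqi_test(1)[OF \<phi>]] sqi_integrable[OF sqi_test(2)[OF \<phi>]] by simp
      qed
      finally show ?thesis
        using K0 unfolding toM eq by (simp add: add.commute mult_left_mono)
    qed
    \<comment> \<open>Both sides are continuous in the gradient of \<open>u\<close> with respect to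
      L2, so the estimate passes from test functions to \<open>H10\<close>.\<close>
    obtain \<phi> where \<phi>: "approximates \<phi> u (weak_grad \<Omega> u)" by (rule H10_approximates[OF u])
    have t: "\<phi> k \<in> test_functions \<Omega>" for k using \<phi> by (auto simp: approximates_def)
    note su = H10_sqi[OF u]
    have lims: "(\<lambda>k. l2 M (\<lambda>x. \<phi> k x - u x)) \<longlonglongrightarrow> 0" "(\<lambda>k. l2 M (\<lambda>x. grad (\<phi> k) x - weak_grad \<Omega> u x)) \<longlonglongrightarrow> 0"
      using \<phi> by (auto simp: approximates_def)
    have sq: "sqi M (\<lambda>x. (?a x * partial_deriv 3 v x) *\<^sub>R axis 3 (1::real) :: real^3)"
    proof (rule sqi_bound[OF sqi_test(1)[OF p3], of _ 1])
      show "(\<lambda>x. (?a x * partial_deriv 3 v x) *\<^sub>R axis 3 (1::real) :: real^3) \<in> borel_measurable M"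
        using test_measurable[OF p3] by measurable
      have "\<bar>?a x\<bar> * \<bar>partial_deriv 3 v x\<bar> \<le> 1 * \<bar>partial_deriv 3 v x\<bar>" for x
        using a_bound by (intro mult_right_mono) auto
      then show "AE x in M. norm ((?a x * partial_deriv 3 v x) *\<^sub>R axis 3 (1::real) :: real^3) \<le> 1 * norm (partial_deriv 3 v x)"
        by (intro AE_I2) (simp add: abs_mult norm_axis_1)
    qed
    have "(\<lambda>k. LINT x|M. ?a x * (partial_deriv 3 (\<phi> k) x * partial_deriv 3 v x)) \<longlonglongrightarrow>
        (LINT x|M. ?a x * (weak_grad \<Omega> u x $ 3 * partial_deriv 3 v x))"
      using tendsto_integral_inner[OF sqi_test(2)[OF t] su(2) sq lims(2)]
      by (simp add: inner_axis mult_ac)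
    then have 1: "(\<lambda>k. \<bar>LINT x|M. ?a x * (partial_deriv 3 (\<phi> k) x * partial_deriv 3 v x)\<bar>) \<longlonglongrightarrow>
        \<bar>LINT x|M. ?a x * (weak_grad \<Omega> u x $ 3 * partial_deriv 3 v x)\<bar>"
      by (rule tendsto_rabs)
    have lim_norm: "(\<lambda>k. l2 M (grad (\<phi> k))) \<longlonglongrightarrow> l2 M (weak_grad \<Omega> u)"
    proof -
      have "\<bar>l2 M (grad (\<phi> k)) - l2 M (weak_grad \<Omega> u)\<bar> \<le> l2 M (\<lambda>x. grad (\<phi> k) x - weak_grad \<Omega> u x)" for k
        using l2_triangle[OF sqi_diff[OF sqi_test(2)[OF t] su(2)] su(2), of k]
          l2_triangle[OF sqi_diff[OF su(2) sqi_test(2)[OF t]] sqi_test(2)[OF t], of k k]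
          l2_minus_commute[of M "grad (\<phi> k)" "weak_grad \<Omega> u"] by simp
      then have "(\<lambda>k. l2 M (grad (\<phi> k)) - l2 M (weak_grad \<Omega> u)) \<longlonglongrightarrow> 0"
        by (intro Lim_null_comparison[OF _ lims(2)]) auto
      then show ?thesis by (simp add: LIM_zero_iff)
    qed
    have "\<bar>LINT x|M. ?a x * (partial_deriv 3 (\<phi> k) x * partial_deriv 3 v x)\<bar> \<le> ?K * (C * (1 + (l2 M (grad (\<phi> k)))\<^sup>2))" for k
    proof -
      have "l2 M (weak_grad \<Omega> (\<phi> k)) = l2 M (grad (\<phi> k))"
      proof (rule l2_cong_AE)
        show "AE x in M. norm (weak_grad \<Omega> (\<phi> k) x) = norm (grad (\<phi> k) x)"
          using test_H10(2)[OF t, of k] by eventually_elim simp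
      qed (rule sqi_measurable[OF H10_sqi(2)[OF test_H10(1)[OF t]]] sqi_measurable[OF sqi_test(2)[OF t]])+
      then have "l2 M (\<phi> k) \<le> P * l2 M (grad (\<phi> k))" using P(2)[OF test_H10(1)[OF t], of k] by simp
      then have "(l2 M (\<phi> k))\<^sup>2 \<le> (P * l2 M (grad (\<phi> k)))\<^sup>2" by (intro power_mono) auto
      then have "b + 2 * E\<^sup>2 * ((l2 M (\<phi> k))\<^sup>2 + (l2 M (grad (\<phi> k)))\<^sup>2)
          \<le> b + 2 * E\<^sup>2 * ((P * l2 M (grad (\<phi> k)))\<^sup>2 + (l2 M (grad (\<phi> k)))\<^sup>2)"
        by (intro add_left_mono mult_left_mono add_right_mono) auto
      also have "\<dots> = b + (2 * E\<^sup>2 * (P\<^sup>2 + 1)) * (l2 M (grad (\<phi> k)))\<^sup>2"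
        by (simp add: power_mult_distrib algebra_simps)
      also have "\<dots> \<le> C + C * (l2 M (grad (\<phi> k)))\<^sup>2"
        using C by (intro add_mono mult_right_mono) auto
      finally have "b + 2 * E\<^sup>2 * ((l2 M (\<phi> k))\<^sup>2 + (l2 M (grad (\<phi> k)))\<^sup>2) \<le> C * (1 + (l2 M (grad (\<phi> k)))\<^sup>2)"
        by (simp add: algebra_simps)
      then have "?K * (b + 2 * E\<^sup>2 * ((l2 M (\<phi> k))\<^sup>2 + (l2 M (grad (\<phi> k)))\<^sup>2)) \<le> ?K * (C * (1 + (l2 M (grad (\<phi> k)))\<^sup>2))"
        using K0 by (rule mult_left_mono)
      with test[OF t, of k] show ?thesis by (rule order_trans)
    qed
    moreover have "(\<lambda>k. ?K * (C * (1 + (l2 M (grad (\<phi> k)))\<^sup>2))) \<longlonglongrightarrow> ?K * (C * (1 + (l2 M (weak_grad \<Omega> u))\<^sup>2))"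
      by (intro tendsto_intros lim_norm)
    ultimately show ?thesis
      using 1 by (intro LIMSEQ_le) auto
  qed
  show ?thesis by (rule that[OF C(1)]) (rule main, simp_all)
qed



section \<open>Oscillating test functions\<close>

text \<open>Differentiation of the sine is a shift by pi/2, which gives all derivatives in one
  formula.\<close>

lemma smooth_real_sin: "smooth_real sin"
  unfolding smooth_real_def
proof (intro exI[of _ "\<lambda>m x. sin (x + real m * (pi / 2))"] conjI allI)
  show "((\<lambda>x. sin (x + real m * (pi / 2))) has_real_derivative sin (x + real (Suc m) * (pi / 2))) (at x)" for m x
  proof -
    have "((\<lambda>x. sin (x + real m * (pi / 2))) has_real_derivative cos (x + real m * (pi / 2))) (at x)"
      by (auto intro!: derivative_eq_intros)
    also have "cos (x + real m * (pi / 2)) = sin ((x + real m * (pi / 2)) + pi / 2)"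
      by (simp add: sin_add)
    also have "(x + real m * (pi / 2)) + pi / 2 = x + real (Suc m) * (pi / 2)"
      by (simp add: algebra_simps add_divide_distrib)
    finally show ?thesis .
  qed
qed simp

text \<open>A cutoff that is 1 on [-7, 7] and 0 outside (-8, 8). It is applied to sin(2 pi x_k /
  \<epsilon>) / r, which on the rods is at most 2 pi < 7 in absolute value; the cutoff at 8 gives
  the width in \<open>slab\<close>.\<close>

definition bump :: "real \<Rightarrow> real" where
  "bump s = smooth_step (8 - s) * smooth_step (8 + s)"

lemma bump_eq_1: "\<bar>s\<bar> \<le> 7 \<Longrightarrow> bump s = 1"
  by (simp add: bump_def smooth_step_eq_1)

lemma bump_eq_0: "\<bar>s\<bar> \<ge> 8 \<Longrightarrow> bump s = 0"
  by (cases "s \<ge> 0") (auto simp: bump_def smooth_step_eq_0)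

lemma bump_abs_le_1: "\<bar>bump s\<bar> \<le> 1"
  using smooth_step_nonneg smooth_step_le_1 by (simp add: bump_def abs_mult mult_le_one)

lemma bump_C1:
  obtains d C where "\<And>s. (bump has_real_derivative d s) (at s)" "0 < C" "\<And>s. \<bar>d s\<bar> \<le> C"
    "\<And>s. \<bar>s\<bar> < 7 \<Longrightarrow> d s = 0" "\<And>s. \<bar>s\<bar> > 8 \<Longrightarrow> d s = 0"
proof -
  obtain e where e: "\<And>x. (smooth_step has_real_derivative e x) (at x)" "continuous_on UNIV e"
    using smooth_step_C1 by metis
  define d where "d s = smooth_step (8 - s) * e (8 + s) - e (8 - s) * smooth_step (8 + s)" for s
  have D: "(bump has_real_derivative d s) (at s)" for s
  proof -
    have 1: "((\<lambda>s. smooth_step (8 - s)) has_real_derivative e (8 - s) * (0 - 1)) (at s)"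
      using DERIV_diff[OF DERIV_const[of 8] DERIV_ident]
      by (rule DERIV_chain2[where f = smooth_step and g = "\<lambda>s. 8 - s", OF e(1)])
    have 2: "((\<lambda>s. smooth_step (8 + s)) has_real_derivative e (8 + s) * (0 + 1)) (at s)"
      using DERIV_add[OF DERIV_const[of 8] DERIV_ident]
      by (rule DERIV_chain2[where f = smooth_step and g = "\<lambda>s. 8 + s", OF e(1)])
    show ?thesis
      unfolding bump_def[abs_def] using DERIV_mult[OF 1 2] by (rule DERIV_cong) (simp add: d_def)
  qed
  have cs: "continuous_on UNIV smooth_step"
    using e(1) by (blast intro: DERIV_isCont continuous_at_imp_continuous_on)
  have c: "continuous_on {-8..8} d"
    unfolding d_def
    by (intro continuous_intros continuous_on_compose2[OF cs] continuous_on_compose2[OF e(2)]) auto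
  have "bounded (d ` {-8..8})"
    by (intro compact_imp_bounded compact_continuous_image c) simp
  then obtain B where "\<forall>y\<in>d ` {-8..8}. norm y \<le> B" unfolding bounded_iff by blast
  then have B: "\<bar>d s\<bar> \<le> B" if "s \<in> {-8..8}" for s using that by auto
  have const: "d s = 0" if S: "open S" "s \<in> S" "\<And>t. t \<in> S \<Longrightarrow> bump t = c" for s S c
  proof -
    have "((\<lambda>_. c) has_real_derivative 0) (at s)" by simp
    then have "(bump has_real_derivative 0) (at s)"
      by (rule has_field_derivative_transform_within_open[OF _ S(1,2)]) (simp add: S(3))
    then show ?thesis using D[of s] by (rule DERIV_unique[symmetric])
  qed
  have z7: "d s = 0" if "\<bar>s\<bar> < 7" for s
    using that by (intro const[of "{-7<..<7}" s 1]) (auto intro!: bump_eq_1)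
  have z8: "d s = 0" if "\<bar>s\<bar> > 8" for s
    using that by (intro const[of "- {-8..8}" s 0]) (auto intro!: bump_eq_0)
  show ?thesis
  proof (rule that[OF D _ _ z7 z8])
    show "0 < max 1 B" by simp
    show "\<bar>d s\<bar> \<le> max 1 B" for s
      using B[of s] z8[of s] by (cases "\<bar>s\<bar> \<le> 8") (auto simp: abs_le_iff)
  qed
qed

lemma smooth_bump: "smooth f \<Longrightarrow> smooth (\<lambda>x. bump (f x))"
  unfolding bump_def by (intro smooth_mult smooth_smooth_step smooth_diff smooth_add smooth_const)

lemma grad_chain:
  assumes "(F has_real_derivative d) (at (f x))" "smooth f"
  shows "grad (\<lambda>x. F (f x)) x = d *\<^sub>R grad f x"
  using partial_deriv_chain[OF assms(1) smooth_differentiable[OF assms(2)]] by (simp add: vec_eq_iff)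

text \<open>Thin slabs around the planes on which 2 y_1 is an integer. Both correctors contain a
  cutoff in the sine of the first coordinate, so their gradients live in this one set.\<close>

definition slab :: "real \<Rightarrow> (real^3) set" where
  "slab r = {y. \<bar>sin (2 * pi * y $ 1)\<bar> \<le> 8 * r}"

lemma sin_2pi_int: "sin (2 * pi * (x + of_int k)) = sin (2 * pi * x)"
  and cos_2pi_int: "cos (2 * pi * (x + of_int k)) = cos (2 * pi * x)"
proof -
  have "sin (2 * pi * of_int k) = 0" "cos (2 * pi * of_int k) = 1"
    using sin_int_2pin[of k] cos_int_2pin[of k] by (simp_all add: mult_ac)
  then show "sin (2 * pi * (x + of_int k)) = sin (2 * pi * x)" "cos (2 * pi * (x + of_int k)) = cos (2 * pi * x)"
    by (simp_all add: distrib_left sin_add cos_add)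
qed

lemma periodic_rods_slab: "periodic_rods (slab r)"
proof
  show "slab r \<in> sets borel"
    unfolding slab_def by (intro borel_closed closed_Collect_le continuous_intros)
  show "\<nu> + y \<in> slab r \<longleftrightarrow> y \<in> slab r" if "\<nu> \<in> lattice" for \<nu> y
    using lattice_nth_int[OF that, of 1] sin_2pi_int[of "y $ 1"] by (auto simp: slab_def add.commute)
  show "y + t *\<^sub>R axis 3 1 \<in> slab r \<longleftrightarrow> y \<in> slab r" for y t
    by (simp add: slab_def axis_def)
qed

text \<open>Off the planes where the sine vanishes each point leaves the slabs for large n;
  dominated convergence gives the limit.\<close>

lemma measure_slab_tendsto:
  assumes "r \<longlonglongrightarrow> 0"
  shows "(\<lambda>n. measure lborel (slab (r n) \<inter> unit_cell)) \<longlonglongrightarrow> 0"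
proof -
  have [measurable]: "slab s \<in> sets borel" for s
    using periodic_rods.A_borel[OF periodic_rods_slab] .
  have "(\<lambda>n. LINT y|lborel. indicator (slab (r n) \<inter> unit_cell) y :: real) \<longlonglongrightarrow> (LINT y|(lborel :: (real^3) measure). 0)"
  proof (rule integral_dominated_convergence[where w = "indicator unit_cell"])
    show "integrable lborel (indicator unit_cell :: real^3 \<Rightarrow> real)"
      by (intro integrable_real_indicator) auto
    have "AE y in lborel. \<forall>k::int. (y :: real^3) $ 1 \<noteq> of_int k / 2"
      unfolding AE_all_countable using AE_nth_neq by blast
    then show "AE y in lborel. (\<lambda>n. indicator (slab (r n) \<inter> unit_cell) y :: real) \<longlonglongrightarrow> 0"
    proof eventually_elim
      case (elim y)
      have "sin (2 * pi * y $ 1) \<noteq> 0"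
      proof
        assume "sin (2 * pi * y $ 1) = 0"
        then obtain k :: int where "2 * pi * y $ 1 = of_int k * pi" by (auto simp: sin_zero_iff_int2)
        then have "y $ 1 = of_int k / 2" by simp
        then show False using elim by blast
      qed
      moreover have "(\<lambda>n. 8 * r n) \<longlonglongrightarrow> 8 * 0" by (intro tendsto_intros assms)
      ultimately have "\<forall>\<^sub>F n in sequentially. 8 * r n < \<bar>sin (2 * pi * y $ 1)\<bar>"
        by (intro order_tendstoD(2)[of _ 0]) auto
      then have "\<forall>\<^sub>F n in sequentially. indicator (slab (r n) \<inter> unit_cell) y = (0::real)"
        by eventually_elim (auto simp: slab_def)
      then show ?case by (rule tendsto_eventually)
    qed
    show "AE y in lborel. norm (indicator (slab (r n) \<inter> unit_cell) y :: real) \<le> indicator unit_cell y" for n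
      by (auto split: split_indicator)
  qed measurable
  then show ?thesis by simp
qed

text \<open>(\<epsilon>/(2 pi)) sin(2 pi x_i/\<epsilon>) is a periodic substitute for the distance
  of x_i to the axis of the fiber: it vanishes there, and its gradient on the rods is the unit
  vector up to O(r). Truncating it in both horizontal sines at the scale \<open>r\<close> makes it
  of size \<epsilon> r while its gradient stays bounded, because the cutoff acts on the length scale
  \<epsilon> r.\<close>

lemma corrector:
  obtains C :: real where "C > 0"
    "\<And>\<epsilon> r i j. 0 < \<epsilon> \<Longrightarrow> 0 < r \<Longrightarrow> {i, j} = {1, 2 :: 3} \<Longrightarrow> \<exists>w. smooth w \<and> (\<forall>x. \<bar>w x\<bar> \<le> C * \<epsilon> * r) \<and>
      (\<forall>x. norm (grad w x) \<le> C * indicator (slab r) (x /\<^sub>R \<epsilon>)) \<and>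
      (\<forall>x. x /\<^sub>R \<epsilon> \<in> rods r \<longrightarrow> norm (grad w x - axis i 1) \<le> C * r)"
proof -
  obtain d B where d: "\<And>s. (bump has_real_derivative d s) (at s)" "0 < B" "\<And>s. \<bar>d s\<bar> \<le> B"
    "\<And>s. \<bar>s\<bar> < 7 \<Longrightarrow> d s = 0" "\<And>s. \<bar>s\<bar> > 8 \<Longrightarrow> d s = 0"
    using bump_C1 by metis
  define C where "C = 10 + 16 * B"
  have "C > 0" using d(2) by (simp add: C_def)
  have "\<exists>w. smooth w \<and> (\<forall>x. \<bar>w x\<bar> \<le> C * \<epsilon> * r) \<and>
      (\<forall>x. norm (grad w x) \<le> C * indicator (slab r) (x /\<^sub>R \<epsilon>)) \<and>
      (\<forall>x. x /\<^sub>R \<epsilon> \<in> rods r \<longrightarrow> norm (grad w x - axis i 1) \<le> C * r)"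
    if \<epsilon>: "0 < \<epsilon>" and r: "0 < r" and ij: "{i, j} = {1, 2 :: 3}" for \<epsilon> r i j
  proof -
    define S where "S k x = (1 / r) * sin (2 * pi / \<epsilon> * x $ k)" for k :: 3 and x :: "real^3"
    define p where "p s = s * bump s" for s
    define dp where "dp s = bump s + s * d s" for s
    \<comment> \<open>The reciprocal of the factor 2 pi / (\<epsilon> r) that each differentiation
      of \<open>S\<close> produces, so that the gradient of \<open>w\<close> has coefficients of
      order 1.\<close>
    define c where "c = \<epsilon> * r / (2 * pi)"
    define w where "w x = c * (p (S i x) * bump (S j x))" for x
    have p_deriv: "(p has_real_derivative dp s) (at s)" for s
      unfolding p_def[abs_def] dp_def using DERIV_mult[OF DERIV_ident d(1)[of s]] by (rule DERIV_cong) simp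
    have smS: "smooth (S k)" for k
      unfolding S_def
      by (intro smooth_mult smooth_const smooth_compose[OF smooth_real_sin] smooth_nth)
    have smb: "smooth (\<lambda>x. bump (S k x))" for k by (intro smooth_bump smS)
    have smp: "smooth (\<lambda>x. p (S k x))" for k
      unfolding p_def by (intro smooth_mult smS smb)
    have sw: "smooth w"
      unfolding w_def by (intro smooth_mult smooth_const smb smp)
    have gS: "grad (S k) x = (2 * pi / (\<epsilon> * r) * cos (2 * pi / \<epsilon> * x $ k)) *\<^sub>R axis k 1" for k x
    proof -
      have "((\<lambda>s. (1 / r) * sin (2 * pi / \<epsilon> * s)) has_real_derivative (2 * pi / (\<epsilon> * r) * cos (2 * pi / \<epsilon> * x $ k))) (at (x $ k))"
        using \<epsilon> r by (auto intro!: derivative_eq_intros)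
      then have "grad (\<lambda>x. (1 / r) * sin (2 * pi / \<epsilon> * x $ k)) x
          = (2 * pi / (\<epsilon> * r) * cos (2 * pi / \<epsilon> * x $ k)) *\<^sub>R grad (\<lambda>x. x $ k) x"
        by (rule grad_chain[where f = "\<lambda>x. x $ k"]) (rule smooth_nth)
      moreover have "grad (\<lambda>x. x $ k) x = axis k 1"
        by (auto simp: vec_eq_iff partial_deriv_nth axis_def)
      ultimately show ?thesis by (simp add: S_def[abs_def])
    qed
    have gw: "grad w x = (p (S i x) * d (S j x) * cos (2 * pi / \<epsilon> * x $ j)) *\<^sub>R axis j 1
        + (bump (S j x) * dp (S i x) * cos (2 * pi / \<epsilon> * x $ i)) *\<^sub>R axis i 1" for x
    proof -
      have cc: "c * (2 * pi / (\<epsilon> * r)) = 1" using \<epsilon> r by (simp add: c_def)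
      have "grad w x = c *\<^sub>R (p (S i x) *\<^sub>R (d (S j x) *\<^sub>R grad (S j) x) + bump (S j x) *\<^sub>R (dp (S i x) *\<^sub>R grad (S i) x))"
        unfolding w_def
        by (simp only: grad_cmult[OF smooth_mult[OF smp smb]] grad_mult[OF smp smb]
            grad_chain[OF d(1) smS] grad_chain[OF p_deriv smS])
      also have "\<dots> = (c * (2 * pi / (\<epsilon> * r))) *\<^sub>R ((p (S i x) * d (S j x) * cos (2 * pi / \<epsilon> * x $ j)) *\<^sub>R axis j 1
        + (bump (S j x) * dp (S i x) * cos (2 * pi / \<epsilon> * x $ i)) *\<^sub>R axis i 1)"
        by (simp add: gS scaleR_add_right mult_ac)
      finally show ?thesis unfolding cc by simp
    qed
    have p_le: "\<bar>p s\<bar> \<le> 8" for s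
    proof (cases "\<bar>s\<bar> \<le> 8")
      case True
      then have "\<bar>s\<bar> * \<bar>bump s\<bar> \<le> 8 * 1" using bump_abs_le_1 by (intro mult_mono) auto
      then show ?thesis by (simp add: p_def abs_mult)
    qed (simp add: p_def bump_eq_0)
    have dp_le: "\<bar>dp s\<bar> \<le> 1 + 8 * B" for s
    proof (cases "\<bar>s\<bar> \<le> 8")
      case True
      then have "\<bar>s\<bar> * \<bar>d s\<bar> \<le> 8 * B" using d(3) by (intro mult_mono) auto
      then show ?thesis
        using bump_abs_le_1[of s] abs_triangle_ineq[of "bump s" "s * d s"] unfolding dp_def abs_mult[of s] by linarith
    next
      case False
      then show ?thesis using d(2) d(5)[of s] by (simp add: dp_def bump_eq_0)
    qed
    have "\<bar>w x\<bar> \<le> C * \<epsilon> * r" for x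
    proof -
      have "\<bar>p (S i x) * bump (S j x)\<bar> \<le> 8 * 1"
        unfolding abs_mult using p_le bump_abs_le_1 by (intro mult_mono) auto
      then have "\<bar>w x\<bar> \<le> c * 8"
        using \<epsilon> r unfolding w_def abs_mult[of c] by (intro mult_mono) (auto simp: c_def)
      also have "\<dots> \<le> (\<epsilon> * r) * C"
      proof (rule mult_mono)
        show "c \<le> \<epsilon> * r" using \<epsilon> r pi_gt3 by (simp add: c_def field_simps)
      qed (use \<epsilon> r d(2) in \<open>auto simp: C_def\<close>)
      finally show ?thesis by (simp add: mult_ac)
    qed
    moreover have "norm (grad w x) \<le> C * indicator (slab r) (x /\<^sub>R \<epsilon>)" for x
    proof (cases "x /\<^sub>R \<epsilon> \<in> slab r")
      case True
      have "\<bar>p (S i x) * d (S j x) * cos (2 * pi / \<epsilon> * x $ j)\<bar> \<le> 8 * B * 1"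
        unfolding abs_mult using p_le d(2,3) by (intro mult_mono) auto
      moreover have "\<bar>bump (S j x) * dp (S i x) * cos (2 * pi / \<epsilon> * x $ i)\<bar> \<le> 1 * (1 + 8 * B) * 1"
        unfolding abs_mult using bump_abs_le_1 dp_le d(2) by (intro mult_mono) auto
      ultimately have "norm (grad w x) \<le> 8 * B * 1 + 1 * (1 + 8 * B) * 1"
        unfolding gw by (intro norm_triangle_le add_mono) (auto simp: norm_axis_1)
      then show ?thesis using True by (simp add: C_def)
    next
      case False
      \<comment> \<open>Only the sine of the first coordinate is known to be large. Whichever of
        \<open>i\<close> and \<open>j\<close> is 1, each of the two terms of \<open>gw\<close> has a
        factor evaluated at \<open>S 1\<close>, and that factor vanishes.\<close>
      then have "\<bar>sin (2 * pi / \<epsilon> * x $ 1)\<bar> > 8 * r" by (simp add: slab_def divide_inverse mult_ac)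
      then have "\<bar>S 1 x\<bar> > 8" using r by (simp add: S_def abs_mult field_simps)
      then have "p (S 1 x) = 0" "bump (S 1 x) = 0" "d (S 1 x) = 0" "dp (S 1 x) = 0"
        using d(5) by (simp_all add: p_def dp_def bump_eq_0)
      moreover have "i = 1 \<or> j = 1" using ij unfolding doubleton_eq_iff by metis
      ultimately have "grad w x = 0" unfolding gw by auto
      then show ?thesis using False by simp
    qed
    moreover have "norm (grad w x - axis i 1) \<le> C * r" if rod: "x /\<^sub>R \<epsilon> \<in> rods r" for x
    proof -
      have near: "\<exists>k::int. \<bar>x $ l / \<epsilon> - of_int k\<bar> \<le> r" if "l = i \<or> l = j" for l
      proof -
        obtain k1 k2 :: int where k: "((x /\<^sub>R \<epsilon>) $ 1 - of_int k1)\<^sup>2 + ((x /\<^sub>R \<epsilon>) $ 2 - of_int k2)\<^sup>2 \<le> r\<^sup>2"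
          using rod by (auto simp: rods_def)
        then have "((x /\<^sub>R \<epsilon>) $ 1 - of_int k1)\<^sup>2 \<le> r\<^sup>2" "((x /\<^sub>R \<epsilon>) $ 2 - of_int k2)\<^sup>2 \<le> r\<^sup>2"
          using zero_le_power2[of "(x /\<^sub>R \<epsilon>) $ 1 - of_int k1"] zero_le_power2[of "(x /\<^sub>R \<epsilon>) $ 2 - of_int k2"] by linarith+
        then have "\<bar>x $ 1 / \<epsilon> - of_int k1\<bar> \<le> r" "\<bar>x $ 2 / \<epsilon> - of_int k2\<bar> \<le> r"
          using r by (simp_all add: abs_le_square_iff[symmetric] divide_inverse mult.commute)
        moreover have "l = 1 \<or> l = 2" using that ij unfolding doubleton_eq_iff by metis
        ultimately show ?thesis by blast
      qed
      have small: "\<bar>S l x\<bar> < 7" "\<bar>cos (2 * pi / \<epsilon> * x $ l) - 1\<bar> \<le> 7 * r" if "l = i \<or> l = j" for l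
      proof -
        obtain k :: int where k: "\<bar>x $ l / \<epsilon> - of_int k\<bar> \<le> r" using near \<open>l = i \<or> l = j\<close> by blast
        define y where "y = x $ l / \<epsilon> - of_int k"
        have arg: "2 * pi / \<epsilon> * x $ l = 2 * pi * (y + of_int k)" by (simp add: y_def)
        have y: "\<bar>2 * pi * y\<bar> \<le> 2 * pi * r" using k by (simp add: y_def abs_mult)
        have pi7: "2 * pi < 7" using pi_approx(2) by simp
        have "\<bar>sin (2 * pi / \<epsilon> * x $ l)\<bar> \<le> 2 * pi * r"
          unfolding arg sin_2pi_int using abs_sin_x_le_abs_x[of "2 * pi * y"] y by linarith
        also have "\<dots> < 7 * r" using pi7 r by simp
        finally show "\<bar>S l x\<bar> < 7" using r by (simp add: S_def abs_mult field_simps)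
        have "\<bar>cos (2 * pi * y) - 1\<bar> = 2 * \<bar>sin (pi * y)\<bar> * \<bar>sin (pi * y)\<bar>"
          using cos_double_sin[of "pi * y"] by (simp add: power2_eq_square mult_ac)
        also have "\<dots> \<le> 2 * \<bar>pi * y\<bar> * 1"
          using abs_sin_x_le_abs_x[of "pi * y"] abs_sin_le_one[of "pi * y"] by (intro mult_mono) auto
        also have "\<dots> \<le> 7 * r"
        proof -
          have "2 * \<bar>pi * y\<bar> * 1 = \<bar>2 * pi * y\<bar>" by (simp add: abs_mult)
          moreover have "2 * pi * r \<le> 7 * r" using pi7 r by (intro mult_right_mono) auto
          ultimately show ?thesis using y by linarith
        qed
        finally show "\<bar>cos (2 * pi / \<epsilon> * x $ l) - 1\<bar> \<le> 7 * r" unfolding arg cos_2pi_int .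
      qed
      have "d (S j x) = 0" "bump (S j x) = 1" "dp (S i x) = 1"
        using small(1)[of i] small(1)[of j] d(4) by (simp_all add: dp_def bump_eq_1)
      then have "grad w x - axis i 1 = (cos (2 * pi / \<epsilon> * x $ i) - 1) *\<^sub>R axis i 1"
        unfolding gw by (simp add: scaleR_diff_left)
      then have "norm (grad w x - axis i 1) \<le> 7 * r"
        using small(2)[of i] by (simp add: norm_axis_1)
      also have "\<dots> \<le> C * r" using r d(2) by (intro mult_right_mono) (auto simp: C_def)
      finally show ?thesis .
    qed
    ultimately show ?thesis using sw by blast
  qed
  with \<open>C > 0\<close> show ?thesis by (rule that)
qed



section \<open>The conductivities\<close>

unbundle cross3_syntax

definition phase :: "real \<Rightarrow> real \<Rightarrow> real^3 \<Rightarrow> real^3 \<Rightarrow> real^3" where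
  "phase a b h \<xi> = a *\<^sub>R \<xi> + b *\<^sub>R (h \<times> \<xi>)"

lemma phase_matrix: "(a *\<^sub>R mat 1 + b *\<^sub>R cross_matrix h) *v \<xi> = phase a b h \<xi>"
  by (simp add: phase_def matrix_vector_mult_add_rdistrib scaleR_matrix_vector_assoc[symmetric] cross_matrix_mult)

text \<open>The Hall term is orthogonal to \<xi> and drops out of the quadratic form, so ellipticity
  and energy depend on \<open>a\<close> alone.\<close>

lemma phase_inner_self: "phase a b h \<xi> \<bullet> \<xi> = a * (norm \<xi>)\<^sup>2"
  by (simp add: phase_def inner_add_left power2_norm_eq_inner dot_cross_self)

lemma norm_cross_le: "norm (h \<times> \<xi>) \<le> norm h * norm \<xi>"
proof (rule power2_le_imp_le)
  show "(norm (h \<times> \<xi>))\<^sup>2 \<le> (norm h * norm \<xi>)\<^sup>2"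
    using norm_cross_dot[of h \<xi>] zero_le_power2[of "h \<bullet> \<xi>"] by linarith
qed simp

lemma norm_phase_le: "norm (phase a b h \<xi>) \<le> (\<bar>a\<bar> + \<bar>b\<bar> * norm h) * norm \<xi>"
proof -
  have "norm (phase a b h \<xi>) \<le> \<bar>a\<bar> * norm \<xi> + \<bar>b\<bar> * norm (h \<times> \<xi>)"
    unfolding phase_def by (rule norm_triangle_le) simp
  also have "\<dots> \<le> \<bar>a\<bar> * norm \<xi> + \<bar>b\<bar> * (norm h * norm \<xi>)"
    by (intro add_left_mono mult_left_mono norm_cross_le) simp
  finally show ?thesis by (simp add: algebra_simps)
qed

lemma abs_phase_inner_le: "\<bar>phase a b h \<xi> \<bullet> \<eta>\<bar> \<le> (\<bar>a\<bar> + \<bar>b\<bar> * norm h) * (norm \<xi> * norm \<eta>)"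
proof -
  have "\<bar>phase a b h \<xi> \<bullet> \<eta>\<bar> \<le> norm (phase a b h \<xi>) * norm \<eta>"
    by (rule Cauchy_Schwarz_ineq2)
  also have "\<dots> \<le> ((\<bar>a\<bar> + \<bar>b\<bar> * norm h) * norm \<xi>) * norm \<eta>"
    by (intro mult_right_mono norm_phase_le) simp
  finally show ?thesis by (simp add: mult.assoc)
qed

lemma phase_measurable [measurable (raw)]:
  assumes [measurable]: "g \<in> borel_measurable M"
  shows "(\<lambda>x. phase a b h (g x)) \<in> borel_measurable M"
proof -
  have "(\<lambda>\<xi>. h \<times> \<xi>) \<in> borel_measurable borel"
    by (intro borel_measurable_continuous_onI continuous_on_cross continuous_intros)
  from measurable_compose[OF assms this] show ?thesis
    unfolding phase_def by measurable
qed

lemma tensor_vertical: "tensor (axis 3 1) (axis 3 1) *v \<xi> = (\<xi> $ 3) *\<^sub>R axis 3 1"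
  by (simp add: tensor_def matrix_vector_mult_def vec_eq_iff sum_3 axis_def)

text \<open>The vector \<open>\<tau>\<close> is the direction in which the adjoint of \<open>phase a b h\<close> is vertical.\<close>

lemma phase_vertical_direction:
  fixes a b :: real and h \<xi> :: "real^3"
  defines "D \<equiv> a\<^sup>2 + b\<^sup>2 * (h $ 3)\<^sup>2"
  defines "\<tau> \<equiv> vector [(a * b * h $ 2 + b\<^sup>2 * h $ 1 * h $ 3) / D, (- a * b * h $ 1 + b\<^sup>2 * h $ 2 * h $ 3) / D, 1] :: real^3"
  assumes "a > 0"
  shows "phase a b h \<xi> \<bullet> \<tau> = (a ^ 3 + a * b\<^sup>2 * (norm h)\<^sup>2) / D * \<xi> $ 3"
proof -
  \<comment> \<open>\<open>\<tau>\<close> is the solution of a \<tau> - b (h x \<tau>) = \<kappa>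
    e_3 with third coordinate 1, where x is the cross product. The first two equations are a linear
    system for the horizontal coordinates, and \<open>D\<close> is its determinant.\<close>
  have D: "D > 0" using \<open>a > 0\<close> by (simp add: D_def add_pos_nonneg)
  have n: "(norm h)\<^sup>2 = (h $ 1)\<^sup>2 + (h $ 2)\<^sup>2 + (h $ 3)\<^sup>2"
    unfolding power2_norm_eq_inner inner_vec_def sum_3 by (simp add: power2_eq_square)
  have \<tau>: "D * \<tau> $ 1 = a * b * h $ 2 + b\<^sup>2 * h $ 1 * h $ 3" "D * \<tau> $ 2 = - a * b * h $ 1 + b\<^sup>2 * h $ 2 * h $ 3" "\<tau> $ 3 = 1"
    using D by (simp_all add: \<tau>_def)
  \<comment> \<open>Multiplying by \<open>D\<close> turns the claim into a polynomial identity in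
    the coordinates.\<close>
  have "D * (phase a b h \<xi> \<bullet> \<tau>) = (phase a b h \<xi> $ 1) * (D * \<tau> $ 1) + (phase a b h \<xi> $ 2) * (D * \<tau> $ 2) + (phase a b h \<xi> $ 3) * D * \<tau> $ 3"
    unfolding inner_vec_def sum_3 inner_real_def by algebra
  also have "\<dots> = (phase a b h \<xi> $ 1) * (a * b * h $ 2 + b\<^sup>2 * h $ 1 * h $ 3)
      + (phase a b h \<xi> $ 2) * (- a * b * h $ 1 + b\<^sup>2 * h $ 2 * h $ 3) + (phase a b h \<xi> $ 3) * D"
    unfolding \<tau> by simp
  also have "\<dots> = (a ^ 3 + a * b\<^sup>2 * (norm h)\<^sup>2) * \<xi> $ 3"
    unfolding n D_def phase_def cross3_def
    by (simp add: algebra_simps power2_eq_square power3_eq_cube)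
  finally show ?thesis using D by (simp add: field_simps)
qed

lemma fibers_sets_lebesgue_on:
  assumes "open \<Omega>" "0 < \<epsilon>"
  shows "fibers \<Omega> \<epsilon> r \<in> sets (lebesgue_on \<Omega>)"
proof -
  have "fibers \<Omega> \<epsilon> r \<in> sets borel" using assms by (intro fibers_borel) auto
  then have "fibers \<Omega> \<epsilon> r \<in> sets lebesgue" by simp
  moreover have "\<Omega> \<in> sets lebesgue" using assms(1) by simp
  moreover have "fibers \<Omega> \<epsilon> r \<subseteq> \<Omega>" by (auto simp: fibers_def)
  ultimately show ?thesis by (auto simp: sets_restrict_space_iff)
qed

text \<open>The upper bound grows with \<open>a\<close> and \<open>b\<close> and serves for
  solvability at fixed n. The ellipticity constant equals \<alpha> as soon as \<open>a\<close> is at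
  least \<alpha>; this is the bound that is uniform in n.\<close>

lemma conductivity_two_phase:
  assumes "bounded_open_set (\<Omega> :: (real^3) set)" "F \<in> sets (lebesgue_on \<Omega>)" "\<alpha> > 0" "a > 0"
  shows "bounded_open_set.conductivity \<Omega> (min \<alpha> a) (\<alpha> + a + (\<bar>\<beta>\<bar> + \<bar>b\<bar>) * norm h) (two_phase_conductivity \<alpha> \<beta> a b F h)"
proof -
  interpret bounded_open_set \<Omega> by fact
  have eq: "two_phase_conductivity \<alpha> \<beta> a b F h x *v \<xi> = (if x \<in> F then phase a b h \<xi> else phase \<alpha> \<beta> h \<xi>)" for x \<xi>
    by (simp add: two_phase_conductivity_def phase_matrix)
  show ?thesis
    unfolding conductivity_def eq
  proof (intro conjI ballI allI)
    fix g :: "real^3 \<Rightarrow> real^3" assume g [measurable]: "g \<in> borel_measurable M"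
    show "(\<lambda>x. if x \<in> F then phase a b h (g x) else phase \<alpha> \<beta> h (g x)) \<in> borel_measurable M"
    proof (rule measurable_If)
      have "F = {x \<in> space M. x \<in> F}" using sets.sets_into_space[OF assms(2)] by auto
      then show "{x \<in> space M. x \<in> F} \<in> sets M" using assms(2) by simp
    qed measurable
  next
    fix x \<xi>
    have nn: "0 \<le> \<bar>\<beta>\<bar> * norm h" "0 \<le> \<bar>b\<bar> * norm h" by simp_all
    have "norm (phase a b h \<xi>) \<le> (\<alpha> + a + (\<bar>\<beta>\<bar> + \<bar>b\<bar>) * norm h) * norm \<xi>"
      using norm_phase_le by (rule order_trans)
        (intro mult_right_mono, use nn assms in \<open>simp_all add: distrib_right\<close>)
    moreover have "norm (phase \<alpha> \<beta> h \<xi>) \<le> (\<alpha> + a + (\<bar>\<beta>\<bar> + \<bar>b\<bar>) * norm h) * norm \<xi>"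
      using norm_phase_le by (rule order_trans)
        (intro mult_right_mono, use nn assms in \<open>simp_all add: distrib_right\<close>)
    ultimately show "norm (if x \<in> F then phase a b h \<xi> else phase \<alpha> \<beta> h \<xi>) \<le> (\<alpha> + a + (\<bar>\<beta>\<bar> + \<bar>b\<bar>) * norm h) * norm \<xi>"
      by simp
    show "min \<alpha> a * (norm \<xi>)\<^sup>2 \<le> (if x \<in> F then phase a b h \<xi> else phase \<alpha> \<beta> h \<xi>) \<bullet> \<xi>"
      by (auto simp: phase_inner_self intro!: mult_right_mono)
  qed (use assms in \<open>auto intro!: add_nonneg_nonneg mult_nonneg_nonneg\<close>)
qed

text \<open>The limit matrix with an unspecified coefficient \<open>c\<close> of the vertical
  tensor, so that the flux estimates can measure how far \<kappa> |omega_n| is from it.\<close>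

definition vertical_conductivity :: "real \<Rightarrow> real \<Rightarrow> real \<Rightarrow> real^3 \<Rightarrow> real^3^3" where
  "vertical_conductivity \<alpha> \<beta> c h =
    \<alpha> *\<^sub>R mat 1 + c *\<^sub>R tensor (axis 3 1) (axis 3 1) + \<beta> *\<^sub>R cross_matrix h"

lemma vertical_conductivity_mult:
  "vertical_conductivity \<alpha> \<beta> c h *v \<xi> = phase \<alpha> \<beta> h \<xi> + (c * \<xi> $ 3) *\<^sub>R axis 3 1"
proof -
  have "vertical_conductivity \<alpha> \<beta> c h = (\<alpha> *\<^sub>R mat 1 + \<beta> *\<^sub>R cross_matrix h) + c *\<^sub>R tensor (axis 3 1) (axis 3 1)"
    by (simp add: vertical_conductivity_def)
  then show ?thesis
    by (simp add: matrix_vector_mult_add_rdistrib[of "\<alpha> *\<^sub>R mat 1 + \<beta> *\<^sub>R cross_matrix h"] phase_matrix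
        scaleR_matrix_vector_assoc[symmetric] tensor_vertical)
qed

lemma vertical_conductivity_inner:
  "(vertical_conductivity \<alpha> \<beta> c h *v \<xi>) \<bullet> \<eta> = phase \<alpha> \<beta> h \<xi> \<bullet> \<eta> + c * (\<xi> $ 3 * \<eta> $ 3)"
  by (simp add: vertical_conductivity_mult inner_add_left inner_axis inner_commute[of "axis 3 1"])

lemma conductivity_vertical:
  assumes "bounded_open_set (\<Omega> :: (real^3) set)" "\<alpha> > 0" "c \<ge> 0"
  shows "bounded_open_set.conductivity \<Omega> \<alpha> (\<alpha> + \<bar>\<beta>\<bar> * norm h + c) (\<lambda>x. vertical_conductivity \<alpha> \<beta> c h)"
proof -
  interpret bounded_open_set \<Omega> by fact
  show ?thesis
    unfolding conductivity_def
  proof (intro conjI ballI allI)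
    fix g :: "real^3 \<Rightarrow> real^3" assume g [measurable]: "g \<in> borel_measurable M"
    have [measurable]: "(\<lambda>x. g x $ 3) \<in> borel_measurable M"
      by (rule measurable_compose[OF g measurable_nth])
    show "(\<lambda>x. vertical_conductivity \<alpha> \<beta> c h *v g x) \<in> borel_measurable M"
      unfolding vertical_conductivity_mult by measurable
  next
    fix x :: "real^3" and \<xi> :: "real^3"
    have "norm (vertical_conductivity \<alpha> \<beta> c h *v \<xi>) \<le> (\<bar>\<alpha>\<bar> + \<bar>\<beta>\<bar> * norm h) * norm \<xi> + c * norm \<xi>"
      unfolding vertical_conductivity_mult
    proof (intro norm_triangle_le add_mono norm_phase_le)
      show "norm ((c * \<xi> $ 3) *\<^sub>R axis 3 1 :: real^3) \<le> c * norm \<xi>"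
        using assms(3) component_le_norm_cart[of \<xi> 3] by (simp add: norm_axis_1 abs_mult mult_left_mono)
    qed
    then show "norm (vertical_conductivity \<alpha> \<beta> c h *v \<xi>) \<le> (\<alpha> + \<bar>\<beta>\<bar> * norm h + c) * norm \<xi>"
      using assms(2) by (simp add: algebra_simps)
    show "\<alpha> * (norm \<xi>)\<^sup>2 \<le> (vertical_conductivity \<alpha> \<beta> c h *v \<xi>) \<bullet> \<xi>"
      using assms(3) by (simp add: vertical_conductivity_inner phase_inner_self)
  qed (use assms in \<open>auto intro!: add_nonneg_nonneg mult_nonneg_nonneg\<close>)
qed

lemma (in bounded_open_set) flux_form_test:
  assumes \<sigma>: "conductivity c K \<sigma>" and u: "u \<in> H10 \<Omega>" and \<phi>: "\<phi> \<in> test_functions \<Omega>"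
  shows "flux_form \<sigma> u \<phi> = (LINT x|M. (\<sigma> x *v weak_grad \<Omega> u x) \<bullet> grad \<phi> x)"
  unfolding flux_form_def
proof (rule integral_cong_AE)
  show "AE x in M. (\<sigma> x *v weak_grad \<Omega> u x) \<bullet> weak_grad \<Omega> \<phi> x = (\<sigma> x *v weak_grad \<Omega> u x) \<bullet> grad \<phi> x"
    using test_H10(2)[OF \<phi>] by eventually_elim simp
qed (intro flux_measurable[OF \<sigma>] H10_sqi(2) u test_H10(1)[OF \<phi>] sqi_test(2)[OF \<phi>])+



section \<open>Passage to the limit\<close>

text \<open>The difference of the two flux forms splits into five integrals, one for each summand of
  the bound. The constant is fixed before the geometry, the fiber coefficients and \<open>u\<close>;
  it depends on the fibers only through the bound \<open>k\<close> for the two slopes of the adjoint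
  direction.\<close>

lemma flux_error_bound:
  fixes \<Omega> :: "(real^3) set" and h :: "real^3" and \<alpha> \<beta> k cs :: real
  assumes "bounded_open_set \<Omega>" and v: "v \<in> test_functions \<Omega>" and \<alpha>: "\<alpha> > 0" and k: "k \<ge> 0" and cs: "cs \<ge> 0"
  obtains C where "C \<ge> 0" "\<And>\<epsilon> r a b u. 0 < \<epsilon> \<Longrightarrow> \<epsilon> < 1 \<Longrightarrow> 0 < r \<Longrightarrow> r < 1/2 \<Longrightarrow> a > 0 \<Longrightarrow> u \<in> H10 \<Omega> \<Longrightarrow>
    \<bar>(a * b * h $ 2 + b\<^sup>2 * h $ 1 * h $ 3) / (a\<^sup>2 + b\<^sup>2 * (h $ 3)\<^sup>2)\<bar> \<le> k \<Longrightarrow>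
    \<bar>(- a * b * h $ 1 + b\<^sup>2 * h $ 2 * h $ 3) / (a\<^sup>2 + b\<^sup>2 * (h $ 3)\<^sup>2)\<bar> \<le> k \<Longrightarrow>
    \<exists>z\<in>test_functions \<Omega>.
      l2 (lebesgue_on \<Omega>) (grad z) \<le> C * (sqrt (measure lborel (slab r \<inter> unit_cell)) + r) \<and>
      \<bar>bounded_open_set.flux_form \<Omega> (two_phase_conductivity \<alpha> \<beta> a b (fibers \<Omega> \<epsilon> r) h) u (\<lambda>x. v x + z x)
        - bounded_open_set.flux_form \<Omega> (\<lambda>x. vertical_conductivity \<alpha> \<beta> cs h) u v\<bar>
      \<le> C * (l2 (lebesgue_on \<Omega>) (weak_grad \<Omega> u) * (sqrt (measure lborel (slab r \<inter> unit_cell)) + r)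
        + (a + \<bar>b\<bar> * norm h) * r * sqrt (measure lborel (cell_fiber r)) *
          l2 (lebesgue_on \<Omega>) (\<lambda>x. indicator (rods r) (x /\<^sub>R \<epsilon>) *\<^sub>R weak_grad \<Omega> u x)
        + l2 (lebesgue_on \<Omega>) (weak_grad \<Omega> u) * sqrt (measure lborel (cell_fiber r))
        + \<bar>(a ^ 3 + a * b\<^sup>2 * (norm h)\<^sup>2) / (a\<^sup>2 + b\<^sup>2 * (h $ 3)\<^sup>2) * measure lborel (cell_fiber r)\<bar> *
          (sqrt (\<epsilon>\<^sup>2 * (1 + \<bar>ln r\<bar>)) * (1 + (l2 (lebesgue_on \<Omega>) (weak_grad \<Omega> u))\<^sup>2))
        + \<bar>(a ^ 3 + a * b\<^sup>2 * (norm h)\<^sup>2) / (a\<^sup>2 + b\<^sup>2 * (h $ 3)\<^sup>2) * measure lborel (cell_fiber r) - cs\<bar> *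
          l2 (lebesgue_on \<Omega>) (weak_grad \<Omega> u))"
proof -
  interpret bounded_open_set \<Omega> by fact
  obtain R where "\<And>x. x \<in> \<Omega> \<Longrightarrow> norm x \<le> R" using bounded_\<Omega> by (auto simp: bounded_iff)
  then have R: "\<Omega> \<subseteq> cball 0 R" by auto
  define b0 where "b0 = measure lborel (cball (0::real^3) (R + 1))"
  obtain C0 where C0: "C0 > 0" "\<And>\<epsilon> r i j. 0 < \<epsilon> \<Longrightarrow> 0 < r \<Longrightarrow> {i, j} = {1, 2 :: 3} \<Longrightarrow>
      \<exists>w. smooth w \<and> (\<forall>x. \<bar>w x\<bar> \<le> C0 * \<epsilon> * r) \<and>
      (\<forall>x. norm (grad w x) \<le> C0 * indicator (slab r) (x /\<^sub>R \<epsilon>)) \<and>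
      (\<forall>x. x /\<^sub>R \<epsilon> \<in> rods r \<longrightarrow> norm (grad w x - axis i 1) \<le> C0 * r)"
  proof (rule corrector, goal_cases)
    case (1 C)
    show ?case by (rule 1(1)[OF 1(2)]) (rule 1(3); assumption)
  qed
  obtain C1 where C1: "C1 \<ge> 0" "\<And>\<epsilon> r A u. 0 < \<epsilon> \<Longrightarrow> \<epsilon> < 1 \<Longrightarrow> 0 < r \<Longrightarrow> r < 1 \<Longrightarrow> periodic_rods A \<Longrightarrow>
    r\<^sup>2 \<le> measure lborel (A \<inter> unit_cell) \<Longrightarrow> u \<in> H10 \<Omega> \<Longrightarrow>
    \<bar>LINT x|M. (indicator A (x /\<^sub>R \<epsilon>) - measure lborel (A \<inter> unit_cell)) *
      (weak_grad \<Omega> u x $ 3 * partial_deriv 3 v x)\<bar>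
    \<le> measure lborel (A \<inter> unit_cell) * sqrt (\<epsilon>\<^sup>2 * (1 + \<bar>ln r\<bar>)) *
      (C1 * (1 + (l2 M (weak_grad \<Omega> u))\<^sup>2))"
  proof (rule vertical_derivative_estimate[OF \<open>bounded_open_set \<Omega>\<close> v], goal_cases)
    case (1 C)
    show ?case by (rule 1(1)[OF 1(2)]) (rule 1(3); assumption)
  qed
  have pv: "partial_deriv i v \<in> test_functions \<Omega>" for i by (rule test_partial_deriv[OF v])
  obtain E where E: "E > 0" "\<And>x. norm (grad v x) \<le> E" "\<And>i x. \<bar>partial_deriv i v x\<bar> \<le> E"
    "\<And>i x. norm (grad (partial_deriv i v) x) \<le> E"
  proof -
    obtain B where B: "B > 0" "\<And>x. norm (grad v x) \<le> B" using test_bounded[OF v] by metis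
    have "\<forall>i. \<exists>D. (\<forall>x. \<bar>partial_deriv i v x\<bar> \<le> D) \<and> (\<forall>x. norm (grad (partial_deriv i v) x) \<le> D)"
      using test_bounded[OF pv] by metis
    then obtain D where D: "\<And>i x. \<bar>partial_deriv i v x\<bar> \<le> D i" "\<And>i x. norm (grad (partial_deriv i v) x) \<le> D i"
      by metis
    define m where "m = max B (Max (range D))"
    have m: "D i \<le> m" "B \<le> m" for i by (simp_all add: m_def le_max_iff_disj)
    show ?thesis
    proof (rule that[of m])
      show "0 < m" using B(1) m(2) by linarith
      show "norm (grad v x) \<le> m" for x using B(2)[of x] m(2) by linarith
      show "\<bar>partial_deriv i v x\<bar> \<le> m" for i x using D(1)[of i x] m(1)[of i] by linarith
      show "norm (grad (partial_deriv i v) x) \<le> m" for i x using D(2)[of i x] m(1)[of i] by linarith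
    qed
  qed
  define K where "K = \<alpha> + \<bar>\<beta>\<bar> * norm h"
  have K: "K \<ge> 0" using \<alpha> by (simp add: K_def)
  \<comment> \<open>Half of it is the product of the corrector constant and the bound (k + 1) E for
    the amplitudes \<psi>1, \<psi>2 and their gradients; four such products occur in the gradient of
    \<open>z\<close>.\<close>
  define L where "L = 2 * C0 * (k + 1) * E"
  have L: "L \<ge> 0" using C0 k E by (simp add: L_def)
  define q where "q = sqrt b0 + l2 M (\<lambda>_. 1 :: real)"
  have q: "q \<ge> 0" by (simp add: q_def b0_def)
  \<comment> \<open>A sum of nonnegative terms that dominates the constant of each of the five
    integrals and of the bound for the gradient of \<open>z\<close>.\<close>
  define C where "C = (K + 1) * L * q + 2 * L * sqrt b0 + K * E * sqrt b0 + C1 + l2 M (grad v)"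
  have C: "0 \<le> C" "K * (L * q) \<le> C" "L * q \<le> C" "2 * L * sqrt b0 \<le> C" "K * E * sqrt b0 \<le> C" "C1 \<le> C" "l2 M (grad v) \<le> C"
  proof -
    have "0 \<le> K * (L * q)" "0 \<le> L * q" "0 \<le> L * sqrt b0" "0 \<le> K * E * sqrt b0" "0 \<le> C1" "0 \<le> l2 M (grad v)"
      using K L q E C1 by (auto simp: b0_def)
    moreover have "C = K * (L * q) + L * q + 2 * L * sqrt b0 + K * E * sqrt b0 + C1 + l2 M (grad v)"
      by (simp add: C_def algebra_simps)
    ultimately show "0 \<le> C" "K * (L * q) \<le> C" "L * q \<le> C" "2 * L * sqrt b0 \<le> C" "K * E * sqrt b0 \<le> C"
      "C1 \<le> C" "l2 M (grad v) \<le> C" by linarith+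
  qed
  have main: "\<exists>z\<in>test_functions \<Omega>. l2 M (grad z) \<le> C * (sqrt ms + r) \<and>
      \<bar>flux_form (two_phase_conductivity \<alpha> \<beta> a b (fibers \<Omega> \<epsilon> r) h) u (\<lambda>x. v x + z x)
        - flux_form (\<lambda>x. vertical_conductivity \<alpha> \<beta> cs h) u v\<bar>
      \<le> C * (l2 M (weak_grad \<Omega> u) * (sqrt ms + r)
        + (a + \<bar>b\<bar> * norm h) * r * sqrt w * l2 M (\<lambda>x. indicator (rods r) (x /\<^sub>R \<epsilon>) *\<^sub>R weak_grad \<Omega> u x)
        + l2 M (weak_grad \<Omega> u) * sqrt w
        + \<bar>\<kappa> * w\<bar> * (sqrt (\<epsilon>\<^sup>2 * (1 + \<bar>ln r\<bar>)) * (1 + (l2 M (weak_grad \<Omega> u))\<^sup>2))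
        + \<bar>\<kappa> * w - cs\<bar> * l2 M (weak_grad \<Omega> u))"
    if \<epsilon>: "0 < \<epsilon>" "\<epsilon> < 1" and r: "0 < r" "r < 1/2" and a: "a > 0" and u: "u \<in> H10 \<Omega>"
      and c1: "c1 = (a * b * h $ 2 + b\<^sup>2 * h $ 1 * h $ 3) / (a\<^sup>2 + b\<^sup>2 * (h $ 3)\<^sup>2)" "\<bar>c1\<bar> \<le> k"
      and c2: "c2 = (- a * b * h $ 1 + b\<^sup>2 * h $ 2 * h $ 3) / (a\<^sup>2 + b\<^sup>2 * (h $ 3)\<^sup>2)" "\<bar>c2\<bar> \<le> k"
      and \<kappa>: "\<kappa> = (a ^ 3 + a * b\<^sup>2 * (norm h)\<^sup>2) / (a\<^sup>2 + b\<^sup>2 * (h $ 3)\<^sup>2)"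
      and ms: "ms = measure lborel (slab r \<inter> unit_cell)" and w: "w = measure lborel (cell_fiber r)"
    for \<epsilon> r a b u c1 c2 \<kappa> ms w
  proof -
    let ?g = "weak_grad \<Omega> u"
    note sg = H10_sqi(2)[OF u]
    interpret rods: periodic_rods "rods r" by (rule periodic_rods_rods)
    interpret slab: periodic_rods "slab r" by (rule periodic_rods_slab)
    have w_rods: "w = measure lborel (rods r \<inter> unit_cell)"
      using r by (simp add: w rods_unit_cell)
    have w2: "r\<^sup>2 \<le> w" using cell_fiber_measure_bounds[OF r] by (simp add: w)
    define X :: "real^3 \<Rightarrow> real" where "X x = indicator (rods r) (x /\<^sub>R \<epsilon>)" for x
    define Y :: "real^3 \<Rightarrow> real" where "Y x = indicator (slab r) (x /\<^sub>R \<epsilon>)" for x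
    have X01: "X x = 0 \<or> X x = 1" "Y x = 0 \<or> Y x = 1" for x by (auto simp: X_def Y_def split: split_indicator)
    have XY_meas [measurable]: "X \<in> borel_measurable M" "Y \<in> borel_measurable M"
      unfolding X_def Y_def by (intro measurable_lebesgue_on; measurable)+
    have sX: "sqi M X"
      by (rule sqi_bounded[where C = 1]) (auto simp: X_def split: split_indicator)
    have sY: "sqi M Y"
      by (rule sqi_bounded[where C = 1]) (auto simp: Y_def split: split_indicator)
    have lX: "l2 M X \<le> sqrt w * sqrt b0"
    proof -
      have "(norm (X x))\<^sup>2 = X x" for x using X01(1)[of x] by auto
      then have "l2 M X = sqrt (LINT x|M. X x)" by (simp add: l2_def)
      also have "\<dots> \<le> sqrt (w * b0)"
        unfolding X_def b0_def w_rods by (intro real_sqrt_le_mono rods.integral_rods_le open_\<Omega> R \<epsilon>)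
      finally show ?thesis by (simp add: real_sqrt_mult)
    qed
    have lY: "l2 M Y \<le> sqrt ms * sqrt b0"
    proof -
      have "(norm (Y x))\<^sup>2 = Y x" for x using X01(2)[of x] by auto
      then have "l2 M Y = sqrt (LINT x|M. Y x)" by (simp add: l2_def)
      also have "\<dots> \<le> sqrt (ms * b0)"
        unfolding Y_def b0_def ms by (intro real_sqrt_le_mono slab.integral_rods_le open_\<Omega> R \<epsilon>)
      finally show ?thesis by (simp add: real_sqrt_mult)
    qed
    obtain w1 where w1: "smooth w1" "\<And>x. \<bar>w1 x\<bar> \<le> C0 * \<epsilon> * r" "\<And>x. norm (grad w1 x) \<le> C0 * Y x"
      "\<And>x. x /\<^sub>R \<epsilon> \<in> rods r \<Longrightarrow> norm (grad w1 x - axis 1 1) \<le> C0 * r"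
      using C0(2)[OF \<epsilon>(1) r(1), of 1 2] unfolding Y_def by auto
    obtain w2' where w2': "smooth w2'" "\<And>x. \<bar>w2' x\<bar> \<le> C0 * \<epsilon> * r" "\<And>x. norm (grad w2' x) \<le> C0 * Y x"
      "\<And>x. x /\<^sub>R \<epsilon> \<in> rods r \<Longrightarrow> norm (grad w2' x - axis 2 1) \<le> C0 * r"
      using C0(2)[OF \<epsilon>(1) r(1), of 2 1] unfolding Y_def by auto
    \<comment> \<open>In the fibers the first corrector adds \<psi>1 to the first component of the
      gradient of \<open>v\<close>, which replaces \<partial>_1 v by c1 \<partial>_3 v; likewise for
      \<psi>2.\<close>
    define \<psi>1 where "\<psi>1 x = c1 * partial_deriv 3 v x - partial_deriv 1 v x" for x
    define \<psi>2 where "\<psi>2 x = c2 * partial_deriv 3 v x - partial_deriv 2 v x" for x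
    have \<psi>: "\<psi>1 \<in> test_functions \<Omega>" "\<psi>2 \<in> test_functions \<Omega>"
      unfolding \<psi>1_def \<psi>2_def by (intro test_diff test_cmult pv)+
    have comb: "\<bar>c * partial_deriv 3 v x - partial_deriv i v x\<bar> \<le> (k + 1) * E"
      "norm (grad (\<lambda>x. c * partial_deriv 3 v x - partial_deriv i v x) x) \<le> (k + 1) * E" if "\<bar>c\<bar> \<le> k" for c i x
    proof -
      have "\<bar>c\<bar> * \<bar>partial_deriv 3 v x\<bar> \<le> k * E" using that E by (intro mult_mono) auto
      then show "\<bar>c * partial_deriv 3 v x - partial_deriv i v x\<bar> \<le> (k + 1) * E"
        using E(3)[of i x] abs_triangle_ineq4[of "c * partial_deriv 3 v x" "partial_deriv i v x"]
        by (simp add: abs_mult algebra_simps)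
      have "grad (\<lambda>x. c * partial_deriv 3 v x - partial_deriv i v x) x = c *\<^sub>R grad (partial_deriv 3 v) x - grad (partial_deriv i v) x"
        by (simp add: grad_diff[OF smooth_mult[OF smooth_const test_smooth[OF pv]] test_smooth[OF pv]]
            grad_cmult[OF test_smooth[OF pv]])
      moreover have "\<bar>c\<bar> * norm (grad (partial_deriv 3 v) x) \<le> k * E" using that E by (intro mult_mono) auto
      ultimately show "norm (grad (\<lambda>x. c * partial_deriv 3 v x - partial_deriv i v x) x) \<le> (k + 1) * E"
        using E(4)[of i x] norm_triangle_ineq4[of "c *\<^sub>R grad (partial_deriv 3 v) x" "grad (partial_deriv i v) x"]
        by (simp only: norm_scaleR distrib_right)
    qed
    have \<psi>_le: "\<bar>\<psi>1 x\<bar> \<le> (k + 1) * E" "\<bar>\<psi>2 x\<bar> \<le> (k + 1) * E"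
      "norm (grad \<psi>1 x) \<le> (k + 1) * E" "norm (grad \<psi>2 x) \<le> (k + 1) * E" for x
      unfolding \<psi>1_def \<psi>2_def using comb c1(2) c2(2) by blast+
    define z where "z x = w1 x * \<psi>1 x + w2' x * \<psi>2 x" for x
    have z: "z \<in> test_functions \<Omega>"
      unfolding z_def by (intro test_add test_mult_smooth w1(1) w2'(1) \<psi>)
    have vz: "(\<lambda>x. v x + z x) \<in> test_functions \<Omega>" by (rule test_add[OF v z])
    have gz: "grad z x = (w1 x *\<^sub>R grad \<psi>1 x + \<psi>1 x *\<^sub>R grad w1 x) + (w2' x *\<^sub>R grad \<psi>2 x + \<psi>2 x *\<^sub>R grad w2' x)" for x
      unfolding z_def
      by (simp add: grad_add[OF smooth_mult[OF w1(1) test_smooth[OF \<psi>(1)]] smooth_mult[OF w2'(1) test_smooth[OF \<psi>(2)]]]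
          grad_mult[OF w1(1) test_smooth[OF \<psi>(1)]] grad_mult[OF w2'(1) test_smooth[OF \<psi>(2)]])
    have small: "norm (ww *\<^sub>R G) \<le> L / 2 * r" if "\<bar>ww\<bar> \<le> C0 * \<epsilon> * r" "norm G \<le> (k + 1) * E" for ww and G :: "real^3"
    proof -
      have "\<bar>ww\<bar> * norm G \<le> (C0 * \<epsilon> * r) * ((k + 1) * E)"
        using that C0(1) \<epsilon> r by (intro mult_mono) auto
      also have "\<dots> = \<epsilon> * (L / 2 * r)" by (simp add: L_def)
      also have "\<dots> \<le> 1 * (L / 2 * r)" using \<epsilon> L r by (intro mult_right_mono) auto
      finally show ?thesis by simp
    qed
    have prod_le: "norm (p *\<^sub>R G) \<le> L / 2 * t" if "\<bar>p\<bar> \<le> (k + 1) * E" "norm G \<le> C0 * t" for p t and G :: "real^3"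
    proof -
      have "\<bar>p\<bar> * norm G \<le> ((k + 1) * E) * (C0 * t)"
        using that k E by (intro mult_mono) auto
      also have "\<dots> = L / 2 * t" by (simp add: L_def)
      finally show ?thesis by (simp only: norm_scaleR)
    qed
    have gz_le: "norm (grad z x) \<le> L * norm (Y x + r)" for x
    proof -
      have "norm (grad z x) \<le> (L / 2 * r + L / 2 * Y x) + (L / 2 * r + L / 2 * Y x)"
        unfolding gz
        by (intro norm_triangle_le add_mono small prod_le w1 w2' \<psi>_le)
      also have "\<dots> = L * (Y x + r)" by (simp add: algebra_simps)
      finally show ?thesis using X01(2)[of x] r by auto
    qed
    have s1: "sqi M (\<lambda>_. r)" by (rule sqi_bounded[where C = r]) (use r in auto)
    have lgz: "l2 M (grad z) \<le> L * q * (sqrt ms + r)"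
    proof -
      have "l2 M (grad z) \<le> L * l2 M (\<lambda>x. Y x + r)"
        using gz_le L by (intro l2_mono_AE sqi_add sY s1 grad_measurable test_smooth[OF z]) auto
      also have "\<dots> \<le> L * (l2 M Y + l2 M (\<lambda>_. r))"
        using L by (intro mult_left_mono l2_triangle sY s1)
      also have "l2 M (\<lambda>_. r) = r * l2 M (\<lambda>_. 1 :: real)"
        using l2_cmult[of M r "\<lambda>_. 1"] r by simp
      also have "L * (l2 M Y + r * l2 M (\<lambda>_. 1 :: real)) \<le> L * (q * (sqrt ms + r))"
      proof (rule mult_left_mono[OF _ L])
        have "l2 M Y \<le> q * sqrt ms"
          using lY by (rule order_trans) (auto simp: q_def ms algebra_simps)
        moreover have "r * l2 M (\<lambda>_. 1 :: real) \<le> q * r"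
          using r by (simp add: q_def b0_def algebra_simps)
        ultimately show "l2 M Y + r * l2 M (\<lambda>_. 1 :: real) \<le> q * (sqrt ms + r)"
          by (simp add: distrib_left)
      qed
      finally show ?thesis by (simp add: mult.assoc)
    qed
    have ms_r: "0 \<le> sqrt ms + r" using r by (simp add: ms)
    define \<tau> :: "real^3" where "\<tau> = vector [c1, c2, 1]"
    define err where "err x = grad (\<lambda>x. v x + z x) x - partial_deriv 3 v x *\<^sub>R \<tau>" for x
    have gvz: "grad (\<lambda>x. v x + z x) x = grad v x + grad z x" for x
      by (rule grad_add[OF test_smooth[OF v] test_smooth[OF z]])
    have err_le: "norm (err x) \<le> 2 * L * r" if rod: "x /\<^sub>R \<epsilon> \<in> rods r" for x
    proof -
      \<comment> \<open>With exact unit vectors in place of the corrector gradients the error would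
        vanish. What is left are the O(r) deviations of these gradients and the terms in which the
        amplitudes are differentiated.\<close>
      have "grad v x + \<psi>1 x *\<^sub>R axis 1 1 + \<psi>2 x *\<^sub>R axis 2 1 = partial_deriv 3 v x *\<^sub>R \<tau>"
        by (simp add: vec_eq_iff forall_3 \<tau>_def \<psi>1_def \<psi>2_def axis_def)
      then have "err x = (w1 x *\<^sub>R grad \<psi>1 x + \<psi>1 x *\<^sub>R (grad w1 x - axis 1 1))
          + (w2' x *\<^sub>R grad \<psi>2 x + \<psi>2 x *\<^sub>R (grad w2' x - axis 2 1))"
        unfolding err_def gvz gz by (simp add: scaleR_diff_right algebra_simps)
      also have "norm \<dots> \<le> (L / 2 * r + L / 2 * r) + (L / 2 * r + L / 2 * r)"
        by (intro norm_triangle_le add_mono small prod_le w1(2,4) w2'(2,4) \<psi>_le rod)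
      finally show ?thesis by simp
    qed
    let ?\<sigma> = "two_phase_conductivity \<alpha> \<beta> a b (fibers \<Omega> \<epsilon> r) h"
    note Fm = fibers_sets_lebesgue_on[OF open_\<Omega> \<epsilon>(1), of r]
    note \<sigma> = conductivity_two_phase[OF \<open>bounded_open_set \<Omega>\<close> Fm \<alpha> a, of \<beta> b h]
    note \<sigma>s = conductivity_vertical[OF \<open>bounded_open_set \<Omega>\<close> \<alpha> cs, of \<beta> h]
    have AE_fib: "AE x in M. x \<in> fibers \<Omega> \<epsilon> r \<longleftrightarrow> x /\<^sub>R \<epsilon> \<in> rods r"
      using r \<epsilon> by (intro fibers_AE \<Omega>_lebesgue) auto
    \<comment> \<open>\<open>T1\<close> is the effect of \<open>z\<close> outside the fibers,
      \<open>T2\<close> that of the imperfect direction inside, and \<open>T3\<close> removes the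
      flux of the matrix material that the limit form also counts in the fibers. \<open>T4\<close>
      carries the deviation of the indicator from its mean, \<open>T5\<close> the mismatch between
      \<kappa> w and the limit coefficient.\<close>
    define T1 where "T1 x = (1 - X x) * (phase \<alpha> \<beta> h (?g x) \<bullet> grad z x)" for x
    define T2 where "T2 x = X x * (phase a b h (?g x) \<bullet> err x)" for x
    define T3 where "T3 x = - (X x * (phase \<alpha> \<beta> h (?g x) \<bullet> grad v x))" for x
    define T4 where "T4 x = (X x - w) * (?g x $ 3 * partial_deriv 3 v x)" for x
    define T5 where "T5 x = ?g x $ 3 * partial_deriv 3 v x" for x
    have gm [measurable]: "?g \<in> borel_measurable M" "grad z \<in> borel_measurable M" "grad v \<in> borel_measurable M"
      "partial_deriv 3 v \<in> borel_measurable M" "(\<lambda>x. ?g x $ 3) \<in> borel_measurable M"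
      using sqi_measurable[OF sg] grad_measurable[OF test_smooth[OF z]] grad_measurable[OF test_smooth[OF v]]
        test_measurable[OF pv] measurable_compose[OF sqi_measurable[OF sg] measurable_nth] by auto
    have em [measurable]: "err \<in> borel_measurable M"
      unfolding err_def gvz by measurable
    have Tm: "T1 \<in> borel_measurable M" "T2 \<in> borel_measurable M" "T3 \<in> borel_measurable M" "T4 \<in> borel_measurable M" "T5 \<in> borel_measurable M"
      unfolding T1_def T2_def T3_def T4_def T5_def by measurable
    have sXg: "sqi M (\<lambda>x. X x *\<^sub>R ?g x)"
    proof (rule sqi_bound[OF sg, where C = 1])
      show "(\<lambda>x. X x *\<^sub>R ?g x) \<in> borel_measurable M"
        by (intro borel_measurable_scaleR XY_meas sqi_measurable[OF sg])
      show "AE x in M. norm (X x *\<^sub>R ?g x) \<le> 1 * norm (?g x)"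
        by (rule AE_I2) (simp add: X_def split: split_indicator)
    qed
    have Ka: "\<bar>phase \<alpha> \<beta> h \<xi> \<bullet> \<eta>\<bar> \<le> K * (norm \<xi> * norm \<eta>)" for \<xi> \<eta>
      using abs_phase_inner_le[of \<alpha> \<beta> h \<xi> \<eta>] \<alpha> by (simp add: K_def)
    have T1_le: "AE x in M. \<bar>T1 x\<bar> \<le> K * (norm (?g x) * norm (grad z x))"
    proof (rule AE_I2)
      fix x
      have "0 \<le> K * (norm (?g x) * norm (grad z x))" using K by simp
      then show "\<bar>T1 x\<bar> \<le> K * (norm (?g x) * norm (grad z x))"
        using Ka[of "?g x" "grad z x"] X01(1)[of x] by (auto simp: T1_def)
    qed
    define G where "G = (a + \<bar>b\<bar> * norm h) * (2 * L * r)"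
    have G: "G \<ge> 0" using a L r by (simp add: G_def)
    have T2_le: "AE x in M. \<bar>T2 x\<bar> \<le> G * (norm (X x *\<^sub>R ?g x) * norm (X x))"
    proof (rule AE_I2)
      fix x
      show "\<bar>T2 x\<bar> \<le> G * (norm (X x *\<^sub>R ?g x) * norm (X x))"
      proof (cases "x /\<^sub>R \<epsilon> \<in> rods r")
        case True
        have "\<bar>phase a b h (?g x) \<bullet> err x\<bar> \<le> (\<bar>a\<bar> + \<bar>b\<bar> * norm h) * (norm (?g x) * norm (err x))"
          by (rule abs_phase_inner_le)
        also have "\<dots> \<le> (\<bar>a\<bar> + \<bar>b\<bar> * norm h) * (norm (?g x) * (2 * L * r))"
          by (intro mult_left_mono err_le True) auto
        also have "\<dots> = G * norm (?g x)"
          using a by (simp only: G_def abs_of_pos mult_ac)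
        finally show ?thesis using True by (simp add: T2_def X_def)
      qed (simp add: T2_def X_def)
    qed
    have T3_le: "AE x in M. \<bar>T3 x\<bar> \<le> (K * E) * (norm (?g x) * norm (X x))"
    proof (rule AE_I2)
      fix x
      have "\<bar>phase \<alpha> \<beta> h (?g x) \<bullet> grad v x\<bar> \<le> K * (norm (?g x) * norm (grad v x))" by (rule Ka)
      also have "\<dots> \<le> K * (norm (?g x) * E)" by (intro mult_left_mono E K) auto
      finally show "\<bar>T3 x\<bar> \<le> (K * E) * (norm (?g x) * norm (X x))"
        using X01(1)[of x] by (auto simp: T3_def mult_ac)
    qed
    have T5_le: "AE x in M. \<bar>T5 x\<bar> \<le> 1 * (norm (?g x) * norm (grad v x))"
    proof (rule AE_I2)
      fix x
      have "\<bar>?g x $ 3\<bar> * \<bar>partial_deriv 3 v x\<bar> \<le> norm (?g x) * norm (grad v x)"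
        using component_le_norm_cart[of "?g x" 3] component_le_norm_cart[of "grad v x" 3] by (intro mult_mono) auto
      then show "\<bar>T5 x\<bar> \<le> 1 * (norm (?g x) * norm (grad v x))" by (simp add: T5_def abs_mult)
    qed
    have w01: "0 \<le> w" "w \<le> 1"
      using rods.area_le_1 by (auto simp: w_rods rods.area_measure ennreal_le_1)
    have T4_le: "AE x in M. \<bar>T4 x\<bar> \<le> 1 * (norm (?g x) * norm (grad v x))"
      using T5_le
    proof eventually_elim
      case (elim x)
      have "\<bar>X x - w\<bar> \<le> 1" using X01(1)[of x] w01 by auto
      then have "\<bar>X x - w\<bar> * \<bar>T5 x\<bar> \<le> 1 * \<bar>T5 x\<bar>" by (intro mult_right_mono) auto
      then show ?case using elim by (simp add: T4_def T5_def abs_mult mult.assoc)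
    qed
    have i: "integrable M T1" "integrable M T2" "integrable M T3" "integrable M T4" "integrable M T5"
      by (rule integrable_sqi_bound[OF sg sqi_test(2)[OF z] Tm(1) T1_le],
          rule integrable_sqi_bound[OF sXg sX Tm(2) T2_le],
          rule integrable_sqi_bound[OF sg sX Tm(3) T3_le],
          rule integrable_sqi_bound[OF sg sqi_test(2)[OF v] Tm(4) T4_le],
          rule integrable_sqi_bound[OF sg sqi_test(2)[OF v] Tm(5) T5_le])
    have "flux_form ?\<sigma> u (\<lambda>x. v x + z x) - flux_form (\<lambda>x. vertical_conductivity \<alpha> \<beta> cs h) u v
        = (LINT x|M. (?\<sigma> x *v ?g x) \<bullet> grad (\<lambda>x. v x + z x) x - (vertical_conductivity \<alpha> \<beta> cs h *v ?g x) \<bullet> grad v x)"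
      unfolding flux_form_test[OF \<sigma> u vz] flux_form_test[OF \<sigma>s u v]
      by (intro Bochner_Integration.integral_diff[symmetric] flux_integrable[OF \<sigma>] flux_integrable[OF \<sigma>s] sg sqi_test(2)[OF vz] sqi_test(2)[OF v])
    also have "\<dots> = (LINT x|M. T1 x + T2 x + T3 x + \<kappa> * T4 x + (\<kappa> * w - cs) * T5 x)"
    proof (rule integral_cong_AE)
      show "(\<lambda>x. (?\<sigma> x *v ?g x) \<bullet> grad (\<lambda>x. v x + z x) x - (vertical_conductivity \<alpha> \<beta> cs h *v ?g x) \<bullet> grad v x) \<in> borel_measurable M"
        by (intro borel_measurable_diff flux_measurable[OF \<sigma>] flux_measurable[OF \<sigma>s] sg sqi_test(2)[OF vz] sqi_test(2)[OF v])
      show "(\<lambda>x. T1 x + T2 x + T3 x + \<kappa> * T4 x + (\<kappa> * w - cs) * T5 x) \<in> borel_measurable M"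
        using Tm by measurable
      show "AE x in M. (?\<sigma> x *v ?g x) \<bullet> grad (\<lambda>x. v x + z x) x - (vertical_conductivity \<alpha> \<beta> cs h *v ?g x) \<bullet> grad v x
          = T1 x + T2 x + T3 x + \<kappa> * T4 x + (\<kappa> * w - cs) * T5 x"
        using AE_fib
      proof eventually_elim
        case (elim x)
        have \<sigma>x: "?\<sigma> x *v ?g x = (if x /\<^sub>R \<epsilon> \<in> rods r then phase a b h (?g x) else phase \<alpha> \<beta> h (?g x))"
          using elim by (simp add: two_phase_conductivity_def phase_matrix)
        show ?case
        proof (cases "x /\<^sub>R \<epsilon> \<in> rods r")
          case True
          have "phase a b h (?g x) \<bullet> grad (\<lambda>x. v x + z x) x
              = phase a b h (?g x) \<bullet> err x + partial_deriv 3 v x * (phase a b h (?g x) \<bullet> \<tau>)"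
            by (simp add: err_def inner_diff_right)
          also have "phase a b h (?g x) \<bullet> \<tau> = \<kappa> * ?g x $ 3"
            unfolding \<tau>_def c1(1) c2(1) \<kappa> by (rule phase_vertical_direction[OF a])
          finally show ?thesis
            using True by (simp add: \<sigma>x vertical_conductivity_inner T1_def T2_def T3_def T4_def T5_def X_def algebra_simps)
        next
          case False
          then show ?thesis
            by (simp add: \<sigma>x vertical_conductivity_inner T1_def T2_def T3_def T4_def T5_def X_def gvz inner_add_right algebra_simps)
        qed
      qed
    qed
    also have "\<dots> = (LINT x|M. T1 x) + (LINT x|M. T2 x) + (LINT x|M. T3 x) + \<kappa> * (LINT x|M. T4 x) + (\<kappa> * w - cs) * (LINT x|M. T5 x)"
      using i by simp
    finally have eq: "flux_form ?\<sigma> u (\<lambda>x. v x + z x) - flux_form (\<lambda>x. vertical_conductivity \<alpha> \<beta> cs h) u v = \<dots>" .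
    have e1: "\<bar>LINT x|M. T1 x\<bar> \<le> C * (l2 M ?g * (sqrt ms + r))"
    proof -
      have "\<bar>LINT x|M. T1 x\<bar> \<le> K * (l2 M ?g * l2 M (grad z))"
        by (rule abs_integral_sqi_le[OF sg sqi_test(2)[OF z] Tm(1) T1_le K])
      also have "\<dots> \<le> K * (l2 M ?g * (L * q * (sqrt ms + r)))"
        by (intro mult_left_mono lgz K) auto
      also have "\<dots> = (K * (L * q)) * (l2 M ?g * (sqrt ms + r))" by (simp add: mult_ac)
      also have "\<dots> \<le> C * (l2 M ?g * (sqrt ms + r))"
        using ms_r by (intro mult_right_mono C) auto
      finally show ?thesis .
    qed
    have e2: "\<bar>LINT x|M. T2 x\<bar> \<le> C * ((a + \<bar>b\<bar> * norm h) * r * sqrt w * l2 M (\<lambda>x. X x *\<^sub>R ?g x))"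
    proof -
      have "\<bar>LINT x|M. T2 x\<bar> \<le> G * (l2 M (\<lambda>x. X x *\<^sub>R ?g x) * l2 M X)"
        by (rule abs_integral_sqi_le[OF sXg sX Tm(2) T2_le G])
      also have "\<dots> \<le> G * (l2 M (\<lambda>x. X x *\<^sub>R ?g x) * (sqrt w * sqrt b0))"
        by (intro mult_left_mono lX G) auto
      also have "\<dots> = (2 * L * sqrt b0) * ((a + \<bar>b\<bar> * norm h) * r * sqrt w * l2 M (\<lambda>x. X x *\<^sub>R ?g x))"
        by (simp add: G_def mult_ac)
      also have "\<dots> \<le> C * ((a + \<bar>b\<bar> * norm h) * r * sqrt w * l2 M (\<lambda>x. X x *\<^sub>R ?g x))"
        using a r w01 by (intro mult_right_mono C) auto
      finally show ?thesis .
    qed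
    have e3: "\<bar>LINT x|M. T3 x\<bar> \<le> C * (l2 M ?g * sqrt w)"
    proof -
      have "\<bar>LINT x|M. T3 x\<bar> \<le> (K * E) * (l2 M ?g * l2 M X)"
        using K E by (intro abs_integral_sqi_le[OF sg sX Tm(3) T3_le]) auto
      also have "\<dots> \<le> (K * E) * (l2 M ?g * (sqrt w * sqrt b0))"
        using K E by (intro mult_left_mono lX) auto
      also have "\<dots> = (K * E * sqrt b0) * (l2 M ?g * sqrt w)" by (simp add: mult_ac)
      also have "\<dots> \<le> C * (l2 M ?g * sqrt w)"
        using w01 by (intro mult_right_mono C) auto
      finally show ?thesis .
    qed
    have e4: "\<bar>\<kappa> * (LINT x|M. T4 x)\<bar> \<le> C * (\<bar>\<kappa> * w\<bar> * (sqrt (\<epsilon>\<^sup>2 * (1 + \<bar>ln r\<bar>)) * (1 + (l2 M ?g)\<^sup>2)))"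
    proof -
      have "\<bar>LINT x|M. T4 x\<bar> \<le> w * sqrt (\<epsilon>\<^sup>2 * (1 + \<bar>ln r\<bar>)) * (C1 * (1 + (l2 M ?g)\<^sup>2))"
        unfolding T4_def X_def w_rods
        by (rule C1(2)[OF \<epsilon> r(1) _ periodic_rods_rods _ u]) (use r w2 w_rods in auto)
      then have "\<bar>\<kappa>\<bar> * \<bar>LINT x|M. T4 x\<bar> \<le> \<bar>\<kappa>\<bar> * (w * sqrt (\<epsilon>\<^sup>2 * (1 + \<bar>ln r\<bar>)) * (C1 * (1 + (l2 M ?g)\<^sup>2)))"
        by (intro mult_left_mono) auto
      also have "\<dots> = C1 * (\<bar>\<kappa> * w\<bar> * (sqrt (\<epsilon>\<^sup>2 * (1 + \<bar>ln r\<bar>)) * (1 + (l2 M ?g)\<^sup>2)))"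
        using w01 by (simp add: abs_mult mult_ac)
      also have "\<dots> \<le> C * (\<bar>\<kappa> * w\<bar> * (sqrt (\<epsilon>\<^sup>2 * (1 + \<bar>ln r\<bar>)) * (1 + (l2 M ?g)\<^sup>2)))"
        by (intro mult_right_mono C) auto
      finally show ?thesis by (simp add: abs_mult)
    qed
    have e5: "\<bar>(\<kappa> * w - cs) * (LINT x|M. T5 x)\<bar> \<le> C * (\<bar>\<kappa> * w - cs\<bar> * l2 M ?g)"
    proof -
      have "\<bar>LINT x|M. T5 x\<bar> \<le> 1 * (l2 M ?g * l2 M (grad v))"
        by (rule abs_integral_sqi_le[OF sg sqi_test(2)[OF v] Tm(5) T5_le]) simp
      then have "\<bar>\<kappa> * w - cs\<bar> * \<bar>LINT x|M. T5 x\<bar> \<le> \<bar>\<kappa> * w - cs\<bar> * (l2 M ?g * l2 M (grad v))"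
        by (intro mult_left_mono) auto
      also have "\<dots> = l2 M (grad v) * (\<bar>\<kappa> * w - cs\<bar> * l2 M ?g)" by (simp add: mult_ac)
      also have "\<dots> \<le> C * (\<bar>\<kappa> * w - cs\<bar> * l2 M ?g)"
        by (intro mult_right_mono C) auto
      finally show ?thesis by (simp add: abs_mult)
    qed
    have tri: "\<bar>p1 + p2 + p3 + p4 + p5\<bar> \<le> \<bar>p1\<bar> + \<bar>p2\<bar> + \<bar>p3\<bar> + \<bar>p4\<bar> + \<bar>p5\<bar>" for p1 p2 p3 p4 p5 :: real
      by linarith
    have "l2 M (grad z) \<le> C * (sqrt ms + r)"
      using lgz by (rule order_trans) (intro mult_right_mono C ms_r)
    moreover have "\<bar>flux_form ?\<sigma> u (\<lambda>x. v x + z x) - flux_form (\<lambda>x. vertical_conductivity \<alpha> \<beta> cs h) u v\<bar>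
      \<le> C * (l2 M ?g * (sqrt ms + r) + (a + \<bar>b\<bar> * norm h) * r * sqrt w * l2 M (\<lambda>x. X x *\<^sub>R ?g x)
        + l2 M ?g * sqrt w + \<bar>\<kappa> * w\<bar> * (sqrt (\<epsilon>\<^sup>2 * (1 + \<bar>ln r\<bar>)) * (1 + (l2 M ?g)\<^sup>2)) + \<bar>\<kappa> * w - cs\<bar> * l2 M ?g)"
      unfolding eq distrib_left[of C] by (rule order_trans[OF tri]) (intro add_mono e1 e2 e3 e4 e5)
    ultimately show ?thesis using z unfolding X_def by blast
  qed
  show ?thesis by (rule that[OF C(1)]) (rule main[OF _ _ _ _ _ _ refl _ refl _ refl refl refl])
qed



text \<open>Every functional has the form v -> \<open>flux_form \<sigma> v z\<close> with a solution
  \<open>z\<close> of the adjoint problem. Replacing \<open>z\<close> by a test function costs an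
  error uniform in n by the energy bound, and for test functions the convergence is assumed.\<close>

lemma (in bounded_open_set) weakly_converges_H10I:
  assumes \<sigma>: "conductivity c K \<sigma>"
    and U: "\<And>n. U n \<in> H10 \<Omega>" and u: "u \<in> H10 \<Omega>"
    and E: "\<forall>\<^sub>F n in sequentially. l2 M (weak_grad \<Omega> (U n)) \<le> E"
    and test: "\<And>v. v \<in> test_functions \<Omega> \<Longrightarrow> (\<lambda>n. flux_form \<sigma> (U n) v) \<longlonglongrightarrow> flux_form \<sigma> u v"
  shows "weakly_converges_H10 \<Omega> U u"
  unfolding weakly_converges_H10_def
proof (intro conjI allI ballI U u)
  fix F assume F: "F \<in> H_minus1 \<Omega>"
  obtain z where z: "z \<in> H10 \<Omega>" "\<And>v. v \<in> H10 \<Omega> \<Longrightarrow> flux_form \<sigma> v z = F v"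
    using flux_form_solvable(2)[OF \<sigma> F] by blast
  obtain \<phi> where ap: "approximates \<phi> z (weak_grad \<Omega> z)" by (rule H10_approximates[OF z(1)])
  have \<phi>: "\<phi> k \<in> test_functions \<Omega>" for k using ap by (simp add: approximates_def)
  have conv: "(\<lambda>k. l2 M (\<lambda>x. grad (\<phi> k) x - weak_grad \<Omega> z x)) \<longlonglongrightarrow> 0"
    using ap by (simp add: approximates_def)
  have K: "K \<ge> 0" using \<sigma> by (simp add: conductivity_def)
  \<comment> \<open>Accounts for the replacement of \<open>z\<close> in both fluxes, that of
    \<open>U n\<close> and that of \<open>u\<close>.\<close>
  define G where "G = K * (\<bar>E\<bar> + l2 M (weak_grad \<Omega> u))"
  have G: "G \<ge> 0" using K by (simp add: G_def)
  have close: "\<bar>flux_form \<sigma> v (\<phi> k) - flux_form \<sigma> v z\<bar> \<le> K * (l2 M (weak_grad \<Omega> v) * l2 M (\<lambda>x. grad (\<phi> k) x - weak_grad \<Omega> z x))"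
    if v: "v \<in> H10 \<Omega>" for v k
  proof -
    note \<phi>k = test_H10(1)[OF \<phi>[of k]]
    have "l2 M (weak_grad \<Omega> (\<lambda>x. \<phi> k x - z x)) = l2 M (\<lambda>x. weak_grad \<Omega> (\<phi> k) x - weak_grad \<Omega> z x)"
      by (rule l2_weak_grad_diff[OF \<phi>k z(1)])
    also have "\<dots> = l2 M (\<lambda>x. grad (\<phi> k) x - weak_grad \<Omega> z x)"
    proof (rule l2_cong_AE)
      show "AE x in M. norm (weak_grad \<Omega> (\<phi> k) x - weak_grad \<Omega> z x) = norm (grad (\<phi> k) x - weak_grad \<Omega> z x)"
        using test_H10(2)[OF \<phi>[of k]] by eventually_elim simp
    qed (intro sqi_measurable sqi_diff H10_sqi(2) \<phi>k z(1) sqi_test(2)[OF \<phi>])+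
    finally show ?thesis
      using flux_form_bound[OF \<sigma> v H10_diff(1)[OF \<phi>k z(1)]] flux_form_diff_right[OF \<sigma> \<phi>k z(1) v] by simp
  qed
  have "(\<lambda>n. flux_form \<sigma> (U n) z) \<longlonglongrightarrow> flux_form \<sigma> u z"
  proof (rule tendstoI)
    fix e :: real assume e: "e > 0"
    have "(\<lambda>k. G * l2 M (\<lambda>x. grad (\<phi> k) x - weak_grad \<Omega> z x)) \<longlonglongrightarrow> G * 0"
      by (intro tendsto_intros conv)
    then have "\<forall>\<^sub>F k in sequentially. G * l2 M (\<lambda>x. grad (\<phi> k) x - weak_grad \<Omega> z x) < e / 2"
      using e by (intro order_tendstoD(2)[where y = "G * 0"]) auto
    then obtain k where k: "G * l2 M (\<lambda>x. grad (\<phi> k) x - weak_grad \<Omega> z x) < e / 2"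
      using eventually_happens'[OF sequentially_bot] by blast
    define d where "d = l2 M (\<lambda>x. grad (\<phi> k) x - weak_grad \<Omega> z x)"
    have d: "d \<ge> 0" by (simp add: d_def)
    have "\<forall>\<^sub>F n in sequentially. dist (flux_form \<sigma> (U n) (\<phi> k)) (flux_form \<sigma> u (\<phi> k)) < e / 2"
      by (rule tendstoD[OF test[OF \<phi>]]) (use e in simp)
    then show "\<forall>\<^sub>F n in sequentially. dist (flux_form \<sigma> (U n) z) (flux_form \<sigma> u z) < e"
      using E
    proof eventually_elim
      case (elim n)
      have "K * (l2 M (weak_grad \<Omega> (U n)) * d) \<le> K * (\<bar>E\<bar> * d)"
        using elim(2) d K by (intro mult_left_mono mult_right_mono) auto
      then have "K * (l2 M (weak_grad \<Omega> (U n)) * d) + K * (l2 M (weak_grad \<Omega> u) * d) \<le> G * d"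
        by (simp add: G_def algebra_simps)
      with close[OF U, of n k] close[OF u, of k] elim(1) k show ?case
        unfolding dist_real_def d_def[symmetric] by linarith
    qed
  qed
  then show "(\<lambda>n. F (U n)) \<longlonglongrightarrow> F u" by (simp add: z(2) U u)
qed

text \<open>The equation is tested with \<open>u\<close> itself; the Hall terms drop out. The
  quadratic form controls the gradient with weight \<alpha> everywhere and with weight
  \<open>a\<close> in the fibers; the second bound keeps the flux through the fibers under control
  although \<open>a\<close> is large.\<close>

lemma two_phase_energy:
  assumes "bounded_open_set (\<Omega> :: (real^3) set)" "0 < \<epsilon>" "0 < r" "r < 1/2" "0 < \<alpha>" "\<alpha> \<le> a"
    and u: "u \<in> H10 \<Omega>" and C0: "0 \<le> C" and C: "\<And>v. v \<in> H10 \<Omega> \<Longrightarrow> \<bar>f v\<bar> \<le> C * l2 (lebesgue_on \<Omega>) (weak_grad \<Omega> v)"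
    and eq: "bounded_open_set.flux_form \<Omega> (two_phase_conductivity \<alpha> \<beta> a b (fibers \<Omega> \<epsilon> r) h) u u = f u"
  shows "l2 (lebesgue_on \<Omega>) (weak_grad \<Omega> u) \<le> C / \<alpha>"
    and "a * (l2 (lebesgue_on \<Omega>) (\<lambda>x. indicator (rods r) (x /\<^sub>R \<epsilon>) *\<^sub>R weak_grad \<Omega> u x))\<^sup>2
      \<le> C * l2 (lebesgue_on \<Omega>) (weak_grad \<Omega> u)"
proof -
  interpret bounded_open_set \<Omega> by fact
  interpret rods: periodic_rods "rods r" by (rule periodic_rods_rods)
  let ?F = "fibers \<Omega> \<epsilon> r" and ?g = "weak_grad \<Omega> u"
  let ?\<sigma> = "two_phase_conductivity \<alpha> \<beta> a b ?F h"
  let ?X = "\<lambda>x. indicator (rods r) (x /\<^sub>R \<epsilon>) :: real"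
  note Fm = fibers_sets_lebesgue_on[OF open_\<Omega> assms(2), of r]
  have a: "a > 0" using assms by linarith
  note \<sigma> = conductivity_two_phase[OF assms(1) Fm assms(5) a, of \<beta> b h]
  note sg = H10_sqi(2)[OF u]
  have le: "flux_form ?\<sigma> u u \<le> C * l2 M ?g" using C[OF u] unfolding eq by linarith
  have "\<alpha> * (l2 M ?g)\<^sup>2 \<le> C * l2 M ?g"
    using flux_form_coercive[OF \<sigma> u] le assms(6) by (simp add: min_absorb1)
  then have *: "\<alpha> * l2 M ?g * l2 M ?g \<le> C * l2 M ?g" by (simp add: power2_eq_square mult_ac)
  have "\<alpha> * l2 M ?g \<le> C"
  proof (cases "l2 M ?g = 0")
    case True
    then show ?thesis using C0 by simp
  next
    case False
    then have "l2 M ?g > 0" by (simp add: less_le)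
    then show ?thesis using * by simp
  qed
  then show "l2 M ?g \<le> C / \<alpha>" using assms(5) by (simp add: field_simps)
  have Xm [measurable]: "?X \<in> borel_measurable M" by (intro measurable_lebesgue_on; measurable)
  have sXg: "sqi M (\<lambda>x. ?X x *\<^sub>R ?g x)"
    by (rule sqi_bound[OF sg, where C = 1]) (use sqi_measurable[OF sg] in \<open>auto split: split_indicator\<close>)
  have "a * (l2 M (\<lambda>x. ?X x *\<^sub>R ?g x))\<^sup>2 = (LINT x|M. a * (norm (?X x *\<^sub>R ?g x))\<^sup>2)"
    by (simp add: l2_power2)
  also have "\<dots> \<le> flux_form ?\<sigma> u u"
    unfolding flux_form_def
  proof (rule integral_mono_AE)
    show "integrable M (\<lambda>x. a * (norm (?X x *\<^sub>R ?g x))\<^sup>2)"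
      by (intro integrable_mult_right sqi_integrable sXg)
    show "AE x in M. a * (norm (?X x *\<^sub>R ?g x))\<^sup>2 \<le> (?\<sigma> x *v ?g x) \<bullet> ?g x"
      using fibers_AE[OF \<Omega>_lebesgue assms(2) less_imp_le[OF assms(3)] assms(4)]
    proof eventually_elim
      case (elim x)
      show ?case
      proof (cases "x \<in> ?F")
        case True
        then show ?thesis using elim by (simp add: two_phase_conductivity_def phase_matrix phase_inner_self)
      next
        case False
        then show ?thesis using elim assms(5) by (simp add: two_phase_conductivity_def phase_matrix phase_inner_self)
      qed
    qed
  qed (rule flux_integrable[OF \<sigma> sg sg])
  finally show "a * (l2 M (\<lambda>x. ?X x *\<^sub>R ?g x))\<^sup>2 \<le> C * l2 M ?g" using le by linarith
qed

text \<open>The slopes of the adjoint direction are homogeneous of degree 0 in (a, b) and \<kappa>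
  is of degree 1, so after scaling by \<open>w\<close> everything is a function of the two
  convergent sequences w a and w b.\<close>

lemma flux_scaling:
  fixes a b w p q s :: real
  assumes "w > 0"
  shows "(a * b * p + b\<^sup>2 * q) / (a\<^sup>2 + b\<^sup>2 * s\<^sup>2) = (w * a * (w * b) * p + (w * b)\<^sup>2 * q) / ((w * a)\<^sup>2 + (w * b)\<^sup>2 * s\<^sup>2)"
    "(a ^ 3 + a * b\<^sup>2 * p) / (a\<^sup>2 + b\<^sup>2 * s\<^sup>2) * w = ((w * a) ^ 3 + (w * a) * (w * b)\<^sup>2 * p) / ((w * a)\<^sup>2 + (w * b)\<^sup>2 * s\<^sup>2)"
proof -
  have D: "(w * a)\<^sup>2 + (w * b)\<^sup>2 * s\<^sup>2 = w\<^sup>2 * (a\<^sup>2 + b\<^sup>2 * s\<^sup>2)" by algebra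
  have "w * a * (w * b) * p + (w * b)\<^sup>2 * q = w\<^sup>2 * (a * b * p + b\<^sup>2 * q)" by algebra
  then show "(a * b * p + b\<^sup>2 * q) / (a\<^sup>2 + b\<^sup>2 * s\<^sup>2) = (w * a * (w * b) * p + (w * b)\<^sup>2 * q) / ((w * a)\<^sup>2 + (w * b)\<^sup>2 * s\<^sup>2)"
    unfolding D using assms by simp
  have "(w * a) ^ 3 + (w * a) * (w * b)\<^sup>2 * p = w\<^sup>2 * ((a ^ 3 + a * b\<^sup>2 * p) * w)" by algebra
  then show "(a ^ 3 + a * b\<^sup>2 * p) / (a\<^sup>2 + b\<^sup>2 * s\<^sup>2) * w = ((w * a) ^ 3 + (w * a) * (w * b)\<^sup>2 * p) / ((w * a)\<^sup>2 + (w * b)\<^sup>2 * s\<^sup>2)"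
    unfolding D using assms by simp
qed

text \<open>Each summand of \<open>flux_error_bound\<close> tends to zero under the energy bounds,
  and the corrector changes the right-hand side only by \<open>f z\<close>, which tends to zero as
  well. The conclusion is about the limit form evaluated at \<open>U n\<close>, in which the
  oscillating coefficient no longer appears.\<close>

lemma flux_tendsto:
  fixes \<Omega> :: "(real^3) set" and h :: "real^3" and \<epsilon> r a b :: "nat \<Rightarrow> real"
  defines "\<mu> \<equiv> \<lambda>n. measure lborel (cell_fiber (r n))"
  assumes "bounded_open_set \<Omega>" and \<alpha>: "\<alpha> > 0"
    and \<epsilon>: "\<And>n. 0 < \<epsilon> n" "\<And>n. \<epsilon> n < 1" and r: "\<And>n. 0 < r n" "\<And>n. r n < 1/2" and a: "\<And>n. a n > 0"
    and \<epsilon>0: "\<epsilon> \<longlonglongrightarrow> 0" and r0: "r \<longlonglongrightarrow> 0" and ln0: "(\<lambda>n. (\<epsilon> n)\<^sup>2 * \<bar>ln (r n)\<bar>) \<longlonglongrightarrow> 0"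
    and A: "(\<lambda>n. \<mu> n * a n) \<longlonglongrightarrow> A" "A > 0" and B: "(\<lambda>n. \<mu> n * b n) \<longlonglongrightarrow> B"
    and f: "f \<in> H_minus1 \<Omega>" and U: "\<And>n. U n \<in> H10 \<Omega>"
    and eq: "\<And>n v. v \<in> H10 \<Omega> \<Longrightarrow>
      bounded_open_set.flux_form \<Omega> (two_phase_conductivity \<alpha> \<beta> (a n) (b n) (fibers \<Omega> (\<epsilon> n) (r n)) h) (U n) v = f v"
    and cs: "cs = (A ^ 3 + A * B\<^sup>2 * (norm h)\<^sup>2) / (A\<^sup>2 + B\<^sup>2 * (h $ 3)\<^sup>2)"
  shows "\<exists>E. \<forall>\<^sub>F n in sequentially. l2 (lebesgue_on \<Omega>) (weak_grad \<Omega> (U n)) \<le> E" (is ?bounded)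
    and "v \<in> test_functions \<Omega> \<Longrightarrow>
      (\<lambda>n. bounded_open_set.flux_form \<Omega> (\<lambda>x. vertical_conductivity \<alpha> \<beta> cs h) (U n) v) \<longlonglongrightarrow> f v"
proof -
  interpret bounded_open_set \<Omega> by fact
  have \<mu>: "(r n)\<^sup>2 \<le> \<mu> n" "\<mu> n \<le> 16 * (r n)\<^sup>2" for n
    unfolding \<mu>_def by (intro cell_fiber_measure_bounds r)+
  have \<mu>0: "\<mu> n > 0" for n using \<mu>(1)[of n] r(1)[of n] zero_less_power[of "r n" 2] by linarith
  have \<mu>_lim: "\<mu> \<longlonglongrightarrow> 0"
  proof (rule tendsto_sandwich[where f = "\<lambda>_. 0"])
    have "(\<lambda>n. 16 * (r n)\<^sup>2) \<longlonglongrightarrow> 16 * 0\<^sup>2" by (intro tendsto_intros r0)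
    then show "(\<lambda>n. 16 * (r n)\<^sup>2) \<longlonglongrightarrow> 0" by simp
  qed (use \<mu> \<mu>0 in \<open>auto simp: less_imp_le\<close>)
  obtain C where C: "C \<ge> 0" "\<And>v. v \<in> H10 \<Omega> \<Longrightarrow> \<bar>f v\<bar> \<le> C * l2 M (weak_grad \<Omega> v)"
    using H_minus1_bound[OF f] by metis
  define E where "E = C / \<alpha>"
  have E: "E \<ge> 0" using C \<alpha> by (simp add: E_def)
  \<comment> \<open>Since \<mu> n a n has a positive limit while \<mu> n tends to zero, the fibers
    eventually conduct better than the matrix; from then on the energy bounds hold.\<close>
  have "(\<lambda>n. \<mu> n * a n - \<mu> n * \<alpha>) \<longlonglongrightarrow> A - 0 * \<alpha>" by (intro tendsto_intros A \<mu>_lim)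
  then have "\<forall>\<^sub>F n in sequentially. \<mu> n * a n - \<mu> n * \<alpha> > 0"
    using A(2) by (intro order_tendstoD(1)[where y = "A - 0 * \<alpha>"]) auto
  then have large: "\<forall>\<^sub>F n in sequentially. \<alpha> \<le> a n"
  proof eventually_elim
    case (elim n)
    then have "\<mu> n * (a n - \<alpha>) > 0" by (simp add: right_diff_distrib)
    then show ?case using \<mu>0[of n] by (simp add: zero_less_mult_iff)
  qed
  let ?\<sigma> = "\<lambda>n. two_phase_conductivity \<alpha> \<beta> (a n) (b n) (fibers \<Omega> (\<epsilon> n) (r n)) h"
  let ?g = "\<lambda>n. l2 M (weak_grad \<Omega> (U n))"
  let ?Xg = "\<lambda>n. l2 M (\<lambda>x. indicator (rods (r n)) (x /\<^sub>R \<epsilon> n) *\<^sub>R weak_grad \<Omega> (U n) x)"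
  have gE: "?g n \<le> E" "a n * (?Xg n)\<^sup>2 \<le> C * E" if n: "\<alpha> \<le> a n" for n
  proof -
    note en = two_phase_energy[OF \<open>bounded_open_set \<Omega>\<close> \<epsilon>(1) r \<alpha> n U C eq[OF U]]
    show "?g n \<le> E" unfolding E_def by (rule en(1))
    then have "C * ?g n \<le> C * E" using C(1) by (rule mult_left_mono)
    then show "a n * (?Xg n)\<^sup>2 \<le> C * E" using en(2) by (rule order_trans[rotated])
  qed
  show ?bounded using large gE(1) by (intro exI[of _ E]) (auto elim: eventually_mono)
  have D: "A\<^sup>2 + B\<^sup>2 * (h $ 3)\<^sup>2 \<noteq> 0" using A(2) zero_less_power[OF A(2), of 2]
    by (smt (verit) zero_le_mult_iff zero_le_power2)
  have cs0: "cs \<ge> 0" using A(2) by (simp add: cs)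
  define c1 where "c1 n = (a n * b n * h $ 2 + (b n)\<^sup>2 * h $ 1 * h $ 3) / ((a n)\<^sup>2 + (b n)\<^sup>2 * (h $ 3)\<^sup>2)" for n
  define c2 where "c2 n = (- a n * b n * h $ 1 + (b n)\<^sup>2 * h $ 2 * h $ 3) / ((a n)\<^sup>2 + (b n)\<^sup>2 * (h $ 3)\<^sup>2)" for n
  define \<kappa> where "\<kappa> n = (a n ^ 3 + a n * (b n)\<^sup>2 * (norm h)\<^sup>2) / ((a n)\<^sup>2 + (b n)\<^sup>2 * (h $ 3)\<^sup>2) * \<mu> n" for n
  have c_eq: "c1 n = (\<mu> n * a n * (\<mu> n * b n) * h $ 2 + (\<mu> n * b n)\<^sup>2 * (h $ 1 * h $ 3)) / ((\<mu> n * a n)\<^sup>2 + (\<mu> n * b n)\<^sup>2 * (h $ 3)\<^sup>2)"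
    "c2 n = (\<mu> n * a n * (\<mu> n * b n) * (- h $ 1) + (\<mu> n * b n)\<^sup>2 * (h $ 2 * h $ 3)) / ((\<mu> n * a n)\<^sup>2 + (\<mu> n * b n)\<^sup>2 * (h $ 3)\<^sup>2)"
    "\<kappa> n = ((\<mu> n * a n) ^ 3 + (\<mu> n * a n) * (\<mu> n * b n)\<^sup>2 * (norm h)\<^sup>2) / ((\<mu> n * a n)\<^sup>2 + (\<mu> n * b n)\<^sup>2 * (h $ 3)\<^sup>2)" for n
    unfolding flux_scaling[OF \<mu>0, symmetric] by (simp_all add: c1_def c2_def \<kappa>_def mult_ac)
  have "c1 \<longlonglongrightarrow> (A * B * h $ 2 + B\<^sup>2 * (h $ 1 * h $ 3)) / (A\<^sup>2 + B\<^sup>2 * (h $ 3)\<^sup>2)"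
    "c2 \<longlonglongrightarrow> (A * B * (- h $ 1) + B\<^sup>2 * (h $ 2 * h $ 3)) / (A\<^sup>2 + B\<^sup>2 * (h $ 3)\<^sup>2)"
    unfolding c_eq[abs_def] by (intro tendsto_intros A B D)+
  \<comment> \<open>The constant of \<open>flux_error_bound\<close> depends on a bound for the
    slopes, so this bound must hold for all n at once.\<close>
  then have "Bseq c1" "Bseq c2" by (blast intro: convergent_imp_Bseq convergentI)+
  then obtain k1 k2 where k: "k1 > 0" "k2 > 0" "\<And>n. \<bar>c1 n\<bar> \<le> k1" "\<And>n. \<bar>c2 n\<bar> \<le> k2"
    unfolding Bseq_def by auto
  have \<kappa>_lim: "\<kappa> \<longlonglongrightarrow> cs"
    unfolding c_eq(3)[abs_def] cs by (intro tendsto_intros A B D)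
  define ms where "ms n = measure lborel (slab (r n) \<inter> unit_cell)" for n
  have ms_lim: "(\<lambda>n. sqrt (ms n) + r n) \<longlonglongrightarrow> sqrt 0 + 0"
    unfolding ms_def by (intro tendsto_intros measure_slab_tendsto r0)
  have ms0: "sqrt (ms n) + r n \<ge> 0" for n using r(1)[of n] by (simp add: ms_def)
  have eln: "(\<lambda>n. sqrt ((\<epsilon> n)\<^sup>2 * (1 + \<bar>ln (r n)\<bar>))) \<longlonglongrightarrow> 0"
  proof -
    have "(\<lambda>n. sqrt ((\<epsilon> n)\<^sup>2 + (\<epsilon> n)\<^sup>2 * \<bar>ln (r n)\<bar>)) \<longlonglongrightarrow> sqrt (0\<^sup>2 + 0)"
      by (intro tendsto_intros \<epsilon>0 ln0)
    then show ?thesis by (simp add: distrib_left)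
  qed
  have k12: "0 \<le> k1 + k2" using k(1,2) by simp
  fix v assume v: "v \<in> test_functions \<Omega>"
  obtain Q where Q: "Q \<ge> 0" and main: "\<And>\<epsilon> r a b u. 0 < \<epsilon> \<Longrightarrow> \<epsilon> < 1 \<Longrightarrow> 0 < r \<Longrightarrow> r < 1/2 \<Longrightarrow> a > 0 \<Longrightarrow> u \<in> H10 \<Omega> \<Longrightarrow>
    \<bar>(a * b * h $ 2 + b\<^sup>2 * h $ 1 * h $ 3) / (a\<^sup>2 + b\<^sup>2 * (h $ 3)\<^sup>2)\<bar> \<le> k1 + k2 \<Longrightarrow>
    \<bar>(- a * b * h $ 1 + b\<^sup>2 * h $ 2 * h $ 3) / (a\<^sup>2 + b\<^sup>2 * (h $ 3)\<^sup>2)\<bar> \<le> k1 + k2 \<Longrightarrow>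
    \<exists>z\<in>test_functions \<Omega>.
      l2 M (grad z) \<le> Q * (sqrt (measure lborel (slab r \<inter> unit_cell)) + r) \<and>
      \<bar>flux_form (two_phase_conductivity \<alpha> \<beta> a b (fibers \<Omega> \<epsilon> r) h) u (\<lambda>x. v x + z x)
        - flux_form (\<lambda>x. vertical_conductivity \<alpha> \<beta> cs h) u v\<bar>
      \<le> Q * (l2 M (weak_grad \<Omega> u) * (sqrt (measure lborel (slab r \<inter> unit_cell)) + r)
        + (a + \<bar>b\<bar> * norm h) * r * sqrt (measure lborel (cell_fiber r)) *
          l2 M (\<lambda>x. indicator (rods r) (x /\<^sub>R \<epsilon>) *\<^sub>R weak_grad \<Omega> u x)
        + l2 M (weak_grad \<Omega> u) * sqrt (measure lborel (cell_fiber r))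
        + \<bar>(a ^ 3 + a * b\<^sup>2 * (norm h)\<^sup>2) / (a\<^sup>2 + b\<^sup>2 * (h $ 3)\<^sup>2) * measure lborel (cell_fiber r)\<bar> *
          (sqrt (\<epsilon>\<^sup>2 * (1 + \<bar>ln r\<bar>)) * (1 + (l2 M (weak_grad \<Omega> u))\<^sup>2))
        + \<bar>(a ^ 3 + a * b\<^sup>2 * (norm h)\<^sup>2) / (a\<^sup>2 + b\<^sup>2 * (h $ 3)\<^sup>2) * measure lborel (cell_fiber r) - cs\<bar> *
          l2 M (weak_grad \<Omega> u))"
  proof (rule flux_error_bound[OF \<open>bounded_open_set \<Omega>\<close> v \<alpha> k12 cs0, where h = h and \<beta> = \<beta>], goal_cases)
    case (1 C)
    show ?case by (rule 1(1)[OF 1(2)]) (rule 1(3); assumption)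
  qed
  \<comment> \<open>The fiber term after the energy bound has been inserted: apart from the factor
    \<open>r n\<close> all factors converge, so it tends to zero.\<close>
  define T where "T n = (\<mu> n * a n + \<bar>\<mu> n * b n\<bar> * norm h) * r n * sqrt (C * E / (\<mu> n * a n))" for n
  define S where "S n = E * (sqrt (ms n) + r n) + T n + E * sqrt (\<mu> n)
    + \<bar>\<kappa> n\<bar> * (sqrt ((\<epsilon> n)\<^sup>2 * (1 + \<bar>ln (r n)\<bar>)) * (1 + E\<^sup>2)) + \<bar>\<kappa> n - cs\<bar> * E" for n
  have T_lim: "T \<longlonglongrightarrow> (A + \<bar>B\<bar> * norm h) * 0 * sqrt (C * E / A)"
    unfolding T_def using A(2) by (intro tendsto_intros A B r0) simp
  have "(\<lambda>n. Q * S n + C * (Q * (sqrt (ms n) + r n))) \<longlonglongrightarrow>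
      Q * (E * (sqrt 0 + 0) + (A + \<bar>B\<bar> * norm h) * 0 * sqrt (C * E / A) + E * sqrt 0
        + \<bar>cs\<bar> * (0 * (1 + E\<^sup>2)) + \<bar>cs - cs\<bar> * E) + C * (Q * (sqrt 0 + 0))"
    unfolding S_def by (intro tendsto_intros ms_lim T_lim \<mu>_lim \<kappa>_lim eln)
  then have lim: "(\<lambda>n. Q * S n + C * (Q * (sqrt (ms n) + r n))) \<longlonglongrightarrow> 0" by simp
  have "(\<lambda>n. flux_form (\<lambda>x. vertical_conductivity \<alpha> \<beta> cs h) (U n) v - f v) \<longlonglongrightarrow> 0"
  proof (rule Lim_null_comparison[OF _ lim])
    show "\<forall>\<^sub>F n in sequentially. norm (flux_form (\<lambda>x. vertical_conductivity \<alpha> \<beta> cs h) (U n) v - f v)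
      \<le> Q * S n + C * (Q * (sqrt (ms n) + r n))"
      using large
    proof eventually_elim
      case (elim n)
      have "\<bar>c1 n\<bar> \<le> k1 + k2" "\<bar>c2 n\<bar> \<le> k1 + k2" using k(1,2) k(3,4)[of n] by linarith+
      then obtain z where z: "z \<in> test_functions \<Omega>" "l2 M (grad z) \<le> Q * (sqrt (ms n) + r n)"
        and err: "\<bar>flux_form (?\<sigma> n) (U n) (\<lambda>x. v x + z x) - flux_form (\<lambda>x. vertical_conductivity \<alpha> \<beta> cs h) (U n) v\<bar>
          \<le> Q * (?g n * (sqrt (ms n) + r n) + (a n + \<bar>b n\<bar> * norm h) * r n * sqrt (\<mu> n) * ?Xg n + ?g n * sqrt (\<mu> n)
            + \<bar>\<kappa> n\<bar> * (sqrt ((\<epsilon> n)\<^sup>2 * (1 + \<bar>ln (r n)\<bar>)) * (1 + (?g n)\<^sup>2)) + \<bar>\<kappa> n - cs\<bar> * ?g n)"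
        using main[OF \<epsilon>[of n] r[of n] a[of n] U[of n], of "b n"]
        unfolding c1_def c2_def \<kappa>_def ms_def \<mu>_def by blast
      have XT: "(a n + \<bar>b n\<bar> * norm h) * r n * sqrt (\<mu> n) * ?Xg n \<le> T n"
      proof -
        have "(?Xg n)\<^sup>2 \<le> C * E / a n"
          using gE(2)[OF elim] a[of n] by (simp add: field_simps)
        then have "?Xg n \<le> sqrt (C * E / a n)" by (simp add: real_le_rsqrt)
        then have "sqrt (\<mu> n) * ?Xg n \<le> sqrt (\<mu> n) * sqrt (C * E / a n)"
          using \<mu>0[of n] by (intro mult_left_mono) auto
        also have "\<dots> = sqrt (\<mu> n * (C * E / a n))" by (simp only: real_sqrt_mult)
        \<comment> \<open>Regrouping in terms of \<mu> n a n: one full factor \<mu> n is gained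
          outside the root and turns \<open>a n\<close> and \<open>b n\<close> into the convergent
          products.\<close>
        also have "\<mu> n * (C * E / a n) = (\<mu> n)\<^sup>2 * (C * E / (\<mu> n * a n))"
          using \<mu>0[of n] a[of n] by (simp add: field_simps power2_eq_square)
        also have "sqrt \<dots> = \<mu> n * sqrt (C * E / (\<mu> n * a n))"
          unfolding real_sqrt_mult using \<mu>0[of n] by simp
        finally have "((a n + \<bar>b n\<bar> * norm h) * r n) * (sqrt (\<mu> n) * ?Xg n)
            \<le> ((a n + \<bar>b n\<bar> * norm h) * r n) * (\<mu> n * sqrt (C * E / (\<mu> n * a n)))"
          using a[of n] r(1)[of n] by (intro mult_left_mono) auto
        also have "\<dots> = T n" using \<mu>0[of n] by (simp add: T_def abs_mult algebra_simps)
        finally show ?thesis by (simp add: mult.assoc)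
      qed
      note gn = gE(1)[OF elim]
      have "?g n * (sqrt (ms n) + r n) + (a n + \<bar>b n\<bar> * norm h) * r n * sqrt (\<mu> n) * ?Xg n + ?g n * sqrt (\<mu> n)
            + \<bar>\<kappa> n\<bar> * (sqrt ((\<epsilon> n)\<^sup>2 * (1 + \<bar>ln (r n)\<bar>)) * (1 + (?g n)\<^sup>2)) + \<bar>\<kappa> n - cs\<bar> * ?g n \<le> S n"
        unfolding S_def
        by (intro add_mono XT mult_left_mono mult_right_mono gn ms0 power_mono order_refl) (use \<mu>0[of n] in auto)
      from mult_left_mono[OF this Q] err
      have err': "\<bar>flux_form (?\<sigma> n) (U n) (\<lambda>x. v x + z x) - flux_form (\<lambda>x. vertical_conductivity \<alpha> \<beta> cs h) (U n) v\<bar> \<le> Q * S n"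
        by linarith
      note vH = test_H10(1)[OF v] and zH = test_H10(1)[OF z(1)]
      \<comment> \<open>The corrected test function is admissible, so the equation yields
        \<open>f v + f z\<close>; the gradient norm of \<open>z\<close>, and with it
        \<open>f z\<close>, tends to zero.\<close>
      have "flux_form (?\<sigma> n) (U n) (\<lambda>x. v x + z x) = f v + f z"
        using eq[OF H10_add(1)[OF vH zH]] f vH zH by (simp add: H_minus1_def)
      moreover have "\<bar>f z\<bar> \<le> C * (Q * (sqrt (ms n) + r n))"
      proof -
        have "l2 M (weak_grad \<Omega> z) = l2 M (grad z)"
          by (rule l2_cong_AE) (use test_H10(2)[OF z(1)] in \<open>auto intro: sqi_measurable H10_sqi(2)[OF zH] sqi_test(2)[OF z(1)] elim: eventually_mono\<close>)
        then show ?thesis using C(2)[OF zH] mult_left_mono[OF z(2) C(1)] by simp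
      qed
      ultimately show ?case using err' unfolding real_norm_def by linarith
    qed
  qed
  then show "(\<lambda>n. flux_form (\<lambda>x. vertical_conductivity \<alpha> \<beta> cs h) (U n) v) \<longlonglongrightarrow> f v"
    by (simp add: LIM_zero_iff)
qed

section \<open>From the cross section to the cylinder, and the conclusion\<close>

lemma open_cylinder:
  assumes "open D"
  shows "open (cylinder D)"
proof -
  have eq: "vector [x $ 1, x $ 2] = x $ 1 *\<^sub>R axis 1 1 + x $ 2 *\<^sub>R (axis 2 1 :: real^2)" for x :: "real^3"
    by (simp add: vec_eq_iff forall_2 axis_def)
  have "continuous_on UNIV (\<lambda>x :: real^3. vector [x $ 1, x $ 2] :: real^2)"
    unfolding eq by (intro continuous_intros)
  then have "open ((\<lambda>x :: real^3. vector [x $ 1, x $ 2] :: real^2) -` D)"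
    using assms by (simp add: open_vimage)
  moreover have "open {x :: real^3. 0 < x $ 3 \<and> x $ 3 < 1}"
    by (intro open_Collect_conj open_Collect_less continuous_intros)
  moreover have "cylinder D = (\<lambda>x :: real^3. vector [x $ 1, x $ 2] :: real^2) -` D \<inter> {x. 0 < x $ 3 \<and> x $ 3 < 1}"
    by (auto simp: cylinder_def)
  ultimately show ?thesis by (simp add: open_Int)
qed

lemma bounded_cylinder:
  assumes "bounded D"
  shows "bounded (cylinder D)"
proof -
  obtain R where R: "\<And>y. y \<in> D \<Longrightarrow> norm y \<le> R" using assms by (auto simp: bounded_iff)
  have "norm x \<le> R + R + 1" if x: "x \<in> cylinder D" for x
  proof -
    let ?y = "vector [x $ 1, x $ 2] :: real^2"
    have "norm ?y \<le> R" "\<bar>x $ 3\<bar> \<le> 1" using x R by (auto simp: cylinder_def)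
    moreover have "\<bar>x $ 1\<bar> \<le> norm ?y" "\<bar>x $ 2\<bar> \<le> norm ?y"
      using component_le_norm_cart[of ?y 1] component_le_norm_cart[of ?y 2] by simp_all
    moreover have "norm x \<le> \<bar>x $ 1\<bar> + \<bar>x $ 2\<bar> + \<bar>x $ 3\<bar>" using norm_le_l1_cart[of x] by (simp add: sum_3)
    ultimately show ?thesis by linarith
  qed
  then show ?thesis by (auto simp: bounded_iff)
qed

lemma homogenized_conductivity_vertical:
  "homogenized_conductivity \<alpha> \<beta> A B h =
    vertical_conductivity \<alpha> \<beta> ((A ^ 3 + A * B\<^sup>2 * (norm h)\<^sup>2) / (A\<^sup>2 + B\<^sup>2 * (h $ 3)\<^sup>2)) h"
  by (simp add: homogenized_conductivity_def vertical_conductivity_def)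


theorem theorem4p1:
  fixes D :: "(real^2) set" and \<Omega> :: "(real^3) set"
    and \<alpha>\<^sub>1 \<beta>\<^sub>1 \<alpha>\<^sub>2 \<beta>\<^sub>2 :: real
    and \<epsilon> r \<alpha>\<^sub>2\<^sub>n \<beta>\<^sub>2\<^sub>n :: "nat \<Rightarrow> real"
  assumes "domain D" and "bounded D" and "lipschitz_boundary D"
    and "\<Omega> = cylinder D"
    and "\<alpha>\<^sub>1 > 0"
    and "\<And>n. 0 < \<epsilon> n \<and> \<epsilon> n < 1"
    and "\<And>n. 0 < r n \<and> r n < 1/2"
    and "\<And>n. \<alpha>\<^sub>2\<^sub>n n > 0"
    and "\<epsilon> \<longlonglongrightarrow> 0" and "r \<longlonglongrightarrow> 0"
    and "(\<lambda>n. (\<epsilon> n)\<^sup>2 * \<bar>ln (r n)\<bar>) \<longlonglongrightarrow> 0"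
    and "(\<lambda>n. measure lebesgue (cell_fiber (r n)) * \<alpha>\<^sub>2\<^sub>n n) \<longlonglongrightarrow> \<alpha>\<^sub>2" and "\<alpha>\<^sub>2 > 0"
    and "(\<lambda>n. measure lebesgue (cell_fiber (r n)) * \<beta>\<^sub>2\<^sub>n n) \<longlonglongrightarrow> \<beta>\<^sub>2"
  shows "\<exists>s :: nat \<Rightarrow> nat. strict_mono s \<and>
    (\<forall>f\<in>H_minus1 \<Omega>. \<forall>h. \<exists>U u.
      (\<forall>n. is_the_solution \<Omega>
        (two_phase_conductivity \<alpha>\<^sub>1 \<beta>\<^sub>1 (\<alpha>\<^sub>2\<^sub>n (s n)) (\<beta>\<^sub>2\<^sub>n (s n)) (fibers \<Omega> (\<epsilon> (s n)) (r (s n))) h)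
        f (U n)) \<and>
      is_the_solution \<Omega> (\<lambda>x. homogenized_conductivity \<alpha>\<^sub>1 \<beta>\<^sub>1 \<alpha>\<^sub>2 \<beta>\<^sub>2 h) f u \<and>
      weakly_converges_H10 \<Omega> U u)"
proof (intro exI[of _ id] conjI ballI allI)
  show "strict_mono (id :: nat \<Rightarrow> nat)" by (simp add: strict_mono_def)
  fix f and h :: "real^3" assume f: "f \<in> H_minus1 \<Omega>"
  have "open \<Omega>" "bounded \<Omega>"
    using assms(1,2,4) open_cylinder bounded_cylinder by (auto simp: domain_def)
  then have bos: "bounded_open_set \<Omega>" by (rule bounded_open_set.intro)
  interpret bounded_open_set \<Omega> by (rule bos)
  define cs where "cs = (\<alpha>\<^sub>2 ^ 3 + \<alpha>\<^sub>2 * \<beta>\<^sub>2\<^sup>2 * (norm h)\<^sup>2) / (\<alpha>\<^sub>2\<^sup>2 + \<beta>\<^sub>2\<^sup>2 * (h $ 3)\<^sup>2)"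
  have "cs \<ge> 0" using \<open>\<alpha>\<^sub>2 > 0\<close> by (simp add: cs_def)
  let ?\<sigma> = "\<lambda>n. two_phase_conductivity \<alpha>\<^sub>1 \<beta>\<^sub>1 (\<alpha>\<^sub>2\<^sub>n n) (\<beta>\<^sub>2\<^sub>n n) (fibers \<Omega> (\<epsilon> n) (r n)) h"
  let ?\<sigma>s = "\<lambda>x. vertical_conductivity \<alpha>\<^sub>1 \<beta>\<^sub>1 cs h"
  have \<epsilon>: "0 < \<epsilon> n" "\<epsilon> n < 1" and r: "0 < r n" "r n < 1/2" for n using assms(6,7) by blast+
  note \<sigma> = conductivity_two_phase[OF bos fibers_sets_lebesgue_on[OF \<open>open \<Omega>\<close> \<epsilon>(1)] \<open>\<alpha>\<^sub>1 > 0\<close> assms(8)]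
  note \<sigma>s = conductivity_vertical[OF bos \<open>\<alpha>\<^sub>1 > 0\<close> \<open>cs \<ge> 0\<close>]
  have "\<forall>n. \<exists>u\<in>H10 \<Omega>. \<forall>v\<in>H10 \<Omega>. flux_form (?\<sigma> n) u v = f v"
    using flux_form_solvable(1)[OF \<sigma> f] by blast
  then obtain U where U: "\<And>n. U n \<in> H10 \<Omega>" "\<And>n v. v \<in> H10 \<Omega> \<Longrightarrow> flux_form (?\<sigma> n) (U n) v = f v"
    by metis
  \<comment> \<open>The limit is constructed independently of \<open>U\<close>. It is linked to the
    sequence only through the common right-hand side: the limit form at \<open>U n\<close> tends to
    \<open>f v\<close>, which is its value at \<open>u\<close>.\<close>
  obtain u where u: "u \<in> H10 \<Omega>" "\<And>v. v \<in> H10 \<Omega> \<Longrightarrow> flux_form ?\<sigma>s u v = f v"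
    using flux_form_solvable(1)[OF \<sigma>s f] by blast
  note lim = flux_tendsto[OF bos \<open>\<alpha>\<^sub>1 > 0\<close> \<epsilon> r assms(8,9,10,11) assms(12)[unfolded measure_cell_fiber] \<open>\<alpha>\<^sub>2 > 0\<close>
      assms(14)[unfolded measure_cell_fiber] f U cs_def]
  have "weakly_converges_H10 \<Omega> U u"
  proof -
    obtain E where E: "\<forall>\<^sub>F n in sequentially. l2 M (weak_grad \<Omega> (U n)) \<le> E" using lim(1) by blast
    show ?thesis
    proof (rule weakly_converges_H10I[OF \<sigma>s U(1) u(1) E])
      fix v assume v: "v \<in> test_functions \<Omega>"
      show "(\<lambda>n. flux_form ?\<sigma>s (U n) v) \<longlonglongrightarrow> flux_form ?\<sigma>s u v"
        using lim(2)[OF _ v] u(2)[OF test_H10(1)[OF v]] by simp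
    qed
  qed
  moreover have "is_the_solution \<Omega> (?\<sigma> n) f (U n)" for n
    by (rule is_the_solutionI[OF \<sigma> U])
  moreover have "is_the_solution \<Omega> (\<lambda>x. homogenized_conductivity \<alpha>\<^sub>1 \<beta>\<^sub>1 \<alpha>\<^sub>2 \<beta>\<^sub>2 h) f u"
    unfolding homogenized_conductivity_vertical cs_def[symmetric] by (rule is_the_solutionI[OF \<sigma>s u])
  ultimately show "\<exists>U u. (\<forall>n. is_the_solution \<Omega> (two_phase_conductivity \<alpha>\<^sub>1 \<beta>\<^sub>1 (\<alpha>\<^sub>2\<^sub>n (id n)) (\<beta>\<^sub>2\<^sub>n (id n))
        (fibers \<Omega> (\<epsilon> (id n)) (r (id n))) h) f (U n)) \<and>
      is_the_solution \<Omega> (\<lambda>x. homogenized_conductivity \<alpha>\<^sub>1 \<beta>\<^sub>1 \<alpha>\<^sub>2 \<beta>\<^sub>2 h) f u \<and> weakly_converges_H10 \<Omega> U u"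
    unfolding id_apply by blast
qed

end
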